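(* The strategy realizability problem for $\forall^*\exists^*$ HyperLTL formulas is 2EXPTIME-complete. This problem is: given a finite $\Gamma$-labeled $\Upsilon$-transition system $\mathcal{S}=\langle S,s_0,\tau,l\rangle$ and a HyperLTL formula $\forall\pi_1\ldots\forall\pi_n.\ \exists\pi'_1\ldots\exists\pi'_m.\ \varphi$ with $\varphi$ quantifier-free, decide whether there exists a finite-state strategy $\sigma\colon(\Upsilon^n)^*\to\Upsilon^m$ such that for every $u=u_0u_1\ldots\in(\Upsilon^n)^\omega$, with $u_i=(u_i^1,\dots,u_i^n)$ and $v_i=\sigma(u_0\cdots u_{i-1})=(v_i^1,\dots,v_i^m)$, the assignment mapping $\pi_j$ to the trace of $\mathcal{S}$ on $u_0^ju_1^j\ldots$ and $\pi'_k$ to the trace of $\mathcal{S}$ on $v_0^kv_1^k\ldots$ satisfies $\varphi$ at position $0$.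
   Context: $I,O$ are disjoint finite sets of propositions, $\Upsilon=2^I$, $\Gamma=2^O$, $\mathrm{AP}=I\cup O$. A $\Gamma$-labeled $\Upsilon$-transition system $\langle S,s_0,\tau,l\rangle$ has finite $S$, $s_0\in S$, $\tau\colon S\times\Upsilon\to S$, $l\colon S\to\Gamma$; $\tau^*(\epsilon)=s_0$, $\tau^*(x\upsilon)=\tau(\tau^*(x),\upsilon)$. The trace of the system on $\upsilon_0\upsilon_1\ldots\in\Upsilon^\omega$ is $(\upsilon_0\cup\gamma_0)(\upsilon_1\cup\gamma_1)\ldots$ with $\gamma_i=l(\tau^*(\upsilon_0\cdots\upsilon_{i-1}))$. A strategy $\sigma\colon(\Upsilon^n)^*\to\Upsilon^m$ is finite-state if it is generated by some finite transition system $\langle X,x_0,\mu,l_\exists\rangle$ with input alphabet $\Upsilon^n$ and output alphabet $\Upsilon^m$, i.e., $\sigma(x)=l_\exists(\mu^*(x))$. Quantifier-free HyperLTL formulas: $\psi::=a_\pi\mid\neg\psi\mid\psi\vee\psi\mid\mathsf{X}\psi\mid\psi\mathsf{U}\psi$ ($a\in\mathrm{AP}$), evaluated on an assignment $\Pi$ of traces to trace variables with the standard LTL semantics, where $a_\pi$ holds at position $i$ iff $a\in\Pi(\pi)[i]$. *)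

theory Defs
  imports "HOL-Library.FuncSet" "HOL-Library.Landau_Symbols"
begin

section \<open>Transition systems and strategies\<close>

record ('s, 'i, 'o) tsys =
  states :: "'s set"
  init :: 's
  trans :: "'s \<Rightarrow> 'i \<Rightarrow> 's"
  label :: "'s \<Rightarrow> 'o"

definition transition_system :: "'i set \<Rightarrow> 'o set \<Rightarrow> ('s, 'i, 'o) tsys \<Rightarrow> bool" where
  "transition_system Ups Gam T \<longleftrightarrow>
     finite (states T) \<and> init T \<in> states T \<and>
     (\<forall>s \<in> states T. \<forall>x \<in> Ups. trans T s x \<in> states T) \<and>
     (\<forall>s \<in> states T. label T s \<in> Gam)"

definition reached :: "('s, 'i, 'o) tsys \<Rightarrow> 'i list \<Rightarrow> 's" where
  "reached T w = foldl (trans T) (init T) w"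

type_synonym 'a trace = "nat \<Rightarrow> 'a set"

definition trace_of :: "('s, 'a set, 'a set) tsys \<Rightarrow> (nat \<Rightarrow> 'a set) \<Rightarrow> 'a trace" where
  "trace_of T u = (\<lambda>i. u i \<union> label T (reached T (map u [0..<i])))"

definition tuples :: "nat \<Rightarrow> 'x set \<Rightarrow> 'x list set" where
  "tuples n A = {x. length x = n \<and> set x \<subseteq> A}"

text \<open>The generating system may live on natural numbers because its state space is finite.\<close>

definition finite_state_strategy ::
    "'x set \<Rightarrow> nat \<Rightarrow> nat \<Rightarrow> ('x list list \<Rightarrow> 'x list) \<Rightarrow> bool" where
  "finite_state_strategy Ups n m \<sigma> \<longleftrightarrow>
     \<sigma> \<in> lists (tuples n Ups) \<rightarrow> tuples m Ups \<and>
     (\<exists>T :: (nat, 'x list, 'x list) tsys.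
        transition_system (tuples n Ups) (tuples m Ups) T \<and>
        (\<forall>x \<in> lists (tuples n Ups). \<sigma> x = label T (reached T x)))"


section \<open>Quantifier-free HyperLTL\<close>

datatype ('a, 'v) qf =
    Prop 'a 'v
  | Neg "('a, 'v) qf"
  | Or "('a, 'v) qf" "('a, 'v) qf"
  | Next "('a, 'v) qf"
  | Until "('a, 'v) qf" "('a, 'v) qf"

primrec sat :: "('v \<rightharpoonup> 'a trace) \<Rightarrow> nat \<Rightarrow> ('a, 'v) qf \<Rightarrow> bool" where
  "sat A i (Prop a v) \<longleftrightarrow> a \<in> the (A v) i"
| "sat A i (Neg \<phi>) \<longleftrightarrow> \<not> sat A i \<phi>"
| "sat A i (Or \<phi> \<psi>) \<longleftrightarrow> sat A i \<phi> \<or> sat A i \<psi>"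
| "sat A i (Next \<phi>) \<longleftrightarrow> sat A (Suc i) \<phi>"
| "sat A i (Until \<phi> \<psi>) \<longleftrightarrow> (\<exists>j\<ge>i. sat A j \<psi> \<and> (\<forall>k. i \<le> k \<and> k < j \<longrightarrow> sat A k \<phi>))"


section \<open>Strategy realizability\<close>

text \<open>
  An instance consists of the disjoint finite sets of input and output propositions, the system,
  and a formula given by the lists of its universally and existentially quantified trace variables
  (either may be empty) and its quantifier-free part.  Propositions, states and trace variables are
  named by arbitrary natural numbers.
\<close>

record problem_instance =
  in_props :: "nat set"
  out_props :: "nat set"
  system :: "(nat, nat set, nat set) tsys"
  univ_vars :: "nat list"
  exist_vars :: "nat list"
  matrix :: "(nat, nat) qf"

definition valid_instance :: "problem_instance \<Rightarrow> bool" where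
  "valid_instance X \<longleftrightarrow>
     finite (in_props X) \<and> finite (out_props X) \<and> in_props X \<inter> out_props X = {} \<and>
     transition_system (Pow (in_props X)) (Pow (out_props X)) (system X) \<and>
     distinct (univ_vars X @ exist_vars X) \<and>
     set1_qf (matrix X) \<subseteq> in_props X \<union> out_props X \<and>
     set2_qf (matrix X) \<subseteq> set (univ_vars X @ exist_vars X)"

definition play_assignment ::
    "problem_instance \<Rightarrow> (nat set list list \<Rightarrow> nat set list) \<Rightarrow> (nat \<Rightarrow> nat set list)
      \<Rightarrow> (nat \<rightharpoonup> nat trace)" where
  "play_assignment X \<sigma> u =
     (let v = (\<lambda>i. \<sigma> (map u [0..<i])) in
        map_of (zip (univ_vars X @ exist_vars X)
          (map (\<lambda>j. trace_of (system X) (\<lambda>i. u i ! j)) [0..<length (univ_vars X)] @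
           map (\<lambda>k. trace_of (system X) (\<lambda>i. v i ! k)) [0..<length (exist_vars X)])))"

definition strategy_realizable :: "problem_instance \<Rightarrow> bool" where
  "strategy_realizable X \<longleftrightarrow>
     (\<exists>\<sigma>. finite_state_strategy (Pow (in_props X))
             (length (univ_vars X)) (length (exist_vars X)) \<sigma> \<and>
          (\<forall>u. (\<forall>i. u i \<in> tuples (length (univ_vars X)) (Pow (in_props X))) \<longrightarrow>
               sat (play_assignment X \<sigma> u) 0 (matrix X)))"


section \<open>Instances as binary words\<close>

datatype tree = Leaf nat | Node "tree list"

text \<open>Binary digits, least significant first; the digit string is never empty.\<close>

fun digits :: "nat \<Rightarrow> bool list" where
  "digits n = (if n < 2 then [odd n] else odd n # digits (n div 2))"

declare digits.simps [simp del]

text \<open>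
  Two bits per token: the digits \<open>b\<close> are \<open>bb\<close>, an opening bracket is \<open>10\<close>, and \<open>01\<close> ends both a
  number and a bracketed sequence.
\<close>

fun tree_word :: "tree \<Rightarrow> bool list" where
  "tree_word (Leaf n) = concat (map (\<lambda>b. [b, b]) (digits n)) @ [False, True]"
| "tree_word (Node ts) = [True, False] @ concat (map tree_word ts) @ [False, True]"

definition set_tree :: "nat set \<Rightarrow> tree" where
  "set_tree A = Node (map Leaf (sorted_list_of_set A))"

text \<open>The transition function is listed explicitly, one entry per state and per subset of \<open>I\<close>.\<close>

definition system_tree :: "nat set \<Rightarrow> (nat, nat set, nat set) tsys \<Rightarrow> tree" where
  "system_tree I T =
     (let ss = sorted_list_of_set (states T) in
      Node [set_tree (states T), Leaf (init T),
        Node [Node [Leaf s, set_tree x, Leaf (trans T s x)].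
               s \<leftarrow> ss, x \<leftarrow> map set (subseqs (sorted_list_of_set I))],
        Node [Node [Leaf s, set_tree (label T s)]. s \<leftarrow> ss]])"

primrec qf_tree :: "(nat, nat) qf \<Rightarrow> tree" where
  "qf_tree (Prop a v) = Node [Leaf 0, Leaf a, Leaf v]"
| "qf_tree (Neg \<phi>) = Node [Leaf 1, qf_tree \<phi>]"
| "qf_tree (Or \<phi> \<psi>) = Node [Leaf 2, qf_tree \<phi>, qf_tree \<psi>]"
| "qf_tree (Next \<phi>) = Node [Leaf 3, qf_tree \<phi>]"
| "qf_tree (Until \<phi> \<psi>) = Node [Leaf 4, qf_tree \<phi>, qf_tree \<psi>]"

definition encode :: "problem_instance \<Rightarrow> bool list" where
  "encode X = tree_word (Node
     [set_tree (in_props X), set_tree (out_props X), system_tree (in_props X) (system X),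
      Node (map Leaf (univ_vars X)), Node (map Leaf (exist_vars X)), qf_tree (matrix X)])"

definition strategy_realizability :: "bool list set" where
  "strategy_realizability = {encode X | X. valid_instance X \<and> strategy_realizable X}"

text \<open>
  The encoding is unambiguous: membership of the code of a valid instance in the language is exactly
  realizability of that instance (last lemma below).
\<close>

lemma digits_ne: "digits k \<noteq> []" by (subst digits.simps) auto

lemma digits_cases:
  "digits k = (if k < 2 then [odd k] else odd k # digits (k div 2))" by (subst digits.simps) (rule refl)

fun undig :: "bool list \<Rightarrow> nat" where "undig [] = 0" | "undig (b # bs) = of_bool b + 2 * undig bs"

lemma undig: "undig (digits n) = n"
proof (induction n rule: digits.induct)
  case (1 n)
  show ?case
  proof (cases "n < 2")
    case True then have "n = 0 \<or> n = 1" by auto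
    then show ?thesis by (subst digits_cases) auto
  next
    case False
    then show ?thesis using 1 by (subst digits_cases) (simp add: of_bool_odd_eq_mod_2)
  qed
qed

lemma digits_inj: "digits m = digits n \<Longrightarrow> m = n" by (metis undig)

lemma doubled_inj:
  "concat (map (\<lambda>b. [b, b]) ds) @ False # True # xs = concat (map (\<lambda>b. [b, b]) es) @ False # True # ys
     \<Longrightarrow> ds = es \<and> xs = ys"
  apply (induction ds arbitrary: es)
  subgoal for es by (cases es) auto
  subgoal for d ds es by (cases es) auto
  done

lemma tree_word_start: "\<exists>c d r. tree_word t = c # d # r \<and> (c, d) \<noteq> (False, True)"
proof (cases t)
  case (Leaf n) then show ?thesis using digits_ne[of n] by (cases "digits n") auto
qed auto

lemma tree_word_append_inj: "tree_word s @ xs = tree_word t @ ys \<Longrightarrow> s = t \<and> xs = ys"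
proof (induction s arbitrary: t xs ys)
  case (Leaf n)
  note eq = Leaf.prems
  obtain d ds where d: "digits n = d # ds" using digits_ne by (cases "digits n") auto
  show ?case
  proof (cases t)
    case (Leaf n')
    with eq doubled_inj[of "digits n" xs "digits n'" ys] have "digits n = digits n' \<and> xs = ys"
      by simp
    with Leaf digits_inj show ?thesis by blast
  next
    case (Node ts)
    with eq d show ?thesis by auto
  qed
next
  case (Node ss)
  note eq = Node.prems and IH = Node.IH
  show ?case
  proof (cases t)
    case (Leaf n')
    obtain d ds where "digits n' = d # ds" using digits_ne by (cases "digits n'") auto
    with eq Leaf show ?thesis by auto
  next
    case (Node ts)
    have "concat (map tree_word ss) @ False # True # xs = concat (map tree_word ts) @ False # True # ys
        \<Longrightarrow> ss = ts \<and> xs = ys" using IH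
    proof (induction ss arbitrary: ts)
      case Nil
      show ?case
      proof (cases ts)
        case (Cons t' ts')
        obtain c d r where "tree_word t' = c # d # r" "(c, d) \<noteq> (False, True)"
          using tree_word_start by blast
        then show ?thesis using Nil.prems(1) Cons by simp
      qed (use Nil.prems(1) in simp)
    next
      case (Cons s ss)
      note eq = Cons.prems(1) and hyp = Cons.prems(2) and IH = Cons.IH
      show ?case
      proof (cases ts)
        case Nil
        obtain c d r where "tree_word s = c # d # r" "(c, d) \<noteq> (False, True)"
          using tree_word_start by blast
        then show ?thesis using eq Nil by simp
      next
        case (Cons t' ts')
        have "s = t' \<and> concat (map tree_word ss) @ False # True # xs
                = concat (map tree_word ts') @ False # True # ys"
          by (rule hyp) (use eq Cons in simp_all)
        moreover from this have "ss = ts' \<and> xs = ys"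
          by (intro IH) (auto dest: hyp[rotated])
        ultimately show ?thesis using Cons by simp
      qed
    qed
    then show ?thesis using eq Node by simp
  qed
qed

lemma tree_word_inj: "tree_word s = tree_word t \<Longrightarrow> s = t"
  using tree_word_append_inj[of s "[]" t "[]"] by simp


lemma set_tree_inj: "finite A \<Longrightarrow> finite B \<Longrightarrow> set_tree A = set_tree B \<Longrightarrow> A = B"
  unfolding set_tree_def
  by (metis injI inj_map_eq_map set_sorted_list_of_set tree.inject(1) tree.inject(2))

lemma qf_tree_inj: "qf_tree \<phi> = qf_tree \<psi> \<Longrightarrow> \<phi> = \<psi>"
proof (induction \<phi> arbitrary: \<psi>)
  case (Prop a v) then show ?case by (cases \<psi>) auto
next
  case (Neg \<phi>) then show ?case by (cases \<psi>) auto
next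
  case (Or \<phi>1 \<phi>2) then show ?case by (cases \<psi>) auto
next
  case (Next \<phi>) then show ?case by (cases \<psi>) auto
next
  case (Until \<phi>1 \<phi>2) then show ?case by (cases \<psi>) auto
qed

lemma concat_blocks_eq:
  "(\<And>x. x \<in> set xs \<Longrightarrow> length (f x) = length (g x)) \<Longrightarrow>
   concat (map f xs) = concat (map g xs) \<Longrightarrow> x \<in> set xs \<Longrightarrow> f x = g x"
  by (induction xs) auto

lemma system_tree_inj:
  assumes T: "transition_system (Pow I) (Pow Out) T" and T': "transition_system (Pow I) (Pow Out) T'"
    and fin: "finite I" "finite Out" and eq: "system_tree I T = system_tree I T'"
  shows "states T = states T'" "init T = init T'"
    "\<And>s x. s \<in> states T \<Longrightarrow> x \<in> Pow I \<Longrightarrow> trans T s x = trans T' s x"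
    "\<And>s. s \<in> states T \<Longrightarrow> label T s = label T' s"
proof -
  have f: "finite (states T)" "finite (states T')" using T T' by (auto simp: transition_system_def)
  show st: "states T = states T'"
    using eq set_tree_inj[OF f] by (simp add: system_tree_def Let_def)
  show "init T = init T'" using eq by (simp add: system_tree_def Let_def)
  let ?ss = "sorted_list_of_set (states T)" and ?xs = "subseqs (sorted_list_of_set I)"
  have tr: "concat (map (\<lambda>s. map (\<lambda>x. Node [Leaf s, set_tree x, Leaf (trans T s x)]) (map set ?xs)) ?ss)
     = concat (map (\<lambda>s. map (\<lambda>x. Node [Leaf s, set_tree x, Leaf (trans T' s x)]) (map set ?xs)) ?ss)"
   and lb: "map (\<lambda>s. Node [Leaf s, set_tree (label T s)]) ?ss
     = map (\<lambda>s. Node [Leaf s, set_tree (label T' s)]) ?ss"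
    using eq st by (simp_all add: system_tree_def Let_def)
  show "trans T s x = trans T' s x" if "s \<in> states T" "x \<in> Pow I" for s x
  proof -
    have "map (\<lambda>x. Node [Leaf s, set_tree x, Leaf (trans T s x)]) (map set ?xs)
       = map (\<lambda>x. Node [Leaf s, set_tree x, Leaf (trans T' s x)]) (map set ?xs)"
      by (rule concat_blocks_eq[OF _ tr]) (use that f in auto)
    moreover have "x \<in> set (map set ?xs)"
      using that fin subseqs_powset[of "sorted_list_of_set I"] by auto
    ultimately have "Node [Leaf s, set_tree x, Leaf (trans T s x)] = Node [Leaf s, set_tree x, Leaf (trans T' s x)]"
      unfolding map_eq_conv by blast
    then show ?thesis by simp
  qed
  show "label T s = label T' s" if "s \<in> states T" for s
  proof -
    have "set_tree (label T s) = set_tree (label T' s)"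
      using lb that f by (auto simp: map_eq_conv)
    moreover have "finite (label T s)" "finite (label T' s)"
      using T T' that st fin unfolding transition_system_def Pow_iff by (metis finite_subset)+
    ultimately show ?thesis using set_tree_inj by blast
  qed
qed

lemma reached_cong:
  assumes T: "transition_system Ups Gam T" and i: "init T = init T'"
    and tr: "\<And>s x. s \<in> states T \<Longrightarrow> x \<in> Ups \<Longrightarrow> trans T s x = trans T' s x"
    and w: "set w \<subseteq> Ups"
  shows "reached T w \<in> states T \<and> reached T w = reached T' w"
  using w
proof (induction w rule: rev_induct)
  case Nil
  then show ?case using T i by (auto simp: reached_def transition_system_def)
next
  case (snoc x w)
  then have r: "reached T w \<in> states T" "reached T w = reached T' w" "x \<in> Ups" by auto
  have "reached T (w @ [x]) = trans T (reached T w) x" "reached T' (w @ [x]) = trans T' (reached T' w) x"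
    by (simp_all add: reached_def)
  then show ?case using r T tr by (auto simp: transition_system_def)
qed

lemma strategy_realizable_cong:
  assumes X: "valid_instance X" and Y: "valid_instance Y" and eq: "encode X = encode Y"
    and X': "strategy_realizable X"
  shows "strategy_realizable Y"
proof -
  have fin: "finite (in_props X)" "finite (out_props X)" "finite (in_props Y)" "finite (out_props Y)"
    using X Y by (auto simp: valid_instance_def)
  have tree: "set_tree (in_props X) = set_tree (in_props Y)" "set_tree (out_props X) = set_tree (out_props Y)"
    "system_tree (in_props X) (system X) = system_tree (in_props Y) (system Y)"
    "map Leaf (univ_vars X) = map Leaf (univ_vars Y)"
    "map Leaf (exist_vars X) = map Leaf (exist_vars Y)"
    "qf_tree (matrix X) = qf_tree (matrix Y)"
    using tree_word_inj[OF eq[unfolded encode_def]] by auto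
  have inj: "inj Leaf" by (simp add: inj_def)
  have e: "in_props Y = in_props X" "out_props Y = out_props X" "matrix Y = matrix X"
    "univ_vars Y = univ_vars X" "exist_vars Y = exist_vars X"
    using tree fin inj set_tree_inj qf_tree_inj by (auto simp: inj_map_eq_map)
  let ?U = "Pow (in_props X)"
  have T: "transition_system ?U (Pow (out_props X)) (system X)"
          "transition_system ?U (Pow (out_props X)) (system Y)"
    using X Y e by (auto simp: valid_instance_def)
  note S = system_tree_inj[OF T fin(1,2)]
  have se: "system_tree (in_props X) (system X) = system_tree (in_props X) (system Y)"
    using tree e by simp
  have tc: "trace_of (system X) u = trace_of (system Y) u" if "\<And>i. u i \<in> ?U" for u
  proof
    fix i
    have "set (map u [0..<i]) \<subseteq> ?U" using that by auto
    from reached_cong[OF T(1) S(2)[OF se] S(3)[OF se] this] S(4)[OF se]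
    show "trace_of (system X) u i = trace_of (system Y) u i" unfolding trace_of_def by metis
  qed
  obtain \<sigma> where \<sigma>: "finite_state_strategy ?U (length (univ_vars X)) (length (exist_vars X)) \<sigma>"
    and s: "\<And>u. (\<forall>i. u i \<in> tuples (length (univ_vars X)) ?U) \<Longrightarrow> sat (play_assignment X \<sigma> u) 0 (matrix X)"
    using X' by (auto simp: strategy_realizable_def)
  have "play_assignment X \<sigma> u = play_assignment Y \<sigma> u"
    if u: "\<And>i. u i \<in> tuples (length (univ_vars X)) ?U" for u
  proof -
    have v: "\<sigma> (map u [0..<i]) \<in> tuples (length (exist_vars X)) ?U" for i
      using \<sigma> u by (auto simp: finite_state_strategy_def Pi_iff in_lists_conv_set)
    have nth: "x ! j \<in> A" if "x \<in> tuples n A" "j < n" for x and n j and A :: "nat set set"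
      using that by (auto simp: tuples_def)
    have "map (\<lambda>j. trace_of (system X) (\<lambda>i. u i ! j)) [0..<length (univ_vars X)] =
          map (\<lambda>j. trace_of (system Y) (\<lambda>i. u i ! j)) [0..<length (univ_vars X)]"
      using tc nth[OF u] by simp
    moreover have "map (\<lambda>k. trace_of (system X) (\<lambda>i. \<sigma> (map u [0..<i]) ! k)) [0..<length (exist_vars X)] =
          map (\<lambda>k. trace_of (system Y) (\<lambda>i. \<sigma> (map u [0..<i]) ! k)) [0..<length (exist_vars X)]"
      using tc nth[OF v] by simp
    ultimately show ?thesis unfolding play_assignment_def e Let_def by (simp only:)
  qed
  with \<sigma> s show ?thesis unfolding strategy_realizable_def e by metis
qed

lemma encode_in_strategy_realizability:
  "valid_instance X \<Longrightarrow> encode X \<in> strategy_realizability \<longleftrightarrow> strategy_realizable X"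
proof
  assume X: "valid_instance X" and "encode X \<in> strategy_realizability"
  then obtain Y where "encode X = encode Y" "valid_instance Y" "strategy_realizable Y"
    by (auto simp: strategy_realizability_def)
  then show "strategy_realizable X" using strategy_realizable_cong[of Y X] X by simp
qed (auto simp: strategy_realizability_def)


section \<open>Deterministic multitape Turing machines\<close>

datatype move = Left | Stay | Right

text \<open>
  Control states are the numbers below \<open>num_states\<close>, tape symbols the numbers below \<open>num_syms\<close>;
  symbol 0 is the blank, symbols 1 and 2 represent the bits.  Tapes are infinite in both directions.
\<close>

record tm =
  num_tapes :: nat
  num_states :: nat
  num_syms :: nat
  start :: nat
  accept :: nat
  reject :: nat
  delta :: "nat \<Rightarrow> nat list \<Rightarrow> nat \<times> (nat \<times> move) list"

definition turing_machine :: "tm \<Rightarrow> bool" where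
  "turing_machine M \<longleftrightarrow>
     num_tapes M \<ge> 1 \<and> num_syms M \<ge> 3 \<and>
     start M < num_states M \<and> accept M < num_states M \<and> reject M < num_states M \<and>
     accept M \<noteq> reject M \<and>
     (\<forall>q < num_states M. \<forall>xs \<in> tuples (num_tapes M) {..<num_syms M}.
        fst (delta M q xs) < num_states M \<and>
        snd (delta M q xs) \<in> tuples (num_tapes M) ({..<num_syms M} \<times> UNIV))"

text \<open>A tape is its contents together with the head position.\<close>

type_synonym tape = "(int \<Rightarrow> nat) \<times> int"
type_synonym config = "nat \<times> tape list"

fun move_head :: "move \<Rightarrow> int \<Rightarrow> int" where
  "move_head Left p = p - 1"
| "move_head Stay p = p"
| "move_head Right p = p + 1"

definition act :: "tape \<Rightarrow> nat \<times> move \<Rightarrow> tape" where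
  "act = (\<lambda>(c, p) (a, d). (c(p := a), move_head d p))"

definition halted :: "tm \<Rightarrow> config \<Rightarrow> bool" where
  "halted M C \<longleftrightarrow> fst C = accept M \<or> fst C = reject M"

definition step :: "tm \<Rightarrow> config \<Rightarrow> config" where
  "step M C =
     (if halted M C then C
      else let (q, as) = delta M (fst C) (map (\<lambda>(c, p). c p) (snd C))
           in (q, map2 act (snd C) as))"

definition word_contents :: "bool list \<Rightarrow> int \<Rightarrow> nat" where
  "word_contents w = (\<lambda>p. if 0 \<le> p \<and> p < int (length w)
                          then (if w ! nat p then 2 else 1) else 0)"

definition initial :: "tm \<Rightarrow> bool list \<Rightarrow> config" where
  "initial M w = (start M, (word_contents w, 0) # replicate (num_tapes M - 1) (word_contents [], 0))"

definition run :: "tm \<Rightarrow> nat \<Rightarrow> bool list \<Rightarrow> config" where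
  "run M t w = (step M ^^ t) (initial M w)"

text \<open>Halted configurations are fixed points of \<open>step\<close>, so \<open>t\<close> is an upper bound on the running time.\<close>

definition decides_in_time :: "tm \<Rightarrow> bool list set \<Rightarrow> (nat \<Rightarrow> nat) \<Rightarrow> bool" where
  "decides_in_time M L t \<longleftrightarrow>
     (\<forall>w. fst (run M (t (length w)) w) = (if w \<in> L then accept M else reject M))"

text \<open>The output is the full contents of the last tape, the word starting at cell 0.\<close>

definition computes_in_time :: "tm \<Rightarrow> (bool list \<Rightarrow> bool list) \<Rightarrow> (nat \<Rightarrow> nat) \<Rightarrow> bool" where
  "computes_in_time M f t \<longleftrightarrow>
     (\<forall>w. halted M (run M (t (length w)) w) \<and>
          fst (last (snd (run M (t (length w)) w))) = word_contents (f w))"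


section \<open>Complexity classes\<close>

definition DTIME :: "(nat \<Rightarrow> nat) \<Rightarrow> bool list set set" where
  "DTIME T = {L. \<exists>M t. turing_machine M \<and> decides_in_time M L t \<and>
                   (\<lambda>n. real (t n)) \<in> O(\<lambda>n. real (T n))}"

definition TWO_EXPTIME :: "bool list set set" where
  "TWO_EXPTIME = (\<Union>k. DTIME (\<lambda>n. 2 ^ (2 ^ (n ^ k))))"

definition poly_time_computable :: "(bool list \<Rightarrow> bool list) \<Rightarrow> bool" where
  "poly_time_computable f \<longleftrightarrow>
     (\<exists>M t k. turing_machine M \<and> computes_in_time M f t \<and>
              (\<lambda>n. real (t n)) \<in> O(\<lambda>n. real (n ^ k)))"

definition poly_time_reducible :: "bool list set \<Rightarrow> bool list set \<Rightarrow> bool" where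
  "poly_time_reducible L L' \<longleftrightarrow>
     (\<exists>f. poly_time_computable f \<and> (\<forall>w. w \<in> L \<longleftrightarrow> f w \<in> L'))"

definition two_exptime_complete :: "bool list set \<Rightarrow> bool" where
  "two_exptime_complete L \<longleftrightarrow>
     L \<in> TWO_EXPTIME \<and> (\<forall>L' \<in> TWO_EXPTIME. poly_time_reducible L' L)"

end

(*
 Membership. Label every position with guessed truth values of all subformulas. A play violates the
 formula iff some consistent labelling starts with a false root and fulfils its eventualities again
 and again. Counting fulfilled eventualities along all labellings at once gives a safety game: a
 counter that exceeds a doubly exponential bound could be pumped into a violating play. The game is
 solved by deleting losing positions. Machines are obtained from a small while language on stacks,
 whose programs are closed under the needed functions on trees.

 Hardness. The strategy prints records of 2^b bits, each claiming the state and one tape symbol of a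
 computation of length 2^(2^b), going backwards in time. The environment follows the claimed cell or
 moves to a symbol read in the previous step, so it can trace a false claim back to the initial
 configuration. Counters of different records are compared at a position marked by the environment.
 The strategy cannot know the mark in time.
*)
theory Submission
 imports Defs
begin

section \<open>A structured language for stack machines\<close>

text \<open>One calculus of polynomial-time functions on trees serves both directions. The reduction
  uses it directly; the decision procedure is polynomial in a padding list of doubly exponential
  length produced beforehand. Enumerations stop growing when they would exceed the padding, so they
  are polynomial unconditionally, and complete once the padding suffices. The input word is never
  parsed. All trees up to a height linear in its length are tried as tabulated instances, printed
  and compared with the word; there are only doubly exponentially many. The obstacle in the upper
  bound is that a finite-state strategy has unknown size, so pumping bounds the counters only in
  terms of that size. Its memory is therefore first exchanged for the game position with an
  age-ordered list of sets of labels. Pumping again gives a bound that depends on the game alone. In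
  the lower bound a formula of polynomial size cannot step over \<open>2 ^ b\<close> positions by
  nested \<open>Next\<close>. The strategy also prints a \<open>b\<close>-bit address, and equal
  addresses in adjacent records pin down the distance.\<close>

datatype cmd = Push nat nat | Wr nat nat | Pop nat | Shift | Nop
 | Seq cmd cmd (infixr ";;" 60) | Cond nat "nat set" cmd cmd | Loop nat "nat set" cmd | Rej

type_synonym store = "nat => nat list"

definition top_of :: "store => nat => nat" where
 "top_of s i = (case s i of [] => 0 | a # _ => a)"

text \<open>
  Stack \<open>i < 5\<close> lives on tape \<open>i\<close> with its top under the head and grows to the left.  Stack 5 is
 virtual: its height is the position of the bottom of tape 4, which \<open>Shift\<close> moves to the right.
\<close>

inductive bs :: "cmd => store => nat => store => bool" where
 bs_Push: "i < 5 ==> bs (Push i a) s 2 (s(i := a # s i))"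
| bs_Pop: "i < 5 ==> s i ~= [] ==> bs (Pop i) s 1 (s(i := tl (s i)))"
| bs_Shift: "s 4 = [] ==> bs Shift s 1 (s(5 := 0 # s 5))"
| bs_Nop: "bs Nop s 1 s"
| bs_Seq: "bs a s t s' ==> bs b s' t' s'' ==> bs (a ;; b) s (Suc (t + t')) s''"
| bs_CondT: "i < 5 ==> top_of s i : A ==> bs a s t s' ==> bs (Cond i A a b) s (Suc t) s'"
| bs_CondF: "i < 5 ==> top_of s i ~: A ==> bs b s t s' ==> bs (Cond i A a b) s (Suc t) s'"
| bs_LoopF: "i < 5 ==> top_of s i ~: A ==> bs (Loop i A c) s 1 s"
| bs_LoopT: "i < 5 ==> top_of s i : A ==> bs c s t s' ==> bs (Loop i A c) s' t' s''
  ==> bs (Loop i A c) s (Suc (t + t')) s''"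

text \<open>Continuation semantics: a control state is the list of commands still to be run.
  \<open>[]\<close> and \<open>[Rej]\<close> are fixed points and become the two halting states.
  \<open>Wr\<close> is the second half of a \<open>Push\<close>, which needs one machine step to
  move left and another to write.\<close>

fun nxt :: "nat list => cmd list => cmd list" where
 "nxt xs [] = []"
| "nxt xs (Push i a # K) = Wr i a # K"
| "nxt xs (Wr i a # K) = K"
| "nxt xs (Pop i # K) = K"
| "nxt xs (Shift # K) = K"
| "nxt xs (Nop # K) = K"
| "nxt xs ((a ;; b) # K) = a # b # K"
| "nxt xs (Cond i A a b # K) = (if xs ! i : A then a else b) # K"
| "nxt xs (Loop i A c # K) = (if xs ! i : A then c # Loop i A c # K else K)"
| "nxt xs (Rej # K) = Rej # K"

fun ac :: "nat list => cmd list => nat => nat * move" where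
 "ac xs (Push i a # K) j = (xs ! j, if j = i then Left else Stay)"
| "ac xs (Wr i a # K) j = (if j = i then a else xs ! j, Stay)"
| "ac xs (Pop i # K) j = (if j = i then (0, Right) else (xs ! j, Stay))"
| "ac xs (Shift # K) j = (xs ! j, if j = 4 then Right else Stay)"
| "ac xs K j = (xs ! j, Stay)"

section \<open>Stack contents as tape contents\<close>

definition reads :: "tape list => nat list" where
 "reads ts = map (%(c, p). c p) ts"

definition cstep :: "cmd list * tape list => cmd list * tape list" where
 "cstep C = (nxt (reads (snd C)) (fst C), map2 act (snd C) (map (ac (reads (snd C)) (fst C)) [0..<5]))"

definition tape_of :: "int => nat list => tape" where
 "tape_of B s = (%x. if B - int (length s) <= x & x < B then s ! nat (x - (B - int (length s))) else 0,
         B - int (length s))"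

text \<open>The cell just right of the bottom of a stack. The input fills cells \<open>0\<close> to
  \<open>n - 1\<close> with the head on cell 0, hence \<open>n\<close> for stack 0. The output has
  to start at cell 0 although stacks grow to the left, so the boundary of tape 4 is moved right once
  per output bit before the bits are pushed.\<close>

definition bottom :: "nat => store => nat => int" where
 "bottom n s i = (if i = 0 then int n else if i = 4 then int (length (s 5)) else 0)"

definition tapes :: "nat => store => tape list" where
 "tapes n s = map (%i. tape_of (bottom n s i) (s i)) [0..<5]"

lemma length_tapes [simp]: "length (tapes n s) = 5" by (simp add: tapes_def)

lemma tape_of_top: "(case tape_of B s of (c, p) => c p) = (case s of [] => 0 | a # _ => a)"
 by (auto simp: tape_of_def split: list.splits)

lemma reads_tapes: "reads (tapes n s) = map (top_of s) [0..<5]"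
 unfolding reads_def tapes_def map_map comp_def tape_of_top top_of_def ..

lemma nth_reads: "i < 5 ==> reads (tapes n s) ! i = top_of s i"
 by (simp add: reads_tapes)

lemma act_Stay: "act (c, p) (c p, Stay) = (c, p)" by (simp add: act_def)

lemma act_tape_Stay: "act (tape_of B s) (case s of [] => 0 | a # _ => a, Stay) = tape_of B s"
 using act_Stay tape_of_top by (metis case_prod_conv surj_pair)

lemma snd_tape_of: "snd (tape_of B s) = B - int (length s)" by (simp add: tape_of_def)

lemma tape_of_below: "x < B - int (length s) ==> fst (tape_of B s) x = 0" by (simp add: tape_of_def)

lemma tape_of_Cons:
 "tape_of B (a # s) = ((fst (tape_of B s))(B - int (length s) - 1 := a), B - int (length s) - 1)"
proof -
 have "fst (tape_of B (a # s)) x = ((fst (tape_of B s))(B - int (length s) - 1 := a)) x" for x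
 proof -
  consider "x < B - int (length s) - 1" | "x = B - int (length s) - 1" | "x >= B - int (length s)" by linarith
  then show ?thesis
  proof cases
   case 3
   have "nat (x - (B - int (length (a # s)))) = Suc (nat (x - (B - int (length s))))" using 3 by simp
   then have "(a # s) ! nat (x - (B - int (length (a # s)))) = s ! nat (x - (B - int (length s)))" by simp
   then show ?thesis using 3 unfolding tape_of_def by (auto simp del: nth_Cons_Suc nth_Cons_numeral)
  qed (auto simp: tape_of_def)
 qed
 then show ?thesis by (auto simp: prod_eq_iff snd_tape_of)
qed

lemma act_tape_Pop: "s ~= [] ==> act (tape_of B s) (0, Right) = tape_of B (tl s)"
proof (cases s)
 case (Cons a l)
 have "(fst (tape_of B l))(B - int (length l) - 1 := 0) = fst (tape_of B l)"
  by (rule fun_upd_idem) (rule tape_of_below, simp)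
 then show ?thesis using Cons by (simp add: act_def tape_of_Cons prod_eq_iff snd_tape_of)
qed simp

lemma act_tape_Push:
 "act (act (tape_of B s) (case s of [] => 0 | a # _ => a, Left)) (a, Stay) = tape_of B (a # s)"
proof -
 have 1: "act (tape_of B s) (case s of [] => 0 | a # _ => a, Left) = (fst (tape_of B s), snd (tape_of B s) - 1)"
  by (auto simp: act_def tape_of_def fun_eq_iff split: list.splits)
 show ?thesis unfolding 1 by (simp add: act_def tape_of_Cons snd_tape_of)
qed

lemma act_tape_Shift: "act (tape_of B []) (0, Right) = tape_of (B + 1) []"
 by (auto simp: act_def tape_of_def)

lemma map2_act_tapes:
 "map2 act (tapes n s) (map f [0..<5]) = map (%i. act (tape_of (bottom n s i) (s i)) (f i)) [0..<5]"
 by (simp add: tapes_def upt_conv_Cons)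

lemma ac_idle: "map2 act (tapes n s) (map (%j. (reads (tapes n s) ! j, Stay)) [0..<5]) = tapes n s"
 unfolding map2_act_tapes reads_tapes
 unfolding tapes_def by (rule map_cong[OF refl]) (simp add: top_of_def act_tape_Stay)

lemma cstep_idle:
 "ac (reads (tapes n s)) K = (%j. (reads (tapes n s) ! j, Stay))
  ==> cstep (K, tapes n s) = (nxt (reads (tapes n s)) K, tapes n s)"
 unfolding cstep_def fst_conv snd_conv by (simp only: ac_idle)

lemma cstep_Push:
 assumes "i < 5"
 shows "(cstep ^^ 2) (Push i a # K, tapes n s) = (K, tapes n (s(i := a # s i)))"
proof -
 let ?f = "%j. act (tape_of (bottom n s j) (s j)) (top_of s j, if j = i then Left else Stay)"
 have 1: "cstep (Push i a # K, tapes n s) = (Wr i a # K, map ?f [0..<5])"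
  unfolding cstep_def fst_conv snd_conv map2_act_tapes by (simp add: reads_tapes)
 have len: "length (map ?f [0..<5]) = 5" by simp
 have "map2 act (map ?f [0..<5]) (map (ac (reads (map ?f [0..<5])) (Wr i a # K)) [0..<5])
   = map (%j. act (?f j) (if j = i then a else reads (map ?f [0..<5]) ! j, Stay)) [0..<5]"
  by (simp add: upt_conv_Cons)
 also have "... = tapes n (s(i := a # s i))" unfolding tapes_def
 proof (rule map_cong[OF refl])
  fix j assume j: "j : set [0..<5::nat]"
  have b: "bottom n (s(i := a # s i)) j = bottom n s j" using assms by (simp add: bottom_def)
  show "act (?f j) (if j = i then a else reads (map ?f [0..<5]) ! j, Stay)
    = tape_of (bottom n (s(i := a # s i)) j) ((s(i := a # s i)) j)"
  proof (cases "j = i")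
   case True
   then show ?thesis unfolding b using act_tape_Push by (simp add: top_of_def)
  next
   case False
   have "?f j = tape_of (bottom n s j) (s j)" using False by (simp add: top_of_def act_tape_Stay)
   moreover have "reads (map ?f [0..<5]) ! j = (case ?f j of (c, p) => c p)"
    using j by (simp add: reads_def)
   ultimately have "reads (map ?f [0..<5]) ! j = (case s j of [] => 0 | a # _ => a)"
    using tape_of_top by simp
   then show ?thesis unfolding b using False act_tape_Stay by (simp add: top_of_def)
  qed
 qed
 finally have 2: "cstep (Wr i a # K, map ?f [0..<5]) = (K, tapes n (s(i := a # s i)))"
  unfolding cstep_def fst_conv snd_conv nxt.simps by simp
 show ?thesis by (simp add: numeral_2_eq_2 1 2)
qed

lemma cstep_Pop:
 assumes "i < 5" "s i ~= []"
 shows "cstep (Pop i # K, tapes n s) = (K, tapes n (s(i := tl (s i))))"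
proof -
 have "map2 act (tapes n s) (map (ac (reads (tapes n s)) (Pop i # K)) [0..<5]) = tapes n (s(i := tl (s i)))"
  unfolding map2_act_tapes tapes_def[of n "s(i := tl (s i))"]
 proof (rule map_cong[OF refl])
  fix j assume j: "j : set [0..<5::nat]"
  have b: "bottom n (s(i := tl (s i))) j = bottom n s j" using assms by (simp add: bottom_def)
  show "act (tape_of (bottom n s j) (s j)) (ac (reads (tapes n s)) (Pop i # K) j)
    = tape_of (bottom n (s(i := tl (s i))) j) ((s(i := tl (s i))) j)"
   unfolding b using j assms by (simp add: nth_reads top_of_def act_tape_Stay act_tape_Pop)
 qed
 then show ?thesis unfolding cstep_def by simp
qed

lemma cstep_Shift:
 assumes "s 4 = []"
 shows "cstep (Shift # K, tapes n s) = (K, tapes n (s(5 := 0 # s 5)))"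
proof -
 have "map2 act (tapes n s) (map (ac (reads (tapes n s)) (Shift # K)) [0..<5]) = tapes n (s(5 := 0 # s 5))"
  unfolding map2_act_tapes tapes_def[of n "s(5 := 0 # s 5)"]
 proof (rule map_cong[OF refl])
  fix j assume j: "j : set [0..<5::nat]"
  show "act (tape_of (bottom n s j) (s j)) (ac (reads (tapes n s)) (Shift # K) j)
    = tape_of (bottom n (s(5 := 0 # s 5)) j) ((s(5 := 0 # s 5)) j)"
   using j assms act_tape_Shift[of "int (length (s 5))"]
   by (auto simp: nth_reads top_of_def act_tape_Stay bottom_def add.commute)
 qed
 then show ?thesis unfolding cstep_def by simp
qed

lemma funpow_add_apply: "(f ^^ (m + n)) x = (f ^^ n) ((f ^^ m) x)"
 by (subst add.commute) (simp add: funpow_add)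

lemma bs_cstep: "bs c s t s' ==> (cstep ^^ t) (c # K, tapes n s) = (K, tapes n s')"
proof (induction arbitrary: K rule: bs.induct)
 case (bs_Push i a s)
 then show ?case by (rule cstep_Push)
next
 case (bs_Pop i s)
 then show ?case using cstep_Pop by (simp del: fun_upd_apply)
next
 case (bs_Shift s)
 then show ?case using cstep_Shift by (simp del: fun_upd_apply)
next
 case (bs_Nop s)
 show ?case by (simp add: cstep_idle fun_eq_iff)
next
 case (bs_Seq a s t s' b t' s'')
 have "cstep ((a ;; b) # K, tapes n s) = (a # b # K, tapes n s)"
  by (subst cstep_idle) (auto simp: fun_eq_iff)
 then show ?case using bs_Seq.IH by (simp add: funpow_swap1 funpow_add_apply)
next
 case (bs_CondT i s A a t s' b)
 then have "cstep (Cond i A a b # K, tapes n s) = (a # K, tapes n s)"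
  by (subst cstep_idle) (auto simp: fun_eq_iff nth_reads)
 then show ?case using bs_CondT.IH by (simp add: funpow_swap1)
next
 case (bs_CondF i s A b t s' a)
 then have "cstep (Cond i A a b # K, tapes n s) = (b # K, tapes n s)"
  by (subst cstep_idle) (auto simp: fun_eq_iff nth_reads)
 then show ?case using bs_CondF.IH by (simp add: funpow_swap1)
next
 case (bs_LoopF i s A c)
 then show ?case by (simp add: cstep_idle fun_eq_iff nth_reads)
next
 case (bs_LoopT i s A c t s' t' s'')
 then have "cstep (Loop i A c # K, tapes n s) = (c # Loop i A c # K, tapes n s)"
  by (subst cstep_idle) (auto simp: fun_eq_iff nth_reads)
 then show ?case using bs_LoopT.IH by (simp add: funpow_swap1 funpow_add_apply)
qed

subsection \<open>Compilation to Turing machines\<close>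

text \<open>All continuations that can arise while \<open>c\<close> runs in front of
  \<open>K\<close>. A loop body returns to the loop itself, which is already in the set, so the set
  is finite although runs are unbounded. Its elements become the states of the Turing
  machine.\<close>

fun conts :: "cmd => cmd list => cmd list set" where
 "conts (a ;; b) K = {(a ;; b) # K} \<union> conts a (b # K) \<union> conts b K"
| "conts (Cond i A a b) K = {Cond i A a b # K} \<union> conts a K \<union> conts b K"
| "conts (Loop i A c) K = {Loop i A c # K} \<union> conts c (Loop i A c # K)"
| "conts (Push i a) K = {Push i a # K, Wr i a # K}"
| "conts c K = {c # K}"

fun wf_cmd :: "cmd => bool" where
 "wf_cmd (a ;; b) = (wf_cmd a & wf_cmd b)"
| "wf_cmd (Cond i A a b) = (wf_cmd a & wf_cmd b)"
| "wf_cmd (Loop i A c) = wf_cmd c"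
| "wf_cmd (Push i a) = (a < 4)"
| "wf_cmd (Wr i a) = (a < 4)"
| "wf_cmd _ = True"

lemma finite_conts: "finite (conts c K)" by (induction c arbitrary: K) auto

lemma conts_start: "c # K : conts c K" by (cases c) auto

lemma conts_closed: "cs : conts c K ==> nxt xs cs : insert K (conts c K)"
proof (induction c arbitrary: K)
 case (Seq a b)
 consider "cs = (a ;; b) # K" | "cs : conts a (b # K)" | "cs : conts b K" using Seq.prems by auto
 then show ?case
 proof cases
  case 1 then show ?thesis using conts_start[of a "b # K"] by simp
 next
  case 2 then show ?thesis using Seq.IH(1)[OF 2] conts_start[of b K] by auto
 next
  case 3 then show ?thesis using Seq.IH(2)[OF 3] by auto
 qed
next
 case (Cond i A a b)
 consider "cs = Cond i A a b # K" | "cs : conts a K" | "cs : conts b K" using Cond.prems by auto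
 then show ?case
 proof cases
  case 1 then show ?thesis using conts_start[of a K] conts_start[of b K] by simp
 next
  case 2 then show ?thesis using Cond.IH(1)[OF 2] by auto
 next
  case 3 then show ?thesis using Cond.IH(2)[OF 3] by auto
 qed
next
 case (Loop i A c)
 consider "cs = Loop i A c # K" | "cs : conts c (Loop i A c # K)" using Loop.prems by auto
 then show ?case
 proof cases
  case 1 then show ?thesis using conts_start[of c "Loop i A c # K"] by simp
 next
  case 2 then show ?thesis using Loop.IH[OF 2] by auto
 qed
qed auto

lemma conts_wf: "cs : conts c K ==> wf_cmd c ==> list_all wf_cmd K ==> list_all wf_cmd cs"
 by (induction c arbitrary: K) auto

lemma ac_bound:
 assumes "list_all wf_cmd cs" "length xs = 5" "set xs <= {..<4}" "j < 5"
 shows "fst (ac xs cs j) < 4"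
proof -
 have "xs ! j < 4" using assms by (metis lessThan_iff nth_mem subsetD)
 then show ?thesis using assms(1) by (cases cs; cases "hd cs") auto
qed

definition input_store :: "bool list => store" where
 "input_store w = (%_. [])(0 := map (%b. if b then 2 else 1) w)"

lemma tm_of_cmd:
 assumes wf: "wf_cmd c"
 shows "EX M g. turing_machine M & (ALL w t. run M t w =
   (g (fst ((cstep ^^ t) ([c], tapes (length w) (input_store w)))),
    snd ((cstep ^^ t) ([c], tapes (length w) (input_store w))))) &
  g [] = accept M & g [Rej] = reject M"
proof -
 define S where "S = conts c [] \<union> {[], [Rej]}"
 have fin: "finite S" by (simp add: S_def finite_conts)
 have closed: "nxt xs cs : S" if "cs : S" for xs cs
  using that conts_closed[of cs c "[]" xs] by (auto simp: S_def)
 have wfS: "list_all wf_cmd cs" if "cs : S" for cs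
  using that wf conts_wf[of cs c "[]"] by (auto simp: S_def)
 obtain g where g: "bij_betw g S {..<card S}"
  using ex_bij_betw_finite_nat[OF fin] by (auto simp: atLeast0LessThan)
 have ginj: "g x = g y \<longleftrightarrow> x = y" if "x : S" "y : S" for x y
  using g that by (auto simp: bij_betw_def inj_on_def)
 have gS: "g x < card S" if "x : S" for x using g that by (auto simp: bij_betw_def)
 have inv: "inv_into S g (g x) = x" if "x : S" for x
  using g that by (simp add: bij_betw_def)
 have invS: "inv_into S g q : S" if "q < card S" for q
  using g that by (metis bij_betw_def inv_into_into lessThan_iff)
 have in_S: "[c] : S" "[] : S" "[Rej] : S" using conts_start[of c "[]"] by (auto simp: S_def)
 define M where "M = \<lparr>num_tapes = 5, num_states = card S, num_syms = 4, start = g [c],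
   accept = g [], reject = g [Rej],
   delta = (%q xs. (g (nxt xs (inv_into S g q)), map (ac xs (inv_into S g q)) [0..<5]))\<rparr>"
 have tm: "turing_machine M"
  unfolding turing_machine_def
 proof (intro conjI allI impI ballI)
  fix q xs assume q: "q < num_states M" and xs: "xs : tuples (num_tapes M) {..<num_syms M}"
  let ?cs = "inv_into S g q"
  have cs: "?cs : S" using invS q by (simp add: M_def)
  then show "fst (delta M q xs) < num_states M" using gS closed by (simp add: M_def)
  have l: "length xs = 5" "set xs <= {..<4}" using xs by (auto simp: M_def tuples_def)
  have "fst (ac xs ?cs j) < 4" if "j < 5" for j
   using ac_bound[OF wfS[OF cs] l that] .
  then have "set (map (ac xs ?cs) [0..<5]) <= {..<4} \<times> UNIV"
   unfolding set_map image_subset_iff mem_Times_iff by simp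
  then show "snd (delta M q xs) : tuples (num_tapes M) ({..<num_syms M} \<times> UNIV)"
   by (simp add: M_def tuples_def)
 qed (use gS in_S ginj in "auto simp: M_def")
 define H where "H = (%C. (g (fst C), snd C) :: config)"
 have stepH: "step M (H C) = H (cstep C) & fst (cstep C) : S & length (snd (cstep C)) = 5"
  if C: "fst C : S" "length (snd C) = 5" for C
 proof -
  obtain cs ts where C': "C = (cs, ts)" by (cases C)
  have len: "length (snd (cstep C)) = 5" using C by (simp add: cstep_def)
  have "step M (H C) = H (cstep C)"
  proof (cases "cs = [] \<or> cs = [Rej]")
   case True
   then have a: "ac (reads ts) cs = (%j. (reads ts ! j, Stay))" "nxt (reads ts) cs = cs" by auto
   have "map2 act ts (map (%j. (reads ts ! j, Stay)) [0..<5]) = ts"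
    by (rule nth_equalityI) (use C C' in "auto simp: reads_def act_def split: prod.splits")
   then have "cstep C = C" unfolding cstep_def C' fst_conv snd_conv a by simp
   moreover have "halted M (H C)" using True by (auto simp: halted_def H_def C' M_def)
   ultimately show ?thesis by (simp add: step_def)
  next
   case False
   then have "~ halted M (H C)" using C in_S ginj by (auto simp: halted_def H_def C' M_def)
   then show ?thesis using C inv
    by (simp add: step_def H_def M_def C' cstep_def reads_def)
  qed
  then show ?thesis using C closed len by (simp add: cstep_def)
 qed
 have runH: "run M t w = H ((cstep ^^ t) ([c], tapes (length w) (input_store w))) &
   fst ((cstep ^^ t) ([c], tapes (length w) (input_store w))) : S &
   length (snd ((cstep ^^ t) ([c], tapes (length w) (input_store w)))) = 5" for t w
 proof (induction t)
  case 0
  have "tape_of (int (length w)) (input_store w 0) = (word_contents w, 0)"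
   by (auto simp: tape_of_def input_store_def word_contents_def fun_eq_iff)
  moreover have "tape_of 0 [] = (word_contents [], 0)"
   by (auto simp: tape_of_def word_contents_def fun_eq_iff)
  ultimately have "initial M w = H ([c], tapes (length w) (input_store w))"
   by (simp add: initial_def H_def M_def tapes_def upt_conv_Cons bottom_def input_store_def numeral_eq_Suc)
  then show ?case using in_S by (simp add: run_def)
 next
  case (Suc t)
  then show ?case using stepH by (simp add: run_def)
 qed
 show ?thesis
  by (rule exI[of _ M], rule exI[of _ g]) (use tm runH in "auto simp: H_def M_def")
qed

section \<open>Deciding and computing by terminating programs\<close>

definition runs :: "cmd => store => nat => store => bool" where
 "runs c s t s' \<longleftrightarrow> (EX t'<=t. bs c s t' s')"

lemma cstep_halted:
 assumes "K = [] \<or> K = [Rej]" shows "(cstep ^^ t) (K, tapes n s) = (K, tapes n s)"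
proof (induction t)
 case (Suc t)
 then show ?case using assms by (auto simp: cstep_idle fun_eq_iff)
qed simp

lemma decides_of_cmd:
 assumes wf: "wf_cmd c" and r: "!!w. runs c (input_store w) (t (length w)) (s w)"
  and L: "!!w. w : L \<longleftrightarrow> top_of (s w) 0 : A"
 shows "EX M. turing_machine M & decides_in_time M L (%n. t n + 3)"
proof -
 \<comment> \<open>The three additional steps unfold the sequence, evaluate the condition, and
   execute \<open>Nop\<close> or remain in \<open>Rej\<close>.\<close>
 let ?c = "c ;; Cond 0 A Nop Rej"
 obtain M g where M: "turing_machine M" "g [] = accept M" "g [Rej] = reject M"
  and run: "!!w t. run M t w = (g (fst ((cstep ^^ t) ([?c], tapes (length w) (input_store w)))),
    snd ((cstep ^^ t) ([?c], tapes (length w) (input_store w))))"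
  using tm_of_cmd[of ?c] wf by auto
 have "fst (run M (t (length w) + 3) w) = (if w : L then accept M else reject M)" for w
 proof -
  obtain t' where t': "t' <= t (length w)" "bs c (input_store w) t' (s w)" using r by (auto simp: runs_def)
  let ?K = "if w : L then [] else [Rej]"
  have 1: "cstep ([?c], tapes (length w) (input_store w)) = ([c, Cond 0 A Nop Rej], tapes (length w) (input_store w))"
   by (subst cstep_idle) (auto simp: fun_eq_iff)
  have 2: "cstep ([Cond 0 A Nop Rej], tapes (length w) (s w)) = ([if w : L then Nop else Rej], tapes (length w) (s w))"
   by (subst cstep_idle) (auto simp: fun_eq_iff nth_reads L)
  have 3: "cstep ([if w : L then Nop else Rej], tapes (length w) (s w)) = (?K, tapes (length w) (s w))"
   by (subst cstep_idle) (auto simp: fun_eq_iff)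
  have Suc': "(cstep ^^ Suc n) x = (cstep ^^ n) (cstep x)" for n x by (simp add: funpow_swap1)
  have "(cstep ^^ (Suc (t' + Suc (Suc (t (length w) - t'))))) ([?c], tapes (length w) (input_store w))
   = (cstep ^^ (Suc (Suc (t (length w) - t')))) ((cstep ^^ t') ([c, Cond 0 A Nop Rej], tapes (length w) (input_store w)))"
   unfolding Suc'[of _ "([?c], _)"] 1 funpow_add_apply ..
  also have "... = (cstep ^^ (t (length w) - t')) (?K, tapes (length w) (s w))"
   unfolding bs_cstep[OF t'(2)] Suc' 2 3 ..
  also have "... = (?K, tapes (length w) (s w))" by (rule cstep_halted) simp
  finally have "(cstep ^^ (Suc (t' + Suc (Suc (t (length w) - t'))))) ([?c], tapes (length w) (input_store w))
   = (?K, tapes (length w) (s w))" .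
  moreover have "Suc (t' + Suc (Suc (t (length w) - t'))) = t (length w) + 3" using t' by simp
  ultimately show ?thesis using M run by (simp add: numeral_eq_Suc)
 qed
 then show ?thesis using M by (auto simp: decides_in_time_def)
qed

lemma computes_of_cmd:
 assumes wf: "wf_cmd c" and r: "!!w. runs c (input_store w) (t (length w)) (s w)"
  and out: "!!w. s w 4 = map (%b. if b then 2 else 1) (f w)" "!!w. length (s w 5) = length (f w)"
 shows "EX M. turing_machine M & computes_in_time M f t"
proof -
 obtain M g where M: "turing_machine M" "g [] = accept M" "g [Rej] = reject M"
  and run: "!!w t. run M t w = (g (fst ((cstep ^^ t) ([c], tapes (length w) (input_store w)))),
    snd ((cstep ^^ t) ([c], tapes (length w) (input_store w))))"
  using tm_of_cmd[OF wf] by auto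
 have "halted M (run M (t (length w)) w) & fst (last (snd (run M (t (length w)) w))) = word_contents (f w)" for w
 proof -
  obtain t' where t': "t' <= t (length w)" "bs c (input_store w) t' (s w)" using r by (auto simp: runs_def)
  have "(cstep ^^ (t' + (t (length w) - t'))) ([c], tapes (length w) (input_store w)) = ([], tapes (length w) (s w))"
   using bs_cstep[OF t'(2)] cstep_halted[of "[]"] by (simp add: funpow_add_apply)
  then have R: "run M (t (length w)) w = (accept M, tapes (length w) (s w))" using run M t' by simp
  have "last (tapes (length w) (s w)) = tape_of (int (length (f w))) (s w 4)"
   using out(2) by (simp add: tapes_def bottom_def upt_conv_Cons numeral_eq_Suc)
  moreover have "fst (tape_of (int (length (f w))) (s w 4)) = word_contents (f w)"
   by (auto simp: tape_of_def word_contents_def out fun_eq_iff)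
  ultimately show ?thesis using R by (simp add: halted_def)
 qed
 then show ?thesis using M by (auto simp: computes_in_time_def)
qed

section \<open>Programs on stacks of binary trees\<close>

datatype dt = Nl | Cn dt dt

text \<open>Polish notation makes pairing and unpairing of the topmost values a single push or pop.\<close>

fun ser :: "dt => nat list" where
 "ser Nl = [1]" | "ser (Cn a b) = 2 # ser a @ ser b"

lemma ser_pos: "length (ser d) >= 1" by (cases d) auto

lemma set_ser: "set (ser d) <= {1, 2}" by (induction d) auto

lemma ser_append_inj: "ser a @ xs = ser b @ ys ==> a = b & xs = ys"
proof (induction a arbitrary: b xs ys)
 case Nl then show ?case by (cases b) auto
next
 case (Cn a1 a2)
 obtain b1 b2 where b: "b = Cn b1 b2" using Cn.prems by (cases b) auto
 with Cn.prems have "ser a1 @ (ser a2 @ xs) = ser b1 @ (ser b2 @ ys)" by simp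
 then have "a1 = b1" "ser a2 @ xs = ser b2 @ ys" using Cn.IH(1) by blast+
 then show ?case using Cn.IH(2) b by blast
qed

lemma ser_inj: "ser a = ser b \<longleftrightarrow> a = b" using ser_append_inj[of a "[]" b "[]"] by auto

text \<open>Between input and output only four stacks are in use: values, saved values, a second
  copy for duplication and comparison, and a unary counter.\<close>

definition stk :: "nat list => nat list => nat list => nat list => store" where
 "stk m r q c = (%_. [])(0 := m, 1 := r, 2 := q, 3 := c)"

definition first :: "nat list => nat" where "first xs = (case xs of [] => 0 | a # _ => a)"

lemma first_simps [simp]: "first [] = 0" "first (a # l) = a" by (auto simp: first_def)

lemma top_stk [simp]:
 "top_of (stk m r q c) 0 = first m" "top_of (stk m r q c) (Suc 0) = first r"
 "top_of (stk m r q c) 2 = first q" "top_of (stk m r q c) 3 = first c"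
 by (auto simp: top_of_def first_def stk_def)

lemma first_ser [simp]: "first (ser d @ m) = (if d = Nl then 1 else 2)" by (cases d) auto

lemma runs_mono: "runs c s t s' ==> t <= t' ==> runs c s t' s'"
 by (meson runs_def order_trans)

lemma runs_Seq: "runs a s t s' ==> runs b s' t' s'' ==> runs (a ;; b) s (Suc (t + t')) s''"
 unfolding runs_def by (meson Suc_le_mono add_mono bs_Seq)

lemma runs_Seq': "runs a s t s' ==> runs b s' t' s'' ==> Suc (t + t') <= T ==> runs (a ;; b) s T s''"
 using runs_Seq runs_mono by blast

lemma runs_CondT: "i < 5 ==> top_of s i : A ==> runs a s t s' ==> runs (Cond i A a b) s (Suc t) s'"
 unfolding runs_def by (meson Suc_le_mono bs_CondT)

lemma runs_CondF: "i < 5 ==> top_of s i ~: A ==> runs b s t s' ==> runs (Cond i A a b) s (Suc t) s'"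
 unfolding runs_def by (meson Suc_le_mono bs_CondF)

lemma runs_LoopF: "i < 5 ==> top_of s i ~: A ==> runs (Loop i A c) s 1 s"
 unfolding runs_def by (meson le_refl bs_LoopF)

lemma runs_LoopT: "i < 5 ==> top_of s i : A ==> runs c s t s' ==> runs (Loop i A c) s' t' s''
  ==> runs (Loop i A c) s (Suc (t + t')) s''"
 unfolding runs_def by (meson Suc_le_mono add_mono bs_LoopT)

lemma runs_Nop: "runs Nop s 1 s" unfolding runs_def by (meson le_refl bs_Nop)

lemma runs_Push:
 "runs (Push 0 a) (stk m r q c) 2 (stk (a # m) r q c)" "runs (Push (Suc 0) a) (stk m r q c) 2 (stk m (a # r) q c)"
 "runs (Push 2 a) (stk m r q c) 2 (stk m r (a # q) c)" "runs (Push 3 a) (stk m r q c) 2 (stk m r q (a # c))"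
proof -
 have P: "i < 5 ==> runs (Push i a) s 2 (s(i := a # s i))" for i s
  unfolding runs_def using bs_Push by blast
 show "runs (Push 0 a) (stk m r q c) 2 (stk (a # m) r q c)" using P[of 0 "stk m r q c"]
  by (simp add: stk_def fun_upd_twist)
 show "runs (Push (Suc 0) a) (stk m r q c) 2 (stk m (a # r) q c)" using P[of 1 "stk m r q c"]
  by (simp add: stk_def fun_upd_twist)
 show "runs (Push 2 a) (stk m r q c) 2 (stk m r (a # q) c)" using P[of 2 "stk m r q c"]
  by (simp add: stk_def fun_upd_twist)
 show "runs (Push 3 a) (stk m r q c) 2 (stk m r q (a # c))" using P[of 3 "stk m r q c"]
  by (simp add: stk_def fun_upd_twist)
qed

lemma runs_Pop:
 "runs (Pop 0) (stk (a # m) r q c) 1 (stk m r q c)" "runs (Pop (Suc 0)) (stk m (a # r) q c) 1 (stk m r q c)"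
 "runs (Pop 2) (stk m r (a # q) c) 1 (stk m r q c)" "runs (Pop 3) (stk m r q (a # c)) 1 (stk m r q c)"
proof -
 have P: "i < 5 ==> s i ~= [] ==> runs (Pop i) s 1 (s(i := tl (s i)))" for i s
  unfolding runs_def using bs_Pop by blast
 show "runs (Pop 0) (stk (a # m) r q c) 1 (stk m r q c)" using P[of 0 "stk (a # m) r q c"]
  by (simp add: stk_def fun_upd_twist)
 show "runs (Pop (Suc 0)) (stk m (a # r) q c) 1 (stk m r q c)" using P[of 1 "stk m (a # r) q c"]
  by (simp add: stk_def fun_upd_twist)
 show "runs (Pop 2) (stk m r (a # q) c) 1 (stk m r q c)" using P[of 2 "stk m r (a # q) c"]
  by (simp add: stk_def fun_upd_twist)
 show "runs (Pop 3) (stk m r q (a # c)) 1 (stk m r q c)" using P[of 3 "stk m r q (a # c)"]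
  by (simp add: stk_def fun_upd_twist)
qed

lemmas runs_prim = runs_Push runs_Pop runs_Nop

definition copy_sym :: "bool => bool => nat => cmd" where
 "copy_sym f g a = (if f then Push 1 a else Nop) ;; (if g then Push 2 a else Nop)"

definition traverse_loop :: "bool => bool => cmd" where
 "traverse_loop f g = Loop 3 {1} (Cond 0 {2} (copy_sym f g 2 ;; (Pop 0 ;; Push 3 1)) (copy_sym f g 1 ;; (Pop 0 ;; Pop 3)))"

text \<open>Pops one value from the main stack; stack 3 counts the subtrees still to be read.\<close>

definition traverse :: "bool => bool => cmd" where
 "traverse f g = Push 3 1 ;; traverse_loop f g"

definition ext :: "bool => nat list => nat list => nat list" where "ext f xs r = (if f then rev xs @ r else r)"

lemma runs_copy_sym: "runs (copy_sym f g a) (stk m r q c) 5 (stk m (ext f [a] r) (ext g [a] q) c)"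
proof -
 have 1: "runs (if f then Push 1 a else Nop) (stk m r q c) 2 (stk m (ext f [a] r) q c)"
  using runs_Push(2) runs_mono[OF runs_Nop] by (auto simp: ext_def)
 have 2: "runs (if g then Push 2 a else Nop) (stk m (ext f [a] r) q c) 2 (stk m (ext f [a] r) (ext g [a] q) c)"
  using runs_Push(3) runs_mono[OF runs_Nop] by (auto simp: ext_def)
 show ?thesis unfolding copy_sym_def by (rule runs_Seq'[OF 1 2]) simp
qed

lemma ext_append: "ext f ys (ext f xs r) = ext f (xs @ ys) r" by (simp add: ext_def)

text \<open>The rest of the loop is a hypothesis, in continuation style. The induction on
  \<open>d\<close> can then chain the two subtrees without cutting the run of the loop into pieces.
  Each symbol costs at most 12 steps.\<close>

lemma runs_traverse_loop:
 "runs (traverse_loop f g) (stk m (ext f (ser d) r) (ext g (ser d) q) c) t s' ==>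
  runs (traverse_loop f g) (stk (ser d @ m) r q (1 # c)) (t + 12 * length (ser d)) s'"
proof (induction d arbitrary: m r q c t)
 case Nl
 have "runs (copy_sym f g 1 ;; (Pop 0 ;; Pop 3)) (stk (1 # m) r q (1 # c)) (Suc (5 + Suc (1 + 1)))
   (stk m (ext f [1] r) (ext g [1] q) c)"
  by (rule runs_Seq runs_copy_sym runs_prim)+
 from runs_CondF[OF _ _ this, of 0 "{2}"]
 have "runs (Cond 0 {2} (copy_sym f g 2 ;; (Pop 0 ;; Push 3 1)) (copy_sym f g 1 ;; (Pop 0 ;; Pop 3)))
   (stk (1 # m) r q (1 # c)) (Suc (Suc (5 + Suc (1 + 1)))) (stk m (ext f [1] r) (ext g [1] q) c)"
  by simp
 from runs_LoopT[OF _ _ this Nl[unfolded traverse_loop_def ser.simps]]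
 have "runs (traverse_loop f g) (stk (1 # m) r q (1 # c)) (Suc (Suc (Suc (5 + Suc (1 + 1))) + t)) s'"
  unfolding traverse_loop_def by simp
 then show ?case by (auto elim!: runs_mono)
next
 case (Cn d1 d2)
 have 1: "runs (copy_sym f g 2 ;; (Pop 0 ;; Push 3 1)) (stk (2 # ser d1 @ ser d2 @ m) r q (1 # c)) (Suc (5 + Suc (1 + 2)))
   (stk (ser d1 @ ser d2 @ m) (ext f [2] r) (ext g [2] q) (1 # 1 # c))"
  by (rule runs_Seq runs_copy_sym runs_prim)+
 have 2: "runs (Cond 0 {2} (copy_sym f g 2 ;; (Pop 0 ;; Push 3 1)) (copy_sym f g 1 ;; (Pop 0 ;; Pop 3)))
   (stk (2 # ser d1 @ ser d2 @ m) r q (1 # c)) 11 (stk (ser d1 @ ser d2 @ m) (ext f [2] r) (ext g [2] q) (1 # 1 # c))"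
  by (rule runs_CondT[OF _ _ 1, THEN runs_mono]) auto
 have "runs (traverse_loop f g) (stk m (ext f (ser d2) (ext f (ser d1) (ext f [2] r))) (ext g (ser d2) (ext g (ser d1) (ext g [2] q))) c) t s'"
  using Cn.prems by (simp add: ext_append)
 from Cn.IH(1)[OF Cn.IH(2)[OF this]]
 have 3: "runs (traverse_loop f g) (stk (ser d1 @ ser d2 @ m) (ext f [2] r) (ext g [2] q) (1 # 1 # c))
  (t + 12 * length (ser d2) + 12 * length (ser d1)) s'" .
 have "runs (traverse_loop f g) (stk (2 # ser d1 @ ser d2 @ m) r q (1 # c))
   (Suc (11 + (t + 12 * length (ser d2) + 12 * length (ser d1)))) s'"
  unfolding traverse_loop_def by (rule runs_LoopT[OF _ _ 2 3[unfolded traverse_loop_def]]) auto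
 then show ?case by (auto elim!: runs_mono)
qed

lemma runs_traverse:
 "runs (traverse f g) (stk (ser d @ m) r q []) (12 * length (ser d) + 4) (stk m (ext f (ser d) r) (ext g (ser d) q) [])"
proof -
 have "runs (traverse_loop f g) (stk m (ext f (ser d) r) (ext g (ser d) q) []) 1 (stk m (ext f (ser d) r) (ext g (ser d) q) [])"
  unfolding traverse_loop_def by (rule runs_LoopF) auto
 from runs_traverse_loop[OF this] show ?thesis unfolding traverse_def
  by (rule runs_Seq'[OF runs_Push(4)]) simp
qed

definition restore :: "nat => cmd" where
 "restore i = Loop i {1, 2} (Cond i {1} (Push 0 1) (Push 0 2) ;; Pop i) ;; Pop i"

lemma runs_restore1:
 assumes "set xs <= {1, 2}"
 shows "runs (restore 1) (stk m (xs @ 3 # r) q c) (6 * length xs + 3) (stk (rev xs @ m) r q c)"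
proof -
 have "runs (Loop 1 {1, 2} (Cond 1 {1} (Push 0 1) (Push 0 2) ;; Pop 1)) (stk m (xs @ 3 # r) q c)
   (6 * length xs + 1) (stk (rev xs @ m) (3 # r) q c)"
  using assms
 proof (induction xs arbitrary: m)
  case Nil then show ?case by (auto intro: runs_LoopF[unfolded One_nat_def])
 next
  case (Cons x xs)
  have "runs (Cond 1 {1} (Push 0 1) (Push 0 2)) (stk m (x # xs @ 3 # r) q c) (Suc 2) (stk (x # m) (x # xs @ 3 # r) q c)"
  proof (cases "x = 1")
   case True
   then show ?thesis by (intro runs_CondT) (auto intro: runs_Push(1))
  next
   case False
   then have "x = 2" using Cons.prems by auto
   then show ?thesis by (intro runs_CondF) (auto intro: runs_Push(1))
  qed
  from runs_Seq[OF this runs_Pop(2)] have 1: "runs (Cond 1 {1} (Push 0 1) (Push 0 2) ;; Pop 1) (stk m (x # xs @ 3 # r) q c) 5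
    (stk (x # m) (xs @ 3 # r) q c)" by simp
  have "runs (Loop 1 {1, 2} (Cond 1 {1} (Push 0 1) (Push 0 2) ;; Pop 1)) (stk m (x # xs @ 3 # r) q c)
    (Suc (5 + (6 * length xs + 1))) (stk (rev xs @ x # m) (3 # r) q c)"
   by (rule runs_LoopT[OF _ _ 1 Cons.IH]) (use Cons.prems in auto)
  then show ?case by simp
 qed
 from runs_Seq[OF this runs_Pop(2)[folded One_nat_def]] show ?thesis unfolding restore_def by (rule runs_mono) simp
qed

lemma runs_restore2:
 assumes "set xs <= {1, 2}"
 shows "runs (restore 2) (stk m r (xs @ 3 # q) c) (6 * length xs + 3) (stk (rev xs @ m) r q c)"
proof -
 have "runs (Loop 2 {1, 2} (Cond 2 {1} (Push 0 1) (Push 0 2) ;; Pop 2)) (stk m r (xs @ 3 # q) c)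
   (6 * length xs + 1) (stk (rev xs @ m) r (3 # q) c)"
  using assms
 proof (induction xs arbitrary: m)
  case Nil then show ?case by (auto intro: runs_LoopF[unfolded One_nat_def])
 next
  case (Cons x xs)
  have "runs (Cond 2 {1} (Push 0 1) (Push 0 2)) (stk m r (x # xs @ 3 # q) c) (Suc 2) (stk (x # m) r (x # xs @ 3 # q) c)"
  proof (cases "x = 1")
   case True
   then show ?thesis by (intro runs_CondT) (auto intro: runs_Push(1))
  next
   case False
   then have "x = 2" using Cons.prems by auto
   then show ?thesis by (intro runs_CondF) (auto intro: runs_Push(1))
  qed
  from runs_Seq[OF this runs_Pop(3)] have 1: "runs (Cond 2 {1} (Push 0 1) (Push 0 2) ;; Pop 2) (stk m r (x # xs @ 3 # q) c) 5
    (stk (x # m) r (xs @ 3 # q) c)" by simp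
  have "runs (Loop 2 {1, 2} (Cond 2 {1} (Push 0 1) (Push 0 2) ;; Pop 2)) (stk m r (x # xs @ 3 # q) c)
    (Suc (5 + (6 * length xs + 1))) (stk (rev xs @ x # m) r (3 # q) c)"
   by (rule runs_LoopT[OF _ _ 1 Cons.IH]) (use Cons.prems in auto)
  then show ?case by simp
 qed
 from runs_Seq[OF this runs_Pop(3)] show ?thesis unfolding restore_def by (rule runs_mono) simp
qed

section \<open>Saving, dropping, duplicating and comparing values\<close>

definition S :: "nat list => nat list => store" where "S m r = stk m r [] []"

text \<open>A saved value is reversed because it was moved symbol by symbol. The separator 3 below
  it tells \<open>restore\<close> where to stop.\<close>

definition blk :: "dt => nat list" where "blk d = rev (ser d) @ [3]"

definition toR :: cmd where "toR = Push 1 3 ;; traverse True False"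
definition fromR :: cmd where "fromR = restore 1"
definition drop_top :: cmd where "drop_top = traverse False False"
definition dup :: cmd where "dup = Push 1 3 ;; (Push 2 3 ;; (traverse True True ;; (restore 1 ;; restore 2)))"

lemma runs_toR: "runs toR (S (ser d @ m) r) (12 * length (ser d) + 7) (S m (blk d @ r))"
proof -
 have "runs (traverse True False) (stk (ser d @ m) (3 # r) [] []) (12 * length (ser d) + 4) (stk m (blk d @ r) [] [])"
  using runs_traverse[of True False d m "3 # r" "[]"] by (simp add: ext_def blk_def)
 then show ?thesis unfolding toR_def S_def One_nat_def by (rule runs_Seq'[OF runs_Push(2)]) simp
qed

lemma runs_drop: "runs drop_top (S (ser d @ m) r) (12 * length (ser d) + 4) (S m r)"
 using runs_traverse[of False False d m r "[]"] by (simp add: ext_def drop_top_def S_def)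

lemma runs_fromR: "runs fromR (S m (blk d @ r)) (6 * length (ser d) + 3) (S (ser d @ m) r)"
 using runs_restore1[of "rev (ser d)" m r "[]" "[]"] set_ser[of d] by (simp add: S_def fromR_def blk_def)

lemma runs_dup: "runs dup (S (ser d @ m) r) (24 * length (ser d) + 20) (S (ser d @ ser d @ m) r)"
proof -
 have 1: "runs (traverse True True) (stk (ser d @ m) (3 # r) [3] []) (12 * length (ser d) + 4)
   (stk m (rev (ser d) @ 3 # r) (rev (ser d) @ [3]) [])"
  using runs_traverse[of True True d m "3 # r" "[3]"] by (simp add: ext_def)
 have 2: "runs (restore 1) (stk m (rev (ser d) @ 3 # r) (rev (ser d) @ [3]) []) (6 * length (ser d) + 3)
   (stk (ser d @ m) r (rev (ser d) @ [3]) [])"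
  using runs_restore1[of "rev (ser d)" m r "rev (ser d) @ [3]" "[]"] set_ser[of d] by simp
 have 3: "runs (restore 2) (stk (ser d @ m) r (rev (ser d) @ [3]) []) (6 * length (ser d) + 3)
   (stk (ser d @ ser d @ m) r [] [])"
  using runs_restore2[of "rev (ser d)" "ser d @ m" r "[]" "[]"] set_ser[of d] by simp
 have "runs dup (S (ser d @ m) r) (Suc (2 + Suc (2 + Suc ((12 * length (ser d) + 4) + Suc ((6 * length (ser d) + 3) + (6 * length (ser d) + 3))))))
  (S (ser d @ ser d @ m) r)"
  unfolding dup_def S_def One_nat_def by (rule runs_Seq runs_Push 1 2[unfolded One_nat_def] 3)+
 then show ?thesis by (rule runs_mono) simp
qed

definition eq_loop :: cmd where
 "eq_loop = Loop 1 {1, 2} (Cond 1 {1} (Cond 2 {1} (Pop 2) (Push 3 1)) (Cond 2 {2} (Pop 2) (Push 3 1)) ;; Pop 1)"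

text \<open>Stack 3 collects a mark at every mismatch and never loses one. The words agree iff there
  are neither marks nor symbols left over from the second word. The sizes of both remainders are
  tracked because they must be cleared afterwards in linear time.\<close>

lemma runs_eq_loop:
 assumes "set xs <= {1, 2}" "set ys <= {1, 2}" "set c <= {1}"
 shows "EX ys' c'. runs eq_loop (stk m (xs @ 3 # r) (ys @ [3]) c) (8 * length xs + 1) (stk m (3 # r) (ys' @ [3]) c') &
   (ys' = [] & c' = [] \<longleftrightarrow> xs = ys & c = []) & length ys' <= length ys & length c' <= length c + length xs
   & set ys' <= {1, 2} & set c' <= {1}"
 using assms
proof (induction xs arbitrary: ys c)
 case Nil
 have "runs eq_loop (stk m (3 # r) (ys @ [3]) c) 1 (stk m (3 # r) (ys @ [3]) c)"
  unfolding eq_loop_def by (rule runs_LoopF) auto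
 with Nil show ?case by (intro exI[of _ ys] exI[of _ c]) auto
next
 case (Cons x xs)
 let ?b = "Cond 1 {1} (Cond 2 {1} (Pop 2) (Push 3 1)) (Cond 2 {2} (Pop 2) (Push 3 1))"
 show ?case
 proof (cases "EX zs. ys = x # zs")
  case True
  then obtain zs where ys: "ys = x # zs" by blast
  have "runs ?b (stk m (x # xs @ 3 # r) (ys @ [3]) c) (Suc (Suc 1)) (stk m (x # xs @ 3 # r) (zs @ [3]) c)"
  proof (cases "x = 1")
   case True
   then show ?thesis unfolding ys append_Cons
    by (intro runs_CondT runs_prim(7)) auto
  next
   case False
   then have "x = 2" using Cons.prems(1) by auto
   then show ?thesis unfolding ys append_Cons
    by (intro runs_CondF[of 1] runs_CondT[of 2] runs_prim(7)) auto
  qed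
  then have "runs ?b (stk m (x # xs @ 3 # r) (ys @ [3]) c) 4 (stk m (x # xs @ 3 # r) (zs @ [3]) c)"
   by (rule runs_mono) simp
  from runs_Seq[OF this runs_Pop(2)] have 1: "runs (?b ;; Pop 1) (stk m (x # xs @ 3 # r) (ys @ [3]) c) 6
    (stk m (xs @ 3 # r) (zs @ [3]) c)" by simp
  obtain ys' c' where IH: "runs eq_loop (stk m (xs @ 3 # r) (zs @ [3]) c) (8 * length xs + 1) (stk m (3 # r) (ys' @ [3]) c')"
   "ys' = [] & c' = [] \<longleftrightarrow> xs = zs & c = []" "length ys' <= length zs" "length c' <= length c + length xs" "set ys' <= {1, 2}" "set c' <= {1}"
   using Cons.IH[of zs c] Cons.prems ys by auto
  have "runs eq_loop (stk m ((x # xs) @ 3 # r) (ys @ [3]) c) (8 * length (x # xs) + 1) (stk m (3 # r) (ys' @ [3]) c')"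
   unfolding eq_loop_def
   by (rule runs_mono[OF runs_LoopT[OF _ _ _ IH(1)[unfolded eq_loop_def]]]) (use 1 Cons.prems in auto)
  with IH ys show ?thesis by (intro exI[of _ ys'] exI[of _ c']) auto
 next
  case False
  then have ne: "first (ys @ [3]) ~= x" using Cons.prems(1) by (cases ys) auto
  have "runs ?b (stk m (x # xs @ 3 # r) (ys @ [3]) c) (Suc (Suc 2)) (stk m (x # xs @ 3 # r) (ys @ [3]) (1 # c))"
  proof (cases "x = 1")
   case True
   then show ?thesis using ne by (intro runs_CondT[of 1] runs_CondF[of 2] runs_prim(4)) auto
  next
   case False
   then have "x = 2" using Cons.prems(1) by auto
   then show ?thesis using ne by (intro runs_CondF[of 1] runs_CondF[of 2] runs_prim(4)) auto
  qed
  then have "runs ?b (stk m (x # xs @ 3 # r) (ys @ [3]) c) 4 (stk m (x # xs @ 3 # r) (ys @ [3]) (1 # c))"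
   by (rule runs_mono) simp
  from runs_Seq[OF this runs_Pop(2)] have 1: "runs (?b ;; Pop 1) (stk m (x # xs @ 3 # r) (ys @ [3]) c) 6
    (stk m (xs @ 3 # r) (ys @ [3]) (1 # c))" by simp
  obtain ys' c' where IH: "runs eq_loop (stk m (xs @ 3 # r) (ys @ [3]) (1 # c)) (8 * length xs + 1) (stk m (3 # r) (ys' @ [3]) c')"
   "~ (ys' = [] & c' = [])" "length ys' <= length ys" "length c' <= length (1 # c) + length xs" "set ys' <= {1, 2}" "set c' <= {1}"
   using Cons.IH[of ys "1 # c"] Cons.prems by auto
  have "runs eq_loop (stk m ((x # xs) @ 3 # r) (ys @ [3]) c) (8 * length (x # xs) + 1) (stk m (3 # r) (ys' @ [3]) c')"
   unfolding eq_loop_def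
   by (rule runs_mono[OF runs_LoopT[OF _ _ _ IH(1)[unfolded eq_loop_def]]]) (use 1 Cons.prems in auto)
  with IH False show ?thesis by (intro exI[of _ ys'] exI[of _ c']) auto
 qed
qed

lemma runs_clear2: "set ys <= {1, 2} ==>
 runs (Loop 2 {1, 2} (Pop 2)) (stk m r (ys @ [3]) c) (2 * length ys + 1) (stk m r [3] c)"
proof (induction ys)
 case Nil then show ?case by (auto intro: runs_LoopF[unfolded One_nat_def])
next
 case (Cons y ys)
 show ?case by (rule runs_mono[OF runs_LoopT[OF _ _ runs_Pop(3)[of m r y "ys @ [3]" c, folded append_Cons]]]) (use Cons in auto)
qed

lemma runs_clear3: "set c <= {1} ==> runs (Loop 3 {1} (Pop 3)) (stk m r q c) (2 * length c + 1) (stk m r q [])"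
proof (induction c)
 case Nil then show ?case by (auto intro: runs_LoopF[unfolded One_nat_def])
next
 case (Cons y ys)
 show ?case by (rule runs_mono[OF runs_LoopT[OF _ _ runs_Pop(4)]]) (use Cons in auto)
qed

definition bool_dt :: "bool => dt" where "bool_dt b = (if b then Cn Nl Nl else Nl)"

definition eq_top :: cmd where
 "eq_top = Push 1 3 ;; (traverse True False ;; (Push 2 3 ;; (traverse False True ;; (eq_loop ;; (Pop 1 ;;
   (Cond 2 {3} Nop (Push 3 1) ;; (Loop 2 {1, 2} (Pop 2) ;; (Pop 2 ;;
   (Cond 3 {1} (Push 0 1) (Push 0 1 ;; (Push 0 1 ;; Push 0 2)) ;; Loop 3 {1} (Pop 3))))))))))"

lemma runs_eq_top:
 "runs eq_top (S (ser a @ ser b @ m) r) (40 * (length (ser a) + length (ser b)) + 60) (S (ser (bool_dt (a = b)) @ m) r)"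
proof -
 have 1: "runs (traverse True False) (stk (ser a @ ser b @ m) (3 # r) [] []) (12 * length (ser a) + 4)
   (stk (ser b @ m) (rev (ser a) @ 3 # r) [] [])"
  using runs_traverse[of True False a "ser b @ m" "3 # r" "[]"] by (simp add: ext_def)
 have 2: "runs (traverse False True) (stk (ser b @ m) (rev (ser a) @ 3 # r) [3] []) (12 * length (ser b) + 4)
   (stk m (rev (ser a) @ 3 # r) (rev (ser b) @ [3]) [])"
  using runs_traverse[of False True b m "rev (ser a) @ 3 # r" "[3]"] by (simp add: ext_def)
 obtain ys c where l: "runs eq_loop (stk m (rev (ser a) @ 3 # r) (rev (ser b) @ [3]) []) (8 * length (ser a) + 1) (stk m (3 # r) (ys @ [3]) c)"
   and e: "ys = [] & c = [] \<longleftrightarrow> a = b" and le: "length ys <= length (ser b)" "length c <= length (ser a)"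
   and s: "set ys <= {1, 2}" "set c <= {1}"
  using runs_eq_loop[of "rev (ser a)" "rev (ser b)" "[]" m r] set_ser[of a] set_ser[of b] ser_inj by auto
 \<comment> \<open>Symbols left over from the second word count as one more mismatch.\<close>
 define c' where "c' = (if ys = [] then c else 1 # c)"
 have s': "set c' <= {1}" and lc: "length c' <= Suc (length (ser a))" and e': "c' = [] \<longleftrightarrow> a = b"
  using s le e by (auto simp: c'_def)
 have 3: "runs (Cond 2 {3} Nop (Push 3 1)) (stk m r (ys @ [3]) c) 3 (stk m r (ys @ [3]) c')"
 proof (cases ys)
  case Nil
  then show ?thesis by (auto simp: c'_def intro!: runs_mono[OF runs_CondT[OF _ _ runs_Nop]])
 next
  case (Cons y zs)
  then show ?thesis using s by (auto simp: c'_def intro!: runs_mono[OF runs_CondF[OF _ _ runs_Push(4)]])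
 qed
 have 4: "runs (Cond 3 {1} (Push 0 1) (Push 0 1 ;; (Push 0 1 ;; Push 0 2))) (stk m r [] c') 9 (stk (ser (bool_dt (a = b)) @ m) r [] c')"
 proof (cases c')
  case Nil
  then have ab: "a = b" using e' by simp
  have "runs (Push 0 1 ;; (Push 0 1 ;; Push 0 2)) (stk m r [] []) (Suc (2 + Suc (2 + 2))) (stk (2 # 1 # 1 # m) r [] [])"
   by (rule runs_Seq runs_prim)+
  then show ?thesis using Nil ab by (auto simp: bool_dt_def intro!: runs_mono[OF runs_CondF])
 next
  case (Cons y zs)
  then have "a ~= b" "y = 1" using e' s' by auto
  then show ?thesis using Cons runs_Push(1)[of 1 m r "[]" c']
   by (auto simp: bool_dt_def intro!: runs_mono[OF runs_CondT])
 qed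
 have "runs eq_top (S (ser a @ ser b @ m) r)
  (Suc (2 + Suc ((12 * length (ser a) + 4) + Suc (2 + Suc ((12 * length (ser b) + 4) + Suc ((8 * length (ser a) + 1) + Suc (1 +
   Suc (3 + Suc ((2 * length ys + 1) + Suc (1 + Suc (9 + (2 * length c' + 1))))))))))))
  (S (ser (bool_dt (a = b)) @ m) r)"
  unfolding eq_top_def S_def One_nat_def
  by (rule runs_Seq runs_Push runs_Pop[unfolded One_nat_def] 1[unfolded One_nat_def] 2[unfolded One_nat_def] l[unfolded One_nat_def] 3[unfolded One_nat_def]
    4[unfolded One_nat_def] runs_clear2[unfolded One_nat_def] runs_clear3[unfolded One_nat_def] s(1)[unfolded One_nat_def] s'[unfolded One_nat_def])+
 then show ?thesis by (rule runs_mono) (use le lc in simp)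
qed

fun push_const :: "dt => cmd" where
 "push_const Nl = Push 0 1"
| "push_const (Cn a b) = push_const b ;; (push_const a ;; Push 0 2)"

lemma runs_push_const: "runs (push_const d) (S m r) (4 * length (ser d)) (S (ser d @ m) r)"
proof (induction d arbitrary: m)
 case Nl
 then show ?case unfolding S_def by (auto intro!: runs_mono[OF runs_Push(1)])
next
 case (Cn a b)
 have "runs (push_const (Cn a b)) (S m r) (Suc (4 * length (ser b) + Suc (4 * length (ser a) + 2))) (S (ser (Cn a b) @ m) r)"
  unfolding push_const.simps by (rule runs_Seq Cn.IH)+ (simp add: S_def runs_prim)
 then show ?case by (rule runs_mono) simp
qed

lemma wf_progs [simp]: "wf_cmd toR" "wf_cmd fromR" "wf_cmd drop_top" "wf_cmd dup" "wf_cmd eq_top" "wf_cmd (push_const d)"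
proof -
 show "wf_cmd (push_const d)" by (induction d) auto
qed (auto simp: toR_def fromR_def drop_top_def dup_def eq_top_def traverse_def traverse_loop_def restore_def copy_sym_def eq_loop_def)

section \<open>Polynomial-time computable functions on data\<close>

class data =
 fixes enc :: "'a => dt"
 assumes enc_inj: "enc x = enc y ==> x = y"

lemma enc_eq: "enc x = enc y \<longleftrightarrow> x = y" using enc_inj by blast

instantiation dt :: data
begin
definition enc_dt :: "dt => dt" where "enc_dt d = d"
instance by standard (simp add: enc_dt_def)
end

instantiation bool :: data
begin
definition enc_bool :: "bool => dt" where "enc_bool b = bool_dt b"
instance by standard (auto simp: enc_bool_def bool_dt_def split: if_splits)
end

instantiation unit :: data
begin
definition enc_unit :: "unit => dt" where "enc_unit b = Nl"
instance by standard simp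
end

text \<open>Numbers are coded in unary, like lists of units, which suits counters, indices and
  lengths. Names of an instance get a binary code of their own later.\<close>

instantiation nat :: data
begin
primrec enc_nat :: "nat => dt" where "enc_nat 0 = Nl" | "enc_nat (Suc n) = Cn Nl (enc_nat n)"
instance
proof
 fix m n :: nat show "enc m = enc n ==> m = n"
 proof (induction m arbitrary: n)
  case 0 then show ?case by (cases n) auto
 next
  case (Suc m) show ?case using Suc.prems Suc.IH by (cases n) auto
 qed
qed
end

instantiation prod :: (data, data) data
begin
definition enc_prod :: "'a * 'b => dt" where "enc_prod z = Cn (enc (fst z)) (enc (snd z))"
instance by standard (auto simp: enc_prod_def enc_eq prod_eq_iff)
end

instantiation list :: (data) data
begin
primrec enc_list :: "'a list => dt" where "enc_list [] = Nl" | "enc_list (x # xs) = Cn (enc x) (enc_list xs)"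
instance
proof
 fix xs ys :: "'a list" show "enc xs = enc ys ==> xs = ys"
 proof (induction xs arbitrary: ys)
  case Nil then show ?case by (cases ys) auto
 next
  case (Cons x xs) show ?case using Cons.prems Cons.IH by (cases ys) (auto simp: enc_eq)
 qed
qed
end

lemma enc_Pair: "enc (a, b) = Cn (enc a) (enc b)" by (simp add: enc_prod_def)

definition sz :: "'a::data => nat" where "sz x = length (ser (enc x))"

lemma sz_pos: "sz x >= 1" unfolding sz_def by (rule ser_pos)

lemma sz_Pair [simp]: "sz (a, b) = Suc (sz a + sz b)" by (simp add: sz_def enc_prod_def)
lemma sz_Nil [simp]: "sz [] = 1" by (simp add: sz_def)
lemma sz_Cons [simp]: "sz (a # l) = Suc (sz a + sz l)" by (simp add: sz_def)
lemma sz_nat [simp]: "sz (n::nat) = 2 * n + 1" by (induction n) (auto simp: sz_def)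
lemma sz_unit [simp]: "sz (u::unit) = 1" by (simp add: sz_def enc_unit_def)
lemma sz_bool: "sz (b::bool) <= 3" by (simp add: sz_def enc_bool_def bool_dt_def)
lemma sz_append: "Suc (sz (xs @ ys)) = sz xs + sz ys" by (induction xs) auto
lemma sz_rev [simp]: "sz (rev xs) = sz xs"
proof (induction xs)
 case (Cons a xs)
 then show ?case using sz_append[of "rev xs" "[a]"] by simp
qed simp
lemma sz_append_le: "sz (xs @ ys) <= sz xs + sz ys" using sz_append[of xs ys] by simp
lemma sz_prefix: "sz ys <= sz (ys @ zs)" using sz_append[of ys zs] sz_pos[of zs] by simp
lemma sz_suffix: "sz zs <= sz (ys @ zs)" using sz_append[of ys zs] sz_pos[of ys] by simp
lemma sz_elem: "a : set l ==> sz a < sz l" by (induction l) auto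
lemma length_le_sz: "length l <= sz l" by (induction l) auto
lemma sz_le_bound: "(!!a. a : set l ==> sz a <= B) ==> sz l <= Suc (length l * Suc B)"
proof (induction l)
 case (Cons a l)
 have "sz a <= B" "sz l <= Suc (length l * Suc B)" using Cons.prems Cons.IH by auto
 then show ?case by simp
qed simp

subsection \<open>Polynomial bounds\<close>

definition pb :: "(nat => nat) => bool" where "pb f \<longleftrightarrow> (EX k. ALL n. f n <= (n + 2) ^ k)"

lemma pb_mono: "pb g ==> (!!n. f n <= g n) ==> pb f" unfolding pb_def by (meson order_trans)

lemma pb_id: "pb (%n. n)" unfolding pb_def by (rule exI[of _ 1]) simp

lemma pb_const: "pb (%n. c)"
 unfolding pb_def
proof (intro exI[of _ c] allI)
 fix n
 have "c <= 2 ^ c" by (simp add: less_imp_le)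
 also have "... <= (n + 2) ^ c" by (rule power_mono) auto
 finally show "c <= (n + 2) ^ c" .
qed

lemma pb_add: assumes "pb f" "pb g" shows "pb (%n. f n + g n)"
proof -
 obtain a b where a: "!!n. f n <= (n + 2) ^ a" and b: "!!n. g n <= (n + 2) ^ b" using assms pb_def by metis
 have "f n + g n <= (n + 2) ^ Suc (max a b)" for n
 proof -
  have "f n <= (n + 2) ^ max a b" "g n <= (n + 2) ^ max a b"
   using order_trans[OF a power_increasing[of a "max a b"]] order_trans[OF b power_increasing[of b "max a b"]] by simp_all
  then have "f n + g n <= 2 * (n + 2) ^ max a b" by simp
  also have "... <= (n + 2) * (n + 2) ^ max a b" by (rule mult_right_mono) auto
  finally show ?thesis by simp
 qed
 then show ?thesis unfolding pb_def by blast
qed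

lemma pb_mult: assumes "pb f" "pb g" shows "pb (%n. f n * g n)"
proof -
 obtain a b where a: "!!n. f n <= (n + 2) ^ a" and b: "!!n. g n <= (n + 2) ^ b" using assms pb_def by metis
 then have "f n * g n <= (n + 2) ^ (a + b)" for n unfolding power_add by (simp add: mult_mono)
 then show ?thesis unfolding pb_def by blast
qed

lemma pb_pow: "pb f ==> pb (%n. f n ^ k)"
 by (induction k) (auto intro: pb_const pb_mult)

lemma pb_comp: assumes "pb f" "pb g" shows "pb (%n. f (g n))"
proof -
 obtain a b where a: "!!n. f n <= (n + 2) ^ a" and b: "!!n. g n <= (n + 2) ^ b" using assms pb_def by metis
 show ?thesis
 proof (rule pb_mono)
  show "f (g n) <= ((n + 2) ^ b + 2) ^ a" for n
   using a[of "g n"] power_mono[of "g n + 2" "(n + 2) ^ b + 2" a] b[of n] by fastforce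
  show "pb (%n. ((n + 2) ^ b + 2) ^ a)" by (intro pb_pow pb_add pb_id pb_const)
 qed
qed

lemma pb_Suc: "pb f ==> pb (%n. Suc (f n))" using pb_add[OF _ pb_const[of 1]] by simp

lemmas pb_intros = pb_Suc pb_add pb_mult pb_pow pb_id pb_const

subsection \<open>Computations and their combinators\<close>

text \<open>The quantified \<open>m\<close> and \<open>r\<close> are a frame: whatever lies below
  the argument, or is saved on stack 1, stays untouched. This is what allows programs to be
  nested.\<close>

definition comp_in :: "cmd => ('a::data => 'b::data) => ('a => nat) => bool" where
 "comp_in c f t \<longleftrightarrow> wf_cmd c &
  (ALL x m r. runs c (S (ser (enc x) @ m) r) (t x) (S (ser (enc (f x)) @ m) r))"

lemma comp_in_mono: "comp_in c f t ==> (!!x. t x <= u x) ==> comp_in c f u"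
 unfolding comp_in_def using runs_mono by blast

lemma comp_in_runs: "comp_in c f t ==> runs c (S (ser (enc x) @ m) r) (t x) (S (ser (enc (f x)) @ m) r)"
 by (simp add: comp_in_def)

text \<open>The output size is bounded together with the time, since composition needs the size of
  the intermediate value.\<close>

definition PT :: "('a::data => 'b::data) => bool" where
 "PT f \<longleftrightarrow> (EX c k. comp_in c f (%x. (sz x + 2) ^ k) & (ALL x. sz (f x) <= (sz x + 2) ^ k))"

lemma PTI:
 assumes c: "comp_in c f t" and t: "!!x. t x <= T (sz x)" "pb T" and s: "!!x. sz (f x) <= U (sz x)" "pb U"
 shows "PT f"
proof -
 have "pb (%n. T n + U n)" using t s pb_add by blast
 then obtain k where k: "!!n. T n + U n <= (n + 2) ^ k" unfolding pb_def by blast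
 have "t x <= (sz x + 2) ^ k" "sz (f x) <= (sz x + 2) ^ k" for x
  using k[of "sz x"] t(1)[of x] s(1)[of x] by linarith+
 then show ?thesis unfolding PT_def by (intro exI conjI allI) (rule comp_in_mono[OF c])
qed

lemma PTE:
 assumes "PT f"
 obtains c T where "comp_in c f (%x. T (sz x))" "pb T" "!!x. sz (f x) <= T (sz x)" "mono T"
proof -
 obtain c k where k: "comp_in c f (%x. (sz x + 2) ^ k)" "!!x. sz (f x) <= (sz x + 2) ^ k" using assms PT_def by blast
 show thesis
 proof (rule that)
  show "comp_in c f (%x. (%n. (n + 2) ^ k) (sz x))" using k by simp
  show "pb (%n. (n + 2) ^ k)" by (intro pb_intros)
  show "sz (f x) <= (%n. (n + 2) ^ k) (sz x)" for x using k by simp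
  show "mono (%n::nat. (n + 2) ^ k)" by (intro monoI power_mono) auto
 qed
qed

lemma PT_ex: "PT f ==> EX c T. comp_in c f (%x. T (sz x)) & pb T & (ALL x. sz (f x) <= T (sz x)) & mono T"
 using PTE by metis

lemma PT_size: assumes "PT f" obtains U where "pb U" "!!x. sz (f x) <= U (sz x)" "mono U"
 using PTE[OF assms] by metis

lemma PT_id: "PT (%x. x)"
proof (rule PTI[where T = "%n. 1" and U = "%n. n"])
 show "comp_in Nop (%x. x) (%x. 1)" by (simp add: comp_in_def runs_Nop[unfolded One_nat_def])
qed (rule order.refl | intro pb_intros)+

lemma PT_same: assumes "!!x. enc (f x) = enc x" shows "PT f"
proof (rule PTI[where T = "%n. 1" and U = "%n. n"])
 show "comp_in Nop f (%x. 1)" using assms by (simp add: comp_in_def runs_Nop[unfolded One_nat_def])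
 show "sz (f x) <= sz x" for x using assms by (simp add: sz_def)
qed (rule order.refl | intro pb_intros)+

lemma PT_comp: assumes "PT g" "PT f" shows "PT (%x. g (f x))"
proof -
 obtain c T where c: "comp_in c f (%x. T (sz x))" "pb T" "!!x. sz (f x) <= T (sz x)" "mono T" using PTE[OF assms(2)] by blast
 obtain d U where d: "comp_in d g (%x. U (sz x))" "pb U" "!!x. sz (g x) <= U (sz x)" "mono U" using PTE[OF assms(1)] by blast
 have UT: "U (sz (f x)) <= U (T (sz x))" for x using c d by (simp add: monoD)
 show ?thesis
 proof (rule PTI)
  show "comp_in (c ;; d) (%x. g (f x)) (%x. Suc (T (sz x) + U (sz (f x))))"
   using c(1) d(1) runs_Seq[OF comp_in_runs[OF c(1)] comp_in_runs[OF d(1)]] by (simp add: comp_in_def)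
  show "Suc (T (sz x) + U (sz (f x))) <= Suc (T (sz x) + U (T (sz x)))" for x using UT by simp
  show "sz (g (f x)) <= U (T (sz x))" for x using UT d(3) order_trans by blast
 qed ((intro pb_intros pb_comp[OF d(2)] c(2))+)
qed

lemma PT_const: "PT (%x. v)"
proof (rule PTI[where T = "%n. Suc ((12 * n + 4) + 4 * sz v)" and U = "%n. sz v"])
 show "comp_in (drop_top ;; push_const (enc v)) (%x. v) (%x. Suc ((12 * sz x + 4) + 4 * sz v))"
  using runs_Seq[OF runs_drop runs_push_const] by (simp add: comp_in_def sz_def del: add_Suc)
qed (rule order.refl | intro pb_intros)+

definition pair_cmd :: "cmd => cmd => cmd" where
 "pair_cmd c d = dup ;; (c ;; (toR ;; (d ;; (fromR ;; Push 0 2))))"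

lemma comp_in_Pair:
 assumes "comp_in c f t" "comp_in d g u"
 shows "comp_in (pair_cmd c d) (%x. (f x, g x)) (%x. t x + u x + 24 * sz x + 18 * sz (f x) + 40)"
 unfolding comp_in_def
proof (intro conjI allI)
 show "wf_cmd (pair_cmd c d)" using assms by (simp add: pair_cmd_def comp_in_def)
next
 fix x m r
 have "runs (pair_cmd c d) (S (ser (enc x) @ m) r)
  (Suc ((24 * length (ser (enc x)) + 20) + Suc (t x + Suc ((12 * length (ser (enc (f x))) + 7) + Suc (u x +
   Suc ((6 * length (ser (enc (f x))) + 3) + 2))))))
   (S (2 # ser (enc (f x)) @ ser (enc (g x)) @ m) r)"
  unfolding pair_cmd_def
  by (rule runs_Seq runs_dup comp_in_runs[OF assms(1)] comp_in_runs[OF assms(2)] runs_toR runs_fromR)+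
   (simp add: S_def runs_Push)
 then show "runs (pair_cmd c d) (S (ser (enc x) @ m) r) (t x + u x + 24 * sz x + 18 * sz (f x) + 40)
   (S (ser (enc (f x, g x)) @ m) r)"
  unfolding enc_Pair ser.simps append_Cons append_assoc by (rule runs_mono) (simp add: sz_def)
qed

lemma PT_Pair: assumes "PT f" "PT g" shows "PT (%x. (f x, g x))"
proof -
 obtain c T where c: "comp_in c f (%x. T (sz x))" "pb T" "!!x. sz (f x) <= T (sz x)" using PTE[OF assms(1)] by metis
 obtain d U where d: "comp_in d g (%x. U (sz x))" "pb U" "!!x. sz (g x) <= U (sz x)" using PTE[OF assms(2)] by metis
 show ?thesis
 proof (rule PTI[OF comp_in_Pair[OF c(1) d(1)]])
  show "T (sz x) + U (sz x) + 24 * sz x + 18 * sz (f x) + 40 <= T (sz x) + U (sz x) + 24 * sz x + 18 * T (sz x) + 40" for x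
   using c(3) by simp
  show "sz (f x, g x) <= Suc (T (sz x) + U (sz x))" for x using c(3) d(3) by (simp add: add_mono)
 qed (rule order.refl | intro pb_intros c d)+
qed

lemma PT_fst0: "PT fst"
proof (rule PTI[where T = "%n. 40 * n + 40" and U = "%n. n"])
 show "comp_in (Pop 0 ;; (toR ;; (drop_top ;; fromR))) (fst :: 'a * 'b => _) (%x. 40 * sz x + 40)"
  unfolding comp_in_def
 proof (intro conjI allI)
  fix x :: "'a * 'b" and m r
  obtain a b where x: "x = (a, b)" by (cases x)
  have 0: "runs (Pop 0) (S (2 # ser (enc a) @ ser (enc b) @ m) r) 1 (S (ser (enc a) @ ser (enc b) @ m) r)"
   unfolding S_def by (rule runs_Pop)
  have "runs (Pop 0 ;; (toR ;; (drop_top ;; fromR))) (S (2 # ser (enc a) @ ser (enc b) @ m) r)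
   (Suc (1 + Suc ((12 * length (ser (enc a)) + 7) + Suc ((12 * length (ser (enc b)) + 4) + (6 * length (ser (enc a)) + 3)))))
   (S (ser (enc a) @ m) r)"
   by (rule runs_Seq 0 runs_toR runs_drop runs_fromR)+
  then show "runs (Pop 0 ;; (toR ;; (drop_top ;; fromR))) (S (ser (enc x) @ m) r) (40 * sz x + 40) (S (ser (enc (fst x)) @ m) r)"
   unfolding x enc_Pair ser.simps append_Cons append_assoc fst_conv by (rule runs_mono) (simp add: sz_def enc_Pair)
 qed simp
 show "sz (fst x) <= sz x" for x :: "'a * 'b" by (cases x) simp
qed (rule order.refl | intro pb_intros)+

lemma PT_snd0: "PT snd"
proof (rule PTI[where T = "%n. 40 * n + 40" and U = "%n. n"])
 show "comp_in (Pop 0 ;; drop_top) (snd :: 'a * 'b => _) (%x. 40 * sz x + 40)"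
  unfolding comp_in_def
 proof (intro conjI allI)
  fix x :: "'a * 'b" and m r
  obtain a b where x: "x = (a, b)" by (cases x)
  have 0: "runs (Pop 0) (S (2 # ser (enc a) @ ser (enc b) @ m) r) 1 (S (ser (enc a) @ ser (enc b) @ m) r)"
   unfolding S_def by (rule runs_Pop)
  have "runs (Pop 0 ;; drop_top) (S (2 # ser (enc a) @ ser (enc b) @ m) r)
   (Suc (1 + (12 * length (ser (enc a)) + 4))) (S (ser (enc b) @ m) r)"
   by (rule runs_Seq 0 runs_drop)+
  then show "runs (Pop 0 ;; drop_top) (S (ser (enc x) @ m) r) (40 * sz x + 40) (S (ser (enc (snd x)) @ m) r)"
   unfolding x enc_Pair ser.simps append_Cons append_assoc snd_conv by (rule runs_mono) (simp add: sz_def enc_Pair)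
 qed simp
 show "sz (snd x) <= sz x" for x :: "'a * 'b" by (cases x) simp
qed (rule order.refl | intro pb_intros)+

lemma PT_eq0: "PT (%z. fst z = snd z)"
proof (rule PTI[where T = "%n. 40 * n + 70" and U = "%n. 3"])
 show "comp_in (Pop 0 ;; eq_top) (%z::'a * 'a. fst z = snd z) (%x. 40 * sz x + 70)"
  unfolding comp_in_def
 proof (intro conjI allI)
  fix x :: "'a * 'a" and m r
  obtain a b where x: "x = (a, b)" by (cases x)
  have 0: "runs (Pop 0) (S (2 # ser (enc a) @ ser (enc b) @ m) r) 1 (S (ser (enc a) @ ser (enc b) @ m) r)"
   unfolding S_def by (rule runs_Pop)
  have "runs (Pop 0 ;; eq_top) (S (2 # ser (enc a) @ ser (enc b) @ m) r)
   (Suc (1 + (40 * (length (ser (enc a)) + length (ser (enc b))) + 60))) (S (ser (bool_dt (enc a = enc b)) @ m) r)"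
   by (rule runs_Seq 0 runs_eq_top)+
  then have "runs (Pop 0 ;; eq_top) (S (2 # ser (enc a) @ ser (enc b) @ m) r) (40 * sz x + 70) (S (ser (enc (a = b)) @ m) r)"
   unfolding enc_eq enc_bool_def by (rule runs_mono) (simp add: x sz_def enc_Pair)
  then show "runs (Pop 0 ;; eq_top) (S (ser (enc x) @ m) r) (40 * sz x + 70) (S (ser (enc (fst x = snd x)) @ m) r)"
   by (simp add: x enc_Pair)
 qed simp
 show "sz (fst x = snd x) <= 3" for x :: "'a * 'a" by (rule sz_bool)
qed (rule order.refl | intro pb_intros)+

lemma enc_bool_Nl [simp]: "enc b = Nl \<longleftrightarrow> ~ b" by (simp add: enc_bool_def bool_dt_def)

lemma top_S [simp]: "top_of (S m r) 0 = first m" by (simp add: S_def)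

lemma PT_If: assumes "PT p" "PT f" "PT g" shows "PT (%x. if p x then f x else g x)"
proof -
 obtain b V where b: "comp_in b p (%x. V (sz x))" "pb V" using PTE[OF assms(1)] by metis
 obtain c T where c: "comp_in c f (%x. T (sz x))" "pb T" "!!x. sz (f x) <= T (sz x)" using PTE[OF assms(2)] by metis
 obtain d U where d: "comp_in d g (%x. U (sz x))" "pb U" "!!x. sz (g x) <= U (sz x)" using PTE[OF assms(3)] by metis
 let ?c = "dup ;; (b ;; Cond 0 {1} (drop_top ;; d) (drop_top ;; c))"
 show ?thesis
 proof (rule PTI[where T = "%n. 24 * n + V n + T n + U n + 100" and U = "%n. T n + U n"])
  show "comp_in ?c (%x. if p x then f x else g x) (%x. 24 * sz x + V (sz x) + T (sz x) + U (sz x) + 100)"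
   unfolding comp_in_def
  proof (intro conjI allI)
   show "wf_cmd ?c" using b c d by (simp add: comp_in_def)
   fix x m r
   have br: "runs (Cond 0 {1} (drop_top ;; d) (drop_top ;; c)) (S (ser (enc (p x)) @ ser (enc x) @ m) r)
     (Suc (Suc (40 + (T (sz x) + U (sz x))))) (S (ser (enc (if p x then f x else g x)) @ m) r)"
   proof (cases "p x")
    case True
    have "runs (drop_top ;; c) (S (ser (enc (p x)) @ ser (enc x) @ m) r)
     (Suc ((12 * length (ser (enc (p x))) + 4) + T (sz x))) (S (ser (enc (f x)) @ m) r)"
     by (rule runs_Seq runs_drop comp_in_runs[OF c(1)])+
    then have "runs (drop_top ;; c) (S (ser (enc (p x)) @ ser (enc x) @ m) r)
     (Suc (40 + (T (sz x) + U (sz x)))) (S (ser (enc (f x)) @ m) r)"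
     using sz_bool[of "p x"] by (elim runs_mono) (simp add: sz_def)
    from runs_CondF[OF _ _ this, of 0 "{1}" "drop_top ;; d"] show ?thesis using True by simp
   next
    case False
    have "runs (drop_top ;; d) (S (ser (enc (p x)) @ ser (enc x) @ m) r)
     (Suc ((12 * length (ser (enc (p x))) + 4) + U (sz x))) (S (ser (enc (g x)) @ m) r)"
     by (rule runs_Seq runs_drop comp_in_runs[OF d(1)])+
    then have "runs (drop_top ;; d) (S (ser (enc (p x)) @ ser (enc x) @ m) r)
     (Suc (40 + (T (sz x) + U (sz x)))) (S (ser (enc (g x)) @ m) r)"
     using sz_bool[of "p x"] by (elim runs_mono) (simp add: sz_def)
    from runs_CondT[OF _ _ this, of 0 "{1}" "drop_top ;; c"] show ?thesis using False by simp
   qed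
   have "runs ?c (S (ser (enc x) @ m) r) (Suc ((24 * length (ser (enc x)) + 20) + Suc (V (sz x) + (Suc (Suc (40 + (T (sz x) + U (sz x))))))))
    (S (ser (enc (if p x then f x else g x)) @ m) r)"
    by (rule runs_Seq runs_dup comp_in_runs[OF b(1)] br)+
   then show "runs ?c (S (ser (enc x) @ m) r) (24 * sz x + V (sz x) + T (sz x) + U (sz x) + 100)
    (S (ser (enc (if p x then f x else g x)) @ m) r)" by (rule runs_mono) (simp add: sz_def)
  qed
  show "sz (if p x then f x else g x) <= T (sz x) + U (sz x)" for x using c(3)[of x] d(3)[of x] by auto
 qed (rule order.refl | intro pb_intros b c d)+
qed

text \<open>The code of \<open>a # as\<close> is also the code of the pair \<open>(a, as)\<close>.
  After the test of its top symbol a nonempty list therefore serves unchanged as the tail of the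
  triple passed to \<open>h\<close>.\<close>

lemma PT_case_list:
 assumes "PT l" "PT g" "PT (%z. h (fst z) (fst (snd z)) (snd (snd z)))"
 shows "PT (%x. case l x of [] => g x | a # as => h x a as)"
proof -
 define f where "f = (%z::'a * 'b list. case snd z of [] => g (fst z) | a # as => h (fst z) a as)"
 obtain c T where c: "comp_in c g (%x. T (sz x))" "pb T" "!!x. sz (g x) <= T (sz x)" "mono T" using PTE[OF assms(2)] by metis
 obtain d U where d: "comp_in d (%z. h (fst z) (fst (snd z)) (snd (snd z))) (%x. U (sz x))" "pb U"
  "!!z. sz (h (fst z) (fst (snd z)) (snd (snd z))) <= U (sz z)" "mono U" using PT_ex[OF assms(3)] by blast
 let ?c = "Pop 0 ;; (toR ;; Cond 0 {1} (Pop 0 ;; (fromR ;; c)) (fromR ;; (Push 0 2 ;; d)))"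
 have "PT f"
 proof (rule PTI[where T = "%n. T n + U n + 20 * n + 100" and U = "%n. T n + U n"])
  show "comp_in ?c f (%x. T (sz x) + U (sz x) + 20 * sz x + 100)"
   unfolding comp_in_def
  proof (intro conjI allI)
   show "wf_cmd ?c" using c d by (simp add: comp_in_def)
   fix z :: "'a * 'b list" and m r
   obtain x xs where z: "z = (x, xs)" by (cases z)
   have 0: "runs (Pop 0) (S (2 # ser (enc x) @ ser (enc xs) @ m) r) 1 (S (ser (enc x) @ ser (enc xs) @ m) r)"
    unfolding S_def by (rule runs_Pop)
   have br: "runs (Cond 0 {1} (Pop 0 ;; (fromR ;; c)) (fromR ;; (Push 0 2 ;; d))) (S (ser (enc xs) @ m) (blk (enc x) @ r))
     (T (sz z) + U (sz z) + 6 * sz x + 20) (S (ser (enc (f z)) @ m) r)"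
   proof (cases xs)
    case Nil
    have 1: "runs (Pop 0) (S (1 # m) (blk (enc x) @ r)) 1 (S m (blk (enc x) @ r))"
     unfolding S_def by (rule runs_Pop)
    have "runs (Pop 0 ;; (fromR ;; c)) (S (1 # m) (blk (enc x) @ r)) (Suc (1 + Suc ((6 * length (ser (enc x)) + 3) + T (sz x))))
     (S (ser (enc (g x)) @ m) r)"
     by (rule runs_Seq 1 runs_fromR comp_in_runs[OF c(1)])+
    then have 2: "runs (Cond 0 {1} (Pop 0 ;; (fromR ;; c)) (fromR ;; (Push 0 2 ;; d))) (S (1 # m) (blk (enc x) @ r))
      (Suc (Suc (1 + Suc ((6 * length (ser (enc x)) + 3) + T (sz x))))) (S (ser (enc (g x)) @ m) r)"
     by (intro runs_CondT) auto
    have "T (sz x) <= T (sz z)" using c(4) z by (simp add: monoD)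
    then show ?thesis using runs_mono[OF 2] Nil z by (simp add: f_def sz_def)
   next
    case (Cons a as)
    have 1: "runs (Push 0 2) (S (ser (enc x) @ ser (enc xs) @ m) r) 2 (S (ser (enc (x, (a, as))) @ m) r)"
     using Cons runs_Push(1) by (simp add: S_def enc_Pair)
    have "runs (fromR ;; (Push 0 2 ;; d)) (S (ser (enc xs) @ m) (blk (enc x) @ r))
     (Suc ((6 * length (ser (enc x)) + 3) + Suc (2 + U (sz (x, (a, as))))))
     (S (ser (enc (h (fst (x, (a, as))) (fst (snd (x, (a, as)))) (snd (snd (x, (a, as)))))) @ m) r)"
     by (rule runs_Seq 1 runs_fromR comp_in_runs[OF d(1)])+
    then have 2: "runs (Cond 0 {1} (Pop 0 ;; (fromR ;; c)) (fromR ;; (Push 0 2 ;; d))) (S (ser (enc xs) @ m) (blk (enc x) @ r))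
      (Suc (Suc ((6 * length (ser (enc x)) + 3) + Suc (2 + U (sz (x, (a, as))))))) (S (ser (enc (h x a as)) @ m) r)"
     using Cons by (intro runs_CondF) auto
    have "sz (x, (a, as)) = sz z" using z Cons by simp
    then show ?thesis using runs_mono[OF 2] Cons z by (simp add: f_def sz_def)
   qed
   have "runs ?c (S (2 # ser (enc x) @ ser (enc xs) @ m) r) (Suc (1 + Suc ((12 * length (ser (enc x)) + 7) + (T (sz z) + U (sz z) + 6 * sz x + 20))))
    (S (ser (enc (f z)) @ m) r)"
    by (rule runs_Seq 0 runs_toR br)+
   then show "runs ?c (S (ser (enc z) @ m) r) (T (sz z) + U (sz z) + 20 * sz z + 100) (S (ser (enc (f z)) @ m) r)"
    unfolding z enc_Pair ser.simps append_Cons append_assoc by (rule runs_mono) (simp add: sz_def enc_Pair)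
  qed
  show "sz (f z) <= T (sz z) + U (sz z)" for z
  proof (cases "snd z")
   case Nil
   have "sz (g (fst z)) <= T (sz z)" using c(3)[of "fst z"] monoD[OF c(4), of "sz (fst z)" "sz z"] by (cases z) force
   then show ?thesis using Nil by (simp add: f_def)
  next
   case (Cons a as)
   then have "sz (fst z, (a, as)) = sz z" by (cases z) simp
   then show ?thesis using Cons d(3)[of "(fst z, (a, as))"] by (simp add: f_def)
  qed
 qed (rule order.refl | intro pb_intros c d)+
 from PT_comp[OF this PT_Pair[OF PT_id assms(1)]] show ?thesis by (simp only: f_def fst_conv snd_conv)
qed

lemma PT_fst: "PT f ==> PT (%x. fst (f x))" by (rule PT_comp[OF PT_fst0])
lemma PT_snd: "PT f ==> PT (%x. snd (f x))" by (rule PT_comp[OF PT_snd0])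
lemma PT_eq: "PT f ==> PT g ==> PT (%x. f x = g x)" using PT_comp[OF PT_eq0 PT_Pair] by force
lemma PT_Cons: assumes "PT f" "PT g" shows "PT (%x. f x # g x)"
proof -
 have "PT (%z. fst z # snd z)" by (rule PT_same) (simp add: enc_prod_def)
 from PT_comp[OF this PT_Pair[OF assms]] show ?thesis by simp
qed

section \<open>Iteration over a list\<close>

definition loop_cmd :: "cmd => cmd" where
 "loop_cmd c = Loop 0 {2} (Push 0 2 ;; (c ;; Pop 0))"

text \<open>The environment \<open>x\<close> travels with the accumulator, so that the loop body is
  a function of a single value and can be obtained from the same combinators.\<close>

definition fold_step :: "('x => 'a => 'b => 'b) => 'a list * 'b * 'x => 'a list * 'b * 'x" where
 "fold_step s z = (case fst z of [] => z | a # l => (l, s (snd (snd z)) a (fst (snd z)), snd (snd z)))"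

lemma runs_fold:
 fixes s :: "'x::data => 'a::data => 'b::data => 'b"
 assumes c: "comp_in c (fold_step s) t"
  and T: "!!ys zs. l = ys @ zs ==> t (zs, fold (s x) ys acc, x) <= T"
 shows "runs (loop_cmd c) (S (ser (enc l) @ ser (enc (acc, x)) @ m) r) (length l * (T + 10) + 1)
  (S (ser (enc ([]::'a list)) @ ser (enc (fold (s x) l acc, x)) @ m) r)"
 using T
proof (induction l arbitrary: acc)
 case Nil
 have "runs (loop_cmd c) (S (1 # ser (enc (acc, x)) @ m) r) 1 (S (1 # ser (enc (acc, x)) @ m) r)"
  unfolding loop_cmd_def by (rule runs_LoopF) auto
 then show ?case by simp
next
 case (Cons a l)
 let ?acc = "s x a acc"
 have 1: "runs (Push 0 2) (S (ser (enc (a # l)) @ ser (enc (acc, x)) @ m) r) 2 (S (ser (enc (a # l, acc, x)) @ m) r)"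
  using runs_Push(1) by (simp add: S_def enc_Pair)
 have 2: "runs c (S (ser (enc (a # l, acc, x)) @ m) r) T (S (ser (enc (l, ?acc, x)) @ m) r)"
  using runs_mono[OF comp_in_runs[OF c, of "(a # l, acc, x)" m r]] Cons.prems[of "[]" "a # l"] by (simp add: fold_step_def)
 have 3: "runs (Pop 0) (S (ser (enc (l, ?acc, x)) @ m) r) 1 (S (ser (enc l) @ ser (enc (?acc, x)) @ m) r)"
  using runs_Pop(1) by (simp add: S_def enc_Pair[of l])
 have 4: "runs (Push 0 2 ;; (c ;; Pop 0)) (S (ser (enc (a # l)) @ ser (enc (acc, x)) @ m) r) (Suc (2 + Suc (T + 1)))
   (S (ser (enc l) @ ser (enc (?acc, x)) @ m) r)"
  by (rule runs_Seq 1 2 3)+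
 have IH: "runs (loop_cmd c) (S (ser (enc l) @ ser (enc (?acc, x)) @ m) r) (length l * (T + 10) + 1)
  (S (ser (enc ([]::'a list)) @ ser (enc (fold (s x) l ?acc, x)) @ m) r)"
 proof (rule Cons.IH)
  fix ys zs assume "l = ys @ zs"
  then show "t (zs, fold (s x) ys ?acc, x) <= T" using Cons.prems[of "a # ys" zs] by simp
 qed
 have "runs (loop_cmd c) (S (ser (enc (a # l)) @ ser (enc (acc, x)) @ m) r)
   (Suc (Suc (2 + Suc (T + 1)) + (length l * (T + 10) + 1)))
   (S (ser (enc ([]::'a list)) @ ser (enc (fold (s x) l ?acc, x)) @ m) r)"
  unfolding loop_cmd_def by (rule runs_LoopT[OF _ _ 4 IH[unfolded loop_cmd_def]]) auto
 then show ?case unfolding fold_simps by (rule runs_mono) simp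
qed

lemma PT_fold_step:
 assumes s: "PT (%z. s (fst z) (fst (snd z)) (snd (snd z)))"
 shows "PT (fold_step (s :: 'x::data => 'a::data => 'b::data => 'b))"
proof -
 let ?w = "%w::(('a list * 'b * 'x) * 'a * 'a list). (snd (snd (fst w)), (fst (snd w), fst (snd (fst w))))"
 have "PT ?w" by (intro PT_Pair PT_fst PT_snd PT_id)
 from PT_comp[OF s this]
 have 1: "PT (%w::(('a list * 'b * 'x) * 'a * 'a list). s (snd (snd (fst w))) (fst (snd w)) (fst (snd (fst w))))"
  by simp
 show ?thesis unfolding fold_step_def
  by (intro PT_case_list[where h = "%z a l. (l, s (snd (snd z)) a (fst (snd z)), snd (snd z))"] PT_Pair PT_fst PT_snd PT_id 1)
qed

text \<open>A step that is polynomial in its argument may square the accumulator in every round. The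
  bound \<open>B\<close> on all intermediate accumulators excludes this; with it each round costs a
  polynomial in the size of \<open>x\<close>.\<close>

lemma PT_fold:
 assumes l: "PT l" and i: "PT i" and s: "PT (%z. s (fst z) (fst (snd z)) (snd (snd z)))"
  and B: "!!x ys zs. l x = ys @ zs ==> sz (fold (s x) ys (i x)) <= B (sz x)" "pb B"
 shows "PT (%x. fold (s x) (l x) (i x))"
proof -
 obtain c T where c: "comp_in c (fold_step s) (%x. T (sz x))" "pb T" "mono T" using PTE[OF PT_fold_step[OF s]] by metis
 obtain L where L: "pb L" "!!x. sz (l x) <= L (sz x)" using PT_size[OF l] by metis
 have "PT (%x. (l x, i x, x))" by (intro PT_Pair l i PT_id)
 then obtain p P where p: "comp_in p (%x. (l x, i x, x)) (%x. P (sz x))" "pb P" using PTE by metis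
 obtain e E where e: "comp_in e (%z. fst (snd z)) (%z::'b list * 'c * 'a. E (sz z))" "pb E" "mono E"
  using PTE[OF PT_fst[OF PT_snd0]] by metis
 let ?c = "p ;; (Pop 0 ;; (loop_cmd c ;; (Push 0 2 ;; e)))"
 define T' where "T' = (%n. T (L n + B n + n + 5))"
 define E' where "E' = (%n. E (B n + n + 5))"
 show ?thesis
 proof (rule PTI[where T = "%n. P n + L n * (T' n + 10) + E' n + 20" and U = "B"])
  show "comp_in ?c (%x. fold (s x) (l x) (i x)) (%x. P (sz x) + L (sz x) * (T' (sz x) + 10) + E' (sz x) + 20)"
   unfolding comp_in_def
  proof (intro conjI allI)
   show "wf_cmd ?c" using c p e by (simp add: comp_in_def loop_cmd_def)
   fix x m r
   have T: "T (sz (zs, fold (s x) ys (i x), x)) <= T' (sz x)" if "l x = ys @ zs" for ys zs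
   proof -
    have "sz zs <= L (sz x)" using L(2)[of x] sz_suffix[of zs ys] that by simp
    moreover note B(1)[OF that]
    ultimately show ?thesis unfolding T'_def by (intro monoD[OF c(3)]) simp
   qed
   have E: "E (sz ([]::'b list, fold (s x) (l x) (i x), x)) <= E' (sz x)"
    unfolding E'_def using B(1)[of x "l x" "[]"] by (intro monoD[OF e(3)]) simp
   have 1: "runs (Pop 0) (S (ser (enc (l x, i x, x)) @ m) r) 1 (S (ser (enc (l x)) @ ser (enc (i x, x)) @ m) r)"
    using runs_Pop(1) by (simp add: S_def enc_Pair[of "l x"])
   have 2: "runs (Push 0 2) (S (ser (enc ([]::'b list)) @ ser (enc (fold (s x) (l x) (i x), x)) @ m) r) 2
     (S (ser (enc ([]::'b list, fold (s x) (l x) (i x), x)) @ m) r)"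
    using runs_Push(1) by (simp add: S_def enc_Pair[of "[]"])
   have 3: "runs e (S (ser (enc ([]::'b list, fold (s x) (l x) (i x), x)) @ m) r) (E' (sz x)) (S (ser (enc (fold (s x) (l x) (i x))) @ m) r)"
    using runs_mono[OF comp_in_runs[OF e(1), of "([]::'b list, fold (s x) (l x) (i x), x)" m r] E] by simp
   have "runs ?c (S (ser (enc x) @ m) r) (Suc (P (sz x) + Suc (1 + Suc ((length (l x) * (T' (sz x) + 10) + 1) + Suc (2 + E' (sz x))))))
     (S (ser (enc (fold (s x) (l x) (i x))) @ m) r)"
    by (rule runs_Seq comp_in_runs[OF p(1)] 1 runs_fold[OF c(1) T] 2 3 | assumption)+
   moreover have "length (l x) * (T' (sz x) + 10) <= L (sz x) * (T' (sz x) + 10)"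
    using L(2)[of x] length_le_sz[of "l x"] by (intro mult_right_mono) auto
   ultimately show "runs ?c (S (ser (enc x) @ m) r) (P (sz x) + L (sz x) * (T' (sz x) + 10) + E' (sz x) + 20)
     (S (ser (enc (fold (s x) (l x) (i x))) @ m) r)" by (elim runs_mono) linarith
  qed
  show "sz (fold (s x) (l x) (i x)) <= B (sz x)" for x using B(1)[of x "l x" "[]"] by simp
  have "pb T'" unfolding T'_def by (rule pb_comp[OF c(2)]) (intro pb_intros L(1) B(2))
  moreover have "pb E'" unfolding E'_def by (rule pb_comp[OF e(2)]) (intro pb_intros B(2))
  ultimately show "pb (%n. P n + L n * (T' n + 10) + E' n + 20)" by (intro pb_intros L(1) p(2))
 qed (use B in auto)
qed

subsection \<open>A library of polynomial-time operations\<close>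

named_theorems pt

lemma PT_size_ex: "PT f ==> EX U. pb U & (ALL x. sz (f x) <= U (sz x)) & mono U"
 using PT_size by metis

lemmas [pt] = PT_id PT_const PT_Pair PT_fst PT_snd PT_Cons PT_eq PT_If PT_case_list

lemma PT_not [pt]: "PT p ==> PT (%x. ~ p x)"
 using PT_If[of p "%_. False" "%_. True"] by (simp add: PT_const if_bool_eq_conj)

lemma PT_and [pt]: assumes "PT p" "PT q" shows "PT (%x. p x & q x)"
proof -
 have "(%x. p x & q x) = (%x. if p x then q x else False)" by auto
 then show ?thesis using PT_If[OF assms PT_const] by simp
qed

lemma PT_or [pt]: assumes "PT p" "PT q" shows "PT (%x. p x \<or> q x)"
proof -
 have "(%x. p x \<or> q x) = (%x. if p x then True else q x)" by auto
 then show ?thesis using PT_If[OF assms(1) PT_const assms(2)] by simp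
qed

lemma PT_imp [pt]: assumes "PT p" "PT q" shows "PT (%x. p x --> q x)"
 using PT_or[OF PT_not[OF assms(1)] assms(2)] by (simp only: imp_conv_disj)

lemma PT_case_prod [pt]: "PT g ==> PT (%x. h x (fst (g x)) (snd (g x))) ==> PT (%x. case g x of (a, b) => h x a b)"
 by (simp add: case_prod_beta)

definition units :: "nat => unit list" where "units n = replicate n ()"

lemma PT_units [pt]: assumes "PT f" shows "PT (%x. units (f x))"
proof -
 have "enc (units n) = enc n" for n by (induction n) (auto simp: units_def enc_unit_def)
 then have "PT units" by (rule PT_same)
 then show ?thesis by (rule PT_comp) (rule assms)
qed

lemma PT_Suc [pt]: assumes "PT f" shows "PT (%x. Suc (f x))"
proof -
 have "PT (%z::unit * nat. Suc (snd z))" by (rule PT_same) (simp add: enc_prod_def enc_unit_def)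
 from PT_comp[OF this PT_Pair[OF PT_const assms]] show ?thesis by simp
qed

lemma fold_fst: "fold (%_. f) l a = (f ^^ length l) a"
 by (induction l arbitrary: a) (auto simp: funpow_swap1)

lemma PT_funpow:
 fixes f :: "'a::data => 'b::data => 'b"
 assumes n: "PT n" and i: "PT i" and f: "PT (%z. f (fst z) (snd z))"
  and B: "!!x j. j <= n x ==> sz ((f x ^^ j) (i x)) <= B (sz x)" "pb B"
 shows "PT (%x. (f x ^^ n x) (i x))"
proof -
 have "PT (%x. fold (%(_::unit). f x) (units (n x)) (i x))"
 proof (rule PT_fold[where s = "%x (_::unit). f x" and B = B])
  show "PT (%z::'a * unit * 'b. f (fst z) (snd (snd z)))"
   using PT_comp[OF f, of "%z::'a * unit * 'b. (fst z, snd (snd z))"] by (simp add: PT_Pair PT_fst PT_snd PT_id)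
  fix x ys zs assume "units (n x) = ys @ zs"
  then have "length (units (n x)) = length ys + length zs" by simp
  then have "length ys <= n x" by (simp add: units_def)
  then show "sz (fold (%_. f x) ys (i x)) <= B (sz x)" using B(1) by (simp add: fold_fst)
 qed (intro pt n i B)+
 then show ?thesis by (simp add: fold_fst units_def)
qed

lemma PT_rev [pt]: assumes "PT l" shows "PT (%x. rev (l x))"
proof -
 obtain L where L: "pb L" "!!x. sz (l x) <= L (sz x)" using PT_size[OF assms] by metis
 have "PT (%x. fold (%a l. a # l) (l x) [])"
 proof (rule PT_fold[where s = "%x a l. a # l"])
  fix x ys zs assume "l x = ys @ zs"
  then show "sz (fold (%a l. a # l) ys []) <= L (sz x)"
   using L(2)[of x] sz_prefix[of ys zs] by (simp add: fold_Cons_rev)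
 qed (intro pt assms L)+
 then show ?thesis by (simp add: fold_Cons_rev)
qed

lemma PT_append [pt]: assumes "PT l" "PT k" shows "PT (%x. l x @ k x)"
proof -
 obtain L where L: "pb L" "!!x. sz (l x) <= L (sz x)" using PT_size[OF assms(1)] by metis
 obtain K where K: "pb K" "!!x. sz (k x) <= K (sz x)" using PT_size[OF assms(2)] by metis
 have "PT (%x. fold (%a l. a # l) (rev (l x)) (k x))"
 proof (rule PT_fold[where s = "%x a l. a # l"])
  fix x ys zs assume "rev (l x) = ys @ zs"
  then have "sz ys <= sz (l x)" using sz_prefix[of ys zs] by (metis sz_rev)
  then show "sz (fold (%a l. a # l) ys (k x)) <= L (sz x) + K (sz x)"
   using L(2)[of x] K(2)[of x] sz_append_le[of "rev ys" "k x"] by (simp add: fold_Cons_rev)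
 qed (intro pt assms pb_intros L K)+
 then show ?thesis by (simp add: fold_Cons_rev)
qed

lemma PT_map [pt]: assumes l: "PT l" and f: "PT (%z. f (fst z) (snd z))" shows "PT (%x. map (f x) (l x))"
proof -
 obtain L where L: "pb L" "!!x. sz (l x) <= L (sz x)" using PT_size[OF l] by metis
 obtain F where F: "pb F" "!!z. sz (f (fst z) (snd z)) <= F (sz z)" "mono F" using PT_size_ex[OF f] by blast
 have fo: "fold (%a acc. f x a # acc) ys acc = rev (map (f x) ys) @ acc" for x ys acc
  by (induction ys arbitrary: acc) auto
 have "PT (%x. fold (%a acc. f x a # acc) (l x) [])"
 proof (rule PT_fold[where s = "%x a acc. f x a # acc" and B = "%n. Suc (L n * Suc (F (n + L n + 1)))"])
  show "PT (%z. f (fst z) (fst (snd z)) # snd (snd z))"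
   by (intro PT_Cons PT_comp[OF f, of "%z. (fst z, fst (snd z))", simplified] pt)
  show "pb (%n. Suc (L n * Suc (F (n + L n + 1))))" by (intro pb_intros L pb_comp[OF F(1)])
  fix x ys zs assume ys: "l x = ys @ zs"
  have le: "sz ys <= L (sz x)" using L(2)[of x] ys sz_prefix[of ys zs] by simp
  have "sz (map (f x) ys) <= Suc (length (map (f x) ys) * Suc (F (sz x + L (sz x) + 1)))"
  proof (rule sz_le_bound)
   fix b assume "b : set (map (f x) ys)"
   then obtain a where a: "a : set ys" "b = f x a" by auto
   have "sz (x, a) <= sz x + L (sz x) + 1" using sz_elem[OF a(1)] le by simp
   then have "F (sz (x, a)) <= F (sz x + L (sz x) + 1)" by (rule monoD[OF F(3)])
   then show "sz b <= F (sz x + L (sz x) + 1)" using F(2)[of "(x, a)"] a by simp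
  qed
  also have "... <= Suc (L (sz x) * Suc (F (sz x + L (sz x) + 1)))"
   using le length_le_sz[of ys] by (intro Suc_leI le_imp_less_Suc mult_right_mono) auto
  finally show "sz (fold (%a acc. f x a # acc) ys []) <= Suc (L (sz x) * Suc (F (sz x + L (sz x) + 1)))"
   by (simp add: fo del: rev_map)
 qed (intro pt l)+
 from PT_rev[OF this] show ?thesis by (simp add: fo)
qed

lemma PT_filter [pt]: assumes l: "PT l" and p: "PT (%z. p (fst z) (snd z))" shows "PT (%x. filter (p x) (l x))"
proof -
 obtain L where L: "pb L" "!!x. sz (l x) <= L (sz x)" using PT_size[OF l] by metis
 have fo: "fold (%a acc. if p x a then a # acc else acc) ys acc = rev (filter (p x) ys) @ acc" for x ys acc
  by (induction ys arbitrary: acc) auto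
 have szf: "sz (filter q ys) <= sz ys" for q and ys :: "'b list" by (induction ys) auto
 have "PT (%x. fold (%a acc. if p x a then a # acc else acc) (l x) [])"
 proof (rule PT_fold[where s = "%x a acc. if p x a then a # acc else acc"])
  show "PT (%z. if p (fst z) (fst (snd z)) then fst (snd z) # snd (snd z) else snd (snd z))"
   using PT_comp[OF p, of "%z. (fst z, fst (snd z))"]
   by (intro PT_If) (simp_all add: PT_Pair PT_fst PT_snd PT_id PT_Cons)
  fix x ys zs assume ys: "l x = ys @ zs"
  show "sz (fold (%a acc. if p x a then a # acc else acc) ys []) <= L (sz x)"
   using L(2)[of x] ys sz_prefix[of ys zs] szf[of "p x" ys] by (simp add: fo del: rev_filter)
 qed (intro pt l L)+
 from PT_rev[OF this] show ?thesis by (simp add: fo)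
qed

lemma PT_concat [pt]: assumes l: "PT l" shows "PT (%x. concat (l x))"
proof -
 obtain L where L: "pb L" "!!x. sz (l x) <= L (sz x)" using PT_size[OF l] by metis
 have fo: "fold (%a acc. a @ acc) ys acc = concat (rev ys) @ acc" for ys and acc :: "'b list"
  by (induction ys arbitrary: acc) auto
 have szc: "sz (concat ys) <= sz ys" for ys :: "'b list list"
 proof (induction ys)
  case (Cons y ys) then show ?case using sz_append_le[of y "concat ys"] by simp
 qed simp
 have "PT (%x. fold (%a acc. a @ acc) (rev (l x)) [])"
 proof (rule PT_fold[where s = "%x a acc. a @ acc"])
  fix x ys zs assume ys: "rev (l x) = ys @ zs"
  then have "sz ys <= sz (l x)" using sz_prefix[of ys zs] by (metis sz_rev)
  then show "sz (fold (%a acc. a @ acc) ys []) <= L (sz x)"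
   using L(2)[of x] szc[of "rev ys"] by (simp add: fo)
 qed (intro pt l L)+
 then show ?thesis by (simp add: fo)
qed

lemma PT_bex [pt]: assumes l: "PT l" and p: "PT (%z. p (fst z) (snd z))" shows "PT (%x. EX a : set (l x). p x a)"
proof -
 have "PT (%x. ~ filter (p x) (l x) = [])" by (intro pt l p)
 then show ?thesis by (simp add: filter_empty_conv)
qed

lemma PT_all [pt]: assumes l: "PT l" and p: "PT (%z. p (fst z) (snd z))" shows "PT (%x. ALL a : set (l x). p x a)"
 using PT_not[OF PT_bex[OF l PT_not[OF p]]] by simp

lemma PT_mem [pt]: assumes "PT f" "PT l" shows "PT (%x. f x : set (l x))"
proof -
 have "PT (%x. EX a : set (l x). a = f x)"
  by (intro pt assms PT_comp[OF assms(1)])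
 then show ?thesis by simp
qed

lemma PT_length [pt]: assumes "PT l" shows "PT (%x. length (l x))"
proof -
 obtain L where L: "pb L" "!!x. sz (l x) <= L (sz x)" using PT_size[OF assms] by metis
 have fo: "fold (%a. Suc) ys n = length ys + n" for ys :: "'b list" and n by (induction ys arbitrary: n) auto
 have "PT (%x. fold (%a. Suc) (l x) 0)"
 proof (rule PT_fold[where s = "%x a. Suc"])
  fix x ys zs assume ys: "l x = ys @ zs"
  then have "length ys <= L (sz x)" using L(2)[of x] length_le_sz[of "l x"] by simp
  then show "sz (fold (%a. Suc) ys (0::nat)) <= 2 * L (sz x) + 1" by (simp add: fo)
 qed (intro pt assms pb_intros L)+
 then show ?thesis by (simp add: fo)
qed

lemma PT_add [pt]: assumes "PT (f :: 'a::data => nat)" "PT g" shows "PT (%x. f x + g x)"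
proof -
 have "PT (%x. length (units (f x) @ units (g x)))" by (intro pt assms)
 then show ?thesis by (simp add: units_def)
qed

lemma PT_mult [pt]: assumes "PT (f :: 'a::data => nat)" "PT g" shows "PT (%x. f x * g x)"
proof -
 have "PT (%x. length (concat (map (%_. units (g x)) (units (f x)))))"
  by (intro pt assms PT_comp[OF assms(2)])
 moreover have "length (concat (map (%_. units m) (units n))) = n * m" for m n
  by (induction n) (auto simp: units_def)
 ultimately show ?thesis by simp
qed

lemma PT_power: "PT (f :: 'a::data => nat) ==> PT (%x. f x ^ k)"
 by (induction k) (auto intro: PT_mult PT_const)

lemma PT_tl [pt]: assumes "PT l" shows "PT (%x. tl (l x))"
proof -
 have "PT (%x. case l x of [] => [] | a # as => as)" by (intro pt assms)
 moreover have "(case l x of [] => [] | a # as => as) = tl (l x)" for x by (cases "l x") auto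
 ultimately show ?thesis by simp
qed

lemma PT_drop [pt]: assumes n: "PT n" and l: "PT l" shows "PT (%x. drop (n x) (l x))"
proof -
 obtain L where L: "pb L" "!!x. sz (l x) <= L (sz x)" using PT_size[OF l] by metis
 have dr: "(tl ^^ j) xs = drop j xs" for j and xs :: "'b list" by (induction j) (auto simp: drop_Suc tl_drop)
 have "PT (%x. (tl ^^ n x) (l x))"
 proof (rule PT_funpow[where f = "%x. tl"])
  fix x j
  show "sz ((tl ^^ j) (l x)) <= L (sz x)" using L(2)[of x] sz_suffix[of "drop j (l x)" "take j (l x)"] by (simp add: dr)
 qed (intro pt n l L)+
 then show ?thesis by (simp add: dr)
qed

lemma PT_take [pt]: assumes n: "PT n" and l: "PT l" shows "PT (%x. take (n x) (l x))"
proof -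
 have "PT (%x. rev (drop (length (drop (n x) (l x))) (rev (l x))))" by (intro pt n l)
 moreover have "rev (drop (length (drop m k)) (rev k)) = take m k" for m and k :: "'b list"
  by (cases "m <= length k") (auto simp: rev_drop)
 ultimately show ?thesis by simp
qed

definition nthd :: "'a => 'a list => nat => 'a" where
 "nthd d l n = (if n < length l then l ! n else d)"

lemma PT_nthd [pt]: assumes d: "PT d" and n: "PT n" and l: "PT l" shows "PT (%x. nthd (d x) (l x) (n x))"
proof -
 have "PT (%x. case drop (n x) (l x) of [] => d x | a # as => a)" by (intro pt assms)
 moreover have "(case drop m k of [] => e | a # as => a) = nthd e k m" for m e and k :: "'b list"
 proof (cases "m < length k")
  case True
  then have "drop m k = k ! m # drop (Suc m) k" by (simp add: Cons_nth_drop_Suc)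
  then show ?thesis using True by (simp add: nthd_def)
 qed (simp add: nthd_def)
 ultimately show ?thesis by simp
qed

lemma PT_minus [pt]: assumes "PT f" "PT g" shows "PT (%x. (f x::nat) - g x)"
proof -
 have "PT (%x. length (drop (g x) (units (f x))))" by (intro pt assms)
 then show ?thesis by (simp add: units_def)
qed

lemma PT_le [pt]: assumes "PT f" "PT g" shows "PT (%x. (f x::nat) <= g x)"
proof -
 have "PT (%x. f x - g x = 0)" by (intro pt assms)
 then show ?thesis by simp
qed

lemma PT_less [pt]: assumes "PT f" "PT g" shows "PT (%x. (f x::nat) < g x)"
 using PT_not[OF PT_le[OF assms(2,1)]] by (simp add: not_le)

lemma PT_upt [pt]: assumes "PT n" shows "PT (%x. [0..<n x])"
proof -
 obtain L where L: "pb L" "!!x. sz (n x) <= L (sz x)" using PT_size[OF assms] by metis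
 have it: "((%l. l @ [length l]) ^^ j) [] = [0..<j]" for j by (induction j) auto
 have "PT (%x. ((%l. l @ [length l]) ^^ n x) [])"
 proof (rule PT_funpow[where f = "%x l. l @ [length l]"])
  fix x j assume j: "j <= n x"
  have "sz [0..<j] <= Suc (length [0..<j] * Suc (2 * j + 1))" by (rule sz_le_bound) auto
  also have "... <= Suc (L (sz x) * Suc (2 * L (sz x) + 1))"
   unfolding length_upt Suc_le_mono by (rule mult_le_mono) (use j L(2)[of x] in simp_all)
  finally show "sz (((%l. l @ [length l]) ^^ j) []) <= Suc (L (sz x) * Suc (2 * L (sz x) + 1))" by (simp add: it)
 qed (intro pt assms pb_intros L)+
 then show ?thesis by (simp add: it)
qed

lemma PT_zip [pt]: assumes "PT l" "PT k" shows "PT (%x. zip (l x) (k x))"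
proof -
 have "PT (%x. map (%i. (nthd undefined (l x) i, nthd undefined (k x) i))
   [0..<(if length (l x) <= length (k x) then length (l x) else length (k x))])"
  by (intro pt assms assms[THEN PT_comp])
 moreover have "map (%i. (nthd undefined xs i, nthd undefined ys i)) [0..<(if length xs <= length ys then length xs else length ys)]
   = zip xs ys" for xs :: "'b list" and ys :: "'c list"
  by (rule nth_equalityI) (auto simp: nthd_def split: if_splits)
 ultimately show ?thesis by simp
qed

lemma PT_replicate [pt]: assumes "PT n" "PT f" shows "PT (%x. replicate (n x) (f x))"
proof -
 have "PT (%x. map (%_. f x) (units (n x)))" by (intro pt assms PT_comp[OF assms(2)])
 then show ?thesis by (simp add: units_def map_replicate)
qed

text \<open>Lists of exponential length are polynomial in the padding; a list that would outgrow it is dropped.\<close>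

definition words :: "unit list => nat => 'a list => 'a list list" where
 "words pad n A = ((%l. if length A * length l <= length pad
   then concat (map (%a. map (%w. a # w) l) A) else []) ^^ n) [[]]"

lemma words_Suc: "words pad (Suc n) A = (if length A * length (words pad n A) <= length pad
   then concat (map (%a. map (%w. a # w) (words pad n A)) A) else [])"
 by (simp add: words_def)

text \<open>There is no assumption on the padding here: the cut-off alone limits the list, so
  \<open>words\<close> is polynomial even where its result is useless.\<close>

lemma words_bound:
 "length (words pad j A) <= Suc (length pad) & (ALL w : set (words pad j A). length w = j & set w <= set A)"
proof (induction j)
 case (Suc j)
 have "length (concat (map (%a. map (%w. a # w) l) A)) = length A * length l" for l by (induction A) auto
 then have "length (words pad (Suc j) A) <= Suc (length pad)" by (simp add: words_Suc)
 moreover have "length w = Suc j & set w <= set A" if w: "w : set (words pad (Suc j) A)" for w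
 proof -
  obtain a v where v: "w = a # v" "a : set A" "v : set (words pad j A)"
   using w unfolding words_Suc by (auto split: if_splits)
  then show ?thesis using Suc.IH by auto
 qed
 ultimately show ?case by blast
next
 case 0
 have "words pad 0 A = [[]]" by (simp add: words_def)
 then show ?case by simp
qed

text \<open>If the padding has room for all words of length \<open>n\<close>, it has room for all
  shorter ones, so the cut-off never took effect.\<close>

lemma words_all:
 assumes "length A ^ n <= length pad" "A ~= []"
 shows "set (words pad n A) = {w. length w = n & set w <= set A} & length (words pad n A) = length A ^ n"
 using assms(1)
proof (induction n)
 case 0 then show ?case by (auto simp: words_def)
next
 case (Suc n)
 have A: "length A >= 1" using assms(2) by (cases A) auto
 have le: "length A ^ n <= length A ^ Suc n" using A by (intro power_increasing) auto
 then have "length A ^ n <= length pad" using Suc.prems by (rule order_trans)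
 from Suc.IH[OF this] have IH: "set (words pad n A) = {w. length w = n & set w <= set A}" "length (words pad n A) = length A ^ n"
  by blast+
 have len: "length (concat (map (%a. map (%w. a # w) l) A)) = length A * length l" for l by (induction A) auto
 have "length A * length (words pad n A) <= length pad" using IH Suc.prems by simp
 then have w: "words pad (Suc n) A = concat (map (%a. map (%w. a # w) (words pad n A)) A)"
  unfolding words_Suc by simp
 show ?case unfolding w len using IH by (auto simp: length_Suc_conv)
qed

lemma PT_words [pt]: assumes p: "PT p" and n: "PT n" and A: "PT A" shows "PT (%x. words (p x) (n x) (A x))"
proof -
 obtain L where L: "pb L" "!!x. sz (p x) <= L (sz x)" using PT_size[OF p] by metis
 obtain K where K: "pb K" "!!x. sz (A x) <= K (sz x)" using PT_size[OF A] by metis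
 obtain N where N: "pb N" "!!x. sz (n x) <= N (sz x)" using PT_size[OF n] by metis
 have "PT (%x. ((%l. if length (A x) * length l <= length (p x)
   then concat (map (%a. map (%w. a # w) l) (A x)) else []) ^^ n x) [[]])"
 proof (rule PT_funpow[where B = "%m. Suc (Suc (L m) * Suc (Suc (N m * Suc (K m))))"])
  show "PT (%z. if length (A (fst z)) * length (snd z) <= length (p (fst z))
   then concat (map (%a. map (%w. a # w) (snd z)) (A (fst z))) else [])"
   by (intro pt PT_comp[OF A] PT_comp[OF p])
  show "pb (%m. Suc (Suc (L m) * Suc (Suc (N m * Suc (K m)))))" by (intro pb_intros L K N)
  fix x j assume j: "j <= n x"
  note b = words_bound[of "p x" j "A x"]
  have "sz (words (p x) j (A x)) <= Suc (length (words (p x) j (A x)) * Suc (Suc (N (sz x) * Suc (K (sz x)))))"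
  proof (rule sz_le_bound)
   fix w assume "w : set (words (p x) j (A x))"
   then have w: "length w = j" "set w <= set (A x)" using b by auto
   have "sz w <= Suc (length w * Suc (K (sz x)))"
   proof (rule sz_le_bound)
    fix a assume "a : set w"
    then show "sz a <= K (sz x)" using w sz_elem[of a "A x"] K(2)[of x] by fastforce
   qed
   also have "... <= Suc (N (sz x) * Suc (K (sz x)))" using w j N(2)[of x] unfolding Suc_le_mono by (intro mult_le_mono) simp_all
   finally show "sz w <= Suc (N (sz x) * Suc (K (sz x)))" .
  qed
  also have "... <= Suc (Suc (L (sz x)) * Suc (Suc (N (sz x) * Suc (K (sz x)))))"
  proof -
   have "length (words (p x) j (A x)) <= Suc (L (sz x))" using b L(2)[of x] length_le_sz[of "p x"] by simp
   then show ?thesis by (intro Suc_leI le_imp_less_Suc mult_right_mono) auto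
  qed
  finally show "sz (((%l. if length (A x) * length l <= length (p x)
   then concat (map (%a. map (%w. a # w) l) (A x)) else []) ^^ j) [[]]) <= Suc (Suc (L (sz x)) * Suc (Suc (N (sz x) * Suc (K (sz x)))))"
   unfolding words_def .
 qed (intro pt n)+
 then show ?thesis unfolding words_def .
qed

section \<open>Thread games\<close>

text \<open>
  Update of an age-ordered list of thread sets with counters.  A set all of whose threads also occur
  in younger sets has its counter increased and takes its threads back; empty sets are removed.
\<close>

definition covered :: "('q set * nat) list => 'q set" where "covered zs = \<Union>(fst ` set zs)"

lemma covered_simps [simp]: "covered [] = {}" "covered (z # zs) = fst z \<union> covered zs"
 "covered (xs @ ys) = covered xs \<union> covered ys"
 by (auto simp: covered_def)

abbreviation minus_all :: "'q set => ('q set * nat) list => ('q set * nat) list" where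
 "minus_all n zs \<equiv> map (%z. (fst z - n, snd z)) zs"

lemma covered_minus [simp]: "covered (minus_all n zs) = covered zs - n" by (auto simp: covered_def)

function (sequential) proc :: "('q set * nat) list => ('q set * nat) list" where
 "proc [] = []"
| "proc ((n, k) # zs) = (if n = {} then proc zs
   else if n <= covered zs then (n, Suc k) # proc (minus_all n zs) else (n, k) # proc zs)"
 by pat_completeness auto
termination by (relation "measure length") auto

text \<open>A counter is a lower bound for the number of increments of every thread in its set, and
  a thread that also occurs in a younger set has made at least one more. This is what entitles a set
  covered by younger ones to raise its counter.\<close>

fun good :: "('q => nat) => ('q set * nat) list => bool" where
 "good c [] = True"
| "good c ((n, k) # zs) = ((ALL L:n. k <= c L) & (ALL L:n \<inter> covered zs. Suc k <= c L) & good c zs)"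

fun own :: "('q set * nat) list => bool" where
 "own [] = True" | "own ((n, k) # zs) = (~ n <= covered zs & own zs)"

lemma covered_proc: "covered (proc zs) <= covered zs"
 by (induction zs rule: proc.induct) (auto split: if_splits)

lemma good_minus: "good c zs ==> good c (minus_all n zs)"
 by (induction zs) (auto)

lemma good_proc: "good c zs ==> good c (proc zs)"
proof (induction zs rule: proc.induct)
 case (2 n k zs)
 show ?case
 proof (cases "n = {}")
  case True then show ?thesis using 2 by simp
 next
  case ne: False
  show ?thesis
  proof (cases "n <= covered zs")
   case True
   have "good c (proc (minus_all n zs))" by (rule 2(2)[OF ne True]) (use 2(4) in "simp add: good_minus")
   moreover have "covered (proc (minus_all n zs)) \<inter> n = {}" using covered_proc[of "minus_all n zs"] by auto
   ultimately show ?thesis using True ne 2(4) by auto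
  next
   case False
   have "good c (proc zs)" by (rule 2(3)[OF ne False]) (use 2(4) in simp)
   then show ?thesis using False ne 2(4) covered_proc[of zs] by auto
  qed
 qed
qed simp

lemma own_proc: "own (proc zs)"
proof (induction zs rule: proc.induct)
 case (2 n k zs)
 then show ?case using covered_proc[of zs] covered_proc[of "minus_all n zs"] by auto
qed simp

text \<open>Each set adds a thread that no younger set contains. The length of the list is thus
  bounded independently of the counters.\<close>

lemma own_length: "own zs ==> covered zs <= Q ==> finite Q ==> length zs <= card (covered zs)"
proof (induction zs)
 case (Cons z zs)
 obtain n k where z: "z = (n, k)" by (cases z)
 have fin: "finite (covered (z # zs))" using Cons.prems finite_subset by blast
 have "length zs <= card (covered zs)" using Cons z by simp
 also have "... < card (covered (z # zs))"
  by (rule psubset_card_mono[OF fin]) (use Cons.prems z in auto)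
 finally show ?case by simp
qed simp

text \<open>The first \<open>r\<close> sets survive the update; they are calm if moreover no counter among them changes.\<close>

fun surv :: "nat => ('q set * nat) list => bool" where
 "surv 0 W = True"
| "surv (Suc r) [] = False"
| "surv (Suc r) ((n, k) # zs) = (n ~= {} & surv r (if n <= covered zs then minus_all n zs else zs))"

fun calm :: "nat => ('q set * nat) list => bool" where
 "calm 0 W = True"
| "calm (Suc r) [] = False"
| "calm (Suc r) ((n, k) # zs) = (n ~= {} & ~ n <= covered zs & calm r zs)"

text \<open>As long as the first \<open>r\<close> sets survive, their places do not shift, so
  counters can be compared index by index. \<open>proc\<close> never lowers a counter, and it raises
  one unless the prefix is calm.\<close>

lemma surv_proc:
 "surv r W ==> r <= length (proc W) & r <= length W & (ALL j<r. snd (W ! j) <= snd (proc W ! j)) &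
   (~ calm r W --> (EX j<r. snd (W ! j) < snd (proc W ! j)))"
proof (induction r arbitrary: W)
 case (Suc r)
 obtain n k zs where W: "W = (n, k) # zs" and ne: "n ~= {}" using Suc.prems by (cases W) auto
 show ?case
 proof (cases "n <= covered zs")
  case True
  then have "surv r (minus_all n zs)" using Suc.prems W by simp
  from Suc.IH[OF this] have IH: "r <= length (proc (minus_all n zs))" "r <= length zs"
   "!!j. j < r ==> snd (zs ! j) <= snd (proc (minus_all n zs) ! j)" by auto
  have "snd (W ! j) <= snd (proc W ! j)" if "j < Suc r" for j
   using that IH(3) True ne W by (cases j) auto
  moreover have "snd (W ! 0) < snd (proc W ! 0)" using True ne W by simp
  ultimately show ?thesis using IH True ne W by auto
 next
  case False
  then have "surv r zs" using Suc.prems W by simp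
  from Suc.IH[OF this] have IH: "r <= length (proc zs)" "r <= length zs"
   "!!j. j < r ==> snd (zs ! j) <= snd (proc zs ! j)" and st: "~ calm r zs --> (EX j<r. snd (zs ! j) < snd (proc zs ! j))" by auto
  have p: "proc W = (n, k) # proc zs" using False ne W by simp
  have "snd (W ! j) <= snd (proc W ! j)" if "j < Suc r" for j
   using that IH(3) W p by (cases j) auto
  moreover have "EX j<Suc r. snd (W ! j) < snd (proc W ! j)" if "~ calm (Suc r) W"
  proof -
   have "~ calm r zs" using that W ne False by simp
   then obtain j where "j < r" "snd (zs ! j) < snd (proc zs ! j)" using st by blast
   then show ?thesis using W p by (intro exI[of _ "Suc j"]) simp
  qed
  ultimately show ?thesis using IH W p by auto
 qed
qed simp

lemma thread_proc0:
 "x < length W ==> L : fst (W ! x) ==> (!!j. j < x ==> L ~: fst (W ! j)) ==>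
  EX y<=x. y < length (proc W) & L : fst (proc W ! y) & (~ surv 1 W --> y < x)"
proof (induction W arbitrary: x rule: proc.induct)
 case (2 n k zs)
 show ?case
 proof (cases x)
  case 0
  then have "L : n" using 2(5) by simp
  then show ?thesis using 0 by auto
 next
  case (Suc x')
  have Ln: "L ~: n" using 2(6)[of 0] Suc by simp
  have x': "x' < length zs" "L : fst (zs ! x')" using 2(4,5) Suc by auto
  have mn: "L ~: fst (zs ! j)" if "j < x'" for j using 2(6)[of "Suc j"] Suc that by simp
  show ?thesis
  proof (cases "n = {}")
   case True
   obtain y where "y <= x'" "y < length (proc zs)" "L : fst (proc zs ! y)" using 2(1)[OF True x' mn] by blast
   then show ?thesis using True Suc by (intro exI[of _ y]) auto
  next
   case ne: False
   show ?thesis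
   proof (cases "n <= covered zs")
    case True
    have "EX y<=x'. y < length (proc (minus_all n zs)) & L : fst (proc (minus_all n zs) ! y) & (~ surv 1 (minus_all n zs) --> y < x')"
     by (rule 2(2)[OF ne True]) (use x' mn Ln in auto)
    then obtain y where "y <= x'" "y < length (proc (minus_all n zs))" "L : fst (proc (minus_all n zs) ! y)" by blast
    then show ?thesis using True ne Suc by (intro exI[of _ "Suc y"]) auto
   next
    case False
    obtain y where "y <= x'" "y < length (proc zs)" "L : fst (proc zs ! y)" using 2(3)[OF ne False x' mn] by blast
    then show ?thesis using False ne Suc by (intro exI[of _ "Suc y"]) auto
   qed
  qed
 qed
qed simp

text \<open>No set before place \<open>x\<close> can take the thread away: the first
  \<open>r\<close> sets are calm and the following ones do not contain it. So its set keeps it and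
  can only shift left. If the prefix of length \<open>Suc r\<close> does not survive, the set at
  place \<open>r\<close> is empty, and the shift is strict.\<close>

lemma thread_proc:
 "calm r W ==> r <= x ==> x < length W ==> L : fst (W ! x) ==> (!!j. r <= j ==> j < x ==> L ~: fst (W ! j)) ==>
  EX y. r <= y & y <= x & y < length (proc W) & L : fst (proc W ! y) & (~ surv (Suc r) W --> y < x)"
proof (induction r arbitrary: W x)
 case 0
 then show ?case using thread_proc0[of x W L] by auto
next
 case (Suc r)
 obtain n k zs where W: "W = (n, k) # zs" and c: "n ~= {}" "~ n <= covered zs" "calm r zs"
  using Suc.prems(1) by (cases W) auto
 obtain x' where x: "x = Suc x'" using Suc.prems(2) by (cases x) auto
 have "L ~: fst (zs ! j)" if "r <= j" "j < x'" for j using Suc.prems(5)[of "Suc j"] that W x by simp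
 with Suc.IH[OF c(3), of x'] Suc.prems W x
 obtain y where "r <= y" "y <= x'" "y < length (proc zs)" "L : fst (proc zs ! y)" "~ surv (Suc r) zs --> y < x'"
  by auto
 then show ?case using W c x by (intro exI[of _ "Suc y"]) auto
qed

lemma wf_eventually:
 assumes "wf R" "Relation.trans R" and st: "!!i. i >= N ==> g (Suc i) = g i \<or> (g (Suc i), g i) : R"
 shows "EX M>=N. ALL i>=M. g i = g M"
proof -
 obtain z where z: "z : g ` {N..}" and mn: "!!y. (y, z) : R ==> y ~: g ` {N..}"
  using wfE_min[OF assms(1), of "g N" "g ` {N..}"] by blast
 obtain M where M: "M >= N" "z = g M" using z by auto
 have "g i = g M" if "i >= M" for i
  using that
 proof (induction i rule: dec_induct)
  case (step i)
  then show ?case using st[of i] M mn[of "g (Suc i)"] by auto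
 qed simp
 then show ?thesis using M by blast
qed

lemma lex_total: "length xs = length ys ==> xs = ys \<or> (xs, ys) : lex less_than \<or> (ys, xs) : lex less_than"
 for xs ys :: "nat list"
proof (induction xs arbitrary: ys)
 case (Cons x xs)
 then obtain y ys' where ys: "ys = y # ys'" by (cases ys) auto
 consider "x < y" | "y < x" | "x = y" by linarith
 then show ?case using Cons ys by cases auto
qed simp

lemma lex_append: "(xs, ys) : lex r ==> length us = length vs ==> (xs @ us, ys @ vs) : lex r"
 unfolding lex_conv by fastforce

lemma lex_pointwise:
 "length xs = length ys ==> (!!j. j < length xs ==> xs ! j <= ys ! j) ==> xs = ys \<or> (xs, ys) : lex less_than"
 for xs ys :: "nat list"
proof (induction xs arbitrary: ys)
 case (Cons x xs)
 then obtain y ys' where ys: "ys = y # ys'" by (cases ys) auto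
 have "x <= y" using Cons.prems(2)[of 0] ys by simp
 moreover have "xs = ys' \<or> (xs, ys') : lex less_than"
  by (rule Cons.IH) (use Cons.prems(1) Cons.prems(2)[of "Suc _"] ys in auto)
 ultimately show ?case using ys Cons.prems(1) by auto
qed simp

section \<open>Games with backward-deterministic threads: pumping and collapse of memory\<close>

locale tgame =
 fixes p0 :: 'p and nxp :: "'p => 'v => 'u => 'p" and Lv :: "'p => 'q set"
  and par :: "'p => 'v => 'u => 'q => 'q" and inc :: "'p => 'v => 'u => 'q => bool"
  and U :: "'u set" and V :: "'v set" and PS :: "'p set" and Q :: "'q set"
 assumes finQ: "finite Q" and finPS: "finite PS" and p0: "p0 : PS" and Une: "U ~= {}"
  and nxp: "!!p v u. p : PS ==> v : V ==> u : U ==> nxp p v u : PS"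
  and LvQ: "!!p. p : PS ==> Lv p <= Q"
  and par: "!!p v u L. p : PS ==> v : V ==> u : U ==> L : Lv (nxp p v u) ==> par p v u L : Lv p"
begin

definition machine :: "'m set => 'm => ('m => 'u => 'm) => ('m => 'v) => bool" where
 "machine MS m0 up out \<longleftrightarrow> m0 : MS & (ALL m:MS. ALL u:U. up m u : MS) & (ALL m:MS. out m : V)"

primrec cf :: "'m => ('m => 'u => 'm) => ('m => 'v) => (nat => 'u) => nat => 'm * 'p" where
 "cf m0 up out u 0 = (m0, p0)"
| "cf m0 up out u (Suc n) = (up (fst (cf m0 up out u n)) (u n),
   nxp (snd (cf m0 up out u n)) (out (fst (cf m0 up out u n))) (u n))"

definition tpar :: "('m => 'v) => 'm * 'p => 'u => 'q => 'q" where
 "tpar out c u = par (snd c) (out (fst c)) u"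
definition tinc :: "('m => 'v) => 'm * 'p => 'u => 'q => bool" where
 "tinc out c u = inc (snd c) (out (fst c)) u"

text \<open>A thread may branch forwards, but its last element determines it through the parent
  function. Hence counts can be attached to the current elements instead of whole threads.\<close>

definition thread :: "'m => ('m => 'u => 'm) => ('m => 'v) => (nat => 'u) => (nat => 'q) => nat => bool" where
 "thread m0 up out u tha t \<longleftrightarrow> (ALL n<=t. tha n : Lv (snd (cf m0 up out u n))) &
   (ALL n<t. tpar out (cf m0 up out u n) (u n) (tha (Suc n)) = tha n)"

definition tic :: "'m => ('m => 'u => 'm) => ('m => 'v) => (nat => 'u) => (nat => 'q) => nat => bool" where
 "tic m0 up out u tha n \<longleftrightarrow> tinc out (cf m0 up out u n) (u n) (tha (Suc n))"

definition safe :: "'m => ('m => 'u => 'm) => ('m => 'v) => bool" where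
 "safe m0 up out \<longleftrightarrow> (ALL u tha. (ALL n. u n : U) --> (ALL t. thread m0 up out u tha t) -->
   (EX i. ALL n>=i. ~ tic m0 up out u tha n))"

definition bounded_by :: "'m => ('m => 'u => 'm) => ('m => 'v) => nat => bool" where
 "bounded_by m0 up out K \<longleftrightarrow> (ALL u tha t. (ALL n. u n : U) --> thread m0 up out u tha t -->
   card {n. n < t & tic m0 up out u tha n} <= K)"

lemma cf_in: "machine MS m0 up out ==> (!!n. u n : U) ==>
  fst (cf m0 up out u n) : MS & snd (cf m0 up out u n) : PS"
 by (induction n) (auto simp: machine_def p0 nxp)

lemma cf_cong: "(!!i. i < n ==> u i = u' i) ==> cf m0 up out u n = cf m0 up out u' n"
 by (induction n) auto

text \<open>Pumping: a repetition of memory, position and thread between two increments could be looped.\<close>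

lemma safe_bounded:
 assumes M: "machine MS m0 up out" and fin: "finite MS" and safe: "safe m0 up out"
 shows "bounded_by m0 up out (card MS * card PS * card Q)"
 unfolding bounded_by_def
proof (intro allI impI, rule ccontr)
 fix u tha t
 assume u: "ALL n. u n : U" and th: "thread m0 up out u tha t"
  and gt: "~ card {n. n < t & tic m0 up out u tha n} <= card MS * card PS * card Q"
 let ?c = "cf m0 up out u"
 let ?I = "{n. n < t & tic m0 up out u tha n}"
 let ?f = "%n. (?c n, tha n)"
 have in_c: "fst (?c n) : MS" "snd (?c n) : PS" for n using cf_in[OF M] u by auto
 have "?f ` ?I <= (MS \<times> PS) \<times> Q"
 proof
  fix x assume "x : ?f ` ?I"
  then obtain n where n: "n < t" "x = ?f n" by blast
  have "tha n : Lv (snd (?c n))" using th n(1) by (simp add: thread_def)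
  then have "tha n : Q" using LvQ[OF in_c(2)[of n]] by blast
  then show "x : (MS \<times> PS) \<times> Q" using in_c[of n] n(2) by (simp add: mem_Times_iff)
 qed
 then have "card (?f ` ?I) <= card MS * card PS * card Q"
  using card_mono[of "(MS \<times> PS) \<times> Q" "?f ` ?I"] fin finPS finQ by (simp add: card_cartesian_product)
 then have "~ inj_on ?f ?I" using gt card_image[of ?f ?I] by force
 then obtain a b where ab: "a : ?I" "b : ?I" "?f a = ?f b" "a ~= b" unfolding inj_on_def by blast
 have "EX i j. i < j & i : ?I & j : ?I & ?f i = ?f j"
 proof (cases "a < b")
  case True
  then show ?thesis using ab by blast
 next
  case False
  then have "b < a" using ab(4) by simp
  then show ?thesis using ab(1,2) ab(3)[symmetric] by blast
 qed
 then obtain i j where ij: "i < j" "?c i = ?c j" "tha i = tha j" "j < t" "tic m0 up out u tha i" by auto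
 define d where "d = j - i"
 have d: "d > 0" using ij by (simp add: d_def)
 define ph where "ph = (%n. if n < i then n else i + (n - i) mod d)"
 have ph_less: "ph n < j" for n
 proof -
  have "(n - i) mod d < d" using d by simp
  moreover have "j = i + d" using ij by (simp add: d_def)
  ultimately have "i + (n - i) mod d < j" by simp
  then show ?thesis using ij by (auto simp: ph_def)
 qed
 have ph_Suc: "ph (Suc n) = Suc (ph n) \<or> (Suc (ph n) = j & ph (Suc n) = i)" for n
 proof (cases "Suc n <= i")
  case True
  then show ?thesis by (cases "Suc n = i") (auto simp: ph_def)
 next
  case False
  then have "Suc n - i = Suc (n - i)" by simp
  then show ?thesis using False ij d by (auto simp: ph_def d_def mod_Suc split: if_splits)
 qed
 define u' where "u' = (%n. u (ph n))"
 define tha' where "tha' = (%n. tha (ph n))"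
 have c': "cf m0 up out u' n = ?c (ph n)" for n
 proof (induction n)
  case 0
  have "ph 0 = 0" by (auto simp: ph_def)
  then show ?case by simp
 next
  case (Suc n)
  have "cf m0 up out u' (Suc n) = ?c (Suc (ph n))" using Suc by (simp add: u'_def)
  then show ?case using ph_Suc[of n] ij by auto
 qed
 have tha_Suc: "tha' (Suc n) = tha (Suc (ph n))" for n using ph_Suc[of n] ij by (auto simp: tha'_def)
 have "thread m0 up out u' tha' T" for T
  unfolding thread_def
 proof (intro conjI allI impI)
  fix n
  have "ph n < t" using ph_less[of n] ij by simp
  then show "tha' n : Lv (snd (cf m0 up out u' n))" "tpar out (cf m0 up out u' n) (u' n) (tha' (Suc n)) = tha' n"
   using th unfolding thread_def c' tha_Suc by (auto simp: tha'_def u'_def)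
 qed
 moreover have "ALL n. u' n : U" using u by (simp add: u'_def)
 ultimately obtain N where N: "ALL n>=N. ~ tic m0 up out u' tha' n" using safe unfolding safe_def by blast
 define n where "n = i + N * d"
 have "ph n = i" by (simp add: n_def ph_def)
 then have "tic m0 up out u' tha' n" using ij(5) unfolding tic_def c' tha_Suc by (simp add: u'_def)
 moreover have "n >= N" using d by (simp add: n_def trans_le_add2)
 ultimately show False using N by blast
qed

text \<open>The number of increments on the one thread that ends in the given element.\<close>

primrec cn :: "'m => ('m => 'u => 'm) => ('m => 'v) => (nat => 'u) => nat => 'q => nat" where
 "cn m0 up out u 0 = (%_. 0)"
| "cn m0 up out u (Suc n) = (%L. cn m0 up out u n (tpar out (cf m0 up out u n) (u n) L)
   + of_bool (tinc out (cf m0 up out u n) (u n) L))"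

lemma cn_thread:
 assumes M: "machine MS m0 up out" and u: "!!n. u n : U" and L: "L : Lv (snd (cf m0 up out u t))"
 shows "EX tha. thread m0 up out u tha t & tha t = L & card {n. n < t & tic m0 up out u tha n} = cn m0 up out u t L"
 using L
proof (induction t arbitrary: L)
 case 0
 then show ?case by (intro exI[of _ "%_. L"]) (auto simp: thread_def)
next
 case (Suc t)
 let ?c = "cf m0 up out u t"
 have c: "fst ?c : MS" "snd ?c : PS" using cf_in[OF M] u by auto
 have "out (fst ?c) : V" using c M by (simp add: machine_def)
 then have "tpar out ?c (u t) L : Lv (snd ?c)" unfolding tpar_def using Suc.prems c u par by simp
 from Suc.IH[OF this] obtain tha where th: "thread m0 up out u tha t" "tha t = tpar out ?c (u t) L"
  "card {n. n < t & tic m0 up out u tha n} = cn m0 up out u t (tpar out ?c (u t) L)" by blast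
 define tha' where "tha' = tha(Suc t := L)"
 have same: "tha' n = tha n" if "n <= t" for n using that by (simp add: tha'_def)
 have last: "tha' (Suc t) = L" by (simp add: tha'_def)
 have "thread m0 up out u tha' (Suc t)"
  unfolding thread_def
 proof (intro conjI allI impI)
  fix n assume "n <= Suc t"
  then show "tha' n : Lv (snd (cf m0 up out u n))"
   using th(1) Suc.prems same last unfolding thread_def by (cases "n = Suc t") auto
 next
  fix n assume "n < Suc t"
  then show "tpar out (cf m0 up out u n) (u n) (tha' (Suc n)) = tha' n"
   using th(1,2) same last unfolding thread_def by (cases "n = t") auto
 qed
 moreover have "card {n. n < Suc t & tic m0 up out u tha' n} = cn m0 up out u (Suc t) L"
 proof -
  have "tic m0 up out u tha' n = tic m0 up out u tha n" if "n < t" for n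
   using that same unfolding tic_def by simp
  moreover have "tic m0 up out u tha' t = tinc out ?c (u t) L" using last by (simp add: tic_def)
  ultimately have "{n. n < Suc t & tic m0 up out u tha' n} =
    {n. n < t & tic m0 up out u tha n} \<union> (if tinc out ?c (u t) L then {t} else {})"
   by (auto simp: less_Suc_eq)
  then show ?thesis using th(3) by (simp add: card_insert_if)
 qed
 ultimately show ?case using last by blast
qed

text \<open>Threads move on inside their sets, and those incremented in this step also found a new
  youngest set. The second membership records the additional increment that \<open>good\<close> asks
  for.\<close>

definition pre :: "'p => 'v => 'u => ('q set * nat) list => ('q set * nat) list" where
 "pre p v u zs = map (%z. ({L : Lv (nxp p v u). par p v u L : fst z}, snd z)) zs @ [({L : Lv (nxp p v u). inc p v u L}, 0)]"

primrec zq :: "'m => ('m => 'u => 'm) => ('m => 'v) => (nat => 'u) => nat => ('q set * nat) list" where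
 "zq m0 up out u 0 = []"
| "zq m0 up out u (Suc n) = proc (pre (snd (cf m0 up out u n)) (out (fst (cf m0 up out u n))) (u n) (zq m0 up out u n))"

lemma zq_cong: "(!!i. i < n ==> u i = u' i) ==> zq m0 up out u n = zq m0 up out u' n"
proof (induction n)
 case (Suc n)
 have "cf m0 up out u n = cf m0 up out u' n" by (rule cf_cong) (use Suc.prems in simp)
 then show ?case using Suc by simp
qed simp

lemma covered_pre: "covered (pre p v u zs) <= Lv (nxp p v u)"
 by (auto simp: pre_def covered_def)

lemma good_pre:
 assumes "good c zs" and c': "!!L. L : Lv (nxp p v u) ==> c' L = c (par p v u L) + of_bool (inc p v u L)"
 shows "good c' (pre p v u zs)"
proof -
 let ?L = "Lv (nxp p v u)"
 have "good c' (map (%z. ({L : ?L. par p v u L : fst z}, snd z)) zs @ [({L : ?L. inc p v u L}, 0)])"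
  using assms(1)
 proof (induction zs)
  case (Cons z zs)
  obtain n k where z: "z = (n, k)" by (cases z)
  have g: "ALL L:n. k <= c L" "ALL L:n \<inter> covered zs. Suc k <= c L" "good c zs" using Cons.prems z by auto
  have a: "k <= c' L" if "L : ?L" "par p v u L : n" for L using g(1) that c' by (simp add: trans_le_add1)
  have cov: "par p v u L : covered zs" if "L : covered (map (%z. ({L : ?L. par p v u L : fst z}, snd z)) zs)" for L
   using that by (auto simp: covered_def)
  have b: "Suc k <= c' L" if "L : ?L" "par p v u L : n"
   "L : covered (map (%z. ({L : ?L. par p v u L : fst z}, snd z)) zs) \<or> inc p v u L" for L
   using that(3)
  proof
   assume "L : covered (map (%z. ({L : ?L. par p v u L : fst z}, snd z)) zs)"
   then have "Suc k <= c (par p v u L)" using g(2) that(2) cov by blast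
   then show ?thesis using c'[OF that(1)] by simp
  next
   assume "inc p v u L"
   moreover have "k <= c (par p v u L)" using g(1) that(2) by blast
   ultimately show ?thesis using c'[OF that(1)] by simp
  qed
  show ?case using Cons.IH[OF g(3)] a b z by auto
 qed simp
 then show ?thesis by (simp add: pre_def)
qed

lemma own_nonempty: "own zs ==> z : set zs ==> fst z ~= {}" by (induction zs rule: own.induct) auto

lemma good_le: "good c zs ==> z : set zs ==> L : fst z ==> snd z <= c L" by (induction zs rule: own.induct) auto

text \<open>The new memory forgets the counters. For each key, a position with a list of sets, a
  reached configuration with lexicographically greatest counters is chosen, and the new machine
  answers as the old one does there. Take the longest prefix of sets that finally always survives.
  Its counters can only grow lexicographically and are at most \<open>K\<close>, so it is calm from
  some time on. A thread incremented after that occurs behind the prefix; its first place there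
  never moves right, and it moves left whenever the set just behind the prefix disappears, which
  happens infinitely often.\<close>

theorem collapse:
 assumes M: "machine MS m0 up out" and B: "bounded_by m0 up out K"
 shows "EX KS k0 up' out'. machine KS (k0 :: 'p * 'q set list) up' out' & safe k0 up' out' &
  KS <= PS \<times> {ns. set ns <= Pow Q & length ns <= card Q}"
proof -
 define R where "R = {(cf m0 up out u n, zq m0 up out u n) | u n. ALL i. u i : U}"
 define stp where "stp = (%e v. ((up (fst (fst e)) v, nxp (snd (fst e)) (out (fst (fst e))) v),
   proc (pre (snd (fst e)) (out (fst (fst e))) v (snd e))))"
 have stpR: "stp e v : R" if eR: "e : R" and vU: "v : U" for e v
 proof -
  obtain u n where u: "ALL i. u i : U" and e: "e = (cf m0 up out u n, zq m0 up out u n)" using eR unfolding R_def by blast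
  define u' where "u' = u(n := v)"
  have "cf m0 up out u' n = cf m0 up out u n" "zq m0 up out u' n = zq m0 up out u n"
   by (auto intro!: cf_cong zq_cong simp: u'_def)
  then have "stp e v = (cf m0 up out u' (Suc n), zq m0 up out u' (Suc n))" by (simp add: stp_def e u'_def)
  moreover have "ALL i. u' i : U" using u vU by (simp add: u'_def)
  ultimately show ?thesis unfolding R_def by blast
 qed
 have inv: "fst (fst e) : MS & snd (fst e) : PS & own (snd e) & covered (snd e) <= Lv (snd (fst e)) &
   (ALL z:set (snd e). snd z <= K)" if eR: "e : R" for e
 proof -
  obtain u n where u: "ALL i. u i : U" and e: "e = (cf m0 up out u n, zq m0 up out u n)" using eR unfolding R_def by blast
  have g: "own (zq m0 up out u n) & covered (zq m0 up out u n) <= Lv (snd (cf m0 up out u n)) & good (cn m0 up out u n) (zq m0 up out u n)"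
  proof (induction n)
   case (Suc n)
   let ?c = "cf m0 up out u n"
   have "good (cn m0 up out u (Suc n)) (pre (snd ?c) (out (fst ?c)) (u n) (zq m0 up out u n))"
    by (rule good_pre[of "cn m0 up out u n"]) (use Suc in "auto simp: tpar_def tinc_def")
   then show ?case using good_proc own_proc covered_proc covered_pre by fastforce
  qed simp
  have "snd z <= K" if z: "z : set (zq m0 up out u n)" for z
  proof -
   obtain L where L: "L : fst z" using own_nonempty[OF _ z] g by blast
   have "L : covered (zq m0 up out u n)" using L z by (auto simp: covered_def)
   then obtain tha where "thread m0 up out u tha n" "card {i. i < n & tic m0 up out u tha i} = cn m0 up out u n L"
    using cn_thread[OF M, of u L n] g u by blast
   then have "cn m0 up out u n L <= K" using B u unfolding bounded_by_def by metis
   then show ?thesis using good_le[OF _ z L] g order_trans by blast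
  qed
  then show ?thesis using g cf_in[OF M] u e by simp
 qed
 define key where "key = (%e :: ('a * 'p) * ('q set * nat) list. (snd (fst e), map fst (snd e)))"
 \<comment> \<open>Subtraction from \<open>K\<close> turns greatest counters into least signatures,
   for which a well-founded order is available. Counters reached are at most \<open>K\<close>, so
   nothing is lost by truncation.\<close>
 define sig where "sig = (%zs :: ('q set * nat) list. map (%z. K - snd z) zs)"
 have ex: "EX e. e : R & key e = k & (ALL e':R. key e' = k --> (sig (snd e'), sig (snd e)) ~: lex less_than)" if kR: "k : key ` R" for k
 proof -
  have "wf (inv_image (lex less_than) (%e. sig (snd e)))" by (intro wf_inv_image wf_lex) simp
  from wfE_min[OF this, of _ "{e : R. key e = k}"] kR obtain e where
   "e : {e : R. key e = k}" "!!e'. (e', e) : inv_image (lex less_than) (%e. sig (snd e)) ==> e' ~: {e : R. key e = k}"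
   by blast
  then show ?thesis by (intro exI[of _ e]) auto
 qed
 define rep where "rep = (%k. SOME e. e : R & key e = k & (ALL e':R. key e' = k --> (sig (snd e'), sig (snd e)) ~: lex less_than))"
 have rep: "rep k : R" "key (rep k) = k" "!!e'. e' : R ==> key e' = k ==> (sig (snd e'), sig (snd (rep k))) ~: lex less_than"
  if "k : key ` R" for k
  using someI_ex[OF ex[OF that]] unfolding rep_def by auto
 define k0 where "k0 = key ((m0, p0), [])"
 define up' where "up' = (%k v. key (stp (rep k) v))"
 define out' where "out' = (%k. out (fst (fst (rep k))))"
 obtain v0 where v0: "v0 : U" using Une by blast
 have "((m0, p0), []) : R" unfolding R_def using v0 by (auto intro!: exI[of _ "%_. v0"] exI[of _ 0])
 then have M': "machine (key ` R) k0 up' out'"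
  unfolding machine_def k0_def up'_def out'_def using rep stpR inv M by (auto simp: machine_def)
 have KS: "key ` R <= PS \<times> {ns. set ns <= Pow Q & length ns <= card Q}"
 proof
  fix k assume "k : key ` R"
  then obtain e where e: "e : R" "k = key e" by blast
  note i = inv[OF e(1)]
  have c: "covered (snd e) <= Q" using i LvQ by blast
  then have "length (snd e) <= card Q" using own_length[of "snd e" Q] i finQ card_mono[OF finQ c] by force
  moreover have "fst ` set (snd e) <= Pow Q" using c by (auto simp: covered_def)
  ultimately show "k : PS \<times> {ns. set ns <= Pow Q & length ns <= card Q}" using i e by (simp add: key_def)
 qed
 have lexwf: "wf (lex less_than)" by (intro wf_lex) simp
 have lextr: "Relation.trans (lex less_than)" by (intro lex_transI) simp
 have "safe k0 up' out'"
  unfolding safe_def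
 proof (intro allI impI, rule ccontr)
  fix u tha
  assume u: "ALL n. u n : U" and th: "ALL t. thread k0 up' out' u tha t"
   and nt: "~ (EX i. ALL n>=i. ~ tic k0 up' out' u tha n)"
  define k where "k = (%n. fst (cf k0 up' out' u n))"
  define e where "e = (%n. rep (k n))"
  define zs where "zs = (%n. snd (e n))"
  define W where "W = (%n. pre (fst (k n)) (out' (k n)) (u n) (zs n))"
  have kR: "k n : key ` R" for n using cf_in[OF M'] u by (simp add: k_def)
  have eR: "e n : R" "key (e n) = k n" for n using rep[OF kR] by (auto simp: e_def)
  have fe: "snd (fst (e n)) = fst (k n)" for n using arg_cong[OF eR(2)[of n], of fst] by (simp add: key_def)
  have p: "snd (cf k0 up' out' u n) = fst (k n)" for n
  proof (cases n)
   case 0 then show ?thesis by (simp add: k_def k0_def key_def)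
  next
   case (Suc n')
   have "snd (cf k0 up' out' u n') = fst (k n')"
   proof (induction n')
    case 0 then show ?case by (simp add: k_def k0_def key_def)
   next
    case (Suc j)
    have "k (Suc j) = key (stp (e j) (u j))" by (simp add: k_def up'_def e_def)
    then have "fst (k (Suc j)) = nxp (fst (k j)) (out' (k j)) (u j)"
     using fe[of j] by (simp add: key_def stp_def out'_def e_def)
    then show ?case using Suc by (simp add: k_def)
   qed
   moreover have "k (Suc n') = key (stp (e n') (u n'))" by (simp add: k_def up'_def e_def)
   then have "fst (k (Suc n')) = nxp (fst (k n')) (out' (k n')) (u n')"
    using fe[of n'] by (simp add: key_def stp_def out'_def e_def)
   ultimately show ?thesis using Suc by (simp add: k_def)
  qed
  have kS: "k (Suc n) = key (stp (e n) (u n))" for n by (simp add: k_def up'_def e_def)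
  have sW: "snd (stp (e n) (u n)) = proc (W n)" for n
   using fe[of n] by (simp add: stp_def W_def out'_def e_def zs_def)
  have mf: "map fst (proc (W n)) = map fst (zs (Suc n))" for n
   using kS[of n] eR(2)[of "Suc n"] sW[of n] by (simp add: key_def zs_def)
  have stR: "stp (e n) (u n) : R" for n using stpR eR u by blast
  have mnl: "(sig (proc (W n)), sig (zs (Suc n))) ~: lex less_than" for n
   using rep(3)[OF kR[of "Suc n"] stR[of n]] kS[of n] sW[of n] by (simp add: zs_def e_def)
  have leK: "ALL z:set (proc (W n)). snd z <= K" for n using inv[OF stR[of n]] sW[of n] by simp
  have lenQ: "length (zs n) <= card Q" for n
  proof -
   have "snd (k n) = map fst (zs n)" using arg_cong[OF eR(2)[of n], of snd] by (simp add: key_def zs_def)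
   moreover have "k n : PS \<times> {ns. set ns <= Pow Q & length ns <= card Q}" using KS kR by blast
   ultimately show ?thesis by (auto simp: mem_Times_iff)
  qed
  have lenW: "length (W n) = Suc (length (zs n))" for n by (simp add: W_def pre_def)
  have Wnth: "snd (W n ! j) = snd (zs n ! j)" if "j < length (zs n)" for n j
   using that by (simp add: W_def pre_def nth_append)
  have thL: "tha n : Lv (fst (k n))" "par (fst (k n)) (out' (k n)) (u n) (tha (Suc n)) = tha n" for n
  proof -
   have "tha n : Lv (snd (cf k0 up' out' u n))" using th[rule_format, of n] by (simp add: thread_def)
   then show "tha n : Lv (fst (k n))" by (simp only: p)
   have "par (snd (cf k0 up' out' u n)) (out' (k n)) (u n) (tha (Suc n)) = tha n"
    using th[rule_format, of "Suc n"] by (simp add: thread_def tpar_def k_def)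
   then show "par (fst (k n)) (out' (k n)) (u n) (tha (Suc n)) = tha n" by (simp only: p)
  qed
  have nk: "nxp (fst (k n)) (out' (k n)) (u n) = fst (k (Suc n))" for n
   using p[of n] p[of "Suc n"] by (simp add: k_def)
  have Wmem: "tha (Suc n) : fst (W n ! j) \<longleftrightarrow> tha n : fst (zs n ! j)" if "j < length (zs n)" for n j
   using that thL(1)[of "Suc n"] thL(2)[of n] by (simp add: W_def pre_def nth_append nk)
  define P where "P = (%r. EX N. ALL n>=N. surv r (W n))"
  have Pb: "r <= card Q" if "P r" for r
  proof -
   from that obtain N where "surv r (W N)" unfolding P_def by blast
   then have "r <= length (proc (W N))" using surv_proc by blast
   also have "... = length (zs (Suc N))" using mf[of N] by (metis length_map)
   finally show ?thesis using lenQ order_trans by blast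
  qed
  have P0: "P 0" by (simp add: P_def)
  \<comment> \<open>The length of the longest prefix that survives every update from some time on;
    it exists because no list is longer than \<open>card Q\<close>.\<close>
  define r where "r = (GREATEST r. P r)"
  have Pr: "P r" unfolding r_def by (rule GreatestI_nat[of P 0 "card Q"]) (use P0 Pb in auto)
  have nP: "~ P (Suc r)"
  proof
   assume "P (Suc r)"
   then have "Suc r <= r" unfolding r_def by (rule Greatest_le_nat[of P _ "card Q"]) (use Pb in auto)
   then show False by simp
  qed
  obtain N where N: "!!n. n >= N ==> surv r (W n)" using Pr P_def by blast
  have rl: "r <= length (zs n)" if "n >= Suc N" for n
  proof -
   from that obtain j where j: "n = Suc j" "j >= N" by (cases n) auto
   then have "r <= length (proc (W j))" using surv_proc N by blast
   then show ?thesis using mf[of j] j by (metis length_map)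
  qed
  define g where "g = (%n. take r (sig (zs n)))"
  have gst: "(g (Suc n) = g n \<or> (g (Suc n), g n) : lex less_than) & (~ calm r (W n) --> g (Suc n) ~= g n)"
   if n: "n >= Suc N" for n
  proof -
   have s: "surv r (W n)" using N n by simp
   note sp = surv_proc[OF s]
   define g' where "g' = take r (sig (proc (W n)))"
   have len: "length g' = r" "length (g n) = r" "length (g (Suc n)) = r"
    using sp rl[OF n] rl[of "Suc n"] n by (auto simp: g'_def g_def sig_def)
   have pt: "g' ! j <= g n ! j" if "j < r" for j
   proof -
    have "snd (zs n ! j) <= snd (proc (W n) ! j)" using sp that rl[OF n] Wnth[of j n] by auto
    then show ?thesis using that sp rl[OF n] by (simp add: g'_def g_def sig_def)
   qed
   have 1: "g' = g n \<or> (g', g n) : lex less_than" by (rule lex_pointwise) (use len pt in auto)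
   have 2: "g' ~= g n" if "~ calm r (W n)"
   proof -
    from sp that obtain j where j: "j < r" "snd (W n ! j) < snd (proc (W n) ! j)" by blast
    have "proc (W n) ! j : set (proc (W n))" using sp j by simp
    then have "snd (proc (W n) ! j) <= K" using leK by blast
    then have "g' ! j < g n ! j" using j sp rl[OF n] Wnth[of j n] by (simp add: g'_def g_def sig_def)
    then show ?thesis by auto
   qed
   \<comment> \<open>Passing to the representative never raises the signature. If the actual
     successor were smaller on the prefix it would be smaller on the whole list, contrary to the
     choice of the representative.\<close>
   have 3: "g (Suc n) = g' \<or> (g (Suc n), g') : lex less_than"
   proof -
    have "(g', g (Suc n)) ~: lex less_than"
    proof
     assume "(g', g (Suc n)) : lex less_than"
     moreover have "length (drop r (sig (proc (W n)))) = length (drop r (sig (zs (Suc n))))"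
      using mf[of n] by (metis length_drop length_map sig_def)
     ultimately have "(g' @ drop r (sig (proc (W n))), g (Suc n) @ drop r (sig (zs (Suc n)))) : lex less_than"
      by (rule lex_append)
     then show False using mnl[of n] by (simp add: g'_def g_def)
    qed
    then show ?thesis using lex_total[of "g (Suc n)" g'] len by auto
   qed
   have irr: "(a, a) ~: lex less_than" for a :: "nat list" using lexwf by auto
   have "(g (Suc n), g n) : lex less_than" if "(g (Suc n), g') : lex less_than \<or> (g', g n) : lex less_than"
    using that 1 3 lextr by (metis transE)
   then show ?thesis using 1 2 3 irr by metis
  qed
  obtain M1 where M1: "M1 >= Suc N" "ALL i>=M1. g i = g M1"
   using wf_eventually[OF lexwf lextr, of "Suc N" g] gst by blast
  have calm: "calm r (W n)" if "n >= M1" for n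
   using gst[of n] M1 that by (metis le_SucI order_trans)
  obtain n0 where n0: "n0 >= M1" "tic k0 up' out' u tha n0" using nt by blast
  define X where "X = (%n x. r <= x & x < length (zs n) & tha n : fst (zs n ! x))"
  \<comment> \<open>The quantity that cannot fall forever: the first place behind the prefix whose
    set contains the thread.\<close>
  define x where "x = (%n. LEAST y. X n y)"
  have go: "EX y'. X (Suc n) y' & y' <= y & (~ surv (Suc r) (W n) --> y' < y)"
   if n1: "n >= M1" and n2: "r <= y" and n3: "y < length (W n)" and n4: "tha (Suc n) : fst (W n ! y)"
    and n5: "!!j. r <= j ==> j < y ==> tha (Suc n) ~: fst (W n ! j)" for n y
  proof -
   obtain y' where y': "r <= y'" "y' <= y" "y' < length (proc (W n))" "tha (Suc n) : fst (proc (W n) ! y')"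
    "~ surv (Suc r) (W n) --> y' < y"
    using thread_proc[OF calm[OF n1] n2 n3 n4 n5] by blast
   have l: "length (proc (W n)) = length (zs (Suc n))" using mf[of n] by (metis length_map)
   have "fst (proc (W n) ! y') = fst (zs (Suc n) ! y')" using mf[of n] y'(3) l by (metis nth_map)
   then show ?thesis using y' l by (auto simp: X_def)
  qed
  have X0: "EX y. X (Suc n0) y"
  proof -
   define Y where "Y = (%y. r <= y & y < length (W n0) & tha (Suc n0) : fst (W n0 ! y))"
   have "inc (fst (k n0)) (out' (k n0)) (u n0) (tha (Suc n0))"
    using n0(2) p[of n0] by (simp add: tic_def tinc_def k_def)
   then have "Y (length (zs n0))" using rl[of n0] n0(1) M1(1) thL(1)[of "Suc n0"]
    by (simp add: Y_def W_def pre_def nth_append nk)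
   then have Yl: "Y (LEAST y. Y y)" by (rule LeastI)
   have "tha (Suc n0) ~: fst (W n0 ! j)" if "r <= j" "j < (LEAST y. Y y)" for j
    using not_less_Least[OF that(2)] that Yl by (auto simp: Y_def)
   then show ?thesis using go[OF n0(1), of "LEAST y. Y y"] Yl unfolding Y_def by blast
  qed
  have Xs: "(EX y. X (Suc n) y) & x (Suc n) <= x n & (~ surv (Suc r) (W n) --> x (Suc n) < x n)"
   if n1: "n >= M1" and n2: "EX y. X n y" for n
  proof -
   have xn: "X n (x n)" unfolding x_def using LeastI_ex[OF n2] .
   have "tha (Suc n) ~: fst (W n ! j)" if "r <= j" "j < x n" for j
    using not_less_Least[of j "X n"] that xn Wmem[of j n] unfolding x_def X_def by auto
   then obtain y' where y': "X (Suc n) y'" "y' <= x n" "~ surv (Suc r) (W n) --> y' < x n"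
    using go[OF n1, of "x n"] xn Wmem[of "x n" n] lenW[of n] unfolding X_def by auto
   have "x (Suc n) <= y'" unfolding x_def using y'(1) by (rule Least_le)
   then show ?thesis using y' by auto
  qed
  have Xall: "EX y. X n y" if "n >= Suc n0" for n
   using that
  proof (induction n rule: dec_induct)
   case (step n) then show ?case using Xs[of n] n0(1) by simp
  qed (rule X0)
  have xst: "!!i. i >= Suc n0 ==> x (Suc i) = x i \<or> (x (Suc i), x i) : less_than"
   using Xs Xall n0(1) by (metis le_SucI le_neq_implies_less less_than_iff Suc_leD order_trans)
  have "EX M>=Suc n0. ALL i>=M. x i = x M"
   by (rule wf_eventually[where R = less_than]) (use xst in auto)
  then obtain M2 where M2: "M2 >= Suc n0" "ALL i>=M2. x i = x M2" by blast
  obtain n where n: "n >= M2" "~ surv (Suc r) (W n)" using nP unfolding P_def by blast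
  have "n >= M1" using n M2 n0 by simp
  moreover have "EX y. X n y" by (rule Xall) (use n(1) M2(1) in simp)
  ultimately have "x (Suc n) < x n" using Xs n(2) by blast
  moreover have "x (Suc n) = x M2" "x n = x M2" using M2(2)[rule_format, of "Suc n"] M2(2)[rule_format, of n] n(1) by auto
  ultimately show False by simp
 qed
 then show ?thesis using M' KS by blast
qed

end

section \<open>Formula tables and label sequences\<close>

text \<open>
  A formula is represented by the list of its subformulas, children first.  An entry
  \<open>(t, (i, j), (a, v))\<close> is the proposition \<open>a\<close> on \<open>v\<close> if \<open>t = 0\<close>, and otherwise a connective
 applied to the entries \<open>i\<close> and \<open>j\<close>.
\<close>

type_synonym 'n nd = "nat * (nat * nat) * ('n * 'n)"

definition wf_nd :: "nat => 'n nd => bool" where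
 "wf_nd k nd \<longleftrightarrow> fst nd ~= 0 --> fst (fst (snd nd)) < k & snd (fst (snd nd)) < k"

definition wf_tab :: "'n nd list => bool" where
 "wf_tab tab \<longleftrightarrow> tab ~= [] & (ALL k < length tab. wf_nd k (tab ! k))"

definition mk :: "('n, 'n) qf list => 'n nd => ('n, 'n) qf" where
 "mk fs = (%(t, (i, j), (a, v)). if t = 0 then Prop a v else if t = 1 then Neg (fs ! i)
   else if t = 2 then Or (fs ! i) (fs ! j) else if t = 3 then Next (fs ! i) else Until (fs ! i) (fs ! j))"

definition forms :: "'n nd list => ('n, 'n) qf list" where
 "forms tab = foldl (%fs nd. fs @ [mk fs nd]) [] tab"

lemma forms_snoc: "forms (tab @ [nd]) = forms tab @ [mk (forms tab) nd]" by (simp add: forms_def)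

lemma length_forms [simp]: "length (forms tab) = length tab"
 by (induction tab rule: rev_induct) (simp_all add: forms_snoc, simp add: forms_def)

lemma mk_append: "wf_nd k nd ==> k <= length fs ==> mk (fs @ gs) nd = mk fs nd"
 by (cases nd) (auto simp: mk_def wf_nd_def nth_append)

lemma forms_nth: "wf_tab tab ==> k < length tab ==> forms tab ! k = mk (forms tab) (tab ! k)"
proof -
 have "ALL k<length tab. wf_nd k (tab ! k) ==> k < length tab ==> forms tab ! k = mk (forms tab) (tab ! k)"
 proof (induction tab arbitrary: k rule: rev_induct)
  case (snoc nd tab)
  show ?case
  proof (cases "k < length tab")
   case True
   have wf: "wf_nd k (tab ! k)" using snoc.prems True by (metis length_append_singleton less_SucI nth_append)
   have "ALL k<length tab. wf_nd k (tab ! k)"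
    using snoc.prems(1) by (metis length_append_singleton less_SucI nth_append)
   from snoc.IH[OF this True] show ?thesis
    using True wf by (simp add: forms_snoc nth_append mk_append)
  next
   case False
   then have k: "k = length tab" using snoc.prems(2) by simp
   have "wf_nd k nd" using snoc.prems k by (metis nth_append_length)
   then show ?thesis using k by (simp add: forms_snoc nth_append mk_append)
  qed
 qed simp
 then show "wf_tab tab ==> k < length tab ==> forms tab ! k = mk (forms tab) (tab ! k)"
  by (simp add: wf_tab_def)
qed

definition nd_at :: "'n nd list => nat => 'n nd" where "nd_at tab k = nthd undefined tab k"
definition look :: "bool list => nat => bool" where "look L k = nthd False L k"

lemma nd_at: "k < length tab ==> nd_at tab k = tab ! k" by (simp add: nd_at_def nthd_def)
lemma look: "k < length L ==> look L k = L ! k" by (simp add: look_def nthd_def)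

text \<open>Local consistency of the label \<open>L\<close> with a valuation of the propositions and the next label.\<close>

definition lval :: "'n nd list => bool list => bool list => bool list => nat => bool" where
 "lval tab pv L L' k = (let t = fst (nd_at tab k); i = fst (fst (snd (nd_at tab k))); j = snd (fst (snd (nd_at tab k))) in
   if t = 0 then look pv k else if t = 1 then ~ look L i else if t = 2 then look L i \<or> look L j
   else if t = 3 then look L' i else look L j \<or> (look L i & look L' k))"

definition cons :: "'n nd list => bool list => bool list => bool list => bool" where
 "cons tab pv L L' \<longleftrightarrow> (ALL k : set [0..<length tab]. look L k = lval tab pv L L' k)"

definition residue :: "nat => nat => nat" where "residue c n = c mod n"

text \<open>Only tags above 3 are untils and carry an obligation; it is met where the until is not
  claimed or its right operand holds. Counting modulo the table length visits all entries
  cyclically.\<close>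

definition ful :: "'n nd list => nat => bool list => bool" where
 "ful tab c L \<longleftrightarrow> (let k = residue c (length tab); nd = nd_at tab k in
   fst nd <= 3 \<or> ~ look L k \<or> look L (snd (fst (snd nd))))"

text \<open>Children precede their parents in the table, and apart from them an entry depends only
  on the valuation and the next label. Labels are thus determined backwards, which is the source of
  the unique parent of a thread.\<close>

lemma cons_unique:
 assumes wf: "wf_tab tab" and c: "cons tab pv L1 L'" "cons tab pv L2 L'"
  and l: "length L1 = length tab" "length L2 = length tab"
 shows "L1 = L2"
proof (rule nth_equalityI)
 fix k assume "k < length L1"
 then have "k < length tab" using l by simp
 then have "look L1 k = look L2 k"
 proof (induction k rule: less_induct)
  case (less k)
  have w: "wf_nd k (nd_at tab k)" using wf less.prems by (simp add: wf_tab_def nd_at)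
  have e: "fst (nd_at tab k) ~= 0 ==> look L1 (fst (fst (snd (nd_at tab k)))) = look L2 (fst (fst (snd (nd_at tab k)))) &
    look L1 (snd (fst (snd (nd_at tab k)))) = look L2 (snd (fst (snd (nd_at tab k))))"
   using w less by (simp add: wf_nd_def)
  have "look L1 k = lval tab pv L1 L' k" "look L2 k = lval tab pv L2 L' k"
   using c less.prems by (auto simp: cons_def)
  then show ?case using e unfolding lval_def Let_def by auto
 qed
 then show "L1 ! k = L2 ! k" using \<open>k < length L1\<close> l by (simp add: look)
qed (use l in simp)

definition TrA :: "(nat => 'n => 'n => bool) => 'n \<rightharpoonup> 'n trace" where
 "TrA \<rho> = (%v. Some (%i. {a. \<rho> i a v}))"

definition Tr :: "'n nd list => (nat => 'n => 'n => bool) => nat => bool list" where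
 "Tr tab \<rho> i = map (sat (TrA \<rho>) i) (forms tab)"

definition pval :: "'n nd list => ('n => 'n => bool) => bool list" where
 "pval tab \<rho> = map (%nd. \<rho> (fst (snd (snd nd))) (snd (snd (snd nd)))) tab"

lemma length_Tr [simp]: "length (Tr tab \<rho> i) = length tab" by (simp add: Tr_def)

lemma look_Tr: "k < length tab ==> look (Tr tab \<rho> i) k = sat (TrA \<rho>) i (forms tab ! k)"
 by (simp add: look) (simp add: Tr_def)

lemma sat_Until: "sat A i (Until ph ps) \<longleftrightarrow> sat A i ps \<or> (sat A i ph & sat A (Suc i) (Until ph ps))"
proof
 assume "sat A i (Until ph ps)"
 then obtain j where j: "j >= i" "sat A j ps" "!!k. i <= k ==> k < j ==> sat A k ph" by auto
 show "sat A i ps \<or> (sat A i ph & sat A (Suc i) (Until ph ps))"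
 proof (cases "j = i")
  case False
  then have "sat A i ph" "Suc i <= j" using j by auto
  moreover have "sat A (Suc i) (Until ph ps)" using j \<open>Suc i <= j\<close> by auto
  ultimately show ?thesis by blast
 qed (use j in simp)
next
 assume "sat A i ps \<or> (sat A i ph & sat A (Suc i) (Until ph ps))"
 then show "sat A i (Until ph ps)"
 proof
  assume a: "sat A i ph & sat A (Suc i) (Until ph ps)"
  then obtain j where j: "j >= Suc i" "sat A j ps" "ALL k. Suc i <= k & k < j --> sat A k ph" by auto
  have "sat A k ph" if "i <= k" "k < j" for k using a j(3) that by (cases "k = i") auto
  then show ?thesis using j(1,2) by (auto intro!: exI[of _ j])
 qed (auto intro: exI[of _ i])
qed

declare sat.simps(5) [simp del]

lemma cons_Tr:
 assumes wf: "wf_tab tab"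
 shows "cons tab (pval tab (\<rho> i)) (Tr tab \<rho> i) (Tr tab \<rho> (Suc i))"
 unfolding cons_def
proof
 fix k assume "k : set [0..<length tab]"
 then have k: "k < length tab" by simp
 obtain t x y a v where nd: "tab ! k = (t, (x, y), (a, v))" by (metis prod.exhaust)
 have w: "t ~= 0 ==> x < length tab & y < length tab" using wf k nd by (force simp: wf_tab_def wf_nd_def)
 have pv: "look (pval tab (\<rho> i)) k = \<rho> i a v" using k nd by (simp add: look pval_def)
 show "look (Tr tab \<rho> i) k = lval tab (pval tab (\<rho> i)) (Tr tab \<rho> i) (Tr tab \<rho> (Suc i)) k"
  using w pv k sat_Until[of "TrA \<rho>" i "forms tab ! x" "forms tab ! y"]
  by (auto simp: lval_def nd_at nd look_Tr forms_nth[OF wf k] mk_def TrA_def)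
qed

definition is_ful :: "'n nd list => nat => bool list => bool" where
 "is_ful tab k L \<longleftrightarrow> fst (tab ! k) <= 3 \<or> ~ look L k \<or> look L (snd (fst (snd (tab ! k))))"

lemma ful_iff: "tab ~= [] ==> ful tab c L \<longleftrightarrow> is_ful tab (c mod length tab) L"
 by (simp add: ful_def residue_def is_ful_def Let_def nd_at)

lemma fair_Tr:
 assumes wf: "wf_tab tab" and k: "k < length tab"
 shows "EX i'>=i. is_ful tab k (Tr tab \<rho> i')"
proof (cases "fst (tab ! k) <= 3 \<or> ~ look (Tr tab \<rho> i) k")
 case True
 then show ?thesis by (auto simp: is_ful_def)
next
 case False
 obtain t x y a v where nd: "tab ! k = (t, (x, y), (a, v))" by (metis prod.exhaust)
 have t: "t > 3" using False nd by simp
 have w: "x < length tab & y < length tab" using wf k nd t by (force simp: wf_tab_def wf_nd_def)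
 have "sat (TrA \<rho>) i (Until (forms tab ! x) (forms tab ! y))"
  using False t by (simp add: look_Tr k forms_nth[OF wf k] mk_def nd)
 then obtain j where "j >= i" "sat (TrA \<rho>) j (forms tab ! y)" by (auto simp: sat.simps(5))
 then show ?thesis using w nd by (auto simp: is_ful_def look_Tr)
qed

text \<open>Consistency alone admits an until that is claimed forever and never fulfilled. Fairness
  excludes exactly this, so a fair consistent sequence consists of the true values. The induction on
  the entry has its children as smaller cases.\<close>

lemma label_unique:
 assumes wf: "wf_tab tab" and len: "!!i. length (La i) = length tab"
  and c: "!!i. cons tab (pval tab (\<rho> i)) (La i) (La (Suc i))"
  and fair: "!!k i. k < length tab ==> EX i'>=i. is_ful tab k (La i')"
 shows "La i = Tr tab \<rho> i"
proof (rule nth_equalityI)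
 fix k assume "k < length (La i)"
 then have k: "k < length tab" using len by simp
 then have "look (La i) k = look (Tr tab \<rho> i) k"
 proof (induction k arbitrary: i rule: less_induct)
  case (less k)
  obtain t x y a v where nd: "tab ! k = (t, (x, y), (a, v))" by (metis prod.exhaust)
  have w: "t ~= 0 ==> x < k & y < k" using wf less.prems nd by (force simp: wf_tab_def wf_nd_def)
  have IHx: "t ~= 0 ==> look (La i) x = look (Tr tab \<rho> i) x" and IHy: "t ~= 0 ==> look (La i) y = look (Tr tab \<rho> i) y" for i
   using less w by auto
  have lv: "look (La i) k = lval tab (pval tab (\<rho> i)) (La i) (La (Suc i)) k" for i
   using c less.prems by (auto simp: cons_def)
  have lt: "look (Tr tab \<rho> i) k = lval tab (pval tab (\<rho> i)) (Tr tab \<rho> i) (Tr tab \<rho> (Suc i)) k" for i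
   using cons_Tr[OF wf] less.prems by (auto simp: cons_def)
  show ?case
  proof (cases "t > 3")
   case False
   then consider "t = 0" | "t = 1" | "t = 2" | "t = 3" by linarith
   then show ?thesis
    unfolding lv[of i] lt[of i] using IHx IHy less.prems by cases (auto simp: lval_def nd_at nd)
  next
   case True
   have un: "look (La i) k \<longleftrightarrow> look (La i) y \<or> (look (La i) x & look (La (Suc i)) k)" for i
    using lv[of i] True less.prems by (simp add: lval_def nd_at nd)
   have xy: "x < length tab" "y < length tab" using w True less.prems by auto
   have sx: "look (La i) x = sat (TrA \<rho>) i (forms tab ! x)" "look (La i) y = sat (TrA \<rho>) i (forms tab ! y)" for i
    using IHx IHy True xy by (auto simp: look_Tr)
   have goal: "look (Tr tab \<rho> i) k = sat (TrA \<rho>) i (Until (forms tab ! x) (forms tab ! y))"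
    using True by (simp add: look_Tr less.prems forms_nth[OF wf less.prems] mk_def nd)
   show ?thesis unfolding goal
   proof
    assume a: "look (La i) k"
    obtain i' where i': "i' >= i" "~ look (La i') k \<or> look (La i') y"
     using fair[OF less.prems, of i] True nd by (auto simp: is_ful_def)
    \<comment> \<open>The least position at which the claim is dropped or fulfilled. Consistency
      carries the claim as far as this position, so it is fulfilled there.\<close>
    then obtain m where m: "m >= i" "~ look (La m) k \<or> look (La m) y"
     and mn: "!!n. i <= n ==> n < m ==> look (La n) k & ~ look (La n) y"
     using exists_least_iff[of "%m. m >= i & (~ look (La m) k \<or> look (La m) y)"] by auto
    have "look (La m) k"
    proof (cases "m = i")
     case False
     then obtain m' where m': "m = Suc m'" "i <= m'" using m(1) by (cases m) auto
     then show ?thesis using mn[of m'] un[of m'] by auto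
    qed (use a in simp)
    then have y: "look (La m) y" using m(2) by blast
    have "look (La n) x" if "i <= n" "n < m" for n using mn[OF that] un[of n] by blast
    then show "sat (TrA \<rho>) i (Until (forms tab ! x) (forms tab ! y))"
     using y m(1) unfolding sx sat.simps(5) by blast
   next
    assume "sat (TrA \<rho>) i (Until (forms tab ! x) (forms tab ! y))"
    then obtain j where j: "j >= i" "look (La j) y" "!!n. i <= n ==> n < j ==> look (La n) x"
     unfolding sat.simps(5) sx by blast
    have "look (La n) k" if "n <= j" "i <= n" for n
     using that
    proof (induction n rule: inc_induct)
     case base then show ?case using un j(2) by blast
    next
     case (step n) then show ?case using un[of n] j(3)[of n] by auto
    qed
    then show "look (La i) k" using j(1) by blast
   qed
  qed
 qed
 then show "La i ! k = Tr tab \<rho> i ! k" using k len by (simp add: look)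
qed (use len in simp)

subsection \<open>Counting fulfilled obligations\<close>

text \<open>
  \<open>C L = 0\<close> means that no label sequence reaches \<open>L\<close>; otherwise \<open>C L - 1\<close> counts the obligations
 fulfilled so far in cyclic order along the unique sequence reaching \<open>L\<close>.
\<close>

definition step_count :: "'n nd list => bool list => bool list list => (bool list => nat) => bool list => nat" where
 "step_count tab pv atoms C L' = (case filter (%L. 0 < C L & cons tab pv L L') atoms of [] => 0
   | L # _ => C L + (if ful tab (C L - 1) L then 1 else 0))"

text \<open>The root is the last entry, and only labels that reject it start alive: the threads are
  the possible refutations of the formula.\<close>

definition init_count :: "'n nd list => bool list => nat" where
 "init_count tab L = (if look L (length tab - 1) then 0 else 1)"

locale label_game =
 fixes tab :: "'n nd list" and atoms :: "bool list list"
  and s0 :: 'st and nx :: "'st => 'v => 'u => 'st" and rho :: "'st => 'v => 'u => 'n => 'n => bool"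
  and U :: "'u set" and V :: "'v set" and Sts :: "'st set"
 assumes wf: "wf_tab tab" and atoms: "set atoms = {L. length L = length tab}"
  and finS: "finite Sts" and s0: "s0 : Sts" and Une: "U ~= {}"
  and nx: "!!s v u. s : Sts ==> v : V ==> u : U ==> nx s v u : Sts"
begin

abbreviation "cl \<equiv> length tab"
abbreviation "pvf s v u \<equiv> pval tab (rho s v u)"

lemma cl_pos: "cl > 0" using wf by (simp add: wf_tab_def)

text \<open>Which obligation is awaited depends on the count modulo the table length only, while 0
  stays reserved for dead labels. Reduction makes the set of positions finite, and it commutes with
  the update of the counts.\<close>

definition red :: "(bool list => nat) => bool list => nat" where
 "red C L = (if L : set atoms & 0 < C L then Suc ((C L - 1) mod cl) else 0)"

definition Lv :: "'st * (bool list => nat) => bool list set" where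
 "Lv p = {L : set atoms. 0 < snd p L}"
definition par :: "'st * (bool list => nat) => 'v => 'u => bool list => bool list" where
 "par p v u L' = hd (filter (%L. 0 < snd p L & cons tab (pvf (fst p) v u) L L') atoms)"
definition inc :: "'st * (bool list => nat) => 'v => 'u => bool list => bool" where
 "inc p v u L' \<longleftrightarrow> ful tab (snd p (par p v u L') - 1) (par p v u L')"
definition nxp :: "'st * (bool list => nat) => 'v => 'u => 'st * (bool list => nat)" where
 "nxp p v u = (nx (fst p) v u, red (step_count tab (pvf (fst p) v u) atoms (snd p)))"
definition PS :: "('st * (bool list => nat)) set" where
 "PS = Sts \<times> {ka. ALL L. ka L <= cl & (L ~: set atoms --> ka L = 0)}"

lemma red_pos: "L : set atoms ==> 0 < red C L \<longleftrightarrow> 0 < C L" by (simp add: red_def)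

lemma red_le: "red C L <= cl" using cl_pos by (auto simp: red_def Suc_le_eq)

lemma ful_red: "L : set atoms ==> 0 < C L ==> ful tab (red C L - 1) L = ful tab (C L - 1) L"
 using cl_pos by (simp add: red_def ful_iff)

lemma filter_red:
 "filter (%L. 0 < red C L & cons tab pv L L') atoms = filter (%L. 0 < C L & cons tab pv L L') atoms"
 by (rule filter_cong) (auto simp: red_pos)

lemma red_step: "red (step_count tab pv atoms (red C)) = red (step_count tab pv atoms C)"
proof
 fix L'
 show "red (step_count tab pv atoms (red C)) L' = red (step_count tab pv atoms C) L'"
 proof (cases "filter (%L. 0 < C L & cons tab pv L L') atoms")
  case Nil
  then show ?thesis by (simp add: red_def[of "step_count _ _ _ _"] step_count_def filter_red)
 next
  case (Cons L Ls)
  have "L : set (filter (%L. 0 < C L & cons tab pv L L') atoms)" unfolding Cons by simp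
  then have L: "L : set atoms" "0 < C L" by auto
  have 1: "step_count tab pv atoms C L' = C L + (if ful tab (C L - 1) L then 1 else 0)"
   using Cons by (simp add: step_count_def)
  have 2: "step_count tab pv atoms (red C) L' = Suc ((C L - 1) mod cl) + (if ful tab (C L - 1) L then 1 else 0)"
  proof -
   have "step_count tab pv atoms (red C) L' = red C L + (if ful tab (red C L - 1) L then 1 else 0)"
    using Cons by (simp add: step_count_def filter_red)
   also have "... = Suc ((C L - 1) mod cl) + (if ful tab (C L - 1) L then 1 else 0)"
    unfolding ful_red[where C = C, OF L] using L by (simp add: red_def)
   finally show ?thesis .
  qed
  have "(Suc ((C L - 1) mod cl) + b - 1) mod cl = (C L + b - 1) mod cl" for b
  proof -
   have "Suc ((C L - 1) mod cl) + b - 1 = (C L - 1) mod cl + b" by simp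
   moreover have "C L + b - 1 = (C L - 1) + b" using L(2) by simp
   ultimately show ?thesis by (simp add: mod_add_left_eq)
  qed
  then show ?thesis unfolding red_def[of "step_count _ _ _ _"] 1 2 using L(2) by simp
 qed
qed

lemma Lv_par:
 assumes "L' : Lv (nxp p v u)"
 shows "par p v u L' : set atoms & 0 < snd p (par p v u L') & cons tab (pvf (fst p) v u) (par p v u L') L'"
proof -
 have "0 < step_count tab (pvf (fst p) v u) atoms (snd p) L'"
  using assms by (auto simp: Lv_def nxp_def red_pos)
 then have "filter (%L. 0 < snd p L & cons tab (pvf (fst p) v u) L L') atoms ~= []"
  unfolding step_count_def by (auto split: list.splits)
 then have "par p v u L' : set (filter (%L. 0 < snd p L & cons tab (pvf (fst p) v u) L L') atoms)"
  unfolding par_def by (rule hd_in_set)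
 then show ?thesis by simp
qed

lemma step_par:
 assumes "0 < step_count tab (pvf s v u) atoms C L'"
 shows "step_count tab (pvf s v u) atoms C L' = C (par (s, C) v u L') + (if ful tab (C (par (s, C) v u L') - 1) (par (s, C) v u L') then 1 else 0)"
 using assms unfolding step_count_def par_def by (auto split: list.splits)

lemma par_red: "par (s, red C) v u = par (s, C) v u"
 unfolding par_def snd_conv fst_conv filter_red ..

lemma finite_PS: "finite PS"
proof -
 have "finite {ka. ALL L. ka L <= cl & (L ~: set atoms --> ka L = 0)}"
  by (rule finite_subset[OF _ finite_set_of_finite_funs[of "set atoms" "{..cl}" 0]]) auto
 then show ?thesis using finS by (simp add: PS_def)
qed

lemma card_PS: "card PS <= card Sts * Suc cl ^ length atoms"
proof -
 let ?F = "{ka. ALL L. ka L <= cl & (L ~: set atoms --> ka L = 0)}"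
 have "inj_on (%ka. map ka atoms) ?F"
 proof (rule inj_onI)
  fix ka ka' assume k: "ka : ?F" "ka' : ?F" and "map ka atoms = map ka' atoms"
  then have "ka L = ka' L" if "L : set atoms" for L using that by simp
  moreover have "ka L = ka' L" if "L ~: set atoms" for L using that k by simp
  ultimately show "ka = ka'" by blast
 qed
 then have "card ?F = card ((%ka. map ka atoms) ` ?F)" by (simp add: card_image)
 also have "... <= card {xs. set xs <= {..cl} & length xs = length atoms}"
  by (rule card_mono) (auto intro: finite_lists_length_eq)
 also have "... = Suc cl ^ length atoms" by (simp add: card_lists_length_eq)
 finally show ?thesis unfolding PS_def card_cartesian_product by simp
qed

end

sublocale label_game < tgame "(s0, red (init_count tab))" nxp Lv par inc U V PS "set atoms"
proof
 show "finite PS" by (rule finite_PS)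
 show "(s0, red (init_count tab)) : PS" using s0 red_le by (simp add: PS_def) (simp add: red_def)
 show "nxp p v u : PS" if "p : PS" "v : V" "u : U" for p v u
  using that nx red_le by (auto simp: PS_def nxp_def) (simp add: red_def)
 show "par p v u L : Lv p" if "L : Lv (nxp p v u)" for p v u L using Lv_par[OF that] by (simp add: Lv_def)
qed (auto simp: Une Lv_def)

section \<open>Boundedness of the counts against truth of the formula\<close>

context label_game
begin

definition pvs :: "'m => ('m => 'u => 'm) => ('m => 'v) => (nat => 'u) => nat => 'n => 'n => bool" where
 "pvs m0 up out u n = rho (fst (snd (cf m0 up out u n))) (out (fst (cf m0 up out u n))) (u n)"

definition holds :: "'m => ('m => 'u => 'm) => ('m => 'v) => (nat => 'u) => bool" where
 "holds m0 up out u \<longleftrightarrow> sat (TrA (pvs m0 up out u)) 0 (forms tab ! (cl - 1))"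

text \<open>The full counts along a play, of which the game position holds only the reduced
  form.\<close>

primrec cnt :: "'m => ('m => 'u => 'm) => ('m => 'v) => (nat => 'u) => nat => bool list => nat" where
 "cnt m0 up out u 0 = init_count tab"
| "cnt m0 up out u (Suc n) = step_count tab (pval tab (pvs m0 up out u n)) atoms (cnt m0 up out u n)"

lemma snd_nxp: "snd (nxp p v u) = red (step_count tab (pvf (fst p) v u) atoms (snd p))"
 by (simp add: nxp_def)

lemma cf_cnt: "snd (snd (cf m0 up out u n)) = red (cnt m0 up out u n)"
proof (induction n)
 case 0 show ?case by (simp only: cf.simps cnt.simps snd_conv)
next
 case (Suc n)
 show ?case unfolding cf.simps cnt.simps snd_conv snd_nxp Suc pvs_def by (rule red_step)
qed

lemma cnt_cn:
 "L : Lv (snd (cf m0 up out u n)) ==> cnt m0 up out u n L = Suc (cn m0 up out u n L)"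
proof (induction n arbitrary: L)
 case 0
 then have "0 < red (init_count tab) L" "L : set atoms" by (simp_all only: Lv_def cf.simps snd_conv mem_Collect_eq)
 then have "init_count tab L = 1" by (simp add: red_pos) (simp add: init_count_def split: if_splits)
 then show ?case by (simp only: cnt.simps cn.simps)
next
 case (Suc n)
 let ?c = "cf m0 up out u n" and ?C = "cnt m0 up out u n"
 let ?s = "fst (snd ?c)" and ?v = "out (fst ?c)"
 have s: "snd ?c = (?s, red ?C)" using cf_cnt[of m0 up out u n] by (simp add: prod_eq_iff)
 have "L : Lv (nxp (snd ?c) ?v (u n))" using Suc.prems by simp
 note pl = Lv_par[OF this]
 have tp: "tpar out ?c (u n) L = par (?s, ?C) ?v (u n) L" unfolding tpar_def by (subst s) (rule fun_cong[OF par_red])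
 let ?P = "par (?s, ?C) ?v (u n) L"
 have P: "?P : set atoms" "0 < ?C ?P"
  using pl tp cf_cnt[of m0 up out u n] unfolding tpar_def by (auto simp: red_pos)
 then have "?P : Lv (snd ?c)" using cf_cnt[of m0 up out u n] by (simp add: Lv_def red_pos)
 from Suc.IH[OF this] have IH: "?C ?P = Suc (cn m0 up out u n ?P)" .
 have "0 < red (cnt m0 up out u (Suc n)) L" "L : set atoms"
  using Suc.prems unfolding Lv_def mem_Collect_eq cf_cnt by blast+
 then have "0 < cnt m0 up out u (Suc n) L" by (simp only: red_pos)
 then have "cnt m0 up out u (Suc n) L = ?C ?P + (if ful tab (?C ?P - 1) ?P then 1 else 0)"
  using step_par[of ?s ?v "u n" ?C L] by (simp add: pvs_def)
 moreover have "tinc out ?c (u n) L \<longleftrightarrow> ful tab (?C ?P - 1) ?P"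
  using tp unfolding tinc_def inc_def tpar_def cf_cnt ful_red[where C = ?C, OF P, symmetric] by (simp only:)
 ultimately show ?case using IH tp by simp
qed

lemma bounded_cnt:
 assumes M: "machine MS m0 up out" and B: "bounded_by m0 up out K" and u: "!!n. u n : U" and L: "L : set atoms"
 shows "cnt m0 up out u n L <= Suc K"
proof (cases "cnt m0 up out u n L = 0")
 case False
 then have LL: "L : Lv (snd (cf m0 up out u n))" using L cf_cnt[of m0 up out u n] by (simp add: Lv_def red_pos)
 obtain tha where th: "thread m0 up out u tha n" "card {i. i < n & tic m0 up out u tha i} = cn m0 up out u n L"
  using cn_thread[OF M u LL] by blast
 have "card {i. i < n & tic m0 up out u tha i} <= K"
  by (rule B[unfolded bounded_by_def, rule_format]) (use u th(1) in blast)+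
 then have "cn m0 up out u n L <= K" unfolding th(2) .
 then show ?thesis using cnt_cn[OF LL] by simp
qed simp

lemma step_cons:
 assumes "L : set atoms" "0 < C L" "cons tab pv L L'"
 shows "step_count tab pv atoms C L' = C L + (if ful tab (C L - 1) L then 1 else 0)"
proof (cases "filter (%L. 0 < C L & cons tab pv L L') atoms")
 case Nil
 then show ?thesis using assms by (auto simp: filter_empty_conv)
next
 case (Cons M Ms)
 have "M : set (filter (%L. 0 < C L & cons tab pv L L') atoms)" unfolding Cons by simp
 then have "M : set atoms" "cons tab pv M L'" by auto
 then have "M = L" using cons_unique[OF wf] assms atoms by auto
 then show ?thesis using Cons by (simp add: step_count_def)
qed

text \<open>A play violating the formula has a fair label sequence rejecting the root, whose count is unbounded.\<close>

lemma bounded_holds: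
 assumes B: "!!n L. L : set atoms ==> cnt m0 up out u n L <= B"
 shows "holds m0 up out u"
proof (rule ccontr)
 assume n: "~ holds m0 up out u"
 define La where "La = Tr tab (pvs m0 up out u)"
 have at: "La n : set atoms" for n by (simp add: atoms La_def)
 let ?C = "cnt m0 up out u"
 have st: "?C n (La n) > 0 & ?C (Suc n) (La (Suc n)) = ?C n (La n) + (if ful tab (?C n (La n) - 1) (La n) then 1 else 0)" for n
 proof -
  have s: "?C (Suc n) (La (Suc n)) = ?C n (La n) + (if ful tab (?C n (La n) - 1) (La n) then 1 else 0)"
   if "?C n (La n) > 0" for n
   unfolding cnt.simps by (rule step_cons[where C = "?C n", OF at that]) (simp add: La_def cons_Tr[OF wf])
  have "?C n (La n) > 0"
  proof (induction n)
   case 0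
   then show ?case using n cl_pos by (simp add: init_count_def La_def look_Tr holds_def)
  next
   case (Suc n)
   then show ?case using s[of n] by simp
  qed
  then show ?thesis using s by blast
 qed
 define x where "x = (%n. ?C n (La n))"
 have xm: "x n <= x (Suc n)" for n using st[of n] by (simp add: x_def)
 have grow: "EX m. x m >= k" for k
 proof (induction k)
  case (Suc k)
  then obtain m where m: "x m >= k" by blast
  show ?case
  proof (cases "x m > k")
   case False
   then have xk: "x m = k" using m by simp
   \<comment> \<open>At count \<open>k\<close> the awaited obligation is
     \<open>(k - 1) mod cl\<close>. Fairness meets it at some later position, unless the count has
     already risen before.\<close>
   obtain i where i: "i >= m" "is_ful tab ((k - 1) mod cl) (La i)"
    unfolding La_def using fair_Tr[OF wf, of "(k - 1) mod cl" m] cl_pos by auto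
   show ?thesis
   proof (cases "x i = k")
    case True
    then have "x (Suc i) = Suc k" using st[of i] i(2) cl_pos by (simp add: x_def ful_iff)
    then show ?thesis by (intro exI[of _ "Suc i"]) simp
   next
    case False
    have "x i >= x m" using lift_Suc_mono_le[of x m i] xm i(1) by blast
    then show ?thesis using False xk by (intro exI[of _ i]) simp
   qed
  qed (auto intro: exI[of _ m])
 qed simp
 then obtain m where "x m >= Suc B" by blast
 then show False using B[OF at, of m m] by (simp add: x_def)
qed

lemma step_through:
 fixes f :: "nat => nat"
 assumes "!!n. f (Suc n) = f n \<or> f (Suc n) = Suc (f n)" "f i <= k" "f m > k" "m >= i"
 shows "EX n>=i. f n = k & f (Suc n) = Suc k"
proof -
 have "f m > k --> (EX n>=i. f n = k & f (Suc n) = Suc k)" using assms(4)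
 proof (induction m rule: dec_induct)
  case base then show ?case using assms(2) by simp
 next
  case (step m)
  then show ?case using assms(1)[of m] by (cases "f m > k") (auto intro!: exI[of _ m])
 qed
 then show ?thesis using assms(3) by blast
qed

text \<open>A thread incremented forever passes through every residue again and again, so it meets
  every obligation infinitely often and is fair. It is then the sequence of truth values and accepts
  the root, whereas every thread starts by rejecting it.\<close>

lemma holds_safe:
 assumes h: "!!u. (ALL n. u n : U) ==> holds m0 up out u"
 shows "safe m0 up out"
 unfolding safe_def
proof (intro allI impI, rule ccontr)
 fix u tha
 assume u: "ALL n. u n : U" and th: "ALL t. thread m0 up out u tha t" and inf: "~ (EX i. ALL n>=i. ~ tic m0 up out u tha n)"
 let ?c = "cf m0 up out u" and ?C = "cnt m0 up out u"
 have live: "tha n : Lv (snd (?c n))" for n using th[rule_format, of n] by (simp add: thread_def)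
 have tp: "tpar out (?c n) (u n) (tha (Suc n)) = tha n" for n using th[rule_format, of "Suc n"] by (simp add: thread_def)
 have at: "tha n : set atoms" and pos: "?C n (tha n) > 0" for n
  using live[of n] cf_cnt[of m0 up out u n] by (auto simp: Lv_def red_pos)
 have cons: "cons tab (pval tab (pvs m0 up out u n)) (tha n) (tha (Suc n))" for n
 proof -
  have "tha (Suc n) : Lv (nxp (snd (?c n)) (out (fst (?c n))) (u n))" using live[of "Suc n"] by simp
  from Lv_par[OF this] show ?thesis using tp[of n] by (simp add: tpar_def pvs_def)
 qed
 have st: "?C (Suc n) (tha (Suc n)) = ?C n (tha n) + (if ful tab (?C n (tha n) - 1) (tha n) then 1 else 0)" for n
  unfolding cnt.simps by (rule step_cons[where C = "?C n", OF at pos cons])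
 have tic: "tic m0 up out u tha n \<longleftrightarrow> ful tab (?C n (tha n) - 1) (tha n)" for n
  using tp[of n] cf_cnt[of m0 up out u n] ful_red[where C = "?C n", OF at pos] unfolding tic_def tinc_def inc_def tpar_def by simp
 define f where "f = (%n. ?C n (tha n) - 1)"
 have fS: "f (Suc n) = f n + (if ful tab (f n) (tha n) then 1 else 0)" for n
  using st[of n] pos[of n] by (simp add: f_def)
 have mono: "m <= n ==> f m <= f n" for m n using lift_Suc_mono_le[of f m n] fS by simp
 have unb: "EX m>=i. f m > k" for i k
 proof (induction k)
  case 0
  obtain n where "n >= i" "tic m0 up out u tha n" using inf by blast
  then show ?case using fS[of n] tic[of n] by (intro exI[of _ "Suc n"]) (simp add: f_def)
 next
  case (Suc k)
  then obtain m where m: "m >= i" "f m > k" by blast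
  obtain n where n: "n >= m" "tic m0 up out u tha n" using inf by blast
  then have "f (Suc n) = Suc (f n)" using fS[of n] tic[of n] by (simp add: f_def)
  then show ?case using n m mono[of m n] by (intro exI[of _ "Suc n"]) simp
 qed
 have "tha i = Tr tab (pvs m0 up out u) i" for i
 proof (rule label_unique[OF wf])
  show "length (tha i) = cl" for i using at atoms by blast
  show "cons tab (pval tab (pvs m0 up out u i)) (tha i) (tha (Suc i))" for i by (rule cons)
  fix k i assume k: "k < cl"
  \<comment> \<open>A value not below the present count with residue \<open>k\<close>. The count
    rises by single steps, so it passes through this value and leaves it only by meeting obligation
    \<open>k\<close>.\<close>
  define K where "K = f i * cl + k"
  have K: "f i <= K" "K mod cl = k" using k cl_pos by (auto simp: K_def trans_le_add1)
  obtain m where "m >= i" "f m > K" using unb by blast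
  moreover have "!!n. f (Suc n) = f n \<or> f (Suc n) = Suc (f n)" using fS by simp
  ultimately obtain n where n: "n >= i" "f n = K" "f (Suc n) = Suc K"
   using step_through[of f i K m] K(1) by blast
  then have "ful tab K (tha n)" using fS[of n] by (auto split: if_splits)
  then show "EX i'>=i. is_ful tab k (tha i')" using n K cl_pos by (auto simp: ful_iff)
 qed
 then have "look (tha 0) (cl - 1)" using h u cl_pos by (simp add: look_Tr holds_def)
 moreover have "~ look (tha 0) (cl - 1)" using pos[of 0] by (simp add: init_count_def split: if_splits)
 ultimately show False by blast
qed

text \<open>Pumping is applied twice. The first bound depends on the unknown size of the given
  machine and only serves to permit the collapse; the second concerns the collapsed memory and
  depends on the game alone.\<close>

lemma holds_bounded:
 assumes M: "machine MS m0 up out" and fin: "finite MS" and h: "!!u. (ALL n. u n : U) ==> holds m0 up out u"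
 shows "EX KS k0 up' out'. machine KS (k0 :: ('st * (bool list => nat)) * bool list set list) up' out' &
  (ALL u n L. (ALL n. u n : U) --> L : set atoms --> cnt k0 up' out' u n L <=
   Suc (card PS * card {ns. set ns <= Pow (set atoms) & length ns <= card (set atoms)} * card PS * card (set atoms)))"
proof -
 let ?N = "{ns. set ns <= Pow (set atoms) & length ns <= card (set atoms)}"
 have fN: "finite ?N" by (rule finite_lists_length_le) simp
 obtain K where "bounded_by m0 up out K" using safe_bounded[OF M fin holds_safe[OF h]] by blast
 from collapse[OF M this] obtain KS k0 up' out' where
  M': "machine KS (k0 :: ('st * (bool list => nat)) * bool list set list) up' out'" and s: "safe k0 up' out'"
  and sub: "KS <= PS \<times> ?N" by blast
 have f: "finite (PS \<times> ?N)" using finite_PS fN by simp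
 then have fK: "finite KS" using sub finite_subset by blast
 have "card KS <= card PS * card ?N" using card_mono[OF f sub] by (simp add: card_cartesian_product)
 then have le: "card KS * card PS * card (set atoms) <= card PS * card ?N * card PS * card (set atoms)"
  by (intro mult_right_mono) auto
 note B = safe_bounded[OF M' fK s]
 have "cnt k0 up' out' u n L <= Suc (card PS * card ?N * card PS * card (set atoms))"
  if "ALL n. u n : U" "L : set atoms" for u n L
 proof -
  have "cnt k0 up' out' u n L <= Suc (card KS * card PS * card (set atoms))"
   by (rule bounded_cnt[OF M' B _ that(2)]) (use that(1) in blast)
  then show ?thesis using le by linarith
 qed
 then show ?thesis using M' by blast
qed

end

subsection \<open>Solving the bounded game\<close>

definition closed_part :: "('p => 'v => 'u => 'p) => 'v list => 'u list => 'p list => 'p list" where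
 "closed_part succ Vl Ul W = filter (%p. EX v:set Vl. ALL u:set Ul. succ p v u : set W) W"

definition solve :: "('p => 'v => 'u => 'p) => 'v list => 'u list => 'p list => 'p list" where
 "solve succ Vl Ul W = (closed_part succ Vl Ul ^^ length W) W"

lemma closed_part_mem:
 "p : set (closed_part succ Vl Ul W) \<longleftrightarrow> p : set W & (EX v:set Vl. ALL u:set Ul. succ p v u : set W)"
 by (auto simp: closed_part_def)

lemma solve_greatest:
 assumes "Y <= set W" and "!!p. p : Y ==> EX v:set Vl. ALL u:set Ul. succ p v u : Y"
 shows "Y <= set (solve succ Vl Ul W)"
proof -
 have "Y <= set ((closed_part succ Vl Ul ^^ n) W)" for n
 proof (induction n)
  case (Suc n)
  show ?case
  proof
   fix p assume p: "p : Y"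
   obtain v where "v : set Vl" "ALL u:set Ul. succ p v u : Y" using assms(2)[OF p] by blast
   then show "p : set ((closed_part succ Vl Ul ^^ Suc n) W)" using Suc p by (auto simp: closed_part_mem)
  qed
 qed (use assms in simp)
 then show ?thesis by (simp add: solve_def)
qed

text \<open>Every round that changes the list removes at least one position, so as many rounds as
  there are positions reach a fixed point.\<close>

lemma solve_closed:
 shows "set (solve succ Vl Ul W) <= set W"
  and "p : set (solve succ Vl Ul W) ==> EX v:set Vl. ALL u:set Ul. succ p v u : set (solve succ Vl Ul W)"
proof -
 let ?f = "closed_part succ Vl Ul"
 have le: "length (?f l) <= length l" and sub: "set (?f l) <= set l" for l by (auto simp: closed_part_def)
 have fixp: "?f l = l" if "length (?f l) = length l" for l
 proof (rule ccontr)
  assume ne: "?f l ~= l"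
  obtain P where P: "?f l = filter P l" unfolding closed_part_def by blast
  with ne obtain x where "x : set l" "~ P x" by (auto simp: filter_id_conv)
  from length_filter_less[of _ l P, OF this] P that show False by simp
 qed
 have "?f ((?f ^^ n) W) = (?f ^^ n) W \<or> length ((?f ^^ n) W) + n <= length W" for n
 proof (induction n)
  case (Suc n)
  then show ?case
  proof
   assume "length ((?f ^^ n) W) + n <= length W"
   then show ?thesis using le[of "(?f ^^ n) W"] fixp[of "(?f ^^ n) W"] by (cases "length (?f ((?f ^^ n) W)) = length ((?f ^^ n) W)") auto
  qed auto
 qed simp
 from this[of "length W"] have fx: "?f (solve succ Vl Ul W) = solve succ Vl Ul W"
  by (auto simp: solve_def closed_part_def)
 show "EX v:set Vl. ALL u:set Ul. succ p v u : set (solve succ Vl Ul W)" if p: "p : set (solve succ Vl Ul W)"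
 proof -
  have "p : set (?f (solve succ Vl Ul W))" using p fx by simp
  then show ?thesis by (simp add: closed_part_mem)
 qed
 have "set ((?f ^^ n) W) <= set W" for n using sub by (induction n) auto
 then show "set (solve succ Vl Ul W) <= set W" by (simp add: solve_def)
qed

definition new_counts :: "'n nd list => bool list => bool list list => nat list => nat list" where
 "new_counts tab pv atoms cs = map (%L'. case filter (%p. 0 < snd p & cons tab pv (fst p) L') (zip atoms cs) of [] => 0
   | p # _ => snd p + (if ful tab (snd p - 1) (fst p) then 1 else 0)) atoms"

lemma new_counts_map: "new_counts tab pv atoms (map C atoms) = map (step_count tab pv atoms C) atoms"
proof -
 have "zip atoms (map C atoms) = map (%L. (L, C L)) atoms" by (rule nth_equalityI) auto
 then show ?thesis unfolding new_counts_def step_count_def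
  by (auto simp: filter_map comp_def split: list.splits)
qed

definition map_nd :: "('c => 'n) => 'c nd => 'n nd" where
 "map_nd f nd = (fst nd, fst (snd nd), (f (fst (snd (snd nd))), f (snd (snd (snd nd)))))"

lemma nd_at_map: "k < length tab ==> nd_at (map (map_nd f) tab) k = map_nd f (nd_at tab k)"
 by (simp add: nd_at)

lemma cons_map [simp]: "cons (map (map_nd f) tab) = cons tab"
 unfolding cons_def fun_eq_iff by (intro allI ball_cong) (auto simp: lval_def nd_at_map map_nd_def)

lemma ful_map [simp]: "tab ~= [] ==> ful (map (map_nd f) tab) c L = ful tab c L"
 by (simp add: ful_def residue_def Let_def nd_at_map map_nd_def)

lemma new_counts_map_nd [simp]:
 "tab ~= [] ==> new_counts (map (map_nd f) tab) pv atoms cs = new_counts tab pv atoms cs"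
 by (simp add: new_counts_def cong: list.case_cong)

lemma (in tgame) cf_shift:
 "cf m0 up out (u(n := x)) n = cf m0 up out u n"
 by (rule cf_cong) simp

lemma (in label_game) cnt_cong:
 "(!!i. i < n ==> u i = u' i) ==> cnt m0 up out u n = cnt m0 up out u' n"
proof (induction n)
 case (Suc n)
 have "cf m0 up out u n = cf m0 up out u' n" by (rule cf_cong) (use Suc.prems in simp)
 then show ?case using Suc by (simp add: pvs_def)
qed simp

text \<open>The solver works on codes of states and letters.\<close>

locale coded_game = label_game tab atoms s0 nx rho U V Sts
 for tab :: "'n nd list" and atoms and s0 :: 'st and nx :: "'st => 'v => 'u => 'st" and rho and U V Sts +
 fixes Ul :: "'cu list" and Vl :: "'cv list" and Sl :: "'cs set"
  and du :: "'cu => 'u" and dv :: "'cv => 'v" and ds :: "'cs => 'st"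
  and sc :: 'cs and nxc :: "'cs => 'cv => 'cu => 'cs" and pvc :: "'cs => 'cv => 'cu => bool list"
  and W :: "('cs * nat list) list" and B :: nat
 assumes U: "du ` set Ul = U" and V: "dv ` set Vl = V" and sc: "sc : Sl" "ds sc = s0"
  and nxc: "!!s v u. s : Sl ==> v : set Vl ==> u : set Ul ==> nxc s v u : Sl & ds (nxc s v u) = nx (ds s) (dv v) (du u)"
  and pvc: "!!s v u. s : Sl ==> v : set Vl ==> u : set Ul ==> pvc s v u = pval tab (rho (ds s) (dv v) (du u))"
  and W: "set W = {(s, cs). s : Sl & length cs = length atoms & set cs <= {..B}}"
begin

text \<open>A count above \<open>B\<close> leads out of \<open>W\<close>. The bound on the counts is
  thereby enforced by the deletion of positions itself.\<close>

definition gsucc :: "'cs * nat list => 'cv => 'cu => 'cs * nat list" where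
 "gsucc p v u = (nxc (fst p) v u, new_counts tab (pvc (fst p) v u) atoms (snd p))"

definition ipos :: "'cs * nat list" where "ipos = (sc, map (init_count tab) atoms)"

text \<open>The remaining positions serve as memory. Along each play they store the true counts,
  which therefore stay below the bound, and bounded counts make the formula hold.\<close>

lemma solver_sound:
 assumes w: "ipos : set (solve gsucc Vl Ul W)"
 shows "EX MS m0 up out. finite MS & machine MS (m0 :: 'cs * nat list) up out & (ALL u. (ALL n. u n : U) --> holds m0 up out u)"
proof -
 let ?Z = "set (solve gsucc Vl Ul W)"
 have "ALL p. EX v. p : ?Z --> v : set Vl & (ALL u:set Ul. gsucc p v u : ?Z)"
  using solve_closed(2)[of _ gsucc Vl Ul W] by blast
 then obtain vc where vc: "!!p. p : ?Z ==> vc p : set Vl & (ALL u:set Ul. gsucc p (vc p) u : ?Z)" by metis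
 have "ALL u. EX c. u : U --> c : set Ul & du c = u" using U by blast
 then obtain uc where uc: "!!u. u : U ==> uc u : set Ul & du (uc u) = u" by metis
 define up where "up = (%p u. gsucc p (vc p) (uc u))"
 define out where "out = (%p. dv (vc p))"
 have M: "machine ?Z ipos up out"
  unfolding machine_def up_def out_def using w vc uc V by blast
 moreover have "holds ipos up out u" if u: "ALL n. u n : U" for u
 proof (rule bounded_holds)
  let ?c = "cf ipos up out u"
  have inZ: "fst (?c n) : ?Z" for n using cf_in[OF M] u by simp
  have st: "ds (fst (fst (?c n))) = fst (snd (?c n)) & snd (fst (?c n)) = map (cnt ipos up out u n) atoms" for n
  proof (induction n)
   case 0
   then show ?case by (simp add: ipos_def sc)
  next
   case (Suc n)
   let ?p = "fst (?c n)"
   have p: "?p : ?Z" "fst ?p : Sl" using inZ[of n] solve_closed(1)[of gsucc Vl Ul W] W by auto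
   have v: "vc ?p : set Vl" "uc (u n) : set Ul" "du (uc (u n)) = u n" using vc p uc u by auto
   note 1 = nxc[OF p(2) v(1,2)] and 2 = pvc[OF p(2) v(1,2)]
   have 3: "fst (fst (?c (Suc n))) = nxc (fst ?p) (vc ?p) (uc (u n))"
    "snd (fst (?c (Suc n))) = new_counts tab (pvc (fst ?p) (vc ?p) (uc (u n))) atoms (snd ?p)"
    by (simp_all add: up_def gsucc_def)
   have 4: "fst (snd (?c (Suc n))) = nx (fst (snd (?c n))) (out ?p) (u n)" by (simp add: nxp_def)
   have 5: "snd ?p = map (cnt ipos up out u n) atoms" "ds (fst ?p) = fst (snd (?c n))" using Suc by auto
   show ?case unfolding 3 4 cnt.simps 2 5(1) new_counts_map pvs_def using 1 5(2) v(3) by (simp add: out_def)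
  qed
  fix n L assume "L : set atoms"
  moreover have "fst (?c n) : set W" using inZ[of n] solve_closed(1)[of gsucc Vl Ul W] by blast
  ultimately show "cnt ipos up out u n L <= B" using st[of n] W by (auto simp: image_subset_iff)
 qed
 ultimately show ?thesis by (intro exI[of _ ?Z]) blast
qed

text \<open>The positions visited by the collapsed machine lie in \<open>W\<close> and are closed
  under its own choices, and \<open>solve\<close> retains every closed set of this kind.\<close>

lemma solver_complete:
 assumes M: "machine MS m0 up out" and fin: "finite MS" and h: "!!u. (ALL n. u n : U) ==> holds m0 up out u"
  and B: "Suc (card PS * card {ns. set ns <= Pow (set atoms) & length ns <= card (set atoms)} * card PS * card (set atoms)) <= B"
 shows "ipos : set (solve gsucc Vl Ul W)"
proof -
 let ?K = "Suc (card PS * card {ns. set ns <= Pow (set atoms) & length ns <= card (set atoms)} * card PS * card (set atoms))"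
 obtain KS k0 up' out' where M': "machine KS (k0 :: ('st * (bool list => nat)) * bool list set list) up' out'"
  and le0: "ALL u n L. (ALL n. u n : U) --> L : set atoms --> cnt k0 up' out' u n L <= ?K"
  using holds_bounded[OF M fin h] by blast
 have le: "cnt k0 up' out' u n L <= B" if "ALL n. u n : U" "L : set atoms" for u n L
  by (rule order_trans[OF le0[rule_format, OF that(1)[rule_format] that(2)] B])
 let ?c = "cf k0 up' out'" and ?C = "cnt k0 up' out'"
 define Y where "Y = {(s, map (?C u n) atoms) | s u n. (ALL n. u n : U) & s : Sl & ds s = fst (snd (?c u n))}"
 have "Y <= set W" unfolding Y_def W using le by auto
 moreover have "EX v:set Vl. ALL u:set Ul. gsucc p v u : Y" if pY: "p : Y" for p
 proof -
  obtain s u n where u: "ALL n. u n : U" and s: "s : Sl" "ds s = fst (snd (?c u n))" and p: "p = (s, map (?C u n) atoms)"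
   using pY unfolding Y_def by blast
  have "fst (?c u n) : KS" using cf_in[OF M', of u n] u by simp
  then have "out' (fst (?c u n)) : V" using M' unfolding machine_def by blast
  then have "out' (fst (?c u n)) : dv ` set Vl" by (simp only: V)
  then obtain v where v0: "out' (fst (?c u n)) = dv v" "v : set Vl" by (rule imageE)
  then have v: "v : set Vl" "dv v = out' (fst (?c u n))" by simp_all
  have "gsucc p v x : Y" if x: "x : set Ul" for x
  proof -
   \<comment> \<open>Changing the input at \<open>n\<close> affects neither the configuration nor
     the counts at \<open>n\<close>, so each letter of the environment is realised by some play
     through this position.\<close>
   define u' where "u' = u(n := du x)"
   have u': "ALL n. u' n : U" using u x U by (auto simp: u'_def)
   have c: "?c u' n = ?c u n" unfolding u'_def by (rule cf_shift)
   have C: "?C u' n = ?C u n" by (rule cnt_cong) (simp add: u'_def)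
   have un: "u' n = du x" by (simp add: u'_def)
   note 1 = nxc[OF s(1) v(1) x] and 2 = pvc[OF s(1) v(1) x]
   have "ds (nxc s v x) = fst (snd (?c u' (Suc n)))" using 1 s v c un by (simp add: nxp_def)
   moreover have "new_counts tab (pvc s v x) atoms (map (?C u n) atoms) = map (?C u' (Suc n)) atoms"
    unfolding new_counts_map 2 cnt.simps pvs_def C c un s v ..
   ultimately have "gsucc p v x = (nxc s v x, map (?C u' (Suc n)) atoms)" "ds (nxc s v x) = fst (snd (?c u' (Suc n)))"
    by (simp_all only: gsucc_def p fst_conv snd_conv)
   then show ?thesis unfolding Y_def using u' 1 by blast
  qed
  then show ?thesis using v(1) by blast
 qed
 ultimately have "Y <= set (solve gsucc Vl Ul W)" by (rule solve_greatest)
 moreover have "ipos : Y"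
 proof -
  obtain u0 where "u0 : U" using Une by blast
  then show ?thesis unfolding Y_def ipos_def
   by (intro CollectI exI[of _ sc] exI[of _ "%_. u0"] exI[of _ 0]) (simp add: sc)
 qed
 ultimately show ?thesis by blast
qed

end

subsection \<open>Strategies of problem instances\<close>

definition inst_rho :: "problem_instance => nat list => nat set list => nat set list => nat => nat => bool" where
 "inst_rho X s v u a w \<longleftrightarrow> (EX j < length (univ_vars X @ exist_vars X). (univ_vars X @ exist_vars X) ! j = w &
   a : (u @ v) ! j \<union> label (system X) (s ! j))"

definition inst_nx :: "problem_instance => nat list => nat set list => nat set list => nat list" where
 "inst_nx X s v u = map2 (trans (system X)) s (u @ v)"

abbreviation "inst_vars X \<equiv> length (univ_vars X) + length (exist_vars X)"

lemma sat_cong: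
 "(!!i a v. v : set2_qf ph ==> a : the (A v) i \<longleftrightarrow> a : the (B v) i) ==> sat A i ph \<longleftrightarrow> sat B i ph"
proof (induction ph arbitrary: i)
 case (Until ph ps)
 have "sat A i ph \<longleftrightarrow> sat B i ph" "sat A i ps \<longleftrightarrow> sat B i ps" for i using Until by auto
 then show ?case by (simp add: sat.simps(5))
qed auto

text \<open>A finite memory of any type can be numbered, as required by the definition of
  finite-state strategies.\<close>

lemma realizableI:
 fixes up :: "'m => nat set list => 'm"
 defines "Ux \<equiv> %X. tuples (length (univ_vars X)) (Pow (in_props X))" and "Vx \<equiv> %X. tuples (length (exist_vars X)) (Pow (in_props X))"
 assumes fin: "finite MS" and m0: "m0 : MS" and up: "!!s x. s : MS ==> x : Ux X ==> up s x : MS"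
  and out: "!!s. s : MS ==> out s : Vx X"
  and h: "!!u. ALL i. u i : Ux X ==> sat (play_assignment X (%x. out (foldl up m0 x)) u) 0 (matrix X)"
 shows "strategy_realizable X"
proof -
 obtain g :: "_ => nat" where g: "inj_on g MS" using finite_imp_inj_to_nat_seg[OF fin] by blast
 define f where "f = inv_into MS g"
 have fg: "f (g s) = s" if "s : MS" for s using g that by (simp add: f_def)
 define T :: "(nat, nat set list, nat set list) tsys" where
  "T = \<lparr>states = g ` MS, init = g m0, trans = (%s x. g (up (f s) x)), label = (%s. out (f s))\<rparr>"
 have T: "transition_system (Ux X) (Vx X) T"
  using m0 up out fin fg by (auto simp: transition_system_def T_def)
 have r: "foldl up m0 x : MS & reached T x = g (foldl up m0 x)" if "x : lists (Ux X)" for x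
  using that
 proof (induction x rule: rev_induct)
  case Nil then show ?case using m0 by (simp add: reached_def T_def)
 next
  case (snoc a x)
  then show ?case using up fg by (auto simp: reached_def T_def)
 qed
 have "out (foldl up m0 x) : Vx X & out (foldl up m0 x) = label T (reached T x)" if "x : lists (Ux X)" for x
  using r[OF that] out fg by (simp add: T_def)
 then have "finite_state_strategy (Pow (in_props X)) (length (univ_vars X)) (length (exist_vars X)) (%x. out (foldl up m0 x))"
  unfolding finite_state_strategy_def using T unfolding Ux_def Vx_def by blast
 then show ?thesis unfolding strategy_realizable_def using h unfolding Ux_def by blast
qed

locale inst_game =
 fixes X :: problem_instance and tab :: "nat nd list" and atoms :: "bool list list"
 assumes valid: "valid_instance X" and wft: "wf_tab tab" and root: "forms tab ! (length tab - 1) = matrix X"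
  and atm: "set atoms = {L. length L = length tab}"
begin

abbreviation "Ux \<equiv> tuples (length (univ_vars X)) (Pow (in_props X))"
abbreviation "Vx \<equiv> tuples (length (exist_vars X)) (Pow (in_props X))"

lemma finite_tuples: "finite A ==> finite (tuples n A)"
 unfolding tuples_def using finite_lists_length_eq[of A n] by (simp add: conj_commute)

sublocale label_game tab atoms "replicate (inst_vars X) (init (system X))" "inst_nx X" "inst_rho X" Ux Vx
 "tuples (inst_vars X) (states (system X))"
proof
 have T: "transition_system (Pow (in_props X)) (Pow (out_props X)) (system X)" using valid by (simp add: valid_instance_def)
 show "finite (tuples (inst_vars X) (states (system X)))"
  by (rule finite_tuples) (use T in "simp add: transition_system_def")
 show "replicate (inst_vars X) (init (system X)) : tuples (inst_vars X) (states (system X))"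
  using T by (auto simp: tuples_def transition_system_def)
 show "Ux ~= {}"
  by (auto simp: tuples_def intro!: exI[of _ "replicate (length (univ_vars X)) {}"])
 show "inst_nx X s v u : tuples (inst_vars X) (states (system X))"
  if "s : tuples (inst_vars X) (states (system X))" "v : Vx" "u : Ux" for s v u
 proof -
  have "trans (system X) a b : states (system X)" if "(a, b) : set (zip s (u @ v))" for a b
  proof -
   have "a : set s" "b : set (u @ v)" using that by (auto dest: set_zip_leftD set_zip_rightD)
   then have "a : states (system X)" "b : Pow (in_props X)"
    using \<open>s : _\<close> \<open>v : _\<close> \<open>u : _\<close> by (auto simp: tuples_def)
   then show ?thesis using T by (simp add: transition_system_def)
  qed
  then show ?thesis using \<open>s : _\<close> \<open>v : _\<close> \<open>u : _\<close> by (auto simp: tuples_def inst_nx_def)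
 qed
qed (use wft atm in auto)

lemma holds_sat:
 assumes u: "ALL n. u n : Ux" and v: "!!n. out (fst (cf m0 up out u n)) = sg (map u [0..<n])"
  and vE: "!!n. sg (map u [0..<n]) : Vx"
 shows "holds m0 up out u \<longleftrightarrow> sat (play_assignment X sg u) 0 (matrix X)"
proof -
 let ?c = "cf m0 up out u" and ?n = "length (univ_vars X)" and ?m = "length (exist_vars X)"
 let ?w = "%i. u i @ sg (map u [0..<i])" and ?vs = "univ_vars X @ exist_vars X"
 have lu: "length (u i) = ?n" and lv: "length (sg (map u [0..<i])) = ?m" for i
  using u vE[of i] by (auto simp: tuples_def)
 have st: "fst (snd (?c i)) = map (%j. reached (system X) (map (%i. ?w i ! j) [0..<i])) [0..<inst_vars X]" for i
 proof (induction i)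
  case 0
  show ?case by (simp add: reached_def map_replicate_const[symmetric] flip: map_replicate_const) (simp add: map_replicate_const)
 next
  case (Suc i)
  have "fst (snd (?c (Suc i))) = map2 (trans (system X)) (fst (snd (?c i))) (?w i)"
   by (simp add: nxp_def inst_nx_def v)
  also have "... = map (%j. reached (system X) (map (%i. ?w i ! j) [0..<Suc i])) [0..<inst_vars X]"
   unfolding Suc by (rule nth_equalityI) (auto simp: lu lv reached_def)
  finally show ?case .
 qed
 have dist: "distinct ?vs" and vars: "set2_qf (matrix X) <= set ?vs" using valid by (simp_all add: valid_instance_def)
 have "map (%j. trace_of (system X) (%i. u i ! j)) [0..<?n] @
      map (%k. trace_of (system X) (%i. sg (map u [0..<i]) ! k)) [0..<?m]
   = map (%j. trace_of (system X) (%i. ?w i ! j)) [0..<length ?vs]"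
  by (rule nth_equalityI) (auto simp: nth_append lu lv)
 then have pa: "play_assignment X sg u = map_of (zip ?vs (map (%j. trace_of (system X) (%i. ?w i ! j)) [0..<length ?vs]))"
  unfolding play_assignment_def Let_def by (simp only:)
 have "holds m0 up out u \<longleftrightarrow> sat (TrA (pvs m0 up out u)) 0 (matrix X)" unfolding holds_def root ..
 also have "... \<longleftrightarrow> sat (play_assignment X sg u) 0 (matrix X)"
 proof (rule sat_cong)
  fix i a x assume "x : set2_qf (matrix X)"
  then obtain j where j: "j < length ?vs" "?vs ! j = x" using vars by (metis in_set_conv_nth subsetD)
  have 1: "play_assignment X sg u x = Some (trace_of (system X) (%i. ?w i ! j))"
   unfolding pa using map_of_zip_nth[of ?vs "map (%j. trace_of (system X) (%i. ?w i ! j)) [0..<length ?vs]" j] dist j by simp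
  have un: "j' = j" if "j' < length ?vs" "?vs ! j' = x" for j' using dist j that by (metis nth_eq_iff_index_eq)
  have "pvs m0 up out u i a x \<longleftrightarrow> a : ?w i ! j \<union> label (system X) (fst (snd (?c i)) ! j)"
  proof -
   have ex: "(EX j'<length ?vs. ?vs ! j' = x & P j') \<longleftrightarrow> P j" for P
   proof
    assume "EX j'<length ?vs. ?vs ! j' = x & P j'"
    then obtain j' where "j' < length ?vs" "?vs ! j' = x" "P j'" by blast
    then show "P j" using un[of j'] by simp
   qed (use j in blast)
   show ?thesis unfolding pvs_def inst_rho_def v ex ..
  qed
  then show "a : the (TrA (pvs m0 up out u) x) i \<longleftrightarrow> a : the (play_assignment X sg u x) i"
   using j(1) unfolding 1 st by (simp add: TrA_def trace_of_def)
 qed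
 finally show ?thesis .
qed

lemma realizable_machine:
 assumes "strategy_realizable X"
 shows "EX MS m0 up out. finite MS & machine MS (m0 :: nat) up out & (ALL u. (ALL n. u n : Ux) --> holds m0 up out u)"
proof -
 obtain sg where f: "finite_state_strategy (Pow (in_props X)) (length (univ_vars X)) (length (exist_vars X)) sg"
  and s0: "ALL u. (ALL i. u i : Ux) --> sat (play_assignment X sg u) 0 (matrix X)"
  using assms unfolding strategy_realizable_def by blast
 obtain T :: "(nat, nat set list, nat set list) tsys" where sg: "sg : lists Ux \<rightarrow> Vx" and T: "transition_system Ux Vx T"
  and gen: "ALL x:lists Ux. sg x = label T (reached T x)"
  using f unfolding finite_state_strategy_def by blast
 have s: "sat (play_assignment X sg u) 0 (matrix X)" if "ALL i. u i : Ux" for u using s0 that by blast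
 have M: "machine (states T) (init T) (trans T) (label T)"
  using T by (simp add: machine_def transition_system_def)
 moreover have "holds (init T) (trans T) (label T) u" if u: "ALL n. u n : Ux" for u
 proof -
  have l: "map u [0..<n] : lists Ux" for n using u by auto
  have "fst (cf (init T) (trans T) (label T) u n) = reached T (map u [0..<n])" for n
   by (induction n) (simp_all add: reached_def)
  then have "label T (fst (cf (init T) (trans T) (label T) u n)) = sg (map u [0..<n])" for n
   using gen l by simp
  from holds_sat[where sg = sg and u = u, OF u this] show ?thesis using sg l s[OF u] by blast
 qed
 ultimately show ?thesis using T unfolding transition_system_def by blast
qed

lemma machine_realizable:
 assumes fin: "finite MS" and M: "machine MS m0 up out" and h: "!!u. (ALL n. u n : Ux) ==> holds m0 up out u"
 shows "strategy_realizable X"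
proof (rule realizableI[of MS m0 X up out])
 fix u :: "nat => nat set list" assume u: "ALL i. u i : Ux"
 have e: "fst (cf m0 up out u n) = foldl up m0 (map u [0..<n])" for n by (induction n) simp_all
 have i: "fst (cf m0 up out u n) : MS" for n using cf_in[OF M] u by simp
 have "out (foldl up m0 (map u [0..<n])) : Vx" for n using i[of n] M unfolding e machine_def by blast
 then show "sat (play_assignment X (%x. out (foldl up m0 x)) u) 0 (matrix X)"
  using holds_sat[where sg = "%x. out (foldl up m0 x)" and u = u and out = out and up = up and ?m0.0 = m0, OF u] h[OF u] e by simp
qed (use fin M in "auto simp: machine_def")

end

section \<open>The decision procedure\<close>

subsection \<open>Binary names and decoding\<close>

lemma PT_cast: "PT f ==> (!!x. enc (g x) = enc (f x)) ==> PT g"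
 unfolding PT_def comp_in_def sz_def by simp

text \<open>A name can be exponential in the length of its written form, so the unary code of
  \<open>nat\<close> is too large. This wrapper is coded by the list of binary digits.\<close>

datatype nm = Nm (the_nm: nat)

instantiation nm :: data
begin
definition enc_nm :: "nm => dt" where "enc_nm a = enc (digits (the_nm a))"
instance by standard (auto simp: enc_nm_def enc_eq intro: digits_inj nm.expand)
end

lemma PT_digits [pt]: assumes "PT f" shows "PT (%x. digits (the_nm (f x)))"
 by (rule PT_cast[OF assms]) (simp add: enc_nm_def)

text \<open>Removal of leading zeros, which stand at the end because the least significant digit
  comes first. It makes the code of a computed name canonical.\<close>

definition strip :: "bool list => bool list" where
 "strip ws = fold (%b acc. if acc = [] & ~ b then [] else b # acc) (rev ws) []"

lemma strip_simps [simp]: "strip [] = []" "strip (b # ws) = (if strip ws = [] & ~ b then [] else b # strip ws)"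
 by (simp_all add: strip_def)

lemma strip_undig: "(strip ws = [] \<longleftrightarrow> undig ws = 0) & digits (undig ws) = (if strip ws = [] then [False] else strip ws)"
proof (induction ws)
 case Nil show ?case by (simp add: digits_cases)
next
 case (Cons b ws)
 show ?case
 proof (cases "undig ws = 0")
  case True
  then show ?thesis using Cons by (cases b) (auto simp: digits_cases)
 next
  case False
  have "digits (undig (b # ws)) = odd (of_bool b + 2 * undig ws) # digits ((of_bool b + 2 * undig ws) div 2)"
   using False by (subst digits_cases) auto
  moreover have "(of_bool b + 2 * undig ws) div 2 = undig ws" "odd (of_bool b + 2 * undig ws) = b"
   by (cases b; simp)+
  ultimately show ?thesis using False Cons by auto
 qed
qed

lemma PT_Nm [pt]: assumes "PT f" shows "PT (%x. Nm (undig (f x)))"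
proof -
 have "PT (%ws. strip ws)"
  unfolding strip_def
 proof (rule PT_fold[where s = "%ws b acc. if acc = [] & ~ b then [] else b # acc" and B = "%n. n"])
  fix ws ys zs assume "rev ws = ys @ (zs :: bool list)"
  then have "sz ys <= sz ws" using sz_prefix[of ys zs] by (metis sz_rev)
  moreover have "sz (fold (%b acc. if acc = [] & ~ b then [] else b # acc) ys acc) + 1 <= sz ys + sz acc" for acc :: "bool list"
  proof (induction ys arbitrary: acc)
   case (Cons y ys)
   show ?case using Cons[of "if acc = [] & ~ y then [] else y # acc"] by (auto split: if_splits)
  qed simp
  from this[of "[]"] have "sz (fold (%b acc. if acc = [] & ~ b then [] else b # acc) ys []) <= sz ys" by simp
  ultimately show "sz (fold (%b acc. if acc = [] & ~ b then [] else b # acc) ys []) <= sz ws" by simp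
 qed (intro pt pb_intros)+
 then have "PT (%x. strip (f x))" by (rule PT_comp) (rule assms)
 then have "PT (%x. if strip (f x) = [] then [False] else strip (f x))" by (intro pt)
 then show ?thesis by (rule PT_cast) (simp add: enc_nm_def strip_undig)
qed

primrec dl :: "dt => dt list" where "dl Nl = []" | "dl (Cn a b) = a # dl b"

lemma enc_dl: "enc (dl d) = enc d" by (induction d) (auto simp: enc_dt_def)

lemma PT_dl [pt]: assumes "PT f" shows "PT (%x. dl (f x))"
 by (rule PT_cast[OF assms]) (simp add: enc_dl)

lemma dl_enc [simp]: "dl (enc xs) = map enc (xs :: 'a::data list)" by (induction xs) auto

definition db :: "dt => bool" where "db d \<longleftrightarrow> ~ d = Nl"
definition dn :: "dt => nat" where "dn d = length (dl d)"
definition dnm :: "dt => nm" where "dnm d = Nm (undig (map db (dl d)))"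
definition dnms :: "dt => nm list" where "dnms d = map dnm (dl d)"

lemma PT_db [pt]: "PT f ==> PT (%x. db (f x))" unfolding db_def by (intro pt)
lemma PT_dn [pt]: "PT f ==> PT (%x. dn (f x))" unfolding dn_def by (intro pt)
lemma PT_dnm [pt]: "PT f ==> PT (%x. dnm (f x))" unfolding dnm_def by (intro pt)
lemma PT_dnms [pt]: "PT f ==> PT (%x. dnms (f x))" unfolding dnms_def by (intro pt)

lemma db_enc [simp]: "db (enc b) = b" by (simp add: db_def)
lemma dn_enc [simp]: "dn (enc n) = n"
proof -
 have "enc n = enc (units n)" by (induction n) (auto simp: units_def enc_unit_def)
 then show ?thesis by (simp add: dn_def units_def)
qed
lemma dnm_enc [simp]: "dnm (enc a) = a"
 by (simp add: dnm_def enc_nm_def comp_def undig)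
lemma dnms_enc [simp]: "dnms (enc l) = l" by (simp add: dnms_def comp_def)

text \<open>An instance as plain tables. The rows for transitions and labels are parallel to the
  list of states, the columns of a transition row are parallel to the list of input subsets, and the
  formula is a table of subformulas.\<close>

type_synonym cand = "nm list * nm list * nm list * nm * nm list list * nm list list * nm list * nm list * nm nd list"

definition cI :: "cand => nm list" where "cI c = fst c"
definition cO :: "cand => nm list" where "cO c = fst (snd c)"
definition cS :: "cand => nm list" where "cS c = fst (snd (snd c))"
definition c0 :: "cand => nm" where "c0 c = fst (snd (snd (snd c)))"
definition ctr :: "cand => nm list list" where "ctr c = fst (snd (snd (snd (snd c))))"
definition clb :: "cand => nm list list" where "clb c = fst (snd (snd (snd (snd (snd c)))))"
definition cuv :: "cand => nm list" where "cuv c = fst (snd (snd (snd (snd (snd (snd c))))))"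
definition cev :: "cand => nm list" where "cev c = fst (snd (snd (snd (snd (snd (snd (snd c)))))))"
definition ctab :: "cand => nm nd list" where "ctab c = snd (snd (snd (snd (snd (snd (snd (snd c)))))))"

lemmas cand_defs = cI_def cO_def cS_def c0_def ctr_def clb_def cuv_def cev_def ctab_def

lemma PT_cand [pt]:
 "PT f ==> PT (%x. cI (f x))" "PT f ==> PT (%x. cO (f x))" "PT f ==> PT (%x. cS (f x))" "PT f ==> PT (%x. c0 (f x))"
 "PT f ==> PT (%x. ctr (f x))" "PT f ==> PT (%x. clb (f x))" "PT f ==> PT (%x. cuv (f x))" "PT f ==> PT (%x. cev (f x))"
 "PT f ==> PT (%x. ctab (f x))"
 unfolding cand_defs by (intro pt; assumption)+

definition dfield :: "dt => nat => dt" where "dfield d i = nthd Nl (dl d) i"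

lemma PT_dfield [pt]: "PT f ==> PT g ==> PT (%x. dfield (f x) (g x))" unfolding dfield_def by (intro pt)

definition dnd :: "dt => nm nd" where
 "dnd d = (dn (dfield d 0), (dn (dfield d 1), dn (dfield d 2)), (dnm (dfield d 3), dnm (dfield d 4)))"

lemma PT_dnd [pt]: "PT f ==> PT (%x. dnd (f x))" unfolding dnd_def by (intro pt)

definition decode :: "dt => cand" where
 "decode d = (dnms (dfield d 0), dnms (dfield d 1), dnms (dfield d 2), dnm (dfield d 3), map dnms (dl (dfield d 4)),
   map dnms (dl (dfield d 5)), dnms (dfield d 6), dnms (dfield d 7), map dnd (dl (dfield d 8)))"

lemma PT_decode [pt]: "PT f ==> PT (%x. decode (f x))" unfolding decode_def by (intro pt)

definition cd_nd :: "nm nd => dt" where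
 "cd_nd nd = enc [enc (fst nd), enc (fst (fst (snd nd))), enc (snd (fst (snd nd))), enc (fst (snd (snd nd))), enc (snd (snd (snd nd)))]"

definition code :: "cand => dt" where
 "code c = enc [enc (cI c), enc (cO c), enc (cS c), enc (c0 c), enc (ctr c), enc (clb c), enc (cuv c), enc (cev c),
   enc (map cd_nd (ctab c))]"

lemma enc_dt_id [simp]: "enc (d :: dt) = d" by (simp add: enc_dt_def)

lemma dfield_enc [simp]: "i < length ds ==> dfield (enc (ds :: dt list)) i = ds ! i"
 by (simp add: dfield_def nthd_def)

lemma decode_code: "decode (code c) = c"
proof -
 have "dnd (cd_nd nd) = nd" for nd by (simp add: dnd_def cd_nd_def dfield_def nthd_def numeral_eq_Suc comp_def)
 then show ?thesis
  by (simp add: decode_def code_def dfield_def nthd_def numeral_eq_Suc comp_def cand_defs)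
qed

definition cmp :: "bool list => bool list => bool" where
 "cmp xs ys = fold (%p acc. if fst p = snd p then acc else snd p) (zip xs ys) False"

definition nless :: "nm => nm => bool" where
 "nless a b = cmp (digits (the_nm a) @ replicate (length (digits (the_nm b))) False)
   (digits (the_nm b) @ replicate (length (digits (the_nm a))) False)"

lemma cmp_undig: "length xs = length ys ==>
 fold (%p acc. if fst p = snd p then acc else snd p) (zip xs ys) acc \<longleftrightarrow> undig xs < undig ys \<or> (undig xs = undig ys & acc)"
proof (induction xs ys arbitrary: acc rule: list_induct2)
 case (Cons x xs y ys)
 show ?case unfolding zip_Cons_Cons fold_simps Cons.IH by (cases x; cases y) auto
qed simp

lemma undig_pad: "undig (xs @ replicate n False) = undig xs"
proof (induction xs)
 case Nil show ?case by (induction n) auto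
qed simp

lemma nless: "nless a b \<longleftrightarrow> the_nm a < the_nm b"
 unfolding nless_def cmp_def by (subst cmp_undig) (simp_all add: undig_pad undig)

lemma PT_bool_fold:
 assumes "PT l" "PT (%z. s (fst z) (fst (snd z)) (snd (snd z)))" "PT i"
 shows "PT (%x. fold (s x) (l x) (i x :: bool))"
 by (rule PT_fold[where B = "%_. 3"]) (use assms sz_bool in "auto intro: pb_const")

lemma PT_nless [pt]: assumes "PT f" "PT g" shows "PT (%x. nless (f x) (g x))"
 unfolding nless_def cmp_def
 by (rule PT_bool_fold[where s = "%x p acc. if fst p = snd p then acc else snd p"]) (intro pt assms)+

subsection \<open>Enumerations\<close>

definition all_dt :: "unit list => nat => dt list" where
 "all_dt pad n = ((%l. if length l * length l <= length pad then Nl # concat (map (%a. map (%b. Cn a b) l) l) else l) ^^ n) [Nl]"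

lemma PT_Cn [pt]: assumes "PT f" "PT g" shows "PT (%x. Cn (f x) (g x))"
 by (rule PT_cast[OF PT_Pair[OF assms]]) (simp add: enc_Pair)

lemma length_prod: "length (concat (map (%a. map (f a) l) k)) = length k * length l" by (induction k) auto

lemma sz_Cn [simp]: "sz (Cn a b) = Suc (sz a + sz b)" by (simp add: sz_def)
lemma sz_Nl [simp]: "sz Nl = 1" by (simp add: sz_def)

lemma all_dt_Suc: "all_dt pad (Suc n) = (if length (all_dt pad n) * length (all_dt pad n) <= length pad
  then Nl # concat (map (%a. map (%b. Cn a b) (all_dt pad n)) (all_dt pad n)) else all_dt pad n)"
 by (simp add: all_dt_def)

text \<open>Bounding each tree by the number of trees listed keeps the whole list polynomial in the
  padding, also when the padding is too short for the next level.\<close>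

lemma all_dt_bound:
 "1 <= length (all_dt pad n) & length (all_dt pad n) <= Suc (length pad) & (ALL d:set (all_dt pad n). sz d + 1 <= 4 * length (all_dt pad n))"
proof (induction n)
 case 0 show ?case by (simp add: all_dt_def)
next
 case (Suc n)
 let ?l = "all_dt pad n"
 show ?case
 proof (cases "length ?l * length ?l <= length pad")
  case True
  then have e: "all_dt pad (Suc n) = Nl # concat (map (%a. map (%b. Cn a b) ?l) ?l)" by (simp add: all_dt_Suc)
  have len: "length (all_dt pad (Suc n)) = Suc (length ?l * length ?l)" by (simp add: e length_prod)
  have "sz d + 1 <= 4 * Suc (length ?l * length ?l)" if d: "d : set (all_dt pad (Suc n))" for d
  proof (cases "d = Nl")
   case False
   then obtain a b where ab: "d = Cn a b" "a : set ?l" "b : set ?l" using d e by auto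
   then have "sz a + 1 <= 4 * length ?l" "sz b + 1 <= 4 * length ?l" using Suc by auto
   moreover have "2 * length ?l <= Suc (length ?l * length ?l)"
    by (cases "length ?l") auto
   ultimately show ?thesis using ab(1) by simp
  qed simp
  then show ?thesis unfolding len using True by simp
 next
  case False
  then show ?thesis using Suc by (simp add: all_dt_Suc)
 qed
qed

lemma PT_all_dt [pt]: assumes p: "PT p" and n: "PT n" shows "PT (%x. all_dt (p x) (n x))"
proof -
 obtain L where L: "pb L" "!!x. sz (p x) <= L (sz x)" using PT_size[OF p] by metis
 show ?thesis unfolding all_dt_def
 proof (rule PT_funpow[where B = "%m. Suc (Suc (L m) * Suc (4 * Suc (L m)))"])
  show "PT (%z. if length (snd z) * length (snd z) <= length (p (fst z))
   then Nl # concat (map (%a. map (%b. Cn a b) (snd z)) (snd z)) else snd z)"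
   by (intro pt PT_comp[OF p])
  show "pb (%m. Suc (Suc (L m) * Suc (4 * Suc (L m))))" by (intro pb_intros L)
  fix x j
  note b = all_dt_bound[of "p x" j]
  have le: "length (all_dt (p x) j) <= Suc (L (sz x))" using b L(2)[of x] length_le_sz[of "p x"] by linarith
  have "sz (all_dt (p x) j) <= Suc (length (all_dt (p x) j) * Suc (4 * Suc (L (sz x))))"
  proof (rule sz_le_bound)
   fix d assume "d : set (all_dt (p x) j)"
   then have "sz d + 1 <= 4 * length (all_dt (p x) j)" using b by blast
   moreover have "4 * length (all_dt (p x) j) <= 4 * Suc (L (sz x))" using le by (rule mult_le_mono2)
   ultimately show "sz d <= 4 * Suc (L (sz x))" by simp
  qed
  also have "... <= Suc (Suc (L (sz x)) * Suc (4 * Suc (L (sz x))))"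
   unfolding Suc_le_mono by (rule mult_right_mono[OF le]) simp
  finally show "sz (((%l. if length l * length l <= length (p x)
   then Nl # concat (map (%a. map (%b. Cn a b) l) l) else l) ^^ j) [Nl]) <= Suc (Suc (L (sz x)) * Suc (4 * Suc (L (sz x))))"
   unfolding all_dt_def .
 qed (intro pt n)+
qed

primrec ht :: "dt => nat" where "ht Nl = 0" | "ht (Cn a b) = Suc (max (ht a) (ht b))"

lemma length_dl: "length (dl d) <= ht d" by (induction d) auto

lemma ht_dl: "a : set (dl d) ==> ht a <= ht d" by (induction d) auto

text \<open>From \<open>N\<close> trees of height at most \<open>n\<close> arise
  \<open>N * N + 1\<close> of height at most \<open>n + 1\<close>, fewer than the square of
  \<open>N + 1\<close>. So \<open>N < 2 ^ (2 ^ n)\<close> is preserved, the bound being squared at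
  each level.\<close>

lemma all_dt_all:
 assumes "2 ^ (2 ^ Suc n) <= length pad"
 shows "length (all_dt pad n) < 2 ^ (2 ^ n) & set (all_dt pad n) = {d. ht d <= n}"
 using assms
proof (induction n)
 case 0
 have "d = Nl" if "ht d = 0" for d using that by (cases d) auto
 then show ?case by (auto simp: all_dt_def)
next
 case (Suc n)
 have "(2::nat) ^ (2 ^ Suc n) <= 2 ^ (2 ^ Suc (Suc n))" by (intro power_increasing) auto
 then have pre: "2 ^ (2 ^ Suc n) <= length pad" using Suc.prems by linarith
 note IH = Suc.IH[OF pre]
 let ?l = "all_dt pad n"
 have sq: "(2::nat) ^ (2 ^ Suc n) = 2 ^ (2 ^ n) * 2 ^ (2 ^ n)" by (simp add: power_add[symmetric] mult_2)
 have lt: "Suc (length ?l) * Suc (length ?l) <= 2 ^ (2 ^ n) * 2 ^ (2 ^ n)" using IH by (intro mult_mono) auto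
 then have "length ?l * length ?l <= length pad" using pre sq by simp
 then have e: "all_dt pad (Suc n) = Nl # concat (map (%a. map (%b. Cn a b) ?l) ?l)" by (simp add: all_dt_Suc)
 have "length (all_dt pad (Suc n)) < 2 ^ (2 ^ Suc n)"
 proof -
  have "1 <= length ?l" using all_dt_bound[of pad n] by blast
  then show ?thesis using lt unfolding sq by (simp add: e length_prod)
 qed
 moreover have "set (all_dt pad (Suc n)) = {d. ht d <= Suc n}"
 proof (rule set_eqI)
  fix d show "d : set (all_dt pad (Suc n)) \<longleftrightarrow> d : {d. ht d <= Suc n}"
   unfolding e using IH by (cases d) auto
 qed
 ultimately show ?case by blast
qed

definition csubs :: "unit list => 'a list => 'a list list" where
 "csubs pad xs = fold (%x acc. if 2 * length acc <= length pad then map (%l. x # l) acc @ acc else []) (rev xs) [[]]"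

lemma csubs_subseqs:
 assumes "2 ^ length xs <= length pad" shows "csubs pad xs = subseqs xs"
 using assms
proof (induction xs)
 case (Cons x xs)
 then have "2 ^ length xs <= length pad" by simp
 from Cons.IH[OF this] have "csubs pad xs = subseqs xs" .
 then show ?case using Cons.prems by (simp add: csubs_def Let_def length_subseqs)
qed (simp add: csubs_def)

lemma PT_csubs [pt]: assumes p: "PT p" and l: "PT l" shows "PT (%x. csubs (p x) (l x))"
proof -
 obtain P where P: "pb P" "!!x. sz (p x) <= P (sz x)" using PT_size[OF p] by metis
 obtain L where L: "pb L" "!!x. sz (l x) <= L (sz x)" using PT_size[OF l] by metis
 show ?thesis unfolding csubs_def
 proof (rule PT_fold[where B = "%m. Suc (Suc (P m) * Suc (L m))"])
  show "PT (%z. if 2 * length (snd (snd z)) <= length (p (fst z)) then map (%l. fst (snd z) # l) (snd (snd z)) @ snd (snd z) else [])"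
   by (intro pt PT_comp[OF p])
  show "pb (%m. Suc (Suc (P m) * Suc (L m)))" by (intro pb_intros P L)
  fix x ys zs assume ys: "rev (l x) = ys @ zs"
  let ?f = "%y acc. if 2 * length acc <= length (p x) then map (%l. y # l) acc @ acc else []"
  have g: "length (fold ?f ys [[]]) <= Suc (length (p x)) & (ALL w : set (fold ?f ys [[]]). sz w <= sz ys)"
  proof (induction ys rule: rev_induct)
   case (snoc y ys)
   have "Suc (sz (ys @ [y])) = sz ys + sz [y]" by (rule sz_append)
   then have e: "sz (ys @ [y]) = sz ys + sz y + 1" by simp
   show ?case using snoc unfolding e by auto
  qed simp
  have "sz ys <= L (sz x)" using ys sz_prefix[of ys zs] L(2)[of x] by (metis order_trans sz_rev)
  with g have "sz (fold ?f ys [[]]) <= Suc (length (fold ?f ys [[]]) * Suc (L (sz x)))"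
   by (intro sz_le_bound) fastforce
  also have "... <= Suc (Suc (P (sz x)) * Suc (L (sz x)))"
   unfolding Suc_le_mono using g P(2)[of x] length_le_sz[of "p x"] by (intro mult_le_mono) auto
  finally show "sz (fold ?f ys [[]]) <= Suc (Suc (P (sz x)) * Suc (L (sz x)))" .
 qed (intro pt l)+
qed

definition assoc :: "'v => 'k => 'k list => 'v list => 'v" where
 "assoc d k ks vs = (case filter (%p. fst p = k) (zip ks vs) of [] => d | p # _ => snd p)"

lemma PT_assoc [pt]: assumes "PT d" "PT k" "PT ks" "PT vs" shows "PT (%x. assoc (d x) (k x) (ks x) (vs x))"
 unfolding assoc_def by (intro pt assms PT_comp[OF assms(2)])

lemma assoc_nth: "distinct ks ==> length vs = length ks ==> i < length ks ==> assoc d (ks ! i) ks vs = vs ! i"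
proof (induction ks arbitrary: vs i)
 case (Cons k ks)
 then obtain v vs' where vs: "vs = v # vs'" by (cases vs) auto
 show ?case
 proof (cases i)
  case (Suc j)
  then have "ks ! j ~= k" using Cons.prems by (metis distinct.simps(2) length_Cons Suc_less_eq nth_mem)
  then show ?thesis using Cons vs Suc by (simp add: assoc_def)
 qed (simp add: vs assoc_def)
qed simp

lemma PT_look [pt]: "PT L ==> PT k ==> PT (%x. look (L x) (k x))" unfolding look_def by (intro pt)

lemma PT_nd_at [pt]: "PT T ==> PT k ==> PT (%x. nd_at (T x) (k x))" unfolding nd_at_def by (intro pt)

lemma PT_lval [pt]:
 assumes "PT T" "PT p" "PT L" "PT M" "PT k" shows "PT (%x. lval (T x) (p x) (L x) (M x) (k x))"
 unfolding lval_def Let_def by (intro pt assms)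

lemma PT_cons [pt]:
 assumes "PT T" "PT p" "PT L" "PT M" shows "PT (%x. cons (T x) (p x) (L x) (M x))"
 unfolding cons_def by (intro pt assms assms[THEN PT_comp])

text \<open>Repeated subtraction: every round that still changes the value lowers it by at least
  one, so as many rounds as the dividend are enough. The guard for divisor 0 agrees with
  \<open>mod\<close>.\<close>

lemma PT_residue [pt]: assumes "PT f" "PT g" shows "PT (%x. residue (f x) (g x))"
proof -
 obtain F where F: "pb F" "!!x. sz (f x) <= F (sz x)" using PT_size[OF assms(1)] by metis
 have it: "((%m. if m < n \<or> n = 0 then m else m - n) ^^ j) m mod n = m mod n" for m n j :: nat
  by (induction j) (auto simp: le_mod_geq)
 have le: "((%m. if m < n \<or> n = 0 then m else m - n) ^^ j) m <= m" for m n j :: nat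
  by (induction j) auto
 have sm: "((%m. if m < n \<or> n = 0 then m else m - n) ^^ j) m < n \<or> ((%m. if m < n \<or> n = 0 then m else m - n) ^^ j) m + j <= m"
  if "n > 0" for m n j :: nat
  using that by (induction j) auto
 have "PT (%x. ((%m. if m < g x \<or> g x = 0 then m else m - g x) ^^ f x) (f x))"
 proof (rule PT_funpow[where B = F])
  show "PT (%z. if snd z < g (fst z) \<or> g (fst z) = 0 then snd z else snd z - g (fst z))"
   by (intro pt PT_comp[OF assms(2)])
  fix x j show "sz (((%m. if m < g x \<or> g x = 0 then m else m - g x) ^^ j) (f x)) <= F (sz x)"
   using le[where m = "f x" and n = "g x" and j = j] F(2)[of x] by simp
 qed (intro assms F)+
 moreover have "((%m. if m < n \<or> n = 0 then m else m - n) ^^ k) k = residue k n" for k n :: nat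
 proof (cases "n = 0")
  case True
  have "((%m. if m < n \<or> n = 0 then m else m - n) ^^ j) k = k" for j using True by (induction j) auto
  then show ?thesis using True by (simp add: residue_def)
 next
  case False
  then have lt: "((%m. if m < n \<or> n = 0 then m else m - n) ^^ k) k < n" using sm[of n k k] by fastforce
  show ?thesis unfolding residue_def using it[where m = k and n = n and j = k] unfolding mod_less[OF lt] .
 qed
 ultimately show ?thesis by simp
qed

lemma PT_ful [pt]: assumes "PT T" "PT c" "PT L" shows "PT (%x. ful (T x) (c x) (L x))"
 unfolding ful_def Let_def by (intro pt assms)

lemma PT_init_count [pt]: "PT T ==> PT L ==> PT (%x. init_count (T x) (L x))"
 unfolding init_count_def by (intro pt)

lemma PT_new_counts [pt]: assumes "PT T" "PT p" "PT A" "PT cs" shows "PT (%x. new_counts (T x) (p x) (A x) (cs x))"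
 unfolding new_counts_def
 by (intro pt assms assms[THEN PT_comp])

subsection \<open>Printing candidates\<close>

definition tw_nm :: "nm => bool list" where
 "tw_nm a = concat (map (%b. [b, b]) (digits (the_nm a))) @ [False, True]"
definition tw_node :: "bool list => bool list" where "tw_node s = [True, False] @ s @ [False, True]"
definition tw_nms :: "nm list => bool list" where "tw_nms l = tw_node (concat (map tw_nm l))"

lemma PT_tw [pt]: "PT f ==> PT (%x. tw_nm (f x))" "PT g ==> PT (%x. tw_node (g x))"
 unfolding tw_nm_def tw_node_def by (intro pt; assumption)+

lemma PT_tw_nms [pt]: "PT f ==> PT (%x. tw_nms (f x))"
 unfolding tw_nms_def by (intro pt)

definition nd_str :: "bool list list => nm nd => bool list" where
 "nd_str ss nd = tw_node (
   if fst nd = 0 then tw_nm (Nm 0) @ tw_nm (fst (snd (snd nd))) @ tw_nm (snd (snd (snd nd)))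
   else if fst nd = 1 then tw_nm (Nm 1) @ nthd [] ss (fst (fst (snd nd)))
   else if fst nd = 2 then tw_nm (Nm 2) @ nthd [] ss (fst (fst (snd nd))) @ nthd [] ss (snd (fst (snd nd)))
   else if fst nd = 3 then tw_nm (Nm 3) @ nthd [] ss (fst (fst (snd nd)))
   else tw_nm (Nm 4) @ nthd [] ss (fst (fst (snd nd))) @ nthd [] ss (snd (fst (snd nd))))"

lemma PT_nd_str [pt]: "PT f ==> PT g ==> PT (%x. nd_str (f x) (g x))"
 unfolding nd_str_def by (intro pt)

text \<open>Strings longer than the whole input are replaced by the empty string, which no formula has.\<close>

definition strs :: "unit list => nm nd list => bool list list" where
 "strs n tab = fold (%nd acc. acc @ [if length (nd_str acc nd) <= length n then nd_str acc nd else []]) tab []"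

lemma strs_snoc: "strs n (tab @ [nd]) = strs n tab @ [if length (nd_str (strs n tab) nd) <= length n then nd_str (strs n tab) nd else []]"
 by (simp add: strs_def)

lemma length_strs [simp]: "length (strs n tab) = length tab"
 by (induction tab rule: rev_induct) (simp_all add: strs_snoc, simp add: strs_def)

lemma PT_strs [pt]: assumes n: "PT n" and t: "PT t" shows "PT (%x. strs (n x) (t x))"
proof -
 obtain N where N: "pb N" "!!x. sz (n x) <= N (sz x)" using PT_size[OF n] by metis
 obtain T where T: "pb T" "!!x. sz (t x) <= T (sz x)" using PT_size[OF t] by metis
 show ?thesis unfolding strs_def
 proof (rule PT_fold[where B = "%m. Suc (T m * Suc (Suc (N m * 4)))"])
  show "PT (%z. snd (snd z) @ [if length (nd_str (snd (snd z)) (fst (snd z))) <= length (n (fst z))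
    then nd_str (snd (snd z)) (fst (snd z)) else []])"
   by (intro pt PT_comp[OF n])
  show "pb (%m. Suc (T m * Suc (Suc (N m * 4))))" by (intro pb_intros N T)
  fix x ys zs assume ys: "t x = ys @ zs"
  have "sz (strs (n x) ys) <= Suc (length (strs (n x) ys) * Suc (Suc (N (sz x) * 4)))"
  proof (rule sz_le_bound)
   fix s assume "s : set (strs (n x) ys)"
   then have l: "length s <= length (n x)"
    by (induction ys rule: rev_induct) (auto simp: strs_snoc simp del: length_strs, simp add: strs_def)
   have "sz s <= Suc (length s * Suc 3)" by (rule sz_le_bound) (rule sz_bool)
   also have "... <= Suc (N (sz x) * 4)" using l N(2)[of x] length_le_sz[of "n x"] by simp
   finally show "sz s <= Suc (N (sz x) * 4)" .
  qed
  also have "... <= Suc (T (sz x) * Suc (Suc (N (sz x) * 4)))"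
   using ys T(2)[of x] length_le_sz[of "t x"] unfolding Suc_le_mono by (intro mult_le_mono) auto
  finally show "sz (fold (%nd acc. acc @ [if length (nd_str acc nd) <= length (n x) then nd_str acc nd else []]) ys [])
    <= Suc (T (sz x) * Suc (Suc (N (sz x) * 4)))" unfolding strs_def .
 qed (intro pt t)+
qed

definition SI :: "unit list => cand => nm list list" where "SI pad c = csubs pad (cI c)"

definition prt :: "unit list => unit list => cand => bool list" where
 "prt n pad c = tw_node (tw_nms (cI c) @ tw_nms (cO c) @
   tw_node (tw_nms (cS c) @ tw_nm (c0 c) @
    tw_node (concat (map (%p. concat (map (%q. tw_node (tw_nm (fst p) @ tw_nms (fst q) @ tw_nm (snd q)))
     (zip (SI pad c) (snd p)))) (zip (cS c) (ctr c)))) @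
    tw_node (concat (map (%p. tw_node (tw_nm (fst p) @ tw_nms (snd p))) (zip (cS c) (clb c))))) @
   tw_nms (cuv c) @ tw_nms (cev c) @ nthd [] (strs n (ctab c)) (length (ctab c) - 1))"

lemma PT_SI [pt]: "PT p ==> PT c ==> PT (%x. SI (p x) (c x))" unfolding SI_def by (intro pt)

lemma PT_prt [pt]: assumes "PT n" "PT p" "PT c" shows "PT (%x. prt (n x) (p x) (c x))"
 unfolding prt_def by (intro pt assms PT_comp[OF assms(2)] PT_comp[OF assms(3)])

definition vsort :: "nm list => bool" where
 "vsort l \<longleftrightarrow> (ALL i:set [0..<length l - 1]. nless (nthd undefined l i) (nthd undefined l (Suc i)))"

lemma PT_vsort [pt]: assumes "PT l" shows "PT (%x. vsort (l x))"
 unfolding vsort_def by (intro pt assms PT_comp[OF assms])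

definition vdist :: "nm list => bool" where
 "vdist l \<longleftrightarrow> (ALL i:set [0..<length l]. nthd undefined l i ~: set (drop (Suc i) l))"

lemma PT_vdist [pt]: assumes "PT l" shows "PT (%x. vdist (l x))"
 unfolding vdist_def by (intro pt assms PT_comp[OF assms])

lemma PT_wf_nd [pt]: "PT k ==> PT n ==> PT (%x. wf_nd (k x) (n x))" unfolding wf_nd_def by (intro pt)

text \<open>Sorted lists and rows of the right length make the printed word the encoding of the
  instance. Nonempty strings certify that no formula was cut off.\<close>

definition vcand :: "unit list => unit list => cand => bool" where
 "vcand n pad c \<longleftrightarrow> vsort (cI c) & vsort (cO c) & vsort (cS c) & (ALL a:set (cI c). a ~: set (cO c)) &
   c0 c : set (cS c) & length (ctr c) = length (cS c) &
   (ALL r:set (ctr c). length r = length (SI pad c) & (ALL s:set r. s : set (cS c))) &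
   length (clb c) = length (cS c) & (ALL l:set (clb c). vsort l & (ALL a:set l. a : set (cO c))) &
   vdist (cuv c @ cev c) & ctab c ~= [] & (ALL k:set [0..<length (ctab c)]. wf_nd k (nd_at (ctab c) k)) &
   (ALL nd:set (ctab c). fst nd = 0 --> fst (snd (snd nd)) : set (cI c @ cO c) & snd (snd (snd nd)) : set (cuv c @ cev c)) &
   (ALL s:set (strs n (ctab c)). s ~= [])"

lemma PT_vcand [pt]: assumes "PT n" "PT p" "PT c" shows "PT (%x. vcand (n x) (p x) (c x))"
 unfolding vcand_def by (intro pt assms PT_comp[OF assms(2)] PT_comp[OF assms(3)])

subsection \<open>The instance of a candidate\<close>

text \<open>The filter recovers from a set of inputs the one sublist of \<open>cI c\<close> that
  represents it among the columns.\<close>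

definition inst :: "unit list => cand => problem_instance" where
 "inst pad c = \<lparr>in_props = the_nm ` set (cI c), out_props = the_nm ` set (cO c),
   system = \<lparr>states = the_nm ` set (cS c), init = the_nm (c0 c),
    trans = (%s x. the_nm (assoc (c0 c) (filter (%a. the_nm a : x) (cI c)) (SI pad c) (assoc [] (Nm s) (cS c) (ctr c)))),
    label = (%s. the_nm ` set (assoc [] (Nm s) (cS c) (clb c)))\<rparr>,
   univ_vars = map the_nm (cuv c), exist_vars = map the_nm (cev c),
   matrix = map_qf the_nm the_nm (forms (ctab c) ! (length (ctab c) - 1))\<rparr>"

lemma the_nm_inj: "inj the_nm" by (auto intro: injI nm.expand)

lemma Nm_the [simp]: "Nm (the_nm a) = a" by simp

lemma tw_nm: "tw_nm a = tree_word (Leaf (the_nm a))" by (simp add: tw_nm_def)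
lemma tw_node: "tw_node (concat (map tree_word ts)) = tree_word (Node ts)" by (simp add: tw_node_def)
lemma tw_nms: "tw_nms l = tree_word (Node (map Leaf (map the_nm l)))"
 by (simp add: tw_nms_def tw_node_def tw_nm_def[abs_def] comp_def)

lemma vsort: "vsort l \<longleftrightarrow> sorted_wrt (<) (map the_nm l)"
proof -
 have "sorted_wrt (<) (map the_nm l) \<longleftrightarrow> (ALL i. Suc i < length l --> the_nm (l ! i) < the_nm (l ! Suc i))"
  by (subst sorted_wrt_iff_nth_Suc_transp) auto
 then show ?thesis unfolding vsort_def nless by (auto simp: nthd_def less_diff_conv)
qed

lemma vdist: "vdist l \<longleftrightarrow> distinct l"
proof -
 have "(ALL i<length l. l ! i ~: set (drop (Suc i) l)) \<longleftrightarrow> distinct l"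
 proof (induction l)
  case (Cons a l)
  have "(ALL i<length (a # l). (a # l) ! i ~: set (drop (Suc i) (a # l))) \<longleftrightarrow> a ~: set l & (ALL i<length l. l ! i ~: set (drop (Suc i) l))"
   by (auto simp: less_Suc_eq_0_disj)
  then show ?case using Cons by simp
 qed simp
 then show ?thesis by (auto simp: vdist_def nthd_def)
qed

lemma sorted_set_tree: "vsort l ==> set_tree (the_nm ` set l) = Node (map Leaf (map the_nm l))"
 unfolding set_tree_def vsort strict_sorted_iff
 using sorted_list_of_set.idem_if_sorted_distinct[of "map the_nm l"] by simp

lemma vsort_distinct: "vsort l ==> distinct l" unfolding vsort strict_sorted_iff by (simp add: distinct_map)

lemma subseqs_map: "subseqs (map f xs) = map (map f) (subseqs xs)"
 by (induction xs) (auto simp: Let_def comp_def)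

lemma subseqs_sorted: "l : set (subseqs xs) ==> sorted_wrt P xs ==> sorted_wrt P l & set l <= set xs"
proof (induction xs arbitrary: l)
 case (Cons x xs)
 consider k where "l = x # k" "k : set (subseqs xs)" | "l : set (subseqs xs)"
  using Cons.prems(1) by (auto simp: Let_def)
 then show ?case
 proof cases
  case 1
  then have "sorted_wrt P k & set k <= set xs" using Cons.IH Cons.prems(2) by simp
  then show ?thesis using 1 Cons.prems(2) by auto
 next
  case 2
  then show ?thesis using Cons.IH[OF 2] Cons.prems(2) by auto
 qed
qed simp

lemma concat_concat_map: "concat (concat (map f xs)) = concat (map (%x. concat (f x)) xs)"
 by (induction xs) auto

lemma assoc_in:
 assumes "distinct ks" "length vs = length ks" "k : set ks" shows "assoc d k ks vs : set vs"
proof -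
 obtain i where i: "i < length ks" "k = ks ! i" using assms(3) by (metis in_set_conv_nth)
 show ?thesis unfolding i(2) assoc_nth[OF assms(1,2) i(1)] using i assms(2) by simp
qed

lemma subseqs_filter:
 "l : set (subseqs xs) ==> distinct xs ==> filter (%a. a : set l) xs = l"
proof (induction xs arbitrary: l)
 case (Cons x xs)
 have sub: "!!k. k : set (subseqs xs) ==> set k <= set xs"
  using subseqs_sorted[where P = "%_ _. True"] by (simp add: sorted_wrt_iff_nth_less)
 consider k where "l = x # k" "k : set (subseqs xs)" | "l : set (subseqs xs)"
  using Cons.prems(1) by (auto simp: Let_def)
 then show ?case
 proof cases
  case 1
  have "filter (%a. a : set l) xs = filter (%a. a : set k) xs"
   by (rule filter_cong) (use 1 Cons.prems(2) in auto)
  then show ?thesis using 1 Cons by simp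
 next
  case 2
  then have "x ~: set l" using sub Cons.prems(2) by auto
  then show ?thesis using 2 Cons by simp
 qed
qed simp

lemma distinct_subseqs: "distinct xs ==> distinct (subseqs xs)"
 using distinct_set_subseqs[of xs] by (simp add: distinct_map)

lemma map_zip_assoc:
 assumes "distinct ks" "length vs = length ks"
 shows "map f (zip ks vs) = map (%k. f (k, assoc d k ks vs)) ks"
 by (rule nth_equalityI) (use assms in "auto simp: assoc_nth")

text \<open>A string that is too long is replaced by the empty one. Without empty entries every
  string was built from the complete strings of its children.\<close>

lemma strs_forms:
 assumes wf: "ALL k<length tab. wf_nd k (tab ! k)" and ne: "ALL s:set (strs n tab). s ~= []" and k: "k < length tab"
 shows "strs n tab ! k = tree_word (qf_tree (map_qf the_nm the_nm (forms tab ! k)))"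
 using assms
proof (induction tab arbitrary: k rule: rev_induct)
 case (snoc nd tab)
 have IH: "strs n tab ! k = tree_word (qf_tree (map_qf the_nm the_nm (forms tab ! k)))" if "k < length tab" for k
 proof (rule snoc.IH[OF _ _ that])
  show "ALL k<length tab. wf_nd k (tab ! k)"
   using snoc.prems(1) by (metis length_append_singleton less_SucI nth_append)
  show "ALL s:set (strs n tab). s ~= []" using snoc.prems(2) by (simp add: strs_snoc)
 qed
 show ?case
 proof (cases "k < length tab")
  case True
  then show ?thesis using IH by (simp add: strs_snoc forms_snoc nth_append)
 next
  case False
  then have k: "k = length tab" using snoc.prems(3) by simp
  obtain t i j a v where nd: "nd = (t, (i, j), (a, v))" by (metis prod.exhaust)
  have "wf_nd (length tab) nd" using snoc.prems(1) by (metis length_append_singleton lessI nth_append_length)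
  then have w: "t ~= 0 ==> i < length tab & j < length tab" by (simp add: wf_nd_def nd)
  have e: "strs n (tab @ [nd]) ! k = nd_str (strs n tab) nd"
   using snoc.prems(2) k by (auto simp: strs_snoc nth_append split: if_splits)
  have "nd_str (strs n tab) nd = tree_word (qf_tree (map_qf the_nm the_nm (mk (forms tab) nd)))"
   using w by (auto simp: nd_str_def nd mk_def nthd_def IH tw_node_def tw_nm)
  then show ?thesis using e k by (simp add: forms_snoc nth_append)
 qed
qed simp

lemma vcand_tab: "vcand n pad c ==> wf_tab (ctab c)"
 by (auto simp: vcand_def wf_tab_def nd_at)

lemma inst_trans:
 assumes v: "vcand n pad c" and p: "2 ^ length (cI c) <= length pad" and x: "x : set (SI pad c)"
 shows "trans (system (inst pad c)) (the_nm s) (the_nm ` set x) = the_nm (assoc (c0 c) x (SI pad c) (assoc [] s (cS c) (ctr c)))"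
proof -
 have "distinct (cI c)" using v vsort_distinct by (auto simp: vcand_def)
 moreover have "x : set (subseqs (cI c))" using x csubs_subseqs[OF p] by (simp add: SI_def)
 ultimately have "filter (%a. a : set x) (cI c) = x" by (rule subseqs_filter[rotated])
 moreover have "the_nm a : the_nm ` set x \<longleftrightarrow> a : set x" for a by (simp add: inj_image_mem_iff the_nm_inj)
 ultimately show ?thesis by (simp add: inst_def)
qed

lemma encode_inst:
 assumes v: "vcand n pad c" and p: "2 ^ length (cI c) <= length pad"
 shows "encode (inst pad c) = prt n pad c"
proof -
 have so: "vsort (cI c)" "vsort (cO c)" "vsort (cS c)" using v by (auto simp: vcand_def)
 have S: "SI pad c = subseqs (cI c)" using csubs_subseqs[OF p] by (simp add: SI_def)
 let ?T = "system (inst pad c)" and ?ss = "map the_nm (cS c)"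
 have ss: "sorted_list_of_set (states ?T) = ?ss"
  using so(3) sorted_list_of_set.idem_if_sorted_distinct[of ?ss] by (simp add: inst_def vsort strict_sorted_iff)
 have si: "sorted_list_of_set (in_props (inst pad c)) = map the_nm (cI c)"
  using so(1) sorted_list_of_set.idem_if_sorted_distinct[of "map the_nm (cI c)"] by (simp add: inst_def vsort strict_sorted_iff)
 have xs: "vsort x" if "x : set (SI pad c)" for x
 proof -
  have "map the_nm x : set (subseqs (map the_nm (cI c)))" using that S by (simp add: subseqs_map)
  then show ?thesis using so(1) subseqs_sorted unfolding vsort by blast
 qed
 have ds: "distinct (cS c)" using so vsort_distinct by blast
 have dI: "distinct (SI pad c)" unfolding S by (rule distinct_subseqs) (use so vsort_distinct in blast)
 have lr: "length (ctr c) = length (cS c)" "length (clb c) = length (cS c)" using v by (auto simp: vcand_def)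
 have row: "assoc [] s (cS c) (ctr c) : set (ctr c)" "assoc [] s (cS c) (clb c) : set (clb c)" if "s : set (cS c)" for s
  by (rule assoc_in[OF ds lr(1) that], rule assoc_in[OF ds lr(2) that])
 have tr: "concat (map tree_word [Node [Leaf s, set_tree x, Leaf (trans ?T s x)]. s \<leftarrow> ?ss, x \<leftarrow> map set (subseqs (map the_nm (cI c)))])
  = concat (map (%p. concat (map (%q. tw_node (tw_nm (fst p) @ tw_nms (fst q) @ tw_nm (snd q))) (zip (SI pad c) (snd p)))) (zip (cS c) (ctr c)))"
 proof -
  have "concat (map tree_word [Node [Leaf s, set_tree x, Leaf (trans ?T s x)]. s \<leftarrow> ?ss, x \<leftarrow> map set (subseqs (map the_nm (cI c)))])
   = concat (map (%s. concat (map (%x. tree_word (Node [Leaf (the_nm s), set_tree (the_nm ` set x), Leaf (trans ?T (the_nm s) (the_nm ` set x))])) (SI pad c))) (cS c))"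
   by (simp add: map_concat comp_def subseqs_map S concat_concat_map del: tree_word.simps)
  also have "... = concat (map (%s. concat (map (%x. tw_node (tw_nm s @ tw_nms x @ tw_nm (assoc (c0 c) x (SI pad c) (assoc [] s (cS c) (ctr c))))) (SI pad c))) (cS c))"
   by (intro arg_cong[where f = concat] map_cong refl)
    (simp add: inst_trans[OF v p] sorted_set_tree xs tw_node_def tw_nm tw_nms)
  also have "... = concat (map (%s. concat (map (%q. tw_node (tw_nm s @ tw_nms (fst q) @ tw_nm (snd q))) (zip (SI pad c) (assoc [] s (cS c) (ctr c))))) (cS c))"
  proof (intro arg_cong[where f = concat] map_cong refl)
   fix s assume "s : set (cS c)"
   then have "length (assoc [] s (cS c) (ctr c)) = length (SI pad c)" using row v by (auto simp: vcand_def)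
   from map_zip_assoc[OF dI this, of "%q. tw_node (tw_nm s @ tw_nms (fst q) @ tw_nm (snd q))" "c0 c"]
   show "map (%x. tw_node (tw_nm s @ tw_nms x @ tw_nm (assoc (c0 c) x (SI pad c) (assoc [] s (cS c) (ctr c))))) (SI pad c)
    = map (%q. tw_node (tw_nm s @ tw_nms (fst q) @ tw_nm (snd q))) (zip (SI pad c) (assoc [] s (cS c) (ctr c)))" by simp
  qed
  also have "... = concat (map (%p. concat (map (%q. tw_node (tw_nm (fst p) @ tw_nms (fst q) @ tw_nm (snd q))) (zip (SI pad c) (snd p)))) (zip (cS c) (ctr c)))"
   unfolding map_zip_assoc[OF ds lr(1), where d = "[]"] by simp
  finally show ?thesis .
 qed
 have lb: "concat (map tree_word [Node [Leaf s, set_tree (label ?T s)]. s \<leftarrow> ?ss])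
  = concat (map (%p. tw_node (tw_nm (fst p) @ tw_nms (snd p))) (zip (cS c) (clb c)))"
 proof -
  have "tree_word (Node [Leaf (the_nm s), set_tree (label ?T (the_nm s))]) = tw_node (tw_nm s @ tw_nms (assoc [] s (cS c) (clb c)))"
   if "s : set (cS c)" for s
  proof -
   have "vsort (assoc [] s (cS c) (clb c))" using row[OF that] v by (auto simp: vcand_def)
   then show ?thesis by (simp add: inst_def sorted_set_tree tw_node_def tw_nm tw_nms)
  qed
  then show ?thesis unfolding map_zip_assoc[OF ds lr(2), where d = "[]"]
   by (simp add: comp_def cong: map_cong)
 qed
 have mx: "tree_word (qf_tree (matrix (inst pad c))) = nthd [] (strs n (ctab c)) (length (ctab c) - 1)"
 proof -
  have "ctab c ~= []" using v by (simp add: vcand_def)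
  then show ?thesis using strs_forms[of "ctab c" n "length (ctab c) - 1"] v vcand_tab[OF v]
   by (simp add: nthd_def inst_def vcand_def wf_tab_def)
 qed
 have sys: "tree_word (system_tree (in_props (inst pad c)) ?T) =
   tw_node (tw_nms (cS c) @ tw_nm (c0 c) @
    tw_node (concat (map (%p. concat (map (%q. tw_node (tw_nm (fst p) @ tw_nms (fst q) @ tw_nm (snd q)))
     (zip (SI pad c) (snd p)))) (zip (cS c) (ctr c)))) @
    tw_node (concat (map (%p. tw_node (tw_nm (fst p) @ tw_nms (snd p))) (zip (cS c) (clb c)))))"
 proof -
  have st: "set_tree (states ?T) = Node (map Leaf (map the_nm (cS c)))" using sorted_set_tree[OF so(3)] by (simp add: inst_def)
  have i: "init ?T = the_nm (c0 c)" by (simp add: inst_def)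
  have tw4: "tree_word (Node [a, b, c, d]) = tw_node (tree_word a @ tree_word b @ tree_word c @ tree_word d)" for a b c d
   by (simp add: tw_node_def)
  show ?thesis
   unfolding system_tree_def Let_def ss si st i tw4 tw_nms[symmetric] tw_nm[symmetric]
   unfolding tw_node[symmetric] tr lb ..
 qed
 have "encode (inst pad c) = tw_node (tree_word (set_tree (in_props (inst pad c))) @ tree_word (set_tree (out_props (inst pad c))) @
   tree_word (system_tree (in_props (inst pad c)) ?T) @ tree_word (Node (map Leaf (univ_vars (inst pad c)))) @
   tree_word (Node (map Leaf (exist_vars (inst pad c)))) @ tree_word (qf_tree (matrix (inst pad c))))"
  by (simp add: encode_def tw_node_def)
 moreover have "set_tree (in_props (inst pad c)) = Node (map Leaf (map the_nm (cI c)))"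
  "set_tree (out_props (inst pad c)) = Node (map Leaf (map the_nm (cO c)))"
  using sorted_set_tree so by (simp_all add: inst_def)
 moreover have "univ_vars (inst pad c) = map the_nm (cuv c)" "exist_vars (inst pad c) = map the_nm (cev c)"
  by (simp_all add: inst_def)
 ultimately show ?thesis unfolding prt_def sys mx by (simp only: tw_nms)
qed

lemma set_forms:
 assumes "!!nd. nd : set tab ==> fst nd = 0 ==> fst (snd (snd nd)) : A & snd (snd (snd nd)) : B"
  and wf: "ALL k<length tab. wf_nd k (tab ! k)" and "ph : set (forms tab)"
 shows "set1_qf ph <= A & set2_qf ph <= B"
 using assms
proof (induction tab arbitrary: ph rule: rev_induct)
 case Nil then show ?case by (simp add: forms_def)
next
 case (snoc nd tab)
 have wf': "ALL k<length tab. wf_nd k (tab ! k)"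
  using snoc.prems(2) by (metis length_append_singleton less_SucI nth_append)
 have IH: "ps : set (forms tab) ==> set1_qf ps <= A & set2_qf ps <= B" for ps
  using snoc.IH[OF _ wf'] snoc.prems(1) by auto
 show ?case
 proof (cases "ph : set (forms tab)")
  case False
  then have ph: "ph = mk (forms tab) nd" using snoc.prems(3) by (simp add: forms_snoc)
  obtain t i j a v where nd: "nd = (t, (i, j), (a, v))" by (metis prod.exhaust)
  have "wf_nd (length tab) nd" using snoc.prems(2) by (metis length_append_singleton lessI nth_append_length)
  then have w: "t ~= 0 ==> forms tab ! i : set (forms tab) & forms tab ! j : set (forms tab)" by (simp add: wf_nd_def nd)
  show ?thesis using w IH snoc.prems(1)[of nd] by (auto simp: ph mk_def nd)
 qed (rule IH)
qed

lemma valid_inst: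
 assumes v: "vcand n pad c" and p: "2 ^ length (cI c) <= length pad"
 shows "valid_instance (inst pad c)"
proof -
 have ds: "distinct (cS c)" using v vsort_distinct by (auto simp: vcand_def)
 have S: "SI pad c = subseqs (cI c)" using csubs_subseqs[OF p] by (simp add: SI_def)
 have dI: "distinct (SI pad c)" unfolding S by (rule distinct_subseqs) (use v vsort_distinct in "auto simp: vcand_def")
 have lr: "length (ctr c) = length (cS c)" "length (clb c) = length (cS c)" using v by (auto simp: vcand_def)
 have row: "assoc [] s (cS c) (ctr c) : set (ctr c)" "assoc [] s (cS c) (clb c) : set (clb c)" if "s : set (cS c)" for s
  by (rule assoc_in[OF ds lr(1) that], rule assoc_in[OF ds lr(2) that])
 have T: "transition_system (Pow (in_props (inst pad c))) (Pow (out_props (inst pad c))) (system (inst pad c))"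
  unfolding transition_system_def
 proof (intro conjI ballI)
  show "finite (states (system (inst pad c)))" by (simp add: inst_def)
  show "init (system (inst pad c)) : states (system (inst pad c))" using v by (simp add: inst_def vcand_def)
 next
  fix s x assume "s : states (system (inst pad c))" and x: "x : Pow (in_props (inst pad c))"
  then obtain s' where s': "s = the_nm s'" "s' : set (cS c)" by (auto simp: inst_def)
  define l where "l = filter (%a. the_nm a : x) (cI c)"
  have "set l : set ` set (subseqs (cI c))" unfolding subseqs_powset l_def by auto
  then obtain l' where l': "l' : set (subseqs (cI c))" "set l' = set l" by auto
  have "filter (%a. a : set l') (cI c) = l'" by (rule subseqs_filter[OF l'(1)]) (use v vsort_distinct in "auto simp: vcand_def")
  moreover have "filter (%a. a : set l') (cI c) = l" unfolding l'(2) by (auto simp: l_def intro: filter_cong)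
  ultimately have ls: "l : set (SI pad c)" using l'(1) S by simp
  have xl: "x = the_nm ` set l" using x by (auto simp: l_def inst_def)
  have r: "length (assoc [] s' (cS c) (ctr c)) = length (SI pad c)" "ALL q:set (assoc [] s' (cS c) (ctr c)). q : set (cS c)"
   using row[OF s'(2)] v by (auto simp: vcand_def)
  have "assoc (c0 c) l (SI pad c) (assoc [] s' (cS c) (ctr c)) : set (cS c)"
   using assoc_in[OF dI r(1) ls] r(2) by blast
  then show "trans (system (inst pad c)) s x : states (system (inst pad c))"
   unfolding s'(1) xl inst_trans[OF v p ls] by (simp add: inst_def)
 next
  fix s assume "s : states (system (inst pad c))"
  then obtain s' where s': "s = the_nm s'" "s' : set (cS c)" by (auto simp: inst_def)
  then show "label (system (inst pad c)) s : Pow (out_props (inst pad c))"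
   using row[OF s'(2)] v by (auto simp: inst_def vcand_def)
 qed
 have t: "ctab c ~= []" "ALL k<length (ctab c). wf_nd k (ctab c ! k)" using vcand_tab[OF v] by (auto simp: wf_tab_def)
 have "forms (ctab c) ! (length (ctab c) - 1) : set (forms (ctab c))" using t by (intro nth_mem) simp
 then have st: "set1_qf (forms (ctab c) ! (length (ctab c) - 1)) <= set (cI c @ cO c)"
  "set2_qf (forms (ctab c) ! (length (ctab c) - 1)) <= set (cuv c @ cev c)"
  using set_forms[OF _ t(2), of "set (cI c @ cO c)" "set (cuv c @ cev c)"] v by (auto simp: vcand_def)
 have mx: "set1_qf (matrix (inst pad c)) <= the_nm ` set (cI c @ cO c)" "set2_qf (matrix (inst pad c)) <= the_nm ` set (cuv c @ cev c)"
  using st by (auto simp: inst_def qf.set_map)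
 have disj: "the_nm ` set (cI c) \<inter> the_nm ` set (cO c) = {}"
  using v the_nm_inj by (auto simp: vcand_def inj_eq)
 have dist: "distinct (map the_nm (cuv c @ cev c))"
  using v the_nm_inj by (simp only: distinct_map vdist[symmetric]) (auto simp: vcand_def inj_def inj_on_def)
 show ?thesis unfolding valid_instance_def
  using T mx disj dist by (auto simp: inst_def image_Un)
qed

subsection \<open>Every instance comes from a small candidate\<close>

lemma forms_append: "EX gs. forms (tab @ e) = forms tab @ gs & length gs = length e"
proof (induction e rule: rev_induct)
 case (snoc x e)
 then show ?case unfolding append_assoc[symmetric] forms_snoc by auto
qed simp

abbreviation (input) qf_len :: "(nm, nm) qf => nat" where
 "qf_len ph \<equiv> length (tree_word (qf_tree (map_qf the_nm the_nm ph)))"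

text \<open>Postorder, so the root of a subformula is the last entry of the list built for it, and
  its index is one less than the length reached.\<close>

primrec flat :: "(nm, nm) qf => nm nd list => nm nd list" where
 "flat (Prop a v) acc = acc @ [(0, (0, 0), (a, v))]"
| "flat (Neg ph) acc = (let r = flat ph acc in r @ [(1, (length r - 1, length r - 1), (Nm 0, Nm 0))])"
| "flat (Or ph ps) acc = (let r = flat ph acc; q = flat ps r in q @ [(2, (length r - 1, length q - 1), (Nm 0, Nm 0))])"
| "flat (Next ph) acc = (let r = flat ph acc in r @ [(3, (length r - 1, length r - 1), (Nm 0, Nm 0))])"
| "flat (Until ph ps) acc = (let r = flat ph acc; q = flat ps r in q @ [(4, (length r - 1, length q - 1), (Nm 0, Nm 0))])"

definition wfs :: "nm nd list => bool" where "wfs tab \<longleftrightarrow> (ALL k<length tab. wf_nd k (tab ! k))"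

definition nd_ok :: "nat => nm set => nm set => nm nd => bool" where
 "nd_ok n A B nd \<longleftrightarrow> fst nd <= 4 & fst (fst (snd nd)) < n & snd (fst (snd nd)) < n &
   (if fst nd = 0 then fst (snd (snd nd)) : A & snd (snd (snd nd)) : B else snd (snd nd) = (Nm 0, Nm 0))"

lemma nd_ok_mono: "nd_ok n A B nd ==> n <= n' ==> A <= A' ==> B <= B' ==> nd_ok n' A' B' nd"
 unfolding nd_ok_def by (cases "fst nd = 0") auto

text \<open>The number \<open>l\<close> stands for a printed length. It bounds both the number of
  new entries, which keeps the unary indices low, and the printed length of every new formula, so
  that \<open>strs\<close> cuts nothing off.\<close>

definition flat_pre :: "nm nd list => nm nd list => nat => nm set => nm set => bool" where
 "flat_pre acc e l A B \<longleftrightarrow> e ~= [] & length e <= l & (wfs acc --> wfs (acc @ e)) &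
   (ALL tha:set (forms (acc @ e)). tha : set (forms acc) \<or> qf_len tha <= l) & (ALL nd:set e. nd_ok (length (acc @ e)) A B nd)"

definition flat_ok :: "(nm, nm) qf => nm nd list => nm nd list => bool" where
 "flat_ok ph acc e \<longleftrightarrow> flat_pre acc e (qf_len ph) (set1_qf ph) (set2_qf ph) & forms (acc @ e) ! (length (acc @ e) - 1) = ph"

lemma flat_pre_append:
 assumes e: "flat_pre acc e l A B" and g: "flat_pre (acc @ e) g l' A' B'"
 shows "flat_pre acc (e @ g) (l + l') (A \<union> A') (B \<union> B')"
 unfolding flat_pre_def
proof (intro conjI ballI)
 fix nd assume "nd : set (e @ g)"
 then consider "nd_ok (length (acc @ e)) A B nd" | "nd_ok (length ((acc @ e) @ g)) A' B' nd"
  using e g unfolding flat_pre_def by auto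
 then show "nd_ok (length (acc @ e @ g)) (A \<union> A') (B \<union> B') nd" by cases (auto elim: nd_ok_mono)
next
 fix tha assume "tha : set (forms (acc @ e @ g))"
 then have "tha : set (forms (acc @ e)) \<or> qf_len tha <= l'" using g unfolding flat_pre_def by simp
 moreover have "tha : set (forms (acc @ e)) ==> tha : set (forms acc) \<or> qf_len tha <= l" using e unfolding flat_pre_def by blast
 ultimately show "tha : set (forms acc) \<or> qf_len tha <= l + l'" by linarith
qed (use e g in "simp_all add: flat_pre_def")

lemma flat_okI:
 assumes e: "flat_pre acc e l A B" and nd: "nd = (t, (i, j), (Nm 0, Nm 0))" "0 < t" "t <= 4"
  and ij: "i < length (acc @ e)" "j < length (acc @ e)" and m: "mk (forms (acc @ e)) nd = \<chi>"
  and l: "l < qf_len \<chi>" and st: "A <= set1_qf \<chi>" "B <= set2_qf \<chi>"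
 shows "flat_ok \<chi> acc (e @ [nd])"
proof -
 have f: "forms (acc @ e @ [nd]) = forms (acc @ e) @ [\<chi>]"
  using m by (simp add: forms_snoc[of "acc @ e", simplified])
 have w: "wf_nd (length (acc @ e)) nd" using ij nd by (simp add: wf_nd_def)
 have "wfs (acc @ e @ [nd])" if "wfs (acc @ e)"
  unfolding wfs_def
 proof (intro allI impI)
  fix k assume "k < length (acc @ e @ [nd])"
  then consider "k < length (acc @ e)" | "k = length (acc @ e)" by fastforce
  then show "wf_nd k ((acc @ e @ [nd]) ! k)"
  proof cases
   case 1
   then have "(acc @ e @ [nd]) ! k = (acc @ e) ! k" using nth_append[of "acc @ e" "[nd]" k] by simp
   then show ?thesis using that[unfolded wfs_def, rule_format, OF 1] by (simp only:)
  qed (use w in "simp add: nth_append")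
 qed
 moreover have "nd_ok (length (acc @ e @ [nd])) (set1_qf \<chi>) (set2_qf \<chi>) x" if "x : set (e @ [nd])" for x
 proof (cases "x = nd")
  case True
  then show ?thesis using nd ij by (auto simp: nd_ok_def)
 next
  case False
  then have "nd_ok (length (acc @ e)) A B x" using that e unfolding flat_pre_def by simp
  then show ?thesis by (rule nd_ok_mono) (use st in simp_all)
 qed
 moreover have "tha : set (forms acc) \<or> qf_len tha <= qf_len \<chi>" if "tha : set (forms (acc @ e @ [nd]))" for tha
 proof (cases "tha = \<chi>")
  case False
  then have "tha : set (forms acc) \<or> qf_len tha <= l" using that e unfolding f flat_pre_def by simp
  then show ?thesis using l by linarith
 qed simp
 moreover have "length (e @ [nd]) <= qf_len \<chi>" using e l by (simp add: flat_pre_def)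
 moreover have "wfs acc --> wfs (acc @ e)" using e unfolding flat_pre_def by blast
 moreover have "forms (acc @ e @ [nd]) ! (length (acc @ e @ [nd]) - 1) = \<chi>" unfolding f by (simp add: nth_append)
 ultimately show ?thesis unfolding flat_ok_def flat_pre_def by blast
qed

lemma flat_ok_two:
 assumes e: "flat_ok ph acc e" and g: "flat_ok ps (acc @ e) g"
  and nd: "nd = (t, (length (acc @ e) - 1, length (acc @ e @ g) - 1), (Nm 0, Nm 0))" "0 < t" "t <= 4"
  and m: "!!fs. fs ! (length (acc @ e) - 1) = ph ==> fs ! (length (acc @ e @ g) - 1) = ps ==> mk fs nd = \<chi>"
  and l: "qf_len ph + qf_len ps < qf_len \<chi>" and st: "set1_qf ph \<union> set1_qf ps <= set1_qf \<chi>" "set2_qf ph \<union> set2_qf ps <= set2_qf \<chi>"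
 shows "flat_ok \<chi> acc ((e @ g) @ [nd])"
proof -
 obtain gs where gs: "forms (acc @ e @ g) = forms (acc @ e) @ gs" using forms_append[of "acc @ e" g] by auto
 have ne: "e ~= []" "g ~= []" using e g by (auto simp: flat_ok_def flat_pre_def)
 have "forms (acc @ e @ g) ! (length (acc @ e) - 1) = ph"
  unfolding gs using e ne by (simp add: flat_ok_def nth_append)
 moreover have "forms (acc @ e @ g) ! (length (acc @ e @ g) - 1) = ps" using g by (simp add: flat_ok_def)
 ultimately have mk: "mk (forms (acc @ e @ g)) nd = \<chi>" by (rule m)
 have "flat_pre acc (e @ g) (qf_len ph + qf_len ps) (set1_qf ph \<union> set1_qf ps) (set2_qf ph \<union> set2_qf ps)"
  using flat_pre_append e g unfolding flat_ok_def by blast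
 moreover have "length (acc @ e) - 1 < length (acc @ e @ g)" "length (acc @ e @ g) - 1 < length (acc @ e @ g)"
  using ne by (cases e; simp)+
 ultimately show ?thesis by (intro flat_okI[OF _ nd]) (use mk l st in "simp_all only: Un_least length_append")
qed

lemma flat_ok: "EX e. flat ph acc = acc @ e & flat_ok ph acc e"
proof (induction ph arbitrary: acc)
 case (Prop a v)
 have "flat_ok (Prop a v) acc [(0, (0, 0), (a, v))]"
  by (auto simp: flat_ok_def flat_pre_def nd_ok_def wfs_def forms_snoc nth_append mk_def wf_nd_def less_Suc_eq)
 then show ?case by auto
next
 case (Neg ph)
 obtain e where e: "flat ph acc = acc @ e" "flat_ok ph acc e" using Neg by blast
 have f: "forms (acc @ e) ! (length (acc @ e) - 1) = ph" "e ~= []" using e(2) by (auto simp: flat_ok_def flat_pre_def nd_ok_def wfs_def)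
 note e3 = conjunct1[OF e(2)[unfolded flat_ok_def]]
 have "flat_ok (Neg ph) acc (e @ [(1, (length (acc @ e) - 1, length (acc @ e) - 1), (Nm 0, Nm 0))])"
  by (rule flat_okI[OF e3 refl]) (use f in "auto simp: mk_def")
 then show ?case using e(1) by (intro exI conjI) (auto simp: Let_def)
next
 case (Next ph)
 obtain e where e: "flat ph acc = acc @ e" "flat_ok ph acc e" using Next by blast
 have f: "forms (acc @ e) ! (length (acc @ e) - 1) = ph" "e ~= []" using e(2) by (auto simp: flat_ok_def flat_pre_def nd_ok_def wfs_def)
 note e3 = conjunct1[OF e(2)[unfolded flat_ok_def]]
 have "flat_ok (Next ph) acc (e @ [(3, (length (acc @ e) - 1, length (acc @ e) - 1), (Nm 0, Nm 0))])"
  by (rule flat_okI[OF e3 refl]) (use f in "auto simp: mk_def")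
 then show ?case using e(1) by (intro exI conjI) (auto simp: Let_def)
next
 case (Or ph ps)
 obtain e where e: "flat ph acc = acc @ e" "flat_ok ph acc e" using Or by blast
 obtain g where g: "flat ps (acc @ e) = (acc @ e) @ g" "flat_ok ps (acc @ e) g" using Or by blast
 have "flat_ok (Or ph ps) acc ((e @ g) @ [(2, (length (acc @ e) - 1, length (acc @ e @ g) - 1), (Nm 0, Nm 0))])"
  by (rule flat_ok_two[OF e(2) g(2) refl]) (auto simp: mk_def)
 then show ?case using e(1) g(1) by (intro exI conjI) (auto simp: Let_def)
next
 case (Until ph ps)
 obtain e where e: "flat ph acc = acc @ e" "flat_ok ph acc e" using Until by blast
 obtain g where g: "flat ps (acc @ e) = (acc @ e) @ g" "flat_ok ps (acc @ e) g" using Until by blast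
 have "flat_ok (Until ph ps) acc ((e @ g) @ [(4, (length (acc @ e) - 1, length (acc @ e @ g) - 1), (Nm 0, Nm 0))])"
  by (rule flat_ok_two[OF e(2) g(2) refl]) (auto simp: mk_def)
 then show ?case using e(1) g(1) by (intro exI conjI) (auto simp: Let_def)
qed

lemma strs_ne:
 assumes wf: "ALL k<length tab. wf_nd k (tab ! k)" and f: "!!ph. ph : set (forms tab) ==> qf_len ph <= length n"
 shows "ALL s:set (strs n tab). s ~= []"
 using assms
proof (induction tab rule: rev_induct)
 case Nil then show ?case by (simp add: strs_def)
next
 case (snoc nd tab)
 have wf: "ALL k<length tab. wf_nd k (tab ! k)"
  using snoc.prems(1) by (metis length_append_singleton less_SucI nth_append)
 have IH: "ALL s:set (strs n tab). s ~= []" by (rule snoc.IH[OF wf]) (use snoc.prems(2) in "simp add: forms_snoc")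
 note st = strs_forms[OF wf IH]
 obtain t i j a v where nd: "nd = (t, (i, j), (a, v))" by (metis prod.exhaust)
 have "wf_nd (length tab) nd" using snoc.prems(1) by (metis length_append_singleton lessI nth_append_length)
 then have w: "t ~= 0 ==> i < length tab & j < length tab" by (simp add: wf_nd_def nd)
 have "nd_str (strs n tab) nd = tree_word (qf_tree (map_qf the_nm the_nm (mk (forms tab) nd)))"
  using w by (auto simp: nd_str_def nd mk_def nthd_def st tw_node_def tw_nm)
 then have "length (nd_str (strs n tab) nd) <= length n" using snoc.prems(2)[of "mk (forms tab) nd"] by (simp add: forms_snoc)
 moreover have "nd_str (strs n tab) nd ~= []" by (simp add: nd_str_def tw_node_def)
 ultimately show ?case using IH by (simp add: strs_snoc)
qed

lemma tree_child: "t : set ts ==> length (tree_word t) <= length (tree_word (Node ts))"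
 by (induction ts) auto

lemma tree_children: "length ts <= length (tree_word (Node ts))"
proof (induction ts)
 case (Cons t ts)
 have "tree_word t ~= []" using tree_word_start[of t] by auto
 then show ?case using Cons by (cases "tree_word t") auto
qed simp

lemma digits_leaf: "length (digits a) <= length (tree_word (Leaf a))"
proof -
 have "length (concat (map (%b. [b, b]) ds)) = 2 * length ds" for ds :: "bool list" by (induction ds) auto
 then show ?thesis by simp
qed

lemma ht_enc_list: "(!!x. x : set xs ==> ht (enc x) <= m) ==> ht (enc (xs :: 'a::data list)) <= length xs + m"
proof (induction xs)
 case (Cons x xs)
 have "ht (enc x) <= m" "ht (enc xs) <= length xs + m" using Cons by auto
 then show ?case by auto
qed simp

lemma ht_bool: "ht (enc (b :: bool)) <= 1" by (simp add: enc_bool_def bool_dt_def)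
lemma ht_nat: "ht (enc (k :: nat)) = k" by (induction k) auto
lemma ht_nm: "length (digits (the_nm a)) <= s ==> ht (enc a) <= s + 1"
 using ht_enc_list[of "digits (the_nm a)" 1] ht_bool by (force simp: enc_nm_def)

lemma system_tree_cong:
 assumes "states T = states T'" "init T = init T'" "finite I" "finite (states T')"
  and tr: "!!s x. s : states T' ==> x <= I ==> trans T s x = trans T' s x"
  and lb: "!!s. s : states T' ==> label T s = label T' s"
 shows "system_tree I T = system_tree I T'"
proof -
 let ?ss = "sorted_list_of_set (states T')"
 have sub: "set x <= I" if "x : set (subseqs (sorted_list_of_set I))" for x
 proof -
  have "set x : set ` set (subseqs (sorted_list_of_set I))" using that by blast
  then show ?thesis unfolding subseqs_powset using assms(3) by simp
 qed
 have 1: "map (%s. map (%x. Node [Leaf s, set_tree x, Leaf (trans T s x)]) (map set (subseqs (sorted_list_of_set I)))) ?ss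
  = map (%s. map (%x. Node [Leaf s, set_tree x, Leaf (trans T' s x)]) (map set (subseqs (sorted_list_of_set I)))) ?ss"
  using tr sub assms(4) by (auto intro!: map_cong)
 have 2: "map (%s. Node [Leaf s, set_tree (label T s)]) ?ss = map (%s. Node [Leaf s, set_tree (label T' s)]) ?ss"
  using lb assms(4) by (auto intro!: map_cong)
 show ?thesis unfolding system_tree_def Let_def assms(1,2) 1 2 ..
qed

lemma map_the_Nm [simp]: "map (the_nm \<circ> Nm) l = l" "the_nm ` Nm ` A = A"
 by (auto simp: comp_def image_image)

lemma sorted_vsort: "finite A ==> vsort (map Nm (sorted_list_of_set A))"
 by (simp add: vsort)

definition cand_of :: "problem_instance => cand" where
 "cand_of X = (let I = sorted_list_of_set (in_props X); ss = sorted_list_of_set (states (system X)) in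
   (map Nm I, map Nm (sorted_list_of_set (out_props X)), map Nm ss, Nm (init (system X)),
   map (%s. map (%x. Nm (trans (system X) s (set x))) (subseqs I)) ss,
   map (%s. map Nm (sorted_list_of_set (label (system X) s))) ss,
   map Nm (univ_vars X), map Nm (exist_vars X), flat (map_qf Nm Nm (matrix X)) []))"

lemma assoc_map:
 assumes "x : set l" "distinct (map k l)" shows "assoc d (k x) (map k l) (map v l) = v x"
proof -
 obtain j where j: "j < length l" "x = l ! j" using assms(1) unfolding in_set_conv_nth by blast
 show ?thesis unfolding j(2) using assoc_nth[OF assms(2), of "map v l" j d] j(1) by simp
qed

context
 fixes X :: problem_instance and n pad :: "unit list"
 assumes valid: "valid_instance X" and n: "length (encode X) <= length n"
  and pad: "2 ^ length (encode X) <= length pad"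
begin

lemma fin_X: "finite (in_props X)" "finite (out_props X)" "finite (states (system X))"
 and T_X: "transition_system (Pow (in_props X)) (Pow (out_props X)) (system X)"
 using valid by (auto simp: valid_instance_def transition_system_def)

lemma fin_label: "s : states (system X) ==> finite (label (system X) s) & label (system X) s <= out_props X"
 using T_X fin_X(2) finite_subset unfolding transition_system_def by (metis PowD)

lemma enc_parts:
 "length (tree_word (set_tree (in_props X))) <= length (encode X)"
 "length (tree_word (set_tree (out_props X))) <= length (encode X)"
 "length (tree_word (system_tree (in_props X) (system X))) <= length (encode X)"
 "length (tree_word (Node (map Leaf (univ_vars X)))) <= length (encode X)"
 "length (tree_word (Node (map Leaf (exist_vars X)))) <= length (encode X)"
 "length (tree_word (qf_tree (matrix X))) <= length (encode X)"
 unfolding encode_def by (auto intro!: tree_child simp del: tree_word.simps)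

lemma leaves_bound:
 assumes "length (tree_word (Node (map Leaf l))) <= length (encode X)"
 shows "length l <= length (encode X)" "a : set l ==> length (digits a) <= length (encode X)"
proof -
 show "length l <= length (encode X)" using tree_children[of "map Leaf l"] assms by simp
 assume "a : set l"
 then have "length (tree_word (Leaf a)) <= length (tree_word (Node (map Leaf l)))" by (intro tree_child) auto
 then show "length (digits a) <= length (encode X)" using digits_leaf[of a] assms by linarith
qed

lemma names_bound:
 "card (in_props X) <= length (encode X)" "a : in_props X ==> length (digits a) <= length (encode X)"
 "card (out_props X) <= length (encode X)" "a : out_props X ==> length (digits a) <= length (encode X)"
 using leaves_bound[OF enc_parts(1)[unfolded set_tree_def]] leaves_bound[OF enc_parts(2)[unfolded set_tree_def]] fin_X
 by auto

text \<open>The transition function is written out for every state and every subset of the inputs,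
  and there is at least one state. So the number of subsets is bounded by the length of the
  word.\<close>

lemma states_bound:
 "card (states (system X)) <= length (encode X)" "a : states (system X) ==> length (digits a) <= length (encode X)"
 "2 ^ card (in_props X) <= length (encode X)"
proof -
 let ?ss = "sorted_list_of_set (states (system X))"
 let ?tr = "[Node [Leaf s, set_tree x, Leaf (trans (system X) s x)]. s \<leftarrow> ?ss, x \<leftarrow> map set (subseqs (sorted_list_of_set (in_props X)))]"
 have c: "length (tree_word (set_tree (states (system X)))) <= length (encode X)"
  "length (tree_word (Node ?tr)) <= length (encode X)"
  by (rule order_trans[OF tree_child enc_parts(3)[unfolded system_tree_def Let_def]]; simp)+
 show "card (states (system X)) <= length (encode X)" "a : states (system X) ==> length (digits a) <= length (encode X)"
  using leaves_bound[OF c(1)[unfolded set_tree_def]] fin_X by auto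
 have "?ss ~= []" using T_X fin_X by (auto simp: transition_system_def)
 then obtain s ss where "?ss = s # ss" by (cases ?ss) auto
 then have "length (subseqs (sorted_list_of_set (in_props X))) <= length ?tr" by simp
 also have "... <= length (encode X)" using tree_children[of ?tr] c(2) by linarith
 finally show "2 ^ card (in_props X) <= length (encode X)" by (simp add: length_subseqs)
qed

lemma SI_cand_of: "SI pad (cand_of X) = map (map Nm) (subseqs (sorted_list_of_set (in_props X)))"
proof -
 have "2 ^ card (in_props X) <= length pad"
  using pad names_bound(1) by (meson order_trans power_increasing one_le_numeral)
 then show ?thesis
  unfolding SI_def by (subst csubs_subseqs) (simp_all add: cand_of_def Let_def cand_defs subseqs_map)
qed

lemma flat_matrix:
 "EX e. ctab (cand_of X) = e & flat_ok (map_qf Nm Nm (matrix X)) [] e"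
 using flat_ok[of "map_qf Nm Nm (matrix X)" "[]"] by (auto simp: cand_of_def Let_def cand_defs)

lemma map_qf_the_Nm: "map_qf the_nm the_nm (map_qf Nm Nm ph) = ph"
 by (induction ph) auto

lemma sub_set: "x : set (subseqs (sorted_list_of_set (in_props X))) ==> set x <= in_props X"
 using subseqs_sorted[where P = "%_ _. True"] fin_X by (fastforce simp: sorted_wrt_iff_nth_less)

lemma vcand_of: "vcand n pad (cand_of X)"
proof -
 obtain e where e: "ctab (cand_of X) = e" "flat_ok (map_qf Nm Nm (matrix X)) [] e" using flat_matrix by blast
 have wf: "ALL k<length e. wf_nd k (e ! k)" using e(2) by (simp add: flat_ok_def flat_pre_def nd_ok_def wfs_def)
 have "ALL s:set (strs n e). s ~= []"
 proof (rule strs_ne[OF wf])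
  fix ph assume "ph : set (forms e)"
  moreover have "ALL tha:set (forms ([] @ e)). tha : set (forms []) \<or> qf_len tha <= qf_len (map_qf Nm Nm (matrix X))"
   using e(2) unfolding flat_ok_def flat_pre_def by blast
  ultimately have "qf_len ph <= qf_len (map_qf Nm Nm (matrix X))" by (auto simp: forms_def)
  then show "qf_len ph <= length n" using enc_parts(6) n by (simp add: map_qf_the_Nm)
 qed
 moreover have "ALL nd:set e. fst nd = 0 --> fst (snd (snd nd)) : Nm ` (in_props X \<union> out_props X) & snd (snd (snd nd)) : Nm ` set (univ_vars X @ exist_vars X)"
 proof (intro ballI impI)
  fix nd assume nd: "nd : set e" "fst nd = 0"
  then have "fst (snd (snd nd)) : set1_qf (map_qf Nm Nm (matrix X)) & snd (snd (snd nd)) : set2_qf (map_qf Nm Nm (matrix X))"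
   using e(2) by (simp add: flat_ok_def flat_pre_def nd_ok_def wfs_def)
  then show "fst (snd (snd nd)) : Nm ` (in_props X \<union> out_props X) & snd (snd (snd nd)) : Nm ` set (univ_vars X @ exist_vars X)"
   using valid unfolding qf.set_map valid_instance_def by blast
 qed
 moreover have "e ~= []" using e(2) by (simp add: flat_ok_def flat_pre_def nd_ok_def wfs_def)
 moreover have "ALL k:set [0..<length e]. wf_nd k (nd_at e k)" using wf by (simp add: nd_at)
 moreover have "vdist (map Nm (univ_vars X) @ map Nm (exist_vars X))"
 proof -
  have "distinct (univ_vars X @ exist_vars X)" using valid by (simp add: valid_instance_def)
  then have "distinct (map Nm (univ_vars X @ exist_vars X))" unfolding distinct_map by (simp add: inj_on_def)
  then show ?thesis by (simp add: vdist)
 qed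
 moreover have "in_props X \<inter> out_props X = {}" using valid by (simp add: valid_instance_def)
 moreover have "init (system X) : states (system X)" using T_X by (simp add: transition_system_def)
 moreover have "trans (system X) s (set x) : states (system X)"
  if "s : states (system X)" "x : set (subseqs (sorted_list_of_set (in_props X)))" for s x
  using T_X that sub_set by (simp add: transition_system_def)
 moreover have "Nm a : Nm ` out_props X" if "s : states (system X)" "a : label (system X) s" for s a
  using fin_label that by blast
 moreover note fin_X fin_label
 ultimately show ?thesis
  unfolding vcand_def e(1) SI_cand_of
  by (auto simp: cand_of_def Let_def cand_defs sorted_vsort image_Un)
qed

lemma prt_cand_of: "prt n pad (cand_of X) = encode X"
proof -
 have c: "length (cI (cand_of X)) = card (in_props X)" by (simp add: cand_of_def Let_def cand_defs)
 have p: "2 ^ length (cI (cand_of X)) <= length pad"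
  unfolding c using pad names_bound(1) by (meson order_trans power_increasing one_le_numeral)
 obtain e where e: "ctab (cand_of X) = e" "flat_ok (map_qf Nm Nm (matrix X)) [] e" using flat_matrix by blast
 let ?Y = "inst pad (cand_of X)" and ?ss = "sorted_list_of_set (states (system X))" and ?xs = "subseqs (sorted_list_of_set (in_props X))"
 have i: "in_props ?Y = in_props X" "out_props ?Y = out_props X" "univ_vars ?Y = univ_vars X" "exist_vars ?Y = exist_vars X"
  "states (system ?Y) = states (system X)" "init (system ?Y) = init (system X)"
  using fin_X by (auto simp: inst_def cand_of_def Let_def cand_defs image_image comp_def)
 have m: "matrix ?Y = matrix X"
  using e(2) map_qf_the_Nm by (simp add: inst_def e(1) flat_ok_def)
 have dI: "distinct ?xs" by (rule distinct_subseqs) simp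
 have cs: "cS (cand_of X) = map Nm ?ss" "ctr (cand_of X) = map (%s. map (%x. Nm (trans (system X) s (set x))) ?xs) ?ss"
  "clb (cand_of X) = map (%s. map Nm (sorted_list_of_set (label (system X) s))) ?ss"
  by (simp_all add: cand_of_def Let_def cand_defs)
 have ds: "distinct (map Nm ?ss)" by (simp add: distinct_map inj_on_def)
 have "system_tree (in_props X) (system ?Y) = system_tree (in_props X) (system X)"
 proof (rule system_tree_cong)
  fix s x assume s: "s : states (system X)" and x: "x <= in_props X"
  have "x : set ` set ?xs" using x fin_X by (simp add: subseqs_powset)
  then obtain l where l: "l : set ?xs" "x = set l" by auto
  have "map Nm l : set (SI pad (cand_of X))" using l by (simp add: SI_cand_of)
  from inst_trans[OF vcand_of p this, of "Nm s"]
  have "trans (system ?Y) s x = the_nm (assoc (c0 (cand_of X)) (map Nm l) (map (map Nm) ?xs) (assoc [] (Nm s) (map Nm ?ss) (map (%s. map (%x. Nm (trans (system X) s (set x))) ?xs) ?ss)))"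
   using l(2) by (simp add: SI_cand_of cs image_image)
  also have "assoc [] (Nm s) (map Nm ?ss) (map (%s. map (%x. Nm (trans (system X) s (set x))) ?xs) ?ss) = map (%x. Nm (trans (system X) s (set x))) ?xs"
   by (rule assoc_map) (use s fin_X ds in auto)
  also have "assoc (c0 (cand_of X)) (map Nm l) (map (map Nm) ?xs) (map (%x. Nm (trans (system X) s (set x))) ?xs) = Nm (trans (system X) s (set l))"
   by (rule assoc_map[OF l(1)]) (use dI in "simp add: distinct_map inj_on_def")
  finally show "trans (system ?Y) s x = trans (system X) s x" using l by simp
 next
  fix s assume s: "s : states (system X)"
  have "assoc [] (Nm s) (map Nm ?ss) (map (%s. map Nm (sorted_list_of_set (label (system X) s))) ?ss) = map Nm (sorted_list_of_set (label (system X) s))"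
   by (rule assoc_map) (use s fin_X ds in auto)
  then show "label (system ?Y) s = label (system X) s" using fin_label[OF s] by (simp add: inst_def cs image_image)
 qed (use fin_X i in simp_all)
 then have "encode ?Y = encode X" unfolding encode_def i m by simp
 then show ?thesis using encode_inst[OF vcand_of p] by simp
qed

text \<open>The height of a list is at most its length plus the height of its elements. With
  \<open>s\<close> the length of the word this gives \<open>s + 1\<close> for a name,
  \<open>2 * s + 1\<close> for names in a row, \<open>3 * s + 1\<close> for a list of rows, and at
  most \<open>2 * s + 9\<close> for the formula table. Nine fields of height at most
  \<open>3 * s + 9\<close> make \<open>3 * s + 18\<close>.\<close>

lemma ht_code: "ht (code (cand_of X)) <= 3 * length (encode X) + 18"
proof -
 let ?s = "length (encode X)"
 obtain e where e: "ctab (cand_of X) = e" "flat_ok (map_qf Nm Nm (matrix X)) [] e" using flat_matrix by blast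
 have st1: "1 <= ?s" by (simp add: encode_def)
 have nm0: "ht (enc (Nm 0)) <= ?s + 1" by (rule ht_nm) (use st1 in "simp add: digits_cases")
 have nm: "ht (enc (Nm a)) <= ?s + 1" if "a : in_props X \<or> a : out_props X \<or> a : states (system X) \<or> a : set (univ_vars X @ exist_vars X)" for a
  by (rule ht_nm) (use that names_bound states_bound leaves_bound[OF enc_parts(4)] leaves_bound[OF enc_parts(5)] in auto)
 have nms: "ht (enc l) <= 3 * ?s + 1" if "length l <= ?s" "!!a. a : set l ==> ht (enc a) <= ?s + 1" for l :: "nm list"
  using ht_enc_list[of l "?s + 1", OF that(2)] that(1) by simp
 have nms2: "ht (enc l) <= 2 * ?s + 1" if "length l <= ?s" "!!a. a : set l ==> ht (enc a) <= ?s + 1" for l :: "nm list"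
  using ht_enc_list[of l "?s + 1", OF that(2)] that(1) by simp
 have h: "ht (enc (cI (cand_of X))) <= 3 * ?s + 1" "ht (enc (cO (cand_of X))) <= 3 * ?s + 1" "ht (enc (cS (cand_of X))) <= 3 * ?s + 1"
  "ht (enc (cuv (cand_of X))) <= 3 * ?s + 1" "ht (enc (cev (cand_of X))) <= 3 * ?s + 1"
  by (rule nms; use names_bound states_bound fin_X nm leaves_bound[OF enc_parts(4)] leaves_bound[OF enc_parts(5)] in
    \<open>auto simp: cand_of_def Let_def cand_defs\<close>)+
 have h0: "ht (enc (c0 (cand_of X))) <= 3 * ?s + 1"
  using nm[of "init (system X)"] T_X by (simp add: cand_of_def Let_def cand_defs transition_system_def)
 have htr: "ht (enc (ctr (cand_of X))) <= 3 * ?s + 1"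
 proof -
  have "ht (enc (ctr (cand_of X))) <= length (ctr (cand_of X)) + (2 * ?s + 1)"
  proof (rule ht_enc_list)
   fix r assume "r : set (ctr (cand_of X))"
   then obtain s where s: "s : states (system X)" "r = map (%x. Nm (trans (system X) s (set x))) (subseqs (sorted_list_of_set (in_props X)))"
    using fin_X by (auto simp: cand_of_def Let_def cand_defs)
   have "trans (system X) s (set x) : states (system X)"
    if "x : set (subseqs (sorted_list_of_set (in_props X)))" for x
    using T_X that sub_set s(1) by (simp add: transition_system_def)
   then show "ht (enc r) <= 2 * ?s + 1" using states_bound(3) nm
    by (intro nms2) (auto simp: s(2) length_subseqs)
  qed
  then show ?thesis using states_bound(1) by (simp add: cand_of_def Let_def cand_defs)
 qed
 have hlb: "ht (enc (clb (cand_of X))) <= 3 * ?s + 1"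
 proof -
  have "ht (enc (clb (cand_of X))) <= length (clb (cand_of X)) + (2 * ?s + 1)"
  proof (rule ht_enc_list)
   fix r assume "r : set (clb (cand_of X))"
   then obtain s where s: "s : states (system X)" "r = map Nm (sorted_list_of_set (label (system X) s))"
    using fin_X by (auto simp: cand_of_def Let_def cand_defs)
   have "card (label (system X) s) <= ?s"
    using fin_label[OF s(1)] names_bound(3) card_mono[OF fin_X(2)] by (meson order_trans)
   then show "ht (enc r) <= 2 * ?s + 1" using fin_label[OF s(1)] nm
    by (intro nms2) (auto simp: s(2))
  qed
  then show ?thesis using states_bound(1) by (simp add: cand_of_def Let_def cand_defs)
 qed
 have el: "length e <= ?s" using e(2) enc_parts(6) by (simp add: flat_ok_def flat_pre_def nd_ok_def wfs_def map_qf_the_Nm)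
 have ht5: "ht (enc [a, b, c, d, f]) <= 5 + m" if "ht a <= m" "ht b <= m" "ht c <= m" "ht d <= m" "ht f <= m" for a b c d f :: dt and m
  using ht_enc_list[of "[a, b, c, d, f]" m] that by auto
 have htab: "ht (enc (map cd_nd e)) <= length (map cd_nd e) + (?s + 9)"
 proof (rule ht_enc_list)
  fix d assume "d : set (map cd_nd e)"
  then obtain nd where nd: "nd : set e" "d = cd_nd nd" by auto
  then have b: "fst nd <= 4" "fst (fst (snd nd)) < length e" "snd (fst (snd nd)) < length e"
   "if fst nd = 0 then fst (snd (snd nd)) : Nm ` set1_qf (matrix X) & snd (snd (snd nd)) : Nm ` set2_qf (matrix X)
     else snd (snd nd) = (Nm 0, Nm 0)"
   using e(2) by (auto simp: flat_ok_def flat_pre_def nd_ok_def wfs_def qf.set_map)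
  have names: "ht (enc (fst (snd (snd nd)))) <= ?s + 4 & ht (enc (snd (snd (snd nd)))) <= ?s + 4"
  proof (cases "fst nd = 0")
   case True
   then obtain a v where av: "fst (snd (snd nd)) = Nm a" "a : set1_qf (matrix X)" "snd (snd (snd nd)) = Nm v" "v : set2_qf (matrix X)"
    using b(4) by auto
   have "a : in_props X \<or> a : out_props X" "v : set (univ_vars X @ exist_vars X)"
    using valid av unfolding valid_instance_def by blast+
   then show ?thesis using nm[of a] nm[of v] av by auto
  next
   case False
   then show ?thesis using b(4) nm0 by simp
  qed
  have "ht (cd_nd nd) <= 5 + (?s + 4)" unfolding cd_nd_def
   by (rule ht5) (use b(1-3) el names st1 in "simp_all add: ht_nat")
  then show "ht (enc d) <= ?s + 9" using nd by simp
 qed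
 have "ht (code (cand_of X)) <= length [enc (cI (cand_of X)), enc (cO (cand_of X)), enc (cS (cand_of X)), enc (c0 (cand_of X)), enc (ctr (cand_of X)), enc (clb (cand_of X)), enc (cuv (cand_of X)), enc (cev (cand_of X)),
   enc (map cd_nd (ctab (cand_of X)))] + (3 * ?s + 9)"
  unfolding code_def
 proof (rule ht_enc_list)
  fix d assume "d : set [enc (cI (cand_of X)), enc (cO (cand_of X)), enc (cS (cand_of X)), enc (c0 (cand_of X)), enc (ctr (cand_of X)), enc (clb (cand_of X)), enc (cuv (cand_of X)), enc (cev (cand_of X)),
   enc (map cd_nd (ctab (cand_of X)))]"
  moreover have "ht (enc (map cd_nd (ctab (cand_of X)))) <= 3 * ?s + 9" using htab el by (simp add: e(1))
  ultimately show "ht (enc d) <= 3 * ?s + 9" using h h0 htr hlb by auto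
 qed
 then show ?thesis by simp
qed

end

subsection \<open>Deciding candidates\<close>

definition step_cd :: "unit list => cand => nm list => nm list list => nm list list => nm list" where
 "step_cd pad c s v u = map (%p. assoc (c0 c) (snd p) (SI pad c) (assoc [] (fst p) (cS c) (ctr c))) (zip s (u @ v))"

definition val_cd :: "cand => nm list => nm list list => nm list list => bool list" where
 "val_cd c s v u = map (%nd. EX j:set [0..<length (cuv c @ cev c)]. nthd undefined (cuv c @ cev c) j = snd (snd (snd nd)) &
   (fst (snd (snd nd)) : set (nthd [] (u @ v) j) \<or> fst (snd (snd nd)) : set (assoc [] (nthd undefined s j) (cS c) (clb c)))) (ctab c)"

definition atoms_cd :: "unit list => cand => bool list list" where
 "atoms_cd pad c = words pad (length (ctab c)) [False, True]"

definition succ_cd :: "unit list => cand => nm list * nat list => nm list list => nm list list => nm list * nat list" where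
 "succ_cd pad c p v u = (step_cd pad c (fst p) v u, new_counts (ctab c) (val_cd c (fst p) v u) (atoms_cd pad c) (snd p))"

definition space_cd :: "unit list => unit list => cand => (nm list * nat list) list" where
 "space_cd kap pad c = concat (map (%s. map (%cs. (s, cs)) (words pad (length (atoms_cd pad c)) [0..<Suc (length kap)]))
   (words pad (length (cuv c @ cev c)) (cS c)))"

definition wins :: "unit list => unit list => cand => bool" where
 "wins kap pad c \<longleftrightarrow> (replicate (length (cuv c @ cev c)) (c0 c), map (init_count (ctab c)) (atoms_cd pad c))
   : set (solve (succ_cd pad c) (words pad (length (cev c)) (SI pad c)) (words pad (length (cuv c)) (SI pad c)) (space_cd kap pad c))"

lemma PT_step_cd [pt]: assumes "PT p" "PT c" "PT s" "PT v" "PT u" shows "PT (%x. step_cd (p x) (c x) (s x) (v x) (u x))"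
 unfolding step_cd_def by (intro pt assms assms[THEN PT_comp])

lemma PT_val_cd [pt]: assumes "PT c" "PT s" "PT v" "PT u" shows "PT (%x. val_cd (c x) (s x) (v x) (u x))"
 unfolding val_cd_def by (intro pt assms assms[THEN PT_comp])

lemma PT_atoms_cd [pt]: "PT p ==> PT c ==> PT (%x. atoms_cd (p x) (c x))" unfolding atoms_cd_def by (intro pt)

lemma PT_succ_cd [pt]:
 assumes "PT p" "PT c" "PT q" "PT v" "PT u" shows "PT (%x. succ_cd (p x) (c x) (q x) (v x) (u x))"
 unfolding succ_cd_def by (intro pt assms)

lemma PT_space_cd [pt]: assumes "PT k" "PT p" "PT c" shows "PT (%x. space_cd (k x) (p x) (c x))"
 unfolding space_cd_def by (intro pt assms assms[THEN PT_comp])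

lemma sz_filter: "sz (filter P l) <= sz (l :: 'a::data list)"
 by (induction l) (auto simp: sz_def)

lemma PT_solve:
 assumes s: "PT (%z. succ (fst z) (fst (snd z)) (fst (snd (snd z))) (snd (snd (snd z))))"
  and V: "PT V" and U: "PT U" and W: "PT W"
 shows "PT (%x. solve (succ x) (V x) (U x) (W x :: 'a::data list))"
proof -
 obtain L where L: "pb L" "!!x. sz (W x) <= L (sz x)" using PT_size[OF W] by metis
 show ?thesis unfolding solve_def
 proof (rule PT_funpow[where B = L])
  show "PT (%z. closed_part (succ (fst z)) (V (fst z)) (U (fst z)) (snd z))"
   unfolding closed_part_def
   by (intro pt PT_comp[OF V] PT_comp[OF U] PT_comp[OF s, of "%z. (fst (fst (fst (fst z))), (snd (fst (fst z)), (snd (fst z), snd z)))", simplified])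
  fix x j
  have "sz ((closed_part (succ x) (V x) (U x) ^^ j) (W x)) <= sz (W x)"
   by (induction j) (auto simp: closed_part_def intro: order_trans[OF sz_filter])
  then show "sz ((closed_part (succ x) (V x) (U x) ^^ j) (W x)) <= L (sz x)" using L(2) order_trans by blast
 qed (intro pt W L)+
qed

lemma PT_wins [pt]: assumes "PT k" "PT p" "PT c" shows "PT (%x. wins (k x) (p x) (c x))"
 unfolding wins_def by (intro pt PT_solve assms PT_comp[OF assms(2)] PT_comp[OF assms(3)])

lemma forms_map_nd:
 "ALL k<length tab. wf_nd k (tab ! k) ==> forms (map (map_nd f) tab) = map (map_qf f f) (forms tab)"
proof (induction tab rule: rev_induct)
 case Nil then show ?case by (simp add: forms_def)
next
 case (snoc nd tab)
 have wf: "ALL k<length tab. wf_nd k (tab ! k)"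
  using snoc.prems by (metis length_append_singleton less_SucI nth_append)
 obtain t i j a v where nd: "nd = (t, (i, j), (a, v))" by (metis prod.exhaust)
 have "wf_nd (length tab) nd" using snoc.prems by (metis length_append_singleton lessI nth_append_length)
 then have w: "t ~= 0 ==> i < length tab & j < length tab" by (simp add: wf_nd_def nd)
 have "mk (map (map_qf f f) (forms tab)) (map_nd f nd) = map_qf f f (mk (forms tab) nd)"
  using w by (auto simp: mk_def map_nd_def nd)
 then show ?case by (simp add: forms_snoc snoc.IH[OF wf])
qed

lemma wf_map_nd: "wf_tab tab ==> wf_tab (map (map_nd f) tab)"
 by (simp add: wf_tab_def wf_nd_def map_nd_def)

lemma card_lists_bound:
 assumes "finite A" shows "card {l. set l <= A & length l <= n} <= Suc n * Suc (card A) ^ n"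
proof -
 have "card {l. set l <= A & length l <= n} = (SUM i<=n. card A ^ i)" by (rule card_lists_length_le[OF assms])
 also have "... <= (SUM i<=n. Suc (card A) ^ n)"
 proof (rule sum_mono)
  fix i assume "i : {..n}"
  then have "card A ^ i <= Suc (card A) ^ i" "Suc (card A) ^ i <= Suc (card A) ^ n"
   by (auto intro: power_mono power_increasing)
  then show "card A ^ i <= Suc (card A) ^ n" by simp
 qed
 finally show ?thesis by simp
qed

section \<open>Sizes of the counter bound and of the padding\<close>

definition kap_len :: "nat => nat" where "kap_len H = 2 ^ (2 ^ (2 * H + 5))"
definition pad_len :: "nat => nat" where "pad_len H = 2 ^ (2 ^ (3 * H + 6))"

lemma less_two_power: "n < (2::nat) ^ n" by (rule less_exp)

text \<open>The most demanding list is that of the count vectors, with up to \<open>2 ^ H\<close>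
  entries from \<open>Suc (kap_len H)\<close> values. Its length is below \<open>2\<close> to the
  power \<open>(2 ^ (2 * H + 5) + 1) * 2 ^ H\<close>, which explains the exponent
  \<open>3 * H + 6\<close>.\<close>

lemma pad_bounds:
 shows "2 ^ H <= pad_len H" "n <= 2 * H ==> i <= H ==> (2 ^ i) ^ n <= pad_len H" "n <= 2 * H ==> i <= H ==> i ^ n <= pad_len H"
  "m <= 2 ^ H ==> Suc (kap_len H) ^ m <= pad_len H" "2 ^ (2 ^ Suc H) <= pad_len H" "kap_len H <= pad_len H"
proof -
 have e: "2 ^ x <= pad_len H" if "x <= 2 ^ (3 * H + 6)" for x
  unfolding pad_len_def using that by (intro power_increasing) auto
 have H: "H <= 2 ^ H" using less_two_power[of H] by simp
 have "(2::nat) ^ H <= 2 ^ (3 * H + 6)" by (intro power_increasing) auto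
 then show "2 ^ H <= pad_len H" by (intro e) (rule order_trans[OF H])
 have sq: "H * (2 * H) <= 2 ^ (3 * H + 6)"
 proof -
  have "H * (2 * H) <= 2 ^ H * (2 * 2 ^ H)" using H by (intro mult_le_mono) auto
  also have "... = 2 ^ (2 * H + 1)" unfolding mult_2[of H] by (simp add: power_add)
  also have "... <= 2 ^ (3 * H + 6)" by (intro power_increasing) auto
  finally show ?thesis .
 qed
 show 1: "(2 ^ i) ^ n <= pad_len H" if "n <= 2 * H" "i <= H" for i n
 proof -
  have "i * n <= H * (2 * H)" using that by (intro mult_le_mono) auto
  then show ?thesis unfolding power_mult[symmetric] using sq by (intro e) simp
 qed
 show "i ^ n <= pad_len H" if "n <= 2 * H" "i <= H" for i n
 proof -
  have "i ^ n <= (2 ^ i) ^ n" using less_two_power[of i] by (intro power_mono) auto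
  then show ?thesis using 1[OF that] by simp
 qed
 show "Suc (kap_len H) ^ m <= pad_len H" if "m <= 2 ^ H" for m
 proof -
  have "Suc (kap_len H) <= 2 ^ (2 ^ (2 * H + 5) + 1)" by (simp add: kap_len_def)
  then have "Suc (kap_len H) ^ m <= (2 ^ (2 ^ (2 * H + 5) + 1)) ^ m" by (rule power_mono) simp
  also have "... = 2 ^ ((2 ^ (2 * H + 5) + 1) * m)" by (simp only: power_mult)
  also have "... <= pad_len H"
  proof (rule e)
   have "(2 ^ (2 * H + 5) + 1) * m <= (2 ^ (2 * H + 5) + 2 ^ (2 * H + 5)) * 2 ^ H" using that by (intro mult_le_mono) auto
   also have "... = 2 ^ (3 * H + 6)"
   proof -
    have "3 * H + 6 = Suc ((2 * H + 5) + H)" by simp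
    then show ?thesis by (simp only: power_Suc power_add) simp
   qed
   finally show "(2 ^ (2 * H + 5) + 1) * m <= 2 ^ (3 * H + 6)" .
  qed
  finally show ?thesis .
 qed
 show "2 ^ (2 ^ Suc H) <= pad_len H" by (rule e) (intro power_increasing; simp)
 show "kap_len H <= pad_len H" unfolding kap_len_def by (rule e) (intro power_increasing; simp)
qed

text \<open>With \<open>a = 2 ^ H\<close> the positions number at most
  \<open>2 ^ (3 * (a * a))\<close>, the lists of label sets \<open>2 ^ (4 * (a * a))\<close>, the
  labels \<open>2 ^ (a * a)\<close>. The product has exponent \<open>11 * (a * a)\<close>, rounded
  up to \<open>32 * (a * a)\<close>, which is \<open>2 ^ (2 * H + 5)\<close>.\<close>

lemma kap_bound:
 assumes cl: "cl <= H" and P: "P <= s * Suc cl ^ A" and s: "s <= (2 ^ H) ^ (2 * H)" and A: "A = 2 ^ cl" and N: "N <= Suc A * Suc (2 ^ A) ^ A"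
 shows "Suc (P * N * P * A) <= kap_len H"
proof -
 define a :: nat where "a = 2 ^ H"
 have H: "H < a" "1 <= a" using less_two_power[of H] by (auto simp: a_def)
 have Aa: "A <= a" unfolding A a_def using cl by (intro power_increasing) auto
 have "s <= 2 ^ (H * (2 * H))" using s by (simp only: power_mult)
 moreover have "Suc cl ^ A <= 2 ^ (H * a)"
 proof -
  have "Suc cl <= 2 ^ H" using cl H(1) unfolding a_def by linarith
  then have "Suc cl ^ A <= (2 ^ H) ^ A" by (rule power_mono) simp
  also have "... <= (2 ^ H) ^ a" using Aa by (intro power_increasing) auto
  finally show ?thesis by (simp only: power_mult)
 qed
 ultimately have "P <= 2 ^ (H * (2 * H)) * 2 ^ (H * a)" using P by (meson order_trans mult_le_mono)
 also have "... = 2 ^ (H * (2 * H) + H * a)" by (simp only: power_add)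
 also have "... <= 2 ^ (3 * (a * a))"
 proof (intro power_increasing)
  have "H * H <= a * a" "H * a <= a * a" using H by (intro mult_le_mono; simp)+
  moreover have "H * (2 * H) = 2 * (H * H)" by simp
  ultimately show "H * (2 * H) + H * a <= 3 * (a * a)" by linarith
 qed simp
 finally have P': "P <= 2 ^ (3 * (a * a))" .
 have N': "N <= 2 ^ (4 * (a * a))"
 proof -
  have "Suc A <= 2 ^ A" using less_two_power[of A] by (rule Suc_leI)
  moreover have "Suc (2 ^ A) ^ A <= (2 ^ Suc A) ^ A" by (intro power_mono) auto
  ultimately have "N <= 2 ^ A * (2 ^ Suc A) ^ A" using N by (meson order_trans mult_le_mono)
  also have "... = 2 ^ (A + Suc A * A)" by (simp only: power_add power_mult)
  also have "... <= 2 ^ (4 * (a * a))"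
  proof (intro power_increasing)
   have "A * A <= a * a" using Aa by (intro mult_le_mono)
   moreover have "A <= a * a" using Aa H(2) by (metis le_trans mult_le_mono mult.right_neutral order_refl)
   ultimately show "A + Suc A * A <= 4 * (a * a)" by simp
  qed simp
  finally show ?thesis .
 qed
 have A': "A <= 2 ^ (a * a)"
 proof -
  have "A <= a * a" using Aa H(2) by (metis le_trans mult_le_mono mult.right_neutral order_refl)
  then show ?thesis using less_two_power[of "a * a"] by linarith
 qed
 have "P * N * P * A <= 2 ^ (3 * (a * a)) * 2 ^ (4 * (a * a)) * 2 ^ (3 * (a * a)) * 2 ^ (a * a)"
  using P' N' A' by (intro mult_le_mono)
 also have "... = 2 ^ (11 * (a * a))" by (simp only: power_add[symmetric]) simp
 finally have 1: "P * N * P * A <= 2 ^ (11 * (a * a))" .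
 have "1 <= a * a" using H(2) by (metis le_trans mult_le_mono mult.right_neutral order_refl)
 then have "(2::nat) ^ Suc (11 * (a * a)) <= 2 ^ (32 * (a * a))" by (intro power_increasing) auto
 also have "(32::nat) * (a * a) = 2 ^ (2 * H + 5)" by (simp add: a_def power_add mult_2[symmetric] power_mult[symmetric]) (simp add: power_mult power2_eq_square mult_2 power_add)
 finally have "2 ^ Suc (11 * (a * a)) <= kap_len H" by (simp only: kap_len_def)
 moreover have "(1::nat) <= 2 ^ (11 * (a * a))" by simp
 ultimately show ?thesis using 1 unfolding power_Suc by linarith
qed

text \<open>The solver works on lists of names, the game on sets of numbers. The padding is long
  enough for all the word lists to be complete, so the codes cover all letters and positions, and
  \<open>kap_len H\<close> is at least the bound on the counts of a collapsed winning
  machine.\<close>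

lemma wins_iff:
 assumes v: "vcand n pad c" and H: "length (cI c) <= H" "length (cS c) <= H" "length (cuv c) <= H" "length (cev c) <= H" "length (ctab c) <= H"
  and kap: "length kap = kap_len H" and pad: "length pad = pad_len H"
 shows "wins kap pad c \<longleftrightarrow> strategy_realizable (inst pad c)"
proof -
 let ?X = "inst pad c" and ?tab = "map (map_nd the_nm) (ctab c)" and ?at = "atoms_cd pad c"
 let ?d = "map (%x. the_nm ` set x) :: nm list list => nat set list"
 have pI: "2 ^ length (cI c) <= length pad"
  using pad_bounds(1)[of H] H(1) pad by (metis order_trans power_increasing one_le_numeral)
 have S: "SI pad c = subseqs (cI c)" using csubs_subseqs[OF pI] by (simp add: SI_def)
 have val: "valid_instance ?X" by (rule valid_inst[OF v pI])
 have wt: "wf_tab (ctab c)" by (rule vcand_tab[OF v])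
 then have ne: "ctab c ~= []" by (simp add: wf_tab_def)
 have at: "set ?at = {L. length L = length (ctab c)}" "length ?at = 2 ^ length (ctab c)"
 proof -
  have "(2::nat) ^ length (ctab c) <= length pad"
   using pad_bounds(1)[of H] H(5) pad by (metis order_trans power_increasing one_le_numeral)
  then show "set ?at = {L. length L = length (ctab c)}" "length ?at = 2 ^ length (ctab c)"
   using words_all[of "[False, True]" "length (ctab c)" pad] by (auto simp: atoms_cd_def numeral_2_eq_2)
 qed
 interpret inst_game ?X ?tab ?at
 proof
  have "ALL k<length (ctab c). wf_nd k (ctab c ! k)" using wt by (simp add: wf_tab_def)
  then show "forms ?tab ! (length ?tab - 1) = matrix ?X"
   using ne by (simp add: forms_map_nd inst_def)
 qed (use val wf_map_nd[OF wt] at in simp_all)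
 have SIs: "(%x. the_nm ` set x) ` set (SI pad c) = Pow (in_props ?X)"
 proof -
  have "(%x. the_nm ` set x) ` set (SI pad c) = (%x. the_nm ` x) ` set ` set (SI pad c)" by (simp add: image_image)
  also have "... = Pow (the_nm ` set (cI c))" unfolding S subseqs_powset by (rule image_Pow_surj[OF refl])
  finally show ?thesis by (simp add: inst_def)
 qed
 have SIne: "SI pad c ~= []" unfolding S using subseqs_refl[of "cI c"] by auto
 have ls: "length (SI pad c) = 2 ^ length (cI c)" unfolding S by (rule length_subseqs)
 have wSI: "set (words pad k (SI pad c)) = {w. length w = k & set w <= set (SI pad c)}" if "k <= 2 * H" for k
 proof -
  have "length (SI pad c) ^ k <= length pad" unfolding ls pad by (rule pad_bounds(2)[OF that H(1)])
  then show ?thesis using words_all[OF _ SIne] by blast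
 qed
 have img: "?d ` {w. length w = k & set w <= set (SI pad c)} = tuples k (Pow (in_props ?X))" for k
 proof -
  have key: "?d ` {w. length w = k & set w <= A} = {w. length w = k & set w <= (%x. the_nm ` set x) ` A}" for A
  proof (intro equalityI subsetI)
   fix w assume "w : {w. length w = k & set w <= (%x. the_nm ` set x) ` A}"
   then have w: "length w = k" "set w <= (%x. the_nm ` set x) ` A" by simp_all
   then have "ALL y:set w. EX x:A. y = the_nm ` set x" by blast
   then obtain g where g: "!!y. y : set w ==> g y : A & y = the_nm ` set (g y)" by metis
   have "w = ?d (map g w)" using g by (auto intro!: map_idI[symmetric])
   moreover have "map g w : {w. length w = k & set w <= A}" using g w by auto
   ultimately show "w : ?d ` {w. length w = k & set w <= A}" by blast
  qed (auto intro!: imageI)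
  show ?thesis unfolding tuples_def SIs[symmetric] by (rule key)
 qed
 have lens: "length (univ_vars ?X) = length (cuv c)" "length (exist_vars ?X) = length (cev c)"
  "states (system ?X) = the_nm ` set (cS c)" by (simp_all add: inst_def)
 let ?Ul = "words pad (length (cuv c)) (SI pad c)" and ?Vl = "words pad (length (cev c)) (SI pad c)"
 have Ul: "set ?Ul = {w. length w = length (cuv c) & set w <= set (SI pad c)}" "?d ` set ?Ul = Ux"
  using wSI[of "length (cuv c)"] img H by (simp_all add: lens)
 have Vl: "set ?Vl = {w. length w = length (cev c) & set w <= set (SI pad c)}" "?d ` set ?Vl = Vx"
  using wSI[of "length (cev c)"] img H by (simp_all add: lens)
 let ?Sl = "{s. length s = length (cuv c @ cev c) & set s <= set (cS c)}"
 have c0S: "c0 c : set (cS c)" using v by (simp add: vcand_def)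
 have dS: "distinct (cS c)" "length (ctr c) = length (cS c)" "length (clb c) = length (cS c)"
  and rows: "ALL r:set (ctr c). length r = length (SI pad c) & set r <= set (cS c)"
  using v vsort_distinct by (auto simp: vcand_def)
 have dI: "distinct (SI pad c)" unfolding S by (rule distinct_subseqs) (use v vsort_distinct in "auto simp: vcand_def")
 interpret g: coded_game ?tab ?at "replicate (inst_vars ?X) (init (system ?X))" "inst_nx ?X" "inst_rho ?X" Ux Vx
  "tuples (inst_vars ?X) (states (system ?X))" ?Ul ?Vl ?Sl ?d ?d "map the_nm" "replicate (length (cuv c @ cev c)) (c0 c)"
  "step_cd pad c" "val_cd c" "space_cd kap pad c" "length kap"
 proof
  show "?d ` set ?Ul = Ux" "?d ` set ?Vl = Vx" by (rule Ul Vl)+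
  show "replicate (length (cuv c @ cev c)) (c0 c) : ?Sl" using c0S by auto
  show "map the_nm (replicate (length (cuv c @ cev c)) (c0 c)) = replicate (inst_vars ?X) (init (system ?X))"
   by (simp add: inst_def)
  show "step_cd pad c s v u : ?Sl & map the_nm (step_cd pad c s v u) = inst_nx ?X (map the_nm s) (?d v) (?d u)"
   if s: "s : ?Sl" and vv: "v : set ?Vl" and u: "u : set ?Ul" for s v u
  proof -
   have l: "length s = length (u @ v)" using s vv u Ul(1) Vl(1) by simp
   have pr: "a : set (cS c) & b : set (SI pad c)" if "(a, b) : set (zip s (u @ v))" for a b
    using that s vv u Ul(1) Vl(1) set_zip_leftD[OF that] set_zip_rightD[OF that] by auto
   have "assoc (c0 c) b (SI pad c) (assoc [] a (cS c) (ctr c)) : set (cS c)" if "(a, b) : set (zip s (u @ v))" for a b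
   proof -
    have r: "assoc [] a (cS c) (ctr c) : set (ctr c)"
     by (rule assoc_in[OF dS(1,2)]) (rule conjunct1[OF pr[OF that]])
    note rr = rows[rule_format, OF r]
    have "assoc (c0 c) b (SI pad c) (assoc [] a (cS c) (ctr c)) : set (assoc [] a (cS c) (ctr c))"
     by (rule assoc_in[OF dI conjunct1[OF rr] conjunct2[OF pr[OF that]]])
    then show ?thesis by (rule subsetD[OF conjunct2[OF rr]])
   qed
   then have 1: "step_cd pad c s v u : ?Sl" using l s by (auto simp: step_cd_def)
   have zm: "zip (map the_nm s) (?d u @ ?d v) = map (%p. (the_nm (fst p), the_nm ` set (snd p))) (zip s (u @ v))"
    unfolding map_append[symmetric] zip_map_map by (simp add: case_prod_beta')
   have "map the_nm (step_cd pad c s v u) = inst_nx ?X (map the_nm s) (?d v) (?d u)"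
    unfolding inst_nx_def zm step_cd_def map_map comp_def
   proof (rule map_cong[OF refl])
    fix p assume "p : set (zip s (u @ v))"
    then have "snd p : set (SI pad c)" using pr[of "fst p" "snd p"] by simp
    then show "the_nm (assoc (c0 c) (snd p) (SI pad c) (assoc [] (fst p) (cS c) (ctr c))) =
     (case (the_nm (fst p), the_nm ` set (snd p)) of (x, y) => tsys.trans (system ?X) x y)"
     using inst_trans[OF assms(1) pI, of "snd p" "fst p"] by simp
   qed
   with 1 show ?thesis ..
  qed
  show "val_cd c s v u = pval ?tab (inst_rho ?X (map the_nm s) (?d v) (?d u))"
   if s: "s : ?Sl" and vv: "v : set ?Vl" and u: "u : set ?Ul" for s v u
  proof -
   have l: "length s = length (cuv c @ cev c)" "length (u @ v) = length (cuv c @ cev c)"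
    using s vv u Ul(1) Vl(1) by simp_all
   have inj: "the_nm a : the_nm ` B \<longleftrightarrow> a : B" for a B by (simp add: inj_image_mem_iff the_nm_inj)
   have "(EX j:set [0..<length (cuv c @ cev c)]. nthd undefined (cuv c @ cev c) j = w &
     (a : set (nthd [] (u @ v) j) \<or> a : set (assoc [] (nthd undefined s j) (cS c) (clb c))))
    \<longleftrightarrow> inst_rho ?X (map the_nm s) (?d v) (?d u) (the_nm a) (the_nm w)" for a w
   proof -
    have vs: "univ_vars ?X @ exist_vars ?X = map the_nm (cuv c @ cev c)" by (simp add: inst_def)
    have lb: "label (system ?X) (the_nm b) = the_nm ` set (assoc [] b (cS c) (clb c))" for b by (simp add: inst_def)
    have uv: "?d u @ ?d v = ?d (u @ v)" by simp
    have "inst_rho ?X (map the_nm s) (?d v) (?d u) (the_nm a) (the_nm w) \<longleftrightarrow>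
     (EX j<length (cuv c @ cev c). the_nm ((cuv c @ cev c) ! j) = the_nm w & the_nm a : the_nm ` set ((u @ v) ! j) \<union> the_nm ` set (assoc [] (s ! j) (cS c) (clb c)))"
     unfolding inst_rho_def vs uv length_map
     by (intro ex_cong1 conj_cong refl) (simp_all only: nth_map l lb)
    also have "... \<longleftrightarrow> (EX j<length (cuv c @ cev c). (cuv c @ cev c) ! j = w & (a : set ((u @ v) ! j) \<or> a : set (assoc [] (s ! j) (cS c) (clb c))))"
     unfolding Un_iff inj by (simp add: inj_eq[OF the_nm_inj])
    also have "... \<longleftrightarrow> (EX j:set [0..<length (cuv c @ cev c)]. nthd undefined (cuv c @ cev c) j = w &
     (a : set (nthd [] (u @ v) j) \<or> a : set (assoc [] (nthd undefined s j) (cS c) (clb c))))"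
     using l by (auto simp: nthd_def)
    finally show ?thesis ..
   qed
   then show ?thesis unfolding val_cd_def pval_def by (simp add: map_nd_def case_prod_beta comp_def)
  qed
  show "set (space_cd kap pad c) = {(s, cs). s : ?Sl & length cs = length ?at & set cs <= {..length kap}}"
  proof -
   have "Suc (length kap) ^ length ?at <= length pad"
    unfolding at kap pad by (rule pad_bounds(4)) (use H in "simp add: power_increasing")
   then have 1: "set (words pad (length ?at) [0..<Suc (length kap)]) = {cs. length cs = length ?at & set cs <= {..length kap}}"
    using words_all[of "[0..<Suc (length kap)]" "length ?at" pad] by (simp add: atLeast0LessThan lessThan_Suc_atMost del: upt_Suc)
   have "length (cS c) ^ length (cuv c @ cev c) <= length pad"
    unfolding pad by (rule pad_bounds(3)) (use H in auto)
   moreover have "cS c ~= []" using c0S by auto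
   ultimately have 2: "set (words pad (length (cuv c @ cev c)) (cS c)) = ?Sl" using words_all by blast
   show ?thesis unfolding space_cd_def using 1 2 by (auto simp del: upt_Suc)
  qed
 qed
 have gs: "g.gsucc = succ_cd pad c"
  using ne by (intro ext) (simp add: g.gsucc_def succ_cd_def)
 have ip: "g.ipos = (replicate (length (cuv c @ cev c)) (c0 c), map (init_count (ctab c)) ?at)"
  unfolding g.ipos_def by (simp add: init_count_def[abs_def])
 have w: "wins kap pad c \<longleftrightarrow> g.ipos : set (solve g.gsucc ?Vl ?Ul (space_cd kap pad c))"
  unfolding wins_def gs ip ..
 show ?thesis
 proof
  assume "wins kap pad c"
  from g.solver_sound[OF this[unfolded w]]
  obtain MS and m0 :: "nm list * nat list" and up out where M: "finite MS" "machine MS m0 up out"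
   "ALL u. (ALL n. u n : Ux) --> holds m0 up out u"
   by (elim exE conjE)
  show "strategy_realizable ?X" by (rule machine_realizable[OF M(1,2)]) (rule M(3)[THEN spec, THEN mp])
 next
  assume "strategy_realizable ?X"
  from realizable_machine[OF this]
  obtain MS and m0 :: nat and up out where M: "finite MS" "machine MS m0 up out"
   "ALL u. (ALL n. u n : Ux) --> holds m0 up out u"
   by (elim exE conjE)
  have ca: "card (set ?at) = 2 ^ length (ctab c)"
  proof -
   have "card {xs :: bool list. set xs <= UNIV & length xs = length (ctab c)} = card (UNIV :: bool set) ^ length (ctab c)"
    by (rule card_lists_length_eq) simp
   then show ?thesis unfolding at by simp
  qed
  have "Suc (card PS * card {ns. set ns <= Pow (set ?at) & length ns <= card (set ?at)} * card PS * card (set ?at)) <= kap_len H"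
  proof (rule kap_bound[OF H(5)])
   show "card PS <= card (tuples (inst_vars ?X) (states (system ?X))) * Suc (length (ctab c)) ^ card (set ?at)"
    using card_PS at ca by simp
   have "card (tuples (inst_vars ?X) (states (system ?X))) = card (states (system ?X)) ^ inst_vars ?X"
    using card_lists_length_eq[of "states (system ?X)" "inst_vars ?X"] by (simp add: tuples_def lens conj_commute)
   also have "... <= (2 ^ H) ^ (2 * H)"
   proof -
    have "card (states (system ?X)) <= length (cS c)" unfolding lens by (rule order_trans[OF card_image_le card_length]) simp
    then have "card (states (system ?X)) <= 2 ^ H" using H(2) less_two_power[of H] by linarith
    then have "card (states (system ?X)) ^ inst_vars ?X <= (2 ^ H) ^ inst_vars ?X" by (rule power_mono) simp
    also have "... <= (2 ^ H) ^ (2 * H)" using H by (intro power_increasing) (auto simp: lens)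
    finally show ?thesis .
   qed
   finally show "card (tuples (inst_vars ?X) (states (system ?X))) <= (2 ^ H) ^ (2 * H)" .
   show "card (set ?at) = 2 ^ length (ctab c)" by (rule ca)
   have "card {ns. set ns <= Pow (set ?at) & length ns <= card (set ?at)} <= Suc (card (set ?at)) * Suc (card (Pow (set ?at))) ^ card (set ?at)"
    by (rule card_lists_bound) simp
   then show "card {ns. set ns <= Pow (set ?at) & length ns <= card (set ?at)} <= Suc (card (set ?at)) * Suc (2 ^ card (set ?at)) ^ card (set ?at)"
    by (simp add: card_Pow)
  qed
  then have B: "Suc (card PS * card {ns. set ns <= Pow (set ?at) & length ns <= card (set ?at)} * card PS * card (set ?at)) <= length kap"
   by (simp only: kap)
  show "wins kap pad c" unfolding w by (rule g.solver_complete[OF M(2,1) _ B]) (rule M(3)[THEN spec, THEN mp])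
 qed
qed

subsection \<open>The decision procedure with a given amount of space\<close>

text \<open>Repeated squaring from length 2, to write down a doubly exponential counter bound in
  unary.\<close>

definition sq :: "unit list => nat => unit list" where
 "sq pad n = ((%l. if length l * length l <= length pad then concat (map (%_. l) l) else l) ^^ n) [(), ()]"

lemma length_sq: "2 ^ (2 ^ n) <= length pad ==> length (sq pad n) = 2 ^ (2 ^ n)"
proof (induction n)
 case 0 then show ?case by (simp add: sq_def)
next
 case (Suc n)
 have e: "(2::nat) ^ (2 ^ Suc n) = 2 ^ (2 ^ n) * 2 ^ (2 ^ n)" by (simp add: mult_2 power_add)
 have "(2::nat) ^ (2 ^ n) <= length pad" using Suc.prems unfolding e by (meson le_square order_trans)
 then have l: "length (sq pad n) = 2 ^ (2 ^ n)" by (rule Suc.IH)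
 have "length (concat (map (%_. l) k)) = length k * length l" for l k :: "unit list" by (induction k) auto
 then have "length (sq pad (Suc n)) = length (sq pad n) * length (sq pad n)"
  using Suc.prems unfolding e l[symmetric] by (simp add: sq_def)
 then show ?case unfolding e l .
qed

lemma PT_sq [pt]: assumes p: "PT p" and n: "PT n" shows "PT (%x. sq (p x) (n x))"
proof -
 obtain L where L: "pb L" "!!x. sz (p x) <= L (sz x)" using PT_size[OF p] by metis
 have cc: "length (concat (map (%_. l) k)) = length k * length l" for l k :: "unit list" by (induction k) auto
 show ?thesis unfolding sq_def
 proof (rule PT_funpow[where B = "%m. Suc ((L m + 2) * Suc 1)"])
  show "PT (%z. if length (snd z) * length (snd z) <= length (p (fst z)) then concat (map (%_. snd z) (snd z)) else snd z)"
   by (intro pt PT_comp[OF p])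
  show "pb (%m. Suc ((L m + 2) * Suc 1))" by (intro pb_intros L)
  fix x j
  have "length (((%l. if length l * length l <= length (p x) then concat (map (%_. l) l) else l) ^^ j) [(), ()]) <= length (p x) + 2"
   by (induction j) (auto simp: cc)
  then have "length (((%l. if length l * length l <= length (p x) then concat (map (%_. l) l) else l) ^^ j) [(), ()]) <= L (sz x) + 2"
   using L(2)[of x] length_le_sz[of "p x"] by linarith
  then have "Suc (length (((%l. if length l * length l <= length (p x) then concat (map (%_. l) l) else l) ^^ j) [(), ()]) * Suc 1) <= Suc ((L (sz x) + 2) * Suc 1)"
   by simp
  then show "sz (((%l. if length l * length l <= length (p x) then concat (map (%_. l) l) else l) ^^ j) [(), ()]) <= Suc ((L (sz x) + 2) * Suc 1)"
   by (rule order_trans[OF sz_le_bound, rotated]) (simp add: sz_def enc_unit_def)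
 qed (intro pt p n)+
qed

definition height_bd :: "bool list => nat" where "height_bd w = 3 * length w + 18"

text \<open>Printing replaces parsing: a candidate is relevant iff it prints as \<open>w\<close>.
  The height bound is that of the code of an instance with encoding \<open>w\<close>, and
  \<open>2 * height_bd w + 5\<close> squarings yield \<open>kap_len (height_bd w)\<close>.\<close>

definition decide :: "bool list => unit list => bool" where
 "decide w pad \<longleftrightarrow> (EX d:set (all_dt pad (height_bd w)). vcand (units (length w)) pad (decode d) &
   prt (units (length w)) pad (decode d) = w & wins (sq pad (2 * height_bd w + 5)) pad (decode d))"

lemma PT_height_bd [pt]: "PT f ==> PT (%x. height_bd (f x))" unfolding height_bd_def by (intro pt)

lemma PT_decide: assumes "PT w" "PT p" shows "PT (%x. decide (w x) (p x))"
 unfolding decide_def by (intro pt assms assms[THEN PT_comp])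

lemma ht_dfield: "ht (dfield d i) <= ht d"
 using ht_dl[of _ d] by (auto simp: dfield_def nthd_def)

lemma decode_lengths:
 assumes "ht d <= H"
 shows "length (cI (decode d)) <= H" "length (cS (decode d)) <= H" "length (cuv (decode d)) <= H"
  "length (cev (decode d)) <= H" "length (ctab (decode d)) <= H"
proof -
 have l: "length (dl (dfield d i)) <= H" for i using length_dl[of "dfield d i"] ht_dfield[of d i] assms by linarith
 show "length (cI (decode d)) <= H" "length (cS (decode d)) <= H" "length (cuv (decode d)) <= H"
  "length (cev (decode d)) <= H" "length (ctab (decode d)) <= H"
  using l by (simp_all add: decode_def cand_defs dnms_def)
qed

lemma decide_iff:
 assumes pad: "length pad = pad_len (height_bd w)"
 shows "decide w pad \<longleftrightarrow> w : strategy_realizability"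
proof -
 let ?H = "height_bd w" and ?n = "units (length w)"
 have all: "set (all_dt pad ?H) = {d. ht d <= ?H}" using all_dt_all[of ?H pad] pad_bounds(5)[of ?H] pad by simp
 have kap: "length (sq pad (2 * ?H + 5)) = kap_len ?H"
  using length_sq[of "2 * ?H + 5" pad] pad_bounds(6)[of ?H] pad by (simp add: kap_len_def)
 have win: "wins (sq pad (2 * ?H + 5)) pad (decode d) \<longleftrightarrow> strategy_realizable (inst pad (decode d))"
  if "ht d <= ?H" "vcand ?n pad (decode d)" for d
  by (rule wins_iff[OF that(2) decode_lengths[OF that(1)] kap pad])
 have p: "2 ^ length (cI (decode d)) <= length pad" if "ht d <= ?H" for d
  using pad_bounds(1)[of ?H] decode_lengths(1)[OF that] pad by (metis order_trans power_increasing one_le_numeral)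
 show ?thesis
 proof
  assume "decide w pad"
  then obtain d where d: "ht d <= ?H" "vcand ?n pad (decode d)" "prt ?n pad (decode d) = w" "wins (sq pad (2 * ?H + 5)) pad (decode d)"
   unfolding decide_def all by blast
  have "strategy_realizable (inst pad (decode d))" using win[OF d(1,2)] d(4) by blast
  moreover have "valid_instance (inst pad (decode d))" by (rule valid_inst[OF d(2) p[OF d(1)]])
  moreover have "encode (inst pad (decode d)) = w" using encode_inst[OF d(2) p[OF d(1)]] d(3) by simp
  ultimately show "w : strategy_realizability" unfolding strategy_realizability_def by blast
 next
  assume "w : strategy_realizability"
  then obtain X where X: "w = encode X" "valid_instance X" "strategy_realizable X" unfolding strategy_realizability_def by blast
  have n: "length (encode X) <= length ?n" by (simp add: X(1) units_def)
  have "length (encode X) <= ?H" by (simp add: X(1) height_bd_def)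
  then have pd: "2 ^ length (encode X) <= length pad"
   using pad_bounds(1)[of ?H] pad by (metis order_trans power_increasing one_le_numeral)
  let ?d = "code (cand_of X)"
  have ht: "ht ?d <= ?H" using ht_code[OF X(2) n pd] by (simp add: X(1) height_bd_def)
  have v: "vcand ?n pad (decode ?d)" unfolding decode_code by (rule vcand_of[OF X(2) n pd])
  have pr: "prt ?n pad (decode ?d) = w" unfolding decode_code X(1) by (rule prt_cand_of[OF X(2) n[unfolded X(1)] pd])
  have "encode (inst pad (decode ?d)) = encode X" using encode_inst[OF v p[OF ht]] pr X(1) by simp
  then have "strategy_realizable (inst pad (decode ?d))"
   using strategy_realizable_cong[OF X(2) valid_inst[OF v p[OF ht]] _ X(3)] by simp
  then have "wins (sq pad (2 * ?H + 5)) pad (decode ?d)" using win[OF ht v] by blast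
  then show "decide w pad" unfolding decide_def all using ht v pr by blast
 qed
qed

section \<open>From programs to Turing machines\<close>

definition ios :: "nat list => nat list => nat list => nat list => store" where
 "ios m r d e = (%_. [])(0 := m, 1 := r, 4 := d, 5 := e)"

lemma S_ios: "S m r = ios m r [] []" by (auto simp: S_def stk_def ios_def)

lemma input_ios: "input_store w = ios (map (%b. if b then 2 else 1) w) [] [] []"
 by (auto simp: input_store_def ios_def)

lemma top_ios [simp]: "top_of (ios m r d e) 0 = first m" "top_of (ios m r d e) (Suc 0) = first r"
 by (auto simp: top_of_def first_def ios_def)

lemma runs_ios:
 "runs (Push 0 a) (ios m r d e) 2 (ios (a # m) r d e)" "runs (Push (Suc 0) a) (ios m r d e) 2 (ios m (a # r) d e)"
 "runs (Push 4 a) (ios m r d e) 2 (ios m r (a # d) e)"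
 "runs (Pop 0) (ios (a # m) r d e) 1 (ios m r d e)" "runs (Pop (Suc 0)) (ios m (a # r) d e) 1 (ios m r d e)"
 "runs Shift (ios m r [] e) 1 (ios m r [] (0 # e))"
proof -
 have P: "i < 5 ==> runs (Push i a) s 2 (s(i := a # s i))" for i s unfolding runs_def using bs_Push by blast
 have Q: "i < 5 ==> s i ~= [] ==> runs (Pop i) s 1 (s(i := tl (s i)))" for i s unfolding runs_def using bs_Pop by blast
 have R: "s 4 = [] ==> runs Shift s 1 (s(5 := 0 # s 5))" for s unfolding runs_def using bs_Shift by blast
 show "runs (Push 0 a) (ios m r d e) 2 (ios (a # m) r d e)" using P[of 0 "ios m r d e"] by (simp add: ios_def fun_upd_twist)
 show "runs (Push (Suc 0) a) (ios m r d e) 2 (ios m (a # r) d e)" using P[of 1 "ios m r d e"] by (simp add: ios_def fun_upd_twist)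
 show "runs (Push 4 a) (ios m r d e) 2 (ios m r (a # d) e)" using P[of 4 "ios m r d e"] by (simp add: ios_def fun_upd_twist)
 show "runs (Pop 0) (ios (a # m) r d e) 1 (ios m r d e)" using Q[of 0 "ios (a # m) r d e"] by (simp add: ios_def fun_upd_twist)
 show "runs (Pop (Suc 0)) (ios m (a # r) d e) 1 (ios m r d e)" using Q[of 1 "ios m (a # r) d e"] by (simp add: ios_def fun_upd_twist)
 show "runs Shift (ios m r [] e) 1 (ios m r [] (0 # e))" using R[of "ios m r [] e"] by (simp add: ios_def fun_upd_twist)
qed

abbreviation raw :: "bool list => nat list" where "raw \<equiv> map (%b. if b then 2 else 1)"

text \<open>Polish notation needs the tail of a list on the stack before its head, so the input is
  first reversed onto stack 1 and the list is then built from its end.\<close>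

definition read_cmd :: cmd where
 "read_cmd = Loop 0 {1, 2} (Cond 0 {1} (Push (Suc 0) 1) (Push (Suc 0) 2) ;; Pop 0) ;; (Push 0 1 ;;
   Loop (Suc 0) {1, 2} (Cond (Suc 0) {1} (Push 0 1) (Push 0 1 ;; (Push 0 1 ;; Push 0 2)) ;; (Push 0 2 ;; Pop (Suc 0))))"

lemma runs_unread:
 "runs (Loop 0 {1, 2} (Cond 0 {1} (Push (Suc 0) 1) (Push (Suc 0) 2) ;; Pop 0)) (ios (raw w) r [] []) (10 * length w + 1) (ios [] (rev (raw w) @ r) [] [])"
proof (induction w arbitrary: r)
 case Nil then show ?case by (simp, intro runs_LoopF[simplified]) auto
next
 case (Cons b w)
 have 1: "runs (Cond 0 {1} (Push (Suc 0) 1) (Push (Suc 0) 2)) (ios (raw (b # w)) r [] []) 3 (ios (raw (b # w)) ((if b then 2 else 1) # r) [] [])"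
 proof (cases b)
  case True
  then have "runs (Cond 0 {1} (Push (Suc 0) 1) (Push (Suc 0) 2)) (ios (raw (b # w)) r [] []) (Suc 2) (ios (raw (b # w)) (2 # r) [] [])"
   by (intro runs_CondF runs_ios) auto
  then show ?thesis using True by simp
 next
  case False
  then have "runs (Cond 0 {1} (Push (Suc 0) 1) (Push (Suc 0) 2)) (ios (raw (b # w)) r [] []) (Suc 2) (ios (raw (b # w)) (1 # r) [] [])"
   by (intro runs_CondT runs_ios) auto
  then show ?thesis using False by simp
 qed
 have 2: "runs (Pop 0) (ios (raw (b # w)) ((if b then 2 else 1) # r) [] []) 1 (ios (raw w) ((if b then 2 else 1) # r) [] [])"
  using runs_ios(4) by simp
 have "runs (Loop 0 {1, 2} (Cond 0 {1} (Push (Suc 0) 1) (Push (Suc 0) 2) ;; Pop 0)) (ios (raw (b # w)) r [] [])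
   (Suc (Suc (3 + 1) + (10 * length w + 1))) (ios [] (rev (raw w) @ ((if b then 2 else 1) # r)) [] [])"
  by (rule runs_LoopT[OF _ _ runs_Seq[OF 1 2] Cons.IH]) auto
 from runs_mono[OF this, of "10 * length (b # w) + 1"] show ?case by simp
qed

lemma runs_build:
 "runs (Loop (Suc 0) {1, 2} (Cond (Suc 0) {1} (Push 0 1) (Push 0 1 ;; (Push 0 1 ;; Push 0 2)) ;; (Push 0 2 ;; Pop (Suc 0))))
   (ios (ser (enc v)) (rev (raw w)) [] []) (20 * length w + 1) (ios (ser (enc (w @ v))) [] [] [])"
proof (induction w arbitrary: v rule: rev_induct)
 case Nil then show ?case by (simp, intro runs_LoopF[simplified]) auto
next
 case (snoc b w)
 have 1: "runs (Cond (Suc 0) {1} (Push 0 1) (Push 0 1 ;; (Push 0 1 ;; Push 0 2))) (ios (ser (enc v)) (rev (raw (w @ [b]))) [] []) 9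
   (ios (ser (enc b) @ ser (enc v)) (rev (raw (w @ [b]))) [] [])"
 proof (cases b)
  case True
  then have "runs (Cond (Suc 0) {1} (Push 0 1) (Push 0 1 ;; (Push 0 1 ;; Push 0 2))) (ios (ser (enc v)) (rev (raw (w @ [b]))) [] []) (Suc (Suc (2 + Suc (2 + 2))))
    (ios (2 # 1 # 1 # ser (enc v)) (rev (raw (w @ [b]))) [] [])"
   by - (rule runs_CondF, simp, simp, (rule runs_Seq runs_ios)+)
  then show ?thesis using True by (simp add: enc_bool_def bool_dt_def)
 next
  case False
  then have "runs (Cond (Suc 0) {1} (Push 0 1) (Push 0 1 ;; (Push 0 1 ;; Push 0 2))) (ios (ser (enc v)) (rev (raw (w @ [b]))) [] []) (Suc 2)
    (ios (1 # ser (enc v)) (rev (raw (w @ [b]))) [] [])"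
   by (intro runs_CondT runs_ios) auto
  then show ?thesis using False runs_mono by (fastforce simp add: enc_bool_def bool_dt_def)
 qed
 have 2: "runs (Push 0 2 ;; Pop (Suc 0)) (ios (ser (enc b) @ ser (enc v)) (rev (raw (w @ [b]))) [] []) (Suc (2 + 1))
   (ios (ser (enc (b # v))) (rev (raw w)) [] [])"
 proof (rule runs_Seq)
  show "runs (Push 0 2) (ios (ser (enc b) @ ser (enc v)) (rev (raw (w @ [b]))) [] []) 2 (ios (ser (enc (b # v))) (rev (raw (w @ [b]))) [] [])"
   using runs_ios(1) by simp
  show "runs (Pop (Suc 0)) (ios (ser (enc (b # v))) (rev (raw (w @ [b]))) [] []) 1 (ios (ser (enc (b # v))) (rev (raw w)) [] [])"
   using runs_ios(5) by simp
 qed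
 have "runs (Loop (Suc 0) {1, 2} (Cond (Suc 0) {1} (Push 0 1) (Push 0 1 ;; (Push 0 1 ;; Push 0 2)) ;; (Push 0 2 ;; Pop (Suc 0))))
   (ios (ser (enc v)) (rev (raw (w @ [b]))) [] []) (Suc (Suc (9 + Suc (2 + 1)) + (20 * length w + 1))) (ios (ser (enc (w @ (b # v)))) [] [] [])"
  by (rule runs_LoopT[OF _ _ runs_Seq[OF 1 2] snoc.IH]) auto
 from runs_mono[OF this, of "20 * length (w @ [b]) + 1"] show ?case by simp
qed

lemma runs_read: "runs read_cmd (input_store w) (30 * length w + 10) (S (ser (enc w)) [])"
proof -
 have 2: "runs (Push 0 1) (ios [] (rev (raw w)) [] []) 2 (ios (ser (enc ([] :: bool list))) (rev (raw w)) [] [])"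
  using runs_ios(1) by simp
 have "runs read_cmd (input_store w) (Suc ((10 * length w + 1) + Suc (2 + (20 * length w + 1)))) (ios (ser (enc (w @ []))) [] [] [])"
  unfolding read_cmd_def input_ios
  by (rule runs_Seq[OF _ runs_Seq[OF 2 runs_build]]) (use runs_unread[of w "[]"] in simp)
 then show ?thesis unfolding S_ios using runs_mono by fastforce
qed

text \<open>The boundary of the output tape can move only while stack 4 is empty, so it is shifted
  once per bit while the bits wait in reverse order on stack 1. Pushing them afterwards ends exactly
  at cell 0.\<close>

definition write_cmd :: cmd where
 "write_cmd = Loop 0 {2} (Pop 0 ;; (Cond 0 {1} (Push (Suc 0) 1 ;; Pop 0) (Push (Suc 0) 2 ;; (Pop 0 ;; (Pop 0 ;; Pop 0))) ;; Shift)) ;;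
   Loop (Suc 0) {1, 2} (Cond (Suc 0) {1} (Push 4 1) (Push 4 2) ;; Pop (Suc 0))"

lemma runs_unbuild:
 "runs (Loop 0 {2} (Pop 0 ;; (Cond 0 {1} (Push (Suc 0) 1 ;; Pop 0) (Push (Suc 0) 2 ;; (Pop 0 ;; (Pop 0 ;; Pop 0))) ;; Shift)))
   (ios (ser (enc w)) r [] e) (20 * length w + 1) (ios [1] (rev (raw w) @ r) [] (replicate (length w) 0 @ e))"
proof (induction w arbitrary: r e)
 case Nil then show ?case by (simp, intro runs_LoopF[simplified]) auto
next
 case (Cons b w)
 have 1: "runs (Pop 0) (ios (ser (enc (b # w))) r [] e) 1 (ios (ser (enc b) @ ser (enc w)) r [] e)" using runs_ios(4) by simp
 have 2: "runs (Cond 0 {1} (Push (Suc 0) 1 ;; Pop 0) (Push (Suc 0) 2 ;; (Pop 0 ;; (Pop 0 ;; Pop 0)))) (ios (ser (enc b) @ ser (enc w)) r [] e) 9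
   (ios (ser (enc w)) ((if b then 2 else 1) # r) [] e)"
 proof (cases b)
  case True
  then have "runs (Cond 0 {1} (Push (Suc 0) 1 ;; Pop 0) (Push (Suc 0) 2 ;; (Pop 0 ;; (Pop 0 ;; Pop 0)))) (ios (2 # 1 # 1 # ser (enc w)) r [] e)
   (Suc (Suc (2 + Suc (1 + Suc (1 + 1))))) (ios (ser (enc w)) (2 # r) [] e)"
   by - (rule runs_CondF, simp, simp, (rule runs_Seq runs_ios)+)
  then show ?thesis using True by (simp add: enc_bool_def bool_dt_def)
 next
  case False
  then have "runs (Cond 0 {1} (Push (Suc 0) 1 ;; Pop 0) (Push (Suc 0) 2 ;; (Pop 0 ;; (Pop 0 ;; Pop 0)))) (ios (1 # ser (enc w)) r [] e)
   (Suc (Suc (2 + 1))) (ios (ser (enc w)) (1 # r) [] e)"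
   by - (rule runs_CondT, simp, simp, (rule runs_Seq runs_ios)+)
  then show ?thesis using False runs_mono by (fastforce simp add: enc_bool_def bool_dt_def)
 qed
 note 3 = runs_ios(6)[of "ser (enc w)" "(if b then 2 else 1) # r" e]
 have "runs (Loop 0 {2} (Pop 0 ;; (Cond 0 {1} (Push (Suc 0) 1 ;; Pop 0) (Push (Suc 0) 2 ;; (Pop 0 ;; (Pop 0 ;; Pop 0))) ;; Shift)))
   (ios (ser (enc (b # w))) r [] e) (Suc (Suc (1 + Suc (9 + 1)) + (20 * length w + 1)))
   (ios [1] (rev (raw w) @ ((if b then 2 else 1) # r)) [] (replicate (length w) 0 @ (0 # e)))"
  by (rule runs_LoopT[OF _ _ runs_Seq[OF 1 runs_Seq[OF 2 3]] Cons.IH]) auto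
 from runs_mono[OF this, of "20 * length (b # w) + 1"] show ?case
  by (simp add: replicate_app_Cons_same)
qed

lemma runs_output:
 "runs (Loop (Suc 0) {1, 2} (Cond (Suc 0) {1} (Push 4 1) (Push 4 2) ;; Pop (Suc 0)))
   (ios m (rev (raw w)) d e) (10 * length w + 1) (ios m [] (raw w @ d) e)"
proof (induction w arbitrary: d rule: rev_induct)
 case Nil then show ?case by (simp, intro runs_LoopF[simplified]) auto
next
 case (snoc b w)
 have 1: "runs (Cond (Suc 0) {1} (Push 4 1) (Push 4 2)) (ios m (rev (raw (w @ [b]))) d e) 3 (ios m (rev (raw (w @ [b]))) ((if b then 2 else 1) # d) e)"
 proof (cases b)
  case True
  then have "runs (Cond (Suc 0) {1} (Push 4 1) (Push 4 2)) (ios m (rev (raw (w @ [b]))) d e) (Suc 2) (ios m (rev (raw (w @ [b]))) (2 # d) e)"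
   by (intro runs_CondF runs_ios) auto
  then show ?thesis using True by simp
 next
  case False
  then have "runs (Cond (Suc 0) {1} (Push 4 1) (Push 4 2)) (ios m (rev (raw (w @ [b]))) d e) (Suc 2) (ios m (rev (raw (w @ [b]))) (1 # d) e)"
   by (intro runs_CondT runs_ios) auto
  then show ?thesis using False by simp
 qed
 have 2: "runs (Pop (Suc 0)) (ios m (rev (raw (w @ [b]))) ((if b then 2 else 1) # d) e) 1 (ios m (rev (raw w)) ((if b then 2 else 1) # d) e)"
  using runs_ios(5) by simp
 have "runs (Loop (Suc 0) {1, 2} (Cond (Suc 0) {1} (Push 4 1) (Push 4 2) ;; Pop (Suc 0))) (ios m (rev (raw (w @ [b]))) d e)
   (Suc (Suc (3 + 1) + (10 * length w + 1))) (ios m [] (raw w @ ((if b then 2 else 1) # d)) e)"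
  by (rule runs_LoopT[OF _ _ runs_Seq[OF 1 2] snoc.IH]) auto
 from runs_mono[OF this, of "10 * length (w @ [b]) + 1"] show ?case by simp
qed

lemma runs_write: "runs write_cmd (S (ser (enc w)) []) (30 * length w + 10) (ios [1] [] (raw w) (replicate (length w) 0))"
proof -
 have "runs write_cmd (S (ser (enc w)) []) (Suc ((20 * length w + 1) + (10 * length w + 1))) (ios [1] [] (raw w @ []) (replicate (length w) 0))"
  unfolding write_cmd_def S_ios
  by (rule runs_Seq[OF _ runs_output]) (use runs_unbuild[of w "[]" "[]"] in simp)
 then show ?thesis using runs_mono by fastforce
qed

lemma sz_word: "sz (w :: bool list) <= 4 * length w + 1"
 using sz_le_bound[of w 3] sz_bool by simp

lemma pb_bigo:
 assumes "pb t" shows "EX k. (%n. real (t n)) : O(%n. real (n ^ k))"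
proof -
 obtain k where k: "!!n. t n <= (n + 2) ^ k" using assms unfolding pb_def by blast
 have "(%n. real (t n)) : O(%n. real (n ^ k))"
 proof (rule bigoI[where c = "3 ^ k"])
  show "\<forall>\<^sub>F n in sequentially. norm (real (t n)) <= 3 ^ k * norm (real (n ^ k))"
  proof (rule eventually_sequentiallyI[of 1])
   fix n :: nat assume "1 <= n"
   then have "(n + 2) ^ k <= (3 * n) ^ k" by (intro power_mono) auto
   then have "t n <= 3 ^ k * n ^ k" using k[of n] unfolding power_mult_distrib by linarith
   then have "real (t n) <= real (3 ^ k * n ^ k)" by (simp only: of_nat_le_iff)
   then show "norm (real (t n)) <= 3 ^ k * norm (real (n ^ k))" by simp
  qed
 qed
 then show ?thesis ..
qed

lemma poly_time_PT:
 assumes f: "PT f" shows "poly_time_computable f"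
proof -
 obtain c k where c: "comp_in c f (%x. (sz x + 2) ^ k)" "!!x. sz (f x) <= (sz x + 2) ^ k"
  using f unfolding PT_def by blast
 define t where "t = (%n. Suc ((30 * n + 10) + Suc ((4 * n + 1 + 2) ^ k + (30 * (4 * n + 1 + 2) ^ k + 10))))"
 have "pb t" unfolding t_def by (intro pb_intros)
 have r: "runs (read_cmd ;; (c ;; write_cmd)) (input_store w) (t (length w)) (ios [1] [] (raw (f w)) (replicate (length (f w)) 0))" for w
 proof -
  have p: "(sz w + 2) ^ k <= (4 * length w + 1 + 2) ^ k" using sz_word[of w] by (intro power_mono) auto
  have "runs c (S (ser (enc w) @ []) []) ((sz w + 2) ^ k) (S (ser (enc (f w)) @ []) [])" by (rule comp_in_runs[OF c(1)])
  then have 2: "runs c (S (ser (enc w)) []) ((4 * length w + 1 + 2) ^ k) (S (ser (enc (f w))) [])" using runs_mono p by simp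
  have "length (f w) <= (4 * length w + 1 + 2) ^ k"
   using length_le_sz[of "f w"] c(2)[of w] p by linarith
  then have "runs write_cmd (S (ser (enc (f w))) []) (30 * (4 * length w + 1 + 2) ^ k + 10) (ios [1] [] (raw (f w)) (replicate (length (f w)) 0))"
   by (intro runs_mono[OF runs_write]) simp
  from runs_Seq[OF runs_read runs_Seq[OF 2 this]] show ?thesis by (simp only: t_def)
 qed
 have wf: "wf_cmd (read_cmd ;; (c ;; write_cmd))" using c(1) by (simp add: comp_in_def read_cmd_def write_cmd_def)
 obtain M where "turing_machine M" "computes_in_time M f t"
  using computes_of_cmd[OF wf r, where f = f] by (auto simp: ios_def)
 then show ?thesis using pb_bigo[OF \<open>pb t\<close>] unfolding poly_time_computable_def by blast
qed

subsection \<open>Membership in doubly exponential time\<close>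

lemma sz_units: "sz (l :: unit list) = 2 * length l + 1"
 by (induction l) (auto simp: sz_def enc_unit_def)

lemma fold_sq: "length (fold (%_ acc. concat (map (%_. acc) acc)) ys (acc :: unit list)) = length acc ^ (2 ^ length ys)"
proof (induction ys arbitrary: acc)
 case (Cons a ys)
 have cc: "length (concat (map (%_. l) k)) = length k * length l" for l k :: "unit list" by (induction k) auto
 show ?case unfolding fold_simps Cons cc by (simp add: power_mult power2_eq_square power_mult_distrib)
qed simp

text \<open>The padding has length \<open>2 ^ (2 ^ (9 * n + 60))\<close>, because
  \<open>3 * (3 * n + 18) + 6 = 9 * n + 60\<close>. A polynomial of degree \<open>k\<close> in it
  increases the inner exponent by at most \<open>2 * k\<close>, and the sum is below
  \<open>n ^ 2\<close> for \<open>n >= 2 * k + 69\<close>.\<close>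

lemma doubly_exp_bigo:
 assumes "pb g" shows "EX k. (%n. real (g (2 ^ (2 ^ (9 * n + 60))))) : O(%n. real (2 ^ (2 ^ (n ^ k))))"
proof -
 obtain k where k: "!!q. g q <= (q + 2) ^ k" using assms unfolding pb_def by blast
 have "(%n. real (g (2 ^ (2 ^ (9 * n + 60))))) : O(%n. real (2 ^ (2 ^ (n ^ 2))))"
 proof (rule bigoI[where c = 1], rule eventually_sequentiallyI[of "2 * k + 69"])
  fix n :: nat assume n: "2 * k + 69 <= n"
  let ?Q = "(2::nat) ^ (2 ^ (9 * n + 60))"
  have "(2::nat) ^ 1 <= ?Q" by (intro power_increasing) auto
  then have "2 <= ?Q" by simp
  then have "?Q + 2 <= ?Q * ?Q" using mult_le_mono1[of 2 ?Q ?Q] by linarith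
  then have "(?Q + 2) ^ k <= (?Q * ?Q) ^ k" by (rule power_mono) simp
  also have "... = 2 ^ (2 ^ (9 * n + 60) * (2 * k))" unfolding power2_eq_square[symmetric] by (simp only: power_mult)
  also have "... <= 2 ^ (2 ^ (n ^ 2))"
  proof (rule power_increasing)
   have "2 * k <= 2 ^ (2 * k)" using less_two_power[of "2 * k"] by linarith
   then have "2 ^ (9 * n + 60) * (2 * k) <= 2 ^ (9 * n + 60) * 2 ^ (2 * k)" by (rule mult_le_mono2)
   also have "... = 2 ^ (9 * n + 60 + 2 * k)" by (simp only: power_add)
   also have "... <= 2 ^ (n ^ 2)"
   proof (rule power_increasing)
    have "n * (2 * k + 69) <= n * n" using n by (intro mult_le_mono) auto
    moreover have "n * (2 * k + 69) = n * (2 * k) + 69 * n" by (simp add: algebra_simps)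
    moreover have "1 * (2 * k) <= n * (2 * k)" using n by (intro mult_le_mono1) simp
    ultimately show "9 * n + 60 + 2 * k <= n ^ 2" using n unfolding power2_eq_square by linarith
   qed simp
   finally show "2 ^ (9 * n + 60) * (2 * k) <= 2 ^ (n ^ 2)" .
  qed simp
  finally have "g ?Q <= 2 ^ (2 ^ (n ^ 2))" using k[of ?Q] by linarith
  then have "real (g ?Q) <= real (2 ^ (2 ^ (n ^ 2)))" by (simp only: of_nat_le_iff)
  then show "norm (real (g ?Q)) <= 1 * norm (real (2 ^ (2 ^ (n ^ 2))))" by simp
 qed
 then show ?thesis ..
qed

text \<open>The only part that is not polynomial is the production of the padding. It is an explicit
  loop of \<open>3 * height_bd w + 6\<close> squarings starting from two units, timed directly; the
  remaining program is polynomial in the padding and the word.\<close>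

lemma strategy_realizability_in_TWO_EXPTIME: "strategy_realizability : TWO_EXPTIME"
proof -
 define f0 :: "bool list => unit list * (unit list * bool list)" where
  "f0 = (%w. (units (3 * height_bd w + 6), ([(), ()], w)))"
 define sq1 :: "bool list => unit => unit list => unit list" where "sq1 = (%_ _ acc. concat (map (%_. acc) acc))"
 have "PT f0" unfolding f0_def by (intro pt)
 then obtain c0 k0 where c0: "comp_in c0 f0 (%x. (sz x + 2) ^ k0)" unfolding PT_def by blast
 have "PT (fold_step sq1)" unfolding fold_step_def sq1_def by (intro pt)
 then obtain c1 k1 where c1: "comp_in c1 (fold_step sq1) (%x. (sz x + 2) ^ k1)" unfolding PT_def by blast
 have "PT (%p. decide (snd p) (fst p))" by (intro PT_decide pt)
 then obtain c2 k2 where c2: "comp_in c2 (%p. decide (snd p) (fst p)) (%x. (sz x + 2) ^ k2)" unfolding PT_def by blast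
 define g where "g = (%q. Suc ((30 * q + 10) + Suc ((4 * q + 3) ^ k0 + Suc (1 + Suc ((q * ((8 * q + 10) ^ k1 + 10) + 1) + Suc (1 + (8 * q + 10) ^ k2))))))"
 define c where "c = read_cmd ;; (c0 ;; (Pop 0 ;; (loop_cmd c1 ;; (Pop 0 ;; c2))))"
 have r: "runs c (input_store w) (g (2 ^ (2 ^ (9 * length w + 60)))) (S (ser (enc (w : strategy_realizability))) [])" for w
 proof -
  define P where "P = 9 * length w + 60"
  define Q where "Q = (2::nat) ^ (2 ^ P)"
  have P: "3 * height_bd w + 6 = P" by (simp add: P_def height_bd_def)
  have "P < 2 ^ P" "(2::nat) ^ P < Q" unfolding Q_def by (rule less_two_power)+
  then have PQ: "P <= Q" by linarith
  then have nQ: "length w <= Q" by (simp add: P_def)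
  have s: "sz w <= 4 * Q + 1" using sz_word[of w] nQ by linarith
  define l where "l = units P"
  define a0 :: "unit list" where "a0 = [(), ()]"
  define pad where "pad = fold (sq1 w) l a0"
  have ll: "length l = P" by (simp add: l_def units_def)
  have acc: "length (fold (sq1 w) ys a0) <= Q" if "length ys <= P" for ys
   unfolding sq1_def fold_sq Q_def a0_def using that by (simp add: power_increasing numeral_2_eq_2[symmetric] del: One_nat_def)
  have padl: "length pad = pad_len (height_bd w)"
   unfolding pad_def sq1_def fold_sq ll pad_len_def P[symmetric] a0_def by (simp add: numeral_2_eq_2[symmetric] del: One_nat_def)
  have padQ: "length pad <= Q" unfolding pad_def by (rule acc) (simp add: ll)
  have 1: "runs c0 (S (ser (enc w)) []) ((4 * Q + 3) ^ k0) (S (2 # ser (enc l) @ ser (enc (a0, w))) [])"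
  proof -
   have "runs c0 (S (ser (enc w) @ []) []) ((sz w + 2) ^ k0) (S (ser (enc (f0 w)) @ []) [])" by (rule comp_in_runs[OF c0])
   moreover have "(sz w + 2) ^ k0 <= (4 * Q + 3) ^ k0" using s by (intro power_mono) auto
   moreover have "ser (enc (f0 w)) = 2 # ser (enc l) @ ser (enc (a0, w))" unfolding f0_def P by (simp add: enc_Pair[of "units P"] l_def a0_def)
   ultimately show ?thesis using runs_mono by simp
  qed
  have 2: "runs (Pop 0) (S (2 # ser (enc l) @ ser (enc (a0, w))) []) 1 (S (ser (enc l) @ ser (enc (a0, w)) @ []) [])"
   using runs_Pop(1) by (simp add: S_def)
  have 3: "runs (loop_cmd c1) (S (ser (enc l) @ ser (enc (a0, w)) @ []) []) (Q * ((8 * Q + 10) ^ k1 + 10) + 1)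
    (S (ser (enc ([] :: unit list)) @ ser (enc (pad, w)) @ []) [])"
  proof -
   have "runs (loop_cmd c1) (S (ser (enc l) @ ser (enc (a0, w)) @ []) []) (length l * ((8 * Q + 10) ^ k1 + 10) + 1)
    (S (ser (enc ([] :: unit list)) @ ser (enc (fold (sq1 w) l a0, w)) @ []) [])"
   proof (rule runs_fold[OF c1])
    fix ys zs assume y: "l = ys @ zs"
    then have yz: "length ys + length zs = P" using ll by simp
    have "length (fold (sq1 w) ys a0) <= Q" using yz by (intro acc) simp
    then have "sz (zs, fold (sq1 w) ys a0, w) + 2 <= 8 * Q + 10" using yz PQ s by (simp add: sz_units)
    then show "(sz (zs, fold (sq1 w) ys a0, w) + 2) ^ k1 <= (8 * Q + 10) ^ k1" by (intro power_mono) auto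
   qed
   moreover have "length l * ((8 * Q + 10) ^ k1 + 10) + 1 <= Q * ((8 * Q + 10) ^ k1 + 10) + 1" using PQ ll by simp
   ultimately show ?thesis unfolding pad_def using runs_mono by blast
  qed
  have 4: "runs (Pop 0) (S (ser (enc ([] :: unit list)) @ ser (enc (pad, w)) @ []) []) 1 (S (ser (enc (pad, w)) @ []) [])"
   using runs_Pop(1) by (simp add: S_def)
  have 5: "runs c2 (S (ser (enc (pad, w)) @ []) []) ((8 * Q + 10) ^ k2) (S (ser (enc (w : strategy_realizability))) [])"
  proof -
   have "runs c2 (S (ser (enc (pad, w)) @ []) []) ((sz (pad, w) + 2) ^ k2) (S (ser (enc (decide (snd (pad, w)) (fst (pad, w)))) @ []) [])"
    by (rule comp_in_runs[OF c2])
   moreover have "(sz (pad, w) + 2) ^ k2 <= (8 * Q + 10) ^ k2" using s padQ by (intro power_mono) (auto simp: sz_units)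
   moreover have "decide w pad \<longleftrightarrow> w : strategy_realizability" by (rule decide_iff[OF padl])
   ultimately show ?thesis using runs_mono by simp
  qed
  have 0: "runs read_cmd (input_store w) (30 * Q + 10) (S (ser (enc w)) [])"
   by (rule runs_mono[OF runs_read]) (use nQ in simp)
  show ?thesis unfolding c_def P_def[symmetric] Q_def[symmetric] g_def
   by (rule runs_Seq[OF 0 runs_Seq[OF 1 runs_Seq[OF 2 runs_Seq[OF 3 runs_Seq[OF 4 5]]]]])
 qed
 have wf: "wf_cmd c" using c0 c1 c2 by (simp add: c_def comp_in_def read_cmd_def loop_cmd_def)
 have L: "w : strategy_realizability \<longleftrightarrow> top_of (S (ser (enc (w : strategy_realizability))) []) 0 : {2}" for w
  by (simp add: S_def enc_bool_def bool_dt_def)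
 obtain M where M: "turing_machine M" "decides_in_time M strategy_realizability (%n. g (2 ^ (2 ^ (9 * n + 60))) + 3)"
  using decides_of_cmd[OF wf r L] by blast
 have "pb (%q. g q + 3)" unfolding g_def by (intro pb_intros)
 from doubly_exp_bigo[OF this] M show ?thesis unfolding TWO_EXPTIME_def DTIME_def by blast
qed

section \<open>Computations on cyclic tapes\<close>

text \<open>Halting states reproduce themselves, so one rule describes all steps of the run,
  including those after halting.\<close>

definition delt :: "tm => nat => nat list => nat * (nat * move) list" where
 "delt M q xs = (if q = accept M \<or> q = reject M then (q, map (%x. (x, Stay)) xs) else delta M q xs)"

lemma step_delt: "step M C = (fst (delt M (fst C) (reads (snd C))), map2 act (snd C) (snd (delt M (fst C) (reads (snd C)))))"
proof (cases "halted M C")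
 case True
 have "map2 act ts (map (%x. (x, Stay)) (reads ts)) = ts" for ts
  by (rule nth_equalityI) (auto simp: reads_def act_def split: prod.splits)
 then show ?thesis using True by (auto simp: step_def halted_def delt_def)
next
 case False
 then show ?thesis by (auto simp: step_def halted_def delt_def reads_def case_prod_beta)
qed

definition shift_of :: "move => int" where "shift_of d = (case d of Left => -1 | Stay => 0 | Right => 1)"

lemma move_shift: "move_head d p = p + shift_of d" by (cases d) (auto simp: shift_of_def)

text \<open>The representative modulo \<open>2 * N\<close> in the window from \<open>-N\<close> to
  \<open>N - 1\<close>. The heads never leave this window, so the tapes can be closed to cycles, and
  with \<open>2 * N = 2 ^ m\<close> an offset from the head is an \<open>m\<close>-bit number that
  may wrap around.\<close>

definition rep :: "nat => int => int" where "rep N z = (z + int N) mod (2 * int N) - int N"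

lemma rep_eq: "N > 0 ==> rep N z = rep N z' \<longleftrightarrow> (z - z') mod (2 * int N) = 0"
 using mod_eq_dvd_iff[of "z + int N" "2 * int N" "z' + int N"] by (simp add: rep_def dvd_eq_mod_eq_0)

lemma rep_id: "- int N <= z ==> z < int N ==> rep N z = z" by (simp add: rep_def)

locale tm_run =
 fixes M :: tm and w :: "bool list" and N t0 :: nat
 assumes tm: "turing_machine M" and halts: "halted M (run M t0 w)" and N: "t0 < N" "length w <= N"
begin

abbreviation "k \<equiv> num_tapes M"
definition "st t = fst (run M t w)"
definition "hd_pos t i = snd (snd (run M t w) ! i)"
definition "rds t = reads (snd (run M t w))"
definition "cont t i z = fst (snd (run M t w) ! i) (rep N z)"
abbreviation "dlt t \<equiv> delt M (st t) (rds t)"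

lemma run_Suc: "run M (Suc t) w = (fst (dlt t), map2 act (snd (run M t w)) (snd (dlt t)))"
 unfolding st_def rds_def using step_delt[of M "run M t w"] by (simp add: run_def)

lemma inv: "st t < num_states M & length (snd (run M t w)) = k & (ALL i<k. ALL z. fst (snd (run M t w) ! i) z < num_syms M)"
 and dlt_wf: "fst (dlt t) < num_states M" "length (snd (dlt t)) = k" "i < k ==> fst (snd (dlt t) ! i) < num_syms M"
 and rds_wf: "rds t : tuples k {..<num_syms M}"
proof -
 have S: "num_syms M >= 3" "k >= 1" using tm by (auto simp: turing_machine_def)
 have rds: "rds t : tuples k {..<num_syms M}"
  if "length (snd (run M t w)) = k" "ALL i<k. ALL z. fst (snd (run M t w) ! i) z < num_syms M" for t
  using that by (auto simp: rds_def reads_def tuples_def in_set_conv_nth split: prod.splits) (metis fst_conv)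
 have dw: "fst (delt M q xs) < num_states M & snd (delt M q xs) : tuples k ({..<num_syms M} \<times> UNIV)"
  if "q < num_states M" "xs : tuples k {..<num_syms M}" for q xs
  using tm that unfolding turing_machine_def delt_def by (auto simp: tuples_def)
 have inv: "st t < num_states M & length (snd (run M t w)) = k & (ALL i<k. ALL z. fst (snd (run M t w) ! i) z < num_syms M)" for t
 proof (induction t)
  case 0
  have "word_contents v z < num_syms M" for v z using S by (auto simp: word_contents_def)
  then show ?case using tm S by (auto simp: st_def run_def initial_def turing_machine_def nth_Cons' nth_replicate)
 next
  case (Suc t)
  have d: "fst (dlt t) < num_states M" "snd (dlt t) : tuples k ({..<num_syms M} \<times> UNIV)"
   using dw[of "st t" "rds t"] rds[of t] Suc by auto
  have "fst (snd (run M (Suc t) w) ! i) z < num_syms M" if "i < k" for i z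
  proof -
   have "snd (dlt t) ! i : {..<num_syms M} \<times> UNIV" using d(2) that by (auto simp: tuples_def)
   then show ?thesis using that d(2) Suc unfolding run_Suc
    by (auto simp: tuples_def act_def split: prod.splits)
  qed
  then show ?case using Suc d unfolding st_def[of "Suc t"] run_Suc by (auto simp: tuples_def)
 qed
 show "st t < num_states M & length (snd (run M t w)) = k & (ALL i<k. ALL z. fst (snd (run M t w) ! i) z < num_syms M)" by (rule inv)
 show r: "rds t : tuples k {..<num_syms M}" using rds inv by blast
 have d: "fst (dlt t) < num_states M" "snd (dlt t) : tuples k ({..<num_syms M} \<times> UNIV)" using dw[OF _ r] inv by auto
 show "fst (dlt t) < num_states M" "length (snd (dlt t)) = k" "i < k ==> fst (snd (dlt t) ! i) < num_syms M"
  using d by (auto simp: tuples_def) (metis SigmaE fst_conv lessThan_iff nth_mem subsetD)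
qed

lemma st_Suc: "st (Suc t) = fst (dlt t)" by (simp add: st_def[of "Suc t"] run_Suc)

lemma hd_Suc: "i < k ==> hd_pos (Suc t) i = hd_pos t i + shift_of (snd (snd (dlt t) ! i))"
 using inv[of t] dlt_wf(2)[of t] unfolding hd_pos_def run_Suc by (auto simp: act_def move_shift split: prod.splits)

lemma stable: "t0 <= t ==> run M t w = run M t0 w"
proof (induction t rule: dec_induct)
 case (step t)
 have "run M (Suc t) w = Defs.step M (run M t w)" by (simp add: run_def)
 then show ?case unfolding step.IH using halts by (simp add: Defs.step_def)
qed simp

lemma hd_bound: assumes "i < k" shows "\<bar>hd_pos t i\<bar> < int N"
proof -
 have b: "\<bar>hd_pos t i\<bar> <= int t" for t
 proof (induction t)
  case 0
  show ?case using assms by (auto simp: hd_pos_def run_def initial_def nth_Cons')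
 next
  case (Suc t)
  have "\<bar>shift_of (snd (snd (dlt t) ! i))\<bar> <= 1" by (auto simp: shift_of_def split: move.split)
  then show ?case using Suc unfolding hd_Suc[OF assms] of_nat_Suc by linarith
 qed
 show ?thesis
 proof (cases "t <= t0")
  case True then show ?thesis using b[of t] N by linarith
 next
  case False
  then have "hd_pos t i = hd_pos t0 i" using stable[of t] by (simp add: hd_pos_def)
  then show ?thesis using b[of t0] N by linarith
 qed
qed

lemma rds_nth: "i < k ==> rds t ! i = cont t i (hd_pos t i)"
 using inv[of t] hd_bound[of i t] by (auto simp: rds_def reads_def cont_def hd_pos_def rep_id split: prod.splits)

lemma cont_Suc:
 assumes i: "i < k"
 shows "cont (Suc t) i z = (if (z - hd_pos t i) mod (2 * int N) = 0 then fst (snd (dlt t) ! i) else cont t i z)"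
proof -
 have "rep N z = hd_pos t i \<longleftrightarrow> (z - hd_pos t i) mod (2 * int N) = 0"
  using rep_id[of N "hd_pos t i"] hd_bound[OF i, of t] rep_eq[of N z "hd_pos t i"] N by auto
 then show ?thesis
  using i inv[of t] dlt_wf(2)[of t] unfolding cont_def run_Suc hd_pos_def by (auto simp: act_def split: prod.splits)
qed

text \<open>Offsets are relative to the moving head: offset \<open>d\<close> after the step is
  offset \<open>d\<close> plus the shift before it. The cell was written in this step iff the latter
  is 0 on the cycle.\<close>

lemma cont_Suc_off: "i < k ==> cont (Suc t) i (hd_pos (Suc t) i + d) =
 (if (d + shift_of (snd (snd (dlt t) ! i))) mod (2 * int N) = 0 then fst (snd (dlt t) ! i)
  else cont t i (hd_pos t i + (d + shift_of (snd (snd (dlt t) ! i)))))"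
 unfolding cont_Suc hd_Suc by (simp add: algebra_simps)

lemma cont_mod: "cont t i (z mod (2 * int N)) = cont t i z" "d mod (2 * int N) = d' mod (2 * int N) ==> cont t i (z + d) = cont t i (z + d')"
proof -
 have m: "x mod (2 * int N) = y mod (2 * int N) ==> cont t i x = cont t i y" for x y
  unfolding cont_def rep_def by (metis mod_add_left_eq)
 show "cont t i (z mod (2 * int N)) = cont t i z" by (rule m) simp
 assume "d mod (2 * int N) = d' mod (2 * int N)"
 then show "cont t i (z + d) = cont t i (z + d')" by (intro m) (metis mod_add_right_eq)
qed

lemma start_run: "st 0 = start M" "i < k ==> hd_pos 0 i = 0"
 "i < k ==> d < 2 * N ==> cont 0 i (int d) = (if i = 0 & d < length w then if w ! d then 2 else 1 else 0)"
proof -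
 show "st 0 = start M" "i < k ==> hd_pos 0 i = 0" by (auto simp: st_def hd_pos_def run_def initial_def nth_Cons')
 assume i: "i < k" and d: "d < 2 * N"
 \<comment> \<open>Offsets from \<open>N\<close> on denote cells left of the origin. These are
   blank, and \<open>length w <= N\<close> keeps the input out of that half.\<close>
 have "rep N (int d) = (if d < N then int d else int d - 2 * int N)"
 proof (cases "d < N")
  case False
  have "(int d + int N) mod (2 * int N) = (int d - int N + 1 * (2 * int N)) mod (2 * int N)" by (rule arg_cong) simp
  also have "... = int d - int N" unfolding mod_mult_self1 using False d by simp
  finally show ?thesis using False by (simp add: rep_def)
 qed (use rep_id[of N "int d"] in simp)
 then show "cont 0 i (int d) = (if i = 0 & d < length w then if w ! d then 2 else 1 else 0)"
  using i d N by (auto simp: cont_def run_def initial_def word_contents_def nth_Cons')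
qed

end

subsection \<open>Binary counters\<close>

definition num :: "(nat => bool) => nat => nat" where "num f n = (SUM i<n. of_bool (f i) * 2 ^ i)"

lemma num_Suc: "num f (Suc n) = num f n + of_bool (f n) * 2 ^ n" by (simp add: num_def)
lemma num_0 [simp]: "num f 0 = 0" by (simp add: num_def)

lemma num_less: "num f n < 2 ^ n" by (induction n) (auto simp: num_Suc)

lemma num_cong: "(!!i. i < n ==> f i = g i) ==> num f n = num g n" by (simp add: num_def)

lemma bit_num: "i < n ==> bit (num f n) i = f i"
proof (induction n)
 case (Suc n)
 show ?case
 proof (cases "i = n")
  case True
  then show ?thesis using num_less[of f n] by (simp add: num_Suc bit_iff_odd div_add1_eq)
 next
  case False
  then have i: "i < n" using Suc.prems by simp
  then have "(2::nat) ^ n = 2 ^ (n - i) * 2 ^ i" by (simp add: power_add[symmetric])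
  then have "num f (Suc n) div 2 ^ i = num f n div 2 ^ i + of_bool (f n) * 2 ^ (n - i)"
   by (simp add: num_Suc)
  then show ?thesis using Suc.IH[OF i] i by (simp add: bit_iff_odd)
 qed
qed simp

lemma num_bit: "num (bit x) n = x mod 2 ^ n"
proof -
 have "num (bit x) n = take_bit n x" by (induction n) (auto simp: num_Suc take_bit_Suc_from_most)
 then show ?thesis by (simp add: take_bit_eq_mod)
qed

lemma num_eq_0: "num f n = 0 \<longleftrightarrow> (ALL i<n. ~ f i)" by (auto simp: num_def)

lemma num_all: "(!!i. i < n ==> f i) ==> num f n = 2 ^ n - 1"
proof (induction n)
 case (Suc n)
 have "(1::nat) <= 2 ^ n" by simp
 then show ?case using Suc by (simp add: num_Suc)
qed simp

lemma ripple_inc: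
 assumes "!!i. i < n ==> c (Suc i) = (c i & x i)"
 shows "num (%i. x i ~= c i) n + of_bool (c n) * 2 ^ n = num x n + of_bool (c 0)"
 using assms
proof (induction n)
 case (Suc n)
 have "c (Suc n) = (c n & x n)" "num (%i. x i ~= c i) n + of_bool (c n) * 2 ^ n = num x n + of_bool (c 0)" using Suc by auto
 then show ?case by (cases "c n"; cases "x n") (simp_all add: num_Suc)
qed simp

lemma ripple_dec:
 assumes "!!i. i < n ==> c (Suc i) = (c i & ~ x i)"
 shows "num (%i. x i ~= c i) n + of_bool (c 0) = num x n + of_bool (c n) * 2 ^ n"
 using assms
proof (induction n)
 case (Suc n)
 have "c (Suc n) = (c n & ~ x n)" "num (%i. x i ~= c i) n + of_bool (c 0) = num x n + of_bool (c n) * 2 ^ n" using Suc by auto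
 then show ?case by (cases "c n"; cases "x n") (simp_all add: num_Suc)
qed simp

text \<open>A carry passes through ones when adding 1 and a borrow through zeros when subtracting 1.
  Comparing the lower bits with \<open>e = 1\<close> treats both cases alike.\<close>

lemma ripple_shift:
 assumes e: "e = -1 \<or> e = 0 \<or> e = (1::int)" and c: "!!i. c i \<longleftrightarrow> e ~= 0 & (ALL j<i. x j \<longleftrightarrow> e = 1)"
 shows "int (num (%i. x i ~= c i) n) mod 2 ^ n = (int (num x n) + e) mod 2 ^ n"
proof -
 let ?y = "num (%i. x i ~= c i) n"
 consider "e = 0" | "e = 1" | "e = -1" using e by blast
 then show ?thesis
 proof cases
  case 1
  then show ?thesis using c by simp
 next
  case 2
  have "?y + of_bool (c n) * 2 ^ n = num x n + of_bool (c 0)"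
   by (rule ripple_inc) (use 2 c in "auto simp: less_Suc_eq")
  then have "num x n + 1 = ?y + of_bool (c n) * 2 ^ n" using 2 c[of 0] by simp
  then have "int (num x n + 1) = int (?y + of_bool (c n) * 2 ^ n)" by (rule arg_cong)
  then have "int (num x n) + 1 = int ?y + of_bool (c n) * 2 ^ n" by simp
  then show ?thesis unfolding 2 by simp
 next
  case 3
  have "?y + of_bool (c 0) = num x n + of_bool (c n) * 2 ^ n"
   by (rule ripple_dec) (use 3 c in "auto simp: less_Suc_eq")
  then have "?y + 1 = num x n + of_bool (c n) * 2 ^ n" using 3 c[of 0] by simp
  then have "int (?y + 1) = int (num x n + of_bool (c n) * 2 ^ n)" by (rule arg_cong)
  then have "int ?y = (int (num x n) + -1) + of_bool (c n) * 2 ^ n" by simp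
  then show ?thesis unfolding 3 by (simp only: mod_mult_self1)
 qed
qed

subsection \<open>Backward computations as records\<close>

text \<open>
  A record at time \<open>t\<close> claims the control state \<open>q\<close> and the symbol \<open>a\<close> at some offset from the head of
 tape \<open>i\<close>, and names the state and the read symbols at time \<open>t - 1\<close>.
\<close>

type_synonym info = "nat * nat * nat list * nat * nat * bool"

definition infos :: "tm => info set" where
 "infos M = {..<num_states M} \<times> {..<num_states M} \<times> tuples (num_tapes M) {..<num_syms M} \<times> {..<num_tapes M} \<times> {..<num_syms M} \<times> UNIV"

abbreviation "iq \<equiv> %io :: info. fst io"
abbreviation "iqm \<equiv> %io :: info. fst (snd io)"
abbreviation "ism \<equiv> %io :: info. fst (snd (snd io))"
abbreviation "ii \<equiv> %io :: info. fst (snd (snd (snd io)))"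
abbreviation "ia \<equiv> %io :: info. fst (snd (snd (snd (snd io))))"
abbreviation "ikp \<equiv> %io :: info. snd (snd (snd (snd (snd io))))"

text \<open>Decoding is total with values in \<open>A\<close>, so any bits printed by the strategy
  denote some record, and ill-formed letters cannot occur.\<close>

lemma finite_coding:
 assumes "finite A" "a0 : A"
 shows "EX ka dec. (ALL l. dec l : A) & (ALL x:A. EX l. length l = ka & dec (l :: bool list) = x)"
proof -
 obtain g :: "'a => nat" and K where g: "g ` A = {i. i < K}" "inj_on g A"
  using finite_imp_inj_to_nat_seg[OF assms(1)] by blast
 define cd where "cd x = map (bit (g x)) [0..<K]" for x
 have nb: "num (bit (g x)) K = g x" if "x : A" for x
 proof -
  have "g x : {i. i < K}" using g(1) that by blast
  then have "g x < 2 ^ K" by (auto intro: less_trans[OF _ less_two_power])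
  then show ?thesis by (simp add: num_bit)
 qed
 have "inj_on cd A"
 proof (rule inj_onI)
  fix x y assume xy: "x : A" "y : A" "cd x = cd y"
  have "bit (g x) i = bit (g y) i" if "i < K" for i
  proof -
   have "cd x ! i = cd y ! i" using xy(3) by simp
   then show ?thesis using that by (simp add: cd_def)
  qed
  then have "num (bit (g x)) K = num (bit (g y)) K" by (rule num_cong)
  then show "x = y" using nb xy(1,2) g(2) unfolding inj_on_def by simp
 qed
 then have inv: "the_inv_into A cd (cd x) = x" if "x : A" for x using that by (rule the_inv_into_f_f)
 show ?thesis
 proof (intro exI[of _ K] exI[of _ "%l. if l : cd ` A then the_inv_into A cd l else a0"] conjI allI ballI)
  show "(if l : cd ` A then the_inv_into A cd l else a0) : A" for l using inv assms(2) by auto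
  show "EX l. length l = K & (if l : cd ` A then the_inv_into A cd l else a0) = x" if "x : A" for x
   using that inv by (intro exI[of _ "cd x"]) (auto simp: cd_def)
 qed
qed

text \<open>The move of the environment: the first flagged tape, whose read symbol is traced next,
  or none to keep following the claimed cell.\<close>

definition sel :: "bool list => nat option" where
 "sel J = (if EX j<length J. J ! j then Some (LEAST j. J ! j) else None)"

lemma sel_Some: "sel J = Some j ==> j < length J & J ! j"
 unfolding sel_def by (auto split: if_splits intro: LeastI Least_le[THEN le_less_trans])

lemma sel_None: "sel J = None ==> j < length J ==> ~ J ! j"
 unfolding sel_def by (auto split: if_splits)

definition mvI :: "tm => info => int" where "mvI M io = shift_of (snd (snd (delt M (iqm io) (ism io)) ! ii io))"
definition wrI :: "tm => info => nat" where "wrI M io = fst (snd (delt M (iqm io) (ism io)) ! ii io)"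

lemma mvI_cases: "mvI M io = -1 \<or> mvI M io = 0 \<or> mvI M io = 1" by (auto simp: mvI_def shift_of_def split: move.split)

text \<open>
  A letter starts with one bit of the time and of the offset, namely the time bit, its borrow, the offset bit,
  its carry, and a flag for the shifted offset being zero so far.
\<close>

abbreviation "info_of \<equiv> %dec (L :: bool list). dec (drop 5 L) :: info"
abbreviation "zero_off \<equiv> %L :: bool list. L ! 4 & ~ (L ! 2 ~= L ! 3)"
abbreviation "zero_time \<equiv> %L :: bool list. L ! 1 & ~ L ! 0"

text \<open>Conditions at the least significant bit: the time is always decremented, so a borrow is
  due; a carry of the offset is due iff the head moved; and no nonzero bit of the shifted offset has
  been seen.\<close>

definition fresh :: "tm => (bool list => info) => bool list => bool" where
 "fresh M dec L \<longleftrightarrow> L ! 1 & L ! 4 & (L ! 3 \<longleftrightarrow> mvI M (info_of dec L) ~= 0)"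

definition init_ok :: "tm => (bool list => info) => bool list => bool" where
 "init_ok M dec L \<longleftrightarrow> fresh M dec L & iq (info_of dec L) = accept M"

text \<open>The flag \<open>zo\<close> tells that the claimed cell was under the head one step
  earlier. Its symbol must then be the one written in that step, and following it backwards turns
  the claim into the symbol read.\<close>

definition next_ok :: "tm => info => bool => bool list => info => bool" where
 "next_ok M io zo J io' \<longleftrightarrow> fst (delt M (iqm io) (ism io)) = iq io & (zo --> ia io = wrI M io) & iq io' = iqm io &
   (case sel J of Some j => ii io' = j & ia io' = ism io ! j & ~ ikp io'
   | None => ii io' = ii io & ia io' = (if zo then ism io ! ii io else ia io) & ikp io')"

text \<open>After the record for time 0 the backward computation starts over from an accepting
  state, which lets a finite memory continue forever.\<close>

definition step_ok :: "tm => (bool list => info) => bool => bool list => bool list => bool list => bool" where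
 "step_ok M dec lst L J L' \<longleftrightarrow>
   (if lst then fresh M dec L' & (if zero_time L then iq (info_of dec L') = accept M
    else next_ok M (info_of dec L) (zero_off L) J (info_of dec L'))
   else info_of dec L' = info_of dec L & (L' ! 1 \<longleftrightarrow> zero_time L) &
    (L' ! 3 \<longleftrightarrow> L ! 3 & (L ! 2 \<longleftrightarrow> mvI M (info_of dec L) = 1)) & (L' ! 4 \<longleftrightarrow> zero_off L))"

text \<open>A followed cell keeps its offset, shifted by the head movement; a freshly selected read
  symbol lies under the head, at offset 0. The flag \<open>kp\<close> belongs to the later of the
  two records.\<close>

definition cmp_ok :: "(bool list => info) => bool list => bool => bool => bool => bool" where
 "cmp_ok dec L tb ob kp \<longleftrightarrow> (tb \<longleftrightarrow> L ! 0 ~= L ! 1) & (ob \<longleftrightarrow> kp & L ! 2 ~= L ! 3)"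

definition input_ok :: "tm => bool list => info => nat => bool" where
 "input_ok M w io d \<longleftrightarrow> iq io = start M & ia io = (if ii io = 0 & d < length w then if w ! d then 2 else 1 else 0)"

locale tm_game = tm_run M w N t0 for M w N t0 +
 fixes m ka :: nat and dec :: "bool list => info"
 assumes m: "0 < m" "2 * N = 2 ^ m"
  and dec: "!!l. dec l : infos M" "!!io. io : infos M ==> EX l. length l = ka & dec l = io"
begin

abbreviation "iof \<equiv> info_of dec"
abbreviation "tm_at r \<equiv> 2 ^ m - Suc r"

definition spec :: "(nat => bool list) => (nat => bool list) => bool" where
 "spec L J \<longleftrightarrow> init_ok M dec (L 0) & (ALL z<m. L z ! 0) & (ALL z. step_ok M dec (Suc z mod m = 0) (L z) (J z) (L (Suc z))) &
  (ALL r. zero_time (L (r * m + (m - 1))) --> input_ok M w (iof (L (r * m))) (num (%al. L (r * m + al) ! 2) m))"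

definition cmp :: "(nat => bool list) => nat => bool" where
 "cmp L y \<longleftrightarrow> cmp_ok dec (L y) (L (y + m) ! 0) (L (y + m) ! 2) (ikp (iof (L (y + m))))"

text \<open>The environment knows the true run and flags exactly the read symbols that are false one
  step before the time of the present record.\<close>

definition challenge :: "nat => bool list => bool list" where
 "challenge z L = map (%j. ism (iof L) ! j ~= rds (tm_at (Suc (z div m))) ! j) [0..<k]"

lemma two_N: "2 * int N = 2 ^ m" using m(2) by (metis of_nat_mult of_nat_numeral of_nat_power)

lemma info_wf: "length (ism (dec l)) = k" "ii (dec l) < k" "length (rds t) = k"
 using dec(1)[of l] rds_wf[of t] by (auto simp: infos_def tuples_def)

text \<open>If a record is true of the run, so is the record printed just before it, for the next
  later time. Falsity of the first record, which claims acceptance, therefore passes down to time 0.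
  There \<open>input_ok\<close> forces the record to be true.\<close>

lemma challenger_wins:
 assumes s: "spec L J" and c: "!!y. cmp L y" and J: "!!z. J z = challenge z (L z)"
 shows "st (2 ^ m - 1) = accept M"
proof (rule ccontr)
 assume na: "st (2 ^ m - 1) ~= accept M"
 define io where "io r = iof (L (r * m))" for r
 define T where "T r al \<longleftrightarrow> L (r * m + al) ! 0" for r al
 define D where "D r al \<longleftrightarrow> L (r * m + al) ! 2" for r al
 define CC where "CC r al \<longleftrightarrow> mvI M (io r) ~= 0 & (ALL \<beta><al. D r \<beta> \<longleftrightarrow> mvI M (io r) = 1)" for r al
 define BB where "BB r al \<longleftrightarrow> (ALL \<beta><al. ~ T r \<beta>)" for r al
 define D' where "D' r al \<longleftrightarrow> D r al ~= CC r al" for r al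
 have st: "step_ok M dec (Suc z mod m = 0) (L z) (J z) (L (Suc z))" for z using s by (simp add: spec_def)
 have lastp: "Suc (r * m + (m - 1)) = Suc r * m" for r using m(1) by simp
 have lst: "step_ok M dec True (L (r * m + (m - 1))) (J (r * m + (m - 1))) (L (Suc r * m))" for r
  using st[of "r * m + (m - 1)"] unfolding lastp by simp
 have fr: "fresh M dec (L (r * m))" for r
 proof (cases r)
  case 0 then show ?thesis using s by (simp add: spec_def init_ok_def)
 next
  case (Suc r') then show ?thesis using lst[of r'] by (simp add: step_ok_def)
 qed
 have bits: "iof (L (r * m + al)) = io r & L (r * m + al) ! 1 = BB r al & L (r * m + al) ! 3 = CC r al & L (r * m + al) ! 4 = (ALL \<beta><al. ~ D' r \<beta>)"
  if "al < m" for r al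
  using that
 proof (induction al)
  case 0
  show ?case using fr[of r] by (simp add: fresh_def io_def BB_def CC_def)
 next
  case (Suc al)
  have "Suc (r * m + al) mod m ~= 0" using Suc.prems by (metis add_Suc_right mod_less mod_mult_self3 nat.distinct(1))
  then have "step_ok M dec False (L (r * m + al)) (J (r * m + al)) (L (r * m + Suc al))" using st[of "r * m + al"] by simp
  moreover have IH: "iof (L (r * m + al)) = io r & L (r * m + al) ! 1 = BB r al & L (r * m + al) ! 3 = CC r al & L (r * m + al) ! 4 = (ALL \<beta><al. ~ D' r \<beta>)"
   using Suc by simp
  ultimately show ?case unfolding step_ok_def
   by (simp add: BB_def CC_def less_Suc_eq all_conj_distrib imp_conjR T_def D_def D'_def)
 qed
 define tv where "tv r = num (T r) m" for r
 define dv where "dv r = num (D r) m" for r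
 define dv' where "dv' r = num (D' r) m" for r
 have m1: "m - 1 < m" using m by simp
 have allm: "(ALL \<beta><m. P \<beta>) \<longleftrightarrow> (ALL \<beta><m - 1. P \<beta>) & P (m - 1)" for P
  using m(1) by (cases m) (auto simp: less_Suc_eq)
 have zt: "zero_time (L (r * m + (m - 1))) \<longleftrightarrow> tv r = 0" for r
  unfolding tv_def num_eq_0 allm[of "%\<beta>. ~ T r \<beta>"] using bits[OF m1, of r] by (simp add: BB_def T_def)
 have zo: "zero_off (L (r * m + (m - 1))) \<longleftrightarrow> dv' r = 0" for r
  unfolding dv'_def num_eq_0 allm[of "%\<beta>. ~ D' r \<beta>"] using bits[OF m1, of r] by (auto simp: D'_def D_def)
 have cm: "T (Suc r) al = (T r al ~= BB r al) & D (Suc r) al = (ikp (io (Suc r)) & D' r al)" if "al < m" for r al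
 proof -
  have "r * m + al + m = Suc r * m + al" by simp
  then show ?thesis using c[of "r * m + al"] bits[OF that, of r] bits[OF that, of "Suc r"]
   unfolding cmp_def cmp_ok_def T_def D_def D'_def by (simp add: ac_simps)
 qed
 have "num (%i. T r i ~= BB r i) m + of_bool (BB r 0) = num (T r) m + of_bool (BB r m) * 2 ^ m" for r
  by (rule ripple_dec) (auto simp: BB_def less_Suc_eq)
 moreover have "num (T (Suc r)) m = num (%i. T r i ~= BB r i) m" for r by (rule num_cong) (use cm in blast)
 ultimately have tdec: "0 < tv r ==> Suc (tv (Suc r)) = tv r" for r
  unfolding tv_def by (auto simp: BB_def num_eq_0[symmetric])
 have t0': "tv 0 = 2 ^ m - 1" unfolding tv_def by (rule num_all) (use s in "simp add: spec_def T_def")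
 have tvr: "r < 2 ^ m ==> tv r = tm_at r" for r
 proof (induction r)
  case (Suc r) then show ?case using tdec[of r] by simp
 qed (use t0' in simp)
 have dmod: "int (dv' r) mod 2 ^ m = (int (dv r) + mvI M (io r)) mod 2 ^ m" for r
  unfolding dv'_def dv_def D'_def[abs_def] by (rule ripple_shift[OF mvI_cases]) (simp add: CC_def)
 have dnext: "dv (Suc r) = (if ikp (io (Suc r)) then dv' r else 0)" for r
 proof -
  have "num (D (Suc r)) m = num (%al. ikp (io (Suc r)) & D' r al) m" by (rule num_cong) (use cm in blast)
  then show ?thesis by (simp add: dv_def dv'_def num_eq_0)
 qed
 define true where "true r \<longleftrightarrow> iq (io r) = st (tm_at r) &
  ia (io r) = cont (tm_at r) (ii (io r)) (hd_pos (tm_at r) (ii (io r)) + int (dv r))" for r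
 have false: "r < 2 ^ m ==> ~ true r" for r
 proof (induction r)
  case 0
  then show ?case using s na by (simp add: true_def io_def spec_def init_ok_def)
 next
  case (Suc r)
  let ?t = "tm_at (Suc r)" and ?z = "r * m + (m - 1)"
  have t: "tm_at r = Suc ?t" using Suc.prems by simp
  have "tv r ~= 0" using tvr[of r] Suc.prems by simp
  then have nx: "next_ok M (io r) (dv' r = 0) (J ?z) (io (Suc r))"
   using lst[of r] bits[OF m1, of r] unfolding step_ok_def zt zo io_def by simp
  have zd: "?z div m = r" by (subst div_mult_self3) (use m m1 in simp_all)
  have Jz: "J ?z = map (%j. ism (io r) ! j ~= rds ?t ! j) [0..<k]"
   unfolding J challenge_def zd using bits[OF m1, of r] by simp
  show ?case
  proof
   assume tr: "true (Suc r)"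
   have q: "iqm (io r) = st ?t" using tr nx by (simp add: true_def next_ok_def)
   have ir: "ii (io r) < k" using info_wf unfolding io_def by blast
   show False
   proof (cases "sel (J ?z)")
    case (Some j)
    then have j: "j < k" "ism (io r) ! j ~= rds ?t ! j" using sel_Some[OF Some] unfolding Jz by auto
    have "ii (io (Suc r)) = j" "ia (io (Suc r)) = ism (io r) ! j" "~ ikp (io (Suc r))" using nx Some by (auto simp: next_ok_def)
    then have "ism (io r) ! j = cont ?t j (hd_pos ?t j)" using tr dnext[of r] by (simp add: true_def)
    then show False using j rds_nth by simp
   next
    case None
    \<comment> \<open>Without a flag all read symbols are right, hence the claimed transition is the
      one the run makes, and the claim for the later time follows from that for the earlier
      one.\<close>
    have "ism (io r) = rds ?t"
    proof (rule nth_equalityI)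
     show "length (ism (io r)) = length (rds ?t)" unfolding io_def using info_wf by metis
     fix j assume "j < length (ism (io r))"
     then have "j < k" unfolding io_def using info_wf by metis
     then show "ism (io r) ! j = rds ?t ! j" using sel_None[OF None, of j] unfolding Jz by simp
    qed
    with q have del: "delt M (iqm (io r)) (ism (io r)) = dlt ?t" by simp
    have kp: "ii (io (Suc r)) = ii (io r)" "ikp (io (Suc r))" "dv' r ~= 0 ==> ia (io (Suc r)) = ia (io r)"
     using nx None by (auto simp: next_ok_def)
    let ?i = "ii (io r)"
    have mv: "mvI M (io r) = shift_of (snd (snd (dlt ?t) ! ?i))" "wrI M (io r) = fst (snd (dlt ?t) ! ?i)"
     by (simp_all add: mvI_def wrI_def del)
    have off: "cont (Suc ?t) ?i (hd_pos (Suc ?t) ?i + int (dv r)) =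
      (if (int (dv r) + mvI M (io r)) mod 2 ^ m = 0 then wrI M (io r) else cont ?t ?i (hd_pos ?t ?i + (int (dv r) + mvI M (io r))))"
     unfolding cont_Suc_off[OF ir] mv two_N ..
    have "dv' r < 2 ^ m" unfolding dv'_def by (rule num_less)
    then have dvm: "int (dv' r) mod 2 ^ m = int (dv' r)" by simp
    have "ia (io r) = cont (Suc ?t) ?i (hd_pos (Suc ?t) ?i + int (dv r))"
    proof (cases "dv' r = 0")
     case True
     then have "(int (dv r) + mvI M (io r)) mod 2 ^ m = 0" using dmod[of r] dvm by simp
     then show ?thesis using off nx True by (simp add: next_ok_def)
    next
     case False
     have "cont ?t ?i (hd_pos ?t ?i + (int (dv r) + mvI M (io r))) = cont ?t ?i (hd_pos ?t ?i + int (dv' r))"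
      by (rule cont_mod(2)) (simp add: two_N dmod)
     moreover have "(int (dv r) + mvI M (io r)) mod 2 ^ m ~= 0" using dmod[of r] dvm False by simp
     moreover have "ia (io r) = cont ?t ?i (hd_pos ?t ?i + int (dv' r))"
      using tr kp False dnext[of r] by (simp add: true_def)
     ultimately show ?thesis using off by simp
    qed
    moreover have "iq (io r) = st (Suc ?t)" using nx del by (simp add: next_ok_def st_Suc)
    ultimately have "true r" unfolding true_def t by blast
    then show False using Suc by simp
   qed
  qed
 qed
 let ?r = "2 ^ m - 1 :: nat"
 have r: "?r < 2 ^ m" "tm_at ?r = 0" by simp_all
 then have "tv ?r = 0" using tvr by metis
 then have "input_ok M w (io ?r) (dv ?r)" using s zt[of ?r] unfolding spec_def io_def dv_def D_def[abs_def] by blast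
 moreover have "dv ?r < 2 * N" unfolding m(2) dv_def by (rule num_less)
 moreover have "ii (io ?r) < k" unfolding io_def by (rule info_wf)
 ultimately have "true ?r" unfolding true_def r(2) by (simp add: input_ok_def start_run)
 then show False using false r(1) by blast
qed

end

section \<open>The strategy that prints the true computation\<close>

context tm_game begin

text \<open>The letter position within a cycle of \<open>2 ^ m\<close> records, the traced tape, the
  offset from its head, and whether the cell was kept from the previous record.\<close>

type_synonym mem = "nat * nat * nat * bool"

abbreviation "mx \<equiv> %s :: mem. fst s"
abbreviation "mi \<equiv> %s :: mem. fst (snd s)"
abbreviation "md \<equiv> %s :: mem. fst (snd (snd s))"
abbreviation "mkp \<equiv> %s :: mem. snd (snd (snd s))"

definition mt :: "mem => nat" where "mt s = tm_at (mx s div m)"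

text \<open>At time 0 the truncated subtraction names time 0 again as the previous configuration.
  This is consistent, since after a record for time 0 only a restart is required.\<close>

definition minfo :: "mem => info" where
 "minfo s = (st (mt s), st (mt s - 1), rds (mt s - 1), mi s, cont (mt s) (mi s) (hd_pos (mt s) (mi s) + int (md s)), mkp s)"

definition mcar :: "mem => nat => bool" where
 "mcar s al \<longleftrightarrow> mvI M (minfo s) ~= 0 & (ALL \<beta><al. bit (md s) \<beta> \<longleftrightarrow> mvI M (minfo s) = 1)"

definition moff :: "mem => nat => bool" where "moff s al \<longleftrightarrow> bit (md s) al ~= mcar s al"

definition menc :: "info => bool list" where "menc io = (SOME l. length l = ka & dec l = io)"

definition mlet :: "mem => bool list" where
 "mlet s = [bit (mt s) (mx s mod m), ALL \<beta><mx s mod m. ~ bit (mt s) \<beta>, bit (md s) (mx s mod m), mcar s (mx s mod m),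
   ALL \<beta><mx s mod m. ~ moff s \<beta>] @ menc (minfo s)"

definition mup :: "mem => bool list => mem" where
 "mup s J = (Suc (mx s) mod (2 ^ m * m),
   if Suc (mx s) mod m ~= 0 then snd s
   else case sel J of Some j => (j, 0, False) | None => (mi s, num (moff s) m, True))"

definition mems :: "mem set" where "mems = {..<2 ^ m * m} \<times> {..<k} \<times> {..<2 ^ m} \<times> UNIV"

lemma k_pos: "0 < k" using tm by (simp add: turing_machine_def)

lemma finite_mems: "finite mems" by (simp add: mems_def)

lemma mup_mems: "s : mems ==> length J = k ==> mup s J : mems"
 using m sel_Some[of J] num_less[of "moff s" m] by (auto simp: mems_def mup_def split: option.split)

lemma minfo_infos: "s : mems ==> minfo s : infos M"
 using inv[of "mt s"] inv[of "mt s - 1"] rds_wf[of "mt s - 1"] k_pos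
 by (auto simp: mems_def minfo_def infos_def cont_def st_def)

lemma menc: "s : mems ==> length (menc (minfo s)) = ka & dec (menc (minfo s)) = minfo s"
 unfolding menc_def by (rule someI_ex) (rule dec(2)[OF minfo_infos])

lemma mlet_nth [simp]:
 "mlet s ! 0 = bit (mt s) (mx s mod m)" "mlet s ! Suc 0 = (ALL \<beta><mx s mod m. ~ bit (mt s) \<beta>)"
 "mlet s ! 2 = bit (md s) (mx s mod m)" "mlet s ! 3 = mcar s (mx s mod m)" "mlet s ! 4 = (ALL \<beta><mx s mod m. ~ moff s \<beta>)"
 by (simp_all add: mlet_def numeral_eq_Suc)

lemma mlet_info: "s : mems ==> iof (mlet s) = minfo s" "s : mems ==> length (mlet s) = 5 + ka"
 using menc by (simp_all add: mlet_def numeral_eq_Suc)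

lemma num_eq_le: "(a::nat) < 2 ^ m ==> num (bit a) m = a" by (simp add: num_bit)

lemma mt_less: "mt s < 2 ^ m" by (simp add: mt_def)

lemma all_zero: "(a::nat) < 2 ^ m ==> (ALL \<beta><m. ~ bit a \<beta>) \<longleftrightarrow> a = 0" using num_eq_0[of "bit a" m] num_eq_le[of a] by simp

lemma moff_mod: "int (num (moff s) m) mod 2 ^ m = (int (num (bit (md s)) m) + mvI M (minfo s)) mod 2 ^ m"
 unfolding moff_def[abs_def] by (rule ripple_shift[OF mvI_cases]) (simp add: mcar_def)

lemma all_below: "Suc x mod m = 0 ==> (ALL \<beta><m. P \<beta>) \<longleftrightarrow> (ALL \<beta><x mod m. P \<beta>) & P (x mod m)"
proof -
 assume "Suc x mod m = 0"
 then have "Suc (x mod m) = m" using m(1) by (simp add: mod_Suc split: if_splits)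
 then show ?thesis by (metis less_Suc_eq)
qed

lemma wrap: "x < 2 ^ m * m ==> Suc x mod m = 0 ==>
  Suc x mod (2 ^ m * m) mod m = 0 &
  tm_at (Suc x mod (2 ^ m * m) div m) = (if tm_at (x div m) = 0 then 2 ^ m - 1 else tm_at (x div m) - 1)"
proof -
 assume x: "x < 2 ^ m * m" and l: "Suc x mod m = 0"
 have d: "Suc x div m = Suc (x div m)" using l by (simp add: div_Suc)
 have e: "Suc x = Suc (x div m) * m" using l d by (metis add.right_neutral div_mult_mod_eq)
 show ?thesis
 proof (cases "Suc x = 2 ^ m * m")
  case True
  then have "Suc (x div m) * m = 2 ^ m * m" using e by metis
  then have "Suc (x div m) = 2 ^ m" unfolding mult_cancel2 using m(1) by blast
  then show ?thesis using True by simp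
 next
  case False
  then have lt: "Suc x < 2 ^ m * m" using x by simp
  then have "Suc (x div m) * m < 2 ^ m * m" using e by metis
  then have "Suc (x div m) < 2 ^ m" unfolding mult_less_cancel2 by blast
  then show ?thesis using lt l d by simp
 qed
qed

lemma mlet_step:
 assumes s: "s : mems" and J: "length J = k" and acc: "st (2 ^ m - 1) = accept M"
 shows "step_ok M dec (Suc (mx s) mod m = 0) (mlet s) J (mlet (mup s J))"
proof -
 let ?s = "mup s J" and ?x = "mx s"
 have s': "?s : mems" by (rule mup_mems[OF s J])
 have x: "?x < 2 ^ m * m" "mi s < k" "md s < 2 ^ m" using s by (auto simp: mems_def)
 show ?thesis
 proof (cases "Suc ?x mod m = 0")
  case False
  then have ne: "Suc ?x ~= 2 ^ m * m" by (metis mod_mult_self2_is_0)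
  then have x': "mx ?s = Suc ?x" using x by (simp add: mup_def)
  have dm: "Suc ?x div m = ?x div m" "Suc ?x mod m = Suc (?x mod m)" using False by (simp_all add: div_Suc mod_Suc split: if_splits)
  have sn: "snd ?s = snd s" using False by (simp add: mup_def)
  have mt': "mt ?s = mt s" by (simp add: mt_def x' dm)
  have inf: "minfo ?s = minfo s" by (simp add: minfo_def mt' sn)
  have car: "mcar ?s = mcar s" "moff ?s = moff s" by (simp_all add: mcar_def moff_def fun_eq_iff inf sn)
  show ?thesis using False
   by (simp add: step_ok_def mlet_info s s' inf x' dm sn mt' car)
    (auto simp: less_Suc_eq mcar_def moff_def)
 next
  case True
  note w = wrap[OF x(1) True]
  have x': "mx ?s = Suc ?x mod (2 ^ m * m)" by (simp add: mup_def)
  have mod0: "mx ?s mod m = 0" and mt': "mt ?s = (if mt s = 0 then 2 ^ m - 1 else mt s - 1)"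
   using w by (simp_all only: x' mt_def)
  have fr: "fresh M dec (mlet ?s)" by (simp add: fresh_def mod0 mlet_info s' mcar_def)
  have zt: "zero_time (mlet s) \<longleftrightarrow> mt s = 0"
   using all_below[OF True, of "%\<beta>. ~ bit (mt s) \<beta>"] all_zero[OF mt_less[of s]] by simp
  have zo: "zero_off (mlet s) \<longleftrightarrow> num (moff s) m = 0"
   using all_below[OF True, of "%\<beta>. ~ moff s \<beta>"] unfolding num_eq_0 by (auto simp: moff_def)
  have nx: "next_ok M (minfo s) (num (moff s) m = 0) J (minfo ?s)" if t: "mt s ~= 0"
  proof -
   obtain t' where St: "mt s = Suc t'" using t by (cases "mt s") auto
   let ?t = t' and ?i = "mi s"
   have m': "mt ?s = ?t" using mt' St by simp
   have mv: "mvI M (minfo s) = shift_of (snd (snd (dlt ?t) ! ?i))" "wrI M (minfo s) = fst (snd (dlt ?t) ! ?i)"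
    by (simp_all add: mvI_def wrI_def minfo_def St)
   have off: "cont (mt s) ?i (hd_pos (mt s) ?i + int (md s)) =
      (if (int (md s) + mvI M (minfo s)) mod 2 ^ m = 0 then wrI M (minfo s) else cont ?t ?i (hd_pos ?t ?i + (int (md s) + mvI M (minfo s))))"
    unfolding St cont_Suc_off[OF x(2)] mv two_N by simp
   have dm: "int (num (moff s) m) = (int (md s) + mvI M (minfo s)) mod 2 ^ m"
    using moff_mod[of s] num_less[of "moff s" m] num_eq_le[OF x(3)] by simp
   have z: "(int (md s) + mvI M (minfo s)) mod 2 ^ m = 0 \<longleftrightarrow> num (moff s) m = 0" using dm by linarith
   have nz: "cont ?t ?i (hd_pos ?t ?i + (int (md s) + mvI M (minfo s))) = cont ?t ?i (hd_pos ?t ?i + int (num (moff s) m))"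
    by (rule cont_mod(2)) (simp add: two_N dm)
   have ia: "ia (minfo s) = (if num (moff s) m = 0 then wrI M (minfo s) else cont ?t ?i (hd_pos ?t ?i + int (num (moff s) m)))"
    using off unfolding z nz by (simp add: minfo_def)
   have q: "fst (delt M (iqm (minfo s)) (ism (minfo s))) = iq (minfo s)" using st_Suc[of ?t] by (simp add: minfo_def St)
   have im: "iqm (minfo s) = st ?t" "ism (minfo s) = rds ?t" "ii (minfo s) = ?i" by (simp_all add: minfo_def St)
   show ?thesis
   proof (cases "sel J")
    case (Some j)
    have jk: "j < k" using sel_Some[OF Some] unfolding J by blast
    have "snd ?s = (j, 0, False)" using True Some by (simp add: mup_def)
    then have i': "minfo ?s = (st ?t, st (?t - 1), rds (?t - 1), j, rds ?t ! j, False)"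
     by (simp add: minfo_def m' rds_nth[OF jk])
    show ?thesis using q ia unfolding next_ok_def Some option.case i' im by simp
   next
    case None
    have "snd ?s = (?i, num (moff s) m, True)" using True None by (simp add: mup_def)
    then have i': "minfo ?s = (st ?t, st (?t - 1), rds (?t - 1), ?i, cont ?t ?i (hd_pos ?t ?i + int (num (moff s) m)), True)"
     by (simp add: minfo_def m')
    show ?thesis using q ia rds_nth[OF x(2), of ?t] unfolding next_ok_def None option.case i' im by simp
   qed
  qed
  have "iq (minfo ?s) = accept M" if "mt s = 0" using acc mt' that by (simp add: minfo_def)
  then show ?thesis using True fr nx unfolding step_ok_def zt zo mlet_info(1)[OF s] mlet_info(1)[OF s'] by simp
 qed
qed

definition mem_at :: "(nat => bool list) => nat => mem" where
 "mem_at J = rec_nat (0, 0, 0, False) (%z s. mup s (J z))"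

lemma mem_at_simps [simp]: "mem_at J 0 = (0, 0, 0, False)" "mem_at J (Suc z) = mup (mem_at J z) (J z)"
 by (simp_all add: mem_at_def)

lemma init_mems: "(0, 0, 0, False) : mems" using m k_pos by (simp add: mems_def)

text \<open>The memory always describes the real run, whatever the environment selects, and the
  counters wrap around consistently between time 0 and the restart. So the comparison is correct at
  every position.\<close>

lemma prover_wins:
 assumes J: "!!z. length (J z) = k" and acc: "st (2 ^ m - 1) = accept M"
 shows "spec (%z. mlet (mem_at J z)) J & cmp (%z. mlet (mem_at J z)) y"
proof -
 let ?s = "mem_at J"
 have S: "?s z : mems" for z by (induction z) (simp_all add: init_mems mup_mems J)
 have X: "mx (?s z) = z mod (2 ^ m * m)" for z by (induction z) (simp_all add: mup_def mod_Suc_eq)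
 have Xm: "mx (?s z) mod m = z mod m" for z unfolding X by (simp add: mod_mod_cancel)
 have Sm: "Suc (mx (?s z)) mod m = 0 \<longleftrightarrow> Suc z mod m = 0" for z using Xm[of z] by (metis mod_Suc_eq)
 have keep: "snd (?s (r * m + al)) = snd (?s (r * m))" if "al < m" for r al
  using that
 proof (induction al)
  case (Suc al)
  have "Suc (r * m + al) mod m ~= 0" using Suc.prems by (metis add_Suc_right mod_less mod_mult_self3 nat.distinct(1))
  then have "Suc (mx (?s (r * m + al))) mod m ~= 0" using Sm by simp
  then show ?case using Suc by (simp add: mup_def)
 qed simp
 have XM: "mx (?s (r * m + al)) = (r mod 2 ^ m) * m + al" if "al < m" for r al
 proof -
  have "(r * m + al) mod (m * 2 ^ m) = m * ((r * m + al) div m mod 2 ^ m) + (r * m + al) mod m" by (rule mod_mult2_eq)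
  then show ?thesis unfolding X using that by (simp add: mult.commute)
 qed
 have MT: "mt (?s (r * m + al)) = tm_at (r mod 2 ^ m)" if "al < m" for r al unfolding mt_def XM[OF that] using that by simp
 have rec: "minfo (?s (r * m + al)) = minfo (?s (r * m)) & moff (?s (r * m + al)) = moff (?s (r * m)) & mcar (?s (r * m + al)) = mcar (?s (r * m)) & md (?s (r * m + al)) = md (?s (r * m))"
  if "al < m" for r al
 proof -
  have i: "minfo (?s (r * m + al)) = minfo (?s (r * m))" using keep[OF that, of r] MT[OF that, of r] MT[of 0 r] m(1) by (simp add: minfo_def)
  then show ?thesis using keep[OF that, of r] by (simp add: mcar_def moff_def fun_eq_iff)
 qed
 have "init_ok M dec (mlet (?s 0))"
  using S[of 0] acc by (simp add: init_ok_def fresh_def mlet_info mcar_def minfo_def mt_def)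
 moreover have "mlet (?s z) ! 0" if "z < m" for z
 proof -
  have "mt (?s z) = 2 ^ m - 1" using MT[OF that, of 0] by simp
  moreover have "num (%_. True) m = 2 ^ m - 1" by (simp add: num_all)
  ultimately show ?thesis using bit_num[OF that, of "%_. True"] Xm[of z] that by simp
 qed
 moreover have "step_ok M dec (Suc z mod m = 0) (mlet (?s z)) (J z) (mlet (?s (Suc z)))" for z
  using mlet_step[OF S[of z] J[of z] acc] unfolding Sm by simp
 moreover have "input_ok M w (iof (mlet (?s (r * m)))) (num (%al. mlet (?s (r * m + al)) ! 2) m)"
  if z: "zero_time (mlet (?s (r * m + (m - 1))))" for r
 proof -
  have m1: "m - 1 < m" using m by simp
  have sm: "Suc (r * m + (m - 1)) mod m = 0" using m(1) by simp
  have xm: "(r * m + (m - 1)) mod m = m - 1" by (subst mod_mult_self3) (use m1 in simp)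
  have "mt (?s (r * m + (m - 1))) = 0"
   using z all_below[OF sm, of "%\<beta>. ~ bit (mt (?s (r * m + (m - 1)))) \<beta>"] all_zero[OF mt_less] unfolding One_nat_def mlet_nth Xm by blast
  then have mt0: "mt (?s (r * m)) = 0" using MT[OF m1, of r] MT[of 0 r] m(1) by simp
  have d: "md (?s (r * m)) < 2 ^ m" "mi (?s (r * m)) < k" using S[of "r * m"] by (auto simp: mems_def)
  have "num (%al. mlet (?s (r * m + al)) ! 2) m = num (bit (md (?s (r * m)))) m"
   by (rule num_cong) (use rec Xm in simp)
  then have "num (%al. mlet (?s (r * m + al)) ! 2) m = md (?s (r * m))" using num_eq_le[OF d(1)] by simp
  then show ?thesis using d start_run(3)[OF d(2), of "md (?s (r * m))"] m(2)
   by (simp add: input_ok_def mlet_info S minfo_def mt0 start_run)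
 qed
 moreover have "cmp (%z. mlet (?s z)) y"
 proof -
  define r al where "r = y div m" and "al = y mod m"
  have a: "al < m" using m(1) by (simp add: al_def)
  have y: "y = r * m + al" "r * m + al + m = Suc r * m + al" by (simp_all add: r_def al_def)
  have m1: "m - 1 < m" using m by simp
  let ?u = "?s (r * m + (m - 1))"
  have lst: "Suc (mx ?u) mod m = 0" using m(1) Sm[of "r * m + (m - 1)"] by simp
  have "Suc (r * m + (m - 1)) = Suc r * m" using m(1) by simp
  then have ns: "?s (Suc r * m) = mup ?u (J (r * m + (m - 1)))" by (metis mem_at_simps(2))
  have nd: "md (?s (Suc r * m)) = (if mkp (?s (Suc r * m)) then num (moff (?s (r * m))) m else 0)"
   unfolding ns using lst rec[OF m1, of r] by (simp add: mup_def split: option.split)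
  have dc: "bit (md (?s (Suc r * m))) al = (mkp (?s (Suc r * m)) & moff (?s (r * m)) al)"
   unfolding nd using bit_num[OF a, of "moff (?s (r * m))"] by simp
  have tt: "mt (?s (Suc r * m)) = (if mt (?s (r * m)) = 0 then 2 ^ m - 1 else mt (?s (r * m)) - 1)"
  proof -
   have x: "mx ?u < 2 ^ m * m" using S[of "r * m + (m - 1)"] by (auto simp: mems_def)
   have "mt (?s (Suc r * m)) = (if mt ?u = 0 then 2 ^ m - 1 else mt ?u - 1)"
    unfolding ns using wrap[OF x lst] by (simp only: mt_def mup_def fst_conv)
   then show ?thesis using MT[OF m1, of r] MT[of 0 r] m(1) by simp
  qed
  have tc: "bit (mt (?s (Suc r * m))) al = (bit (mt (?s (r * m))) al ~= (ALL \<beta><al. ~ bit (mt (?s (r * m))) \<beta>))"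
  proof -
   let ?t = "mt (?s (r * m))" and ?c = "%al. ALL \<beta><al. ~ bit (mt (?s (r * m))) \<beta>"
   have "num (%i. bit ?t i ~= ?c i) m + of_bool (?c 0) = num (bit ?t) m + of_bool (?c m) * 2 ^ m"
    by (rule ripple_dec) (auto simp: less_Suc_eq)
   then have "num (%i. bit ?t i ~= ?c i) m + 1 = ?t + of_bool (?t = 0) * 2 ^ m"
    unfolding all_zero[OF mt_less] num_eq_le[OF mt_less] by simp
   moreover have "X = (if t = 0 then P - 1 else t - 1)" if "X + 1 = t + of_bool (t = 0) * P" for X t P :: nat
    using that by auto
   ultimately have "num (%i. bit ?t i ~= ?c i) m = mt (?s (Suc r * m))" unfolding tt by blast
   then show ?thesis using bit_num[OF a, of "%i. bit ?t i ~= ?c i"] by simp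
  qed
  have Y: "mx (?s (r * m + al)) mod m = al" "mx (?s (Suc r * m + al)) mod m = al"
   unfolding Xm mod_mult_self3 using a by simp_all
  have T: "mt (?s (r * m + al)) = mt (?s (r * m))" "mt (?s (Suc r * m + al)) = mt (?s (Suc r * m))"
   using MT[OF a, of r] MT[OF a, of "Suc r"] MT[of 0 r] MT[of 0 "Suc r"] m(1) by simp_all
  have ik: "ikp (iof (mlet (?s (Suc r * m + al)))) = mkp (?s (Suc r * m))"
   using keep[OF a, of "Suc r"] by (simp only: mlet_info(1)[OF S]) (simp add: minfo_def)
  show ?thesis unfolding cmp_def cmp_ok_def y(1) y(2) One_nat_def mlet_nth ik Y T
   using tc dc rec[OF a, of r] rec[OF a, of "Suc r"] by (simp only: moff_def)
 qed
 ultimately show ?thesis unfolding spec_def by blast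
qed

end

section \<open>The formula of a computation\<close>

type_synonym fm = "(nat, nat) qf"

definition pv :: "nat => fm" where "pv p = Prop 0 (2 * p + 1)"
text \<open>Powers of two have digits that are trivial to print, which matters because the number of
  address variables grows with the input. The odd names of \<open>pv\<close> are constants for a
  fixed machine and are distinct from these even ones.\<close>

definition pa :: "nat => fm" where "pa i = Prop 0 (2 ^ Suc i)"
definition ttf :: fm where "ttf = Or (pv 0) (Neg (pv 0))"
definition andf :: "fm => fm => fm" where "andf ph ps = Neg (Or (Neg ph) (Neg ps))"
definition conjf :: "fm list => fm" where "conjf phs = foldr andf phs ttf"
definition allf :: "fm => fm" where "allf ph = Neg (Until ttf (Neg ph))"

text \<open>The truth table of \<open>R\<close> as a formula. It is exponential in the number of
  arguments, so it is applied only to lists whose length does not depend on the input.\<close>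

fun bf :: "(bool list => bool) => fm list => fm" where
 "bf R [] = (if R [] then ttf else Neg ttf)"
| "bf R (ph # phs) = Or (andf ph (bf (%l. R (True # l)) phs)) (andf (Neg ph) (bf (%l. R (False # l)) phs))"

lemma sat_ttf [simp]: "sat A i ttf" by (simp add: ttf_def)
lemma sat_andf [simp]: "sat A i (andf ph ps) \<longleftrightarrow> sat A i ph & sat A i ps" by (simp add: andf_def)
lemma sat_conjf [simp]: "sat A i (conjf phs) \<longleftrightarrow> (ALL ph:set phs. sat A i ph)" by (induction phs) (auto simp: conjf_def)
lemma sat_allf [simp]: "sat A i (allf ph) \<longleftrightarrow> (ALL j>=i. sat A j ph)" by (auto simp: allf_def sat.simps(5))
lemma sat_bf [simp]: "sat A i (bf R phs) \<longleftrightarrow> R (map (sat A i) phs)"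
proof (induction phs arbitrary: R)
 case (Cons ph phs) then show ?case by (cases "sat A i ph") simp_all
qed simp

fun incb :: "bool => bool list => bool list" where
 "incb c [] = [c]" | "incb c (d # ds) = (d ~= c) # incb (d & c) ds"

text \<open>A numeral for \<open>l\<close> with \<open>l\<close> digits, one more per increment. The
  surplus digits are leading zeros, and the length stays polynomial.\<close>

primrec dg :: "nat => bool list" where "dg 0 = []" | "dg (Suc l) = incb True (dg l)"

lemma incb: "undig (incb c ds) = undig ds + of_bool c & length (incb c ds) = Suc (length ds)"
 by (induction c ds rule: incb.induct) auto

lemma dg: "undig (dg l) = l & length (dg l) = l" by (induction l) (simp_all add: incb)

locale game_formula =
 fixes M :: tm and ka :: nat and dec :: "bool list => info" and b :: nat and w :: "bool list"
begin

abbreviation "kt \<equiv> num_tapes M"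
abbreviation "K \<equiv> 5 + ka"

definition "svs = map pv [0..<K]"
definition "mkf = pv K"
definition "chs = map pv [Suc K..<Suc K + kt]"
definition "lst = conjf (map pa [0..<b])"
definition "fst_f = conjf (map (%i. Neg (pa i)) [0..<b])"
text \<open>Quantification over the rest of the current record, which ends where all address bits
  are set.\<close>

definition "ue ph ps = Until (andf ph (Neg lst)) (andf lst ps)"
definition "incf i = bf (%l. l ! 0 = (l ! 1 ~= l ! 2)) [Next (pa i), pa i, conjf (map pa [0..<i])]"
definition "step_f = bf (%l. step_ok M dec (l ! 0) (take K (drop 1 l)) (take kt (drop (Suc K) l)) (drop (Suc K + kt) l))
 (lst # svs @ chs @ map Next svs)"
text \<open>Evaluates \<open>ps\<close> at the first mark, provided that this mark lies in the next
  record.\<close>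

definition "nmf ps = ue (Neg mkf) (andf (Neg mkf) (Next (Until (andf (Neg mkf) (Neg lst)) (andf mkf ps))))"
text \<open>Addresses are compared bit by bit, so only a mark at the same place of the next record
  triggers the check. This reaches \<open>2 ^ b\<close> positions ahead in size polynomial in
  \<open>b\<close>.\<close>

definition "cmp_f = bf (%l. l ! 0 & l ! 1 --> cmp_ok dec (drop 5 l) (l ! 2) (l ! 3) (l ! 4))
 ([nmf ttf, conjf (map (%i. bf (%l. l ! 0 = l ! 1) [pa i, nmf (pa i)]) [0..<b]), nmf (pv 0), nmf (pv 2),
  nmf (bf (%l. ikp (dec (drop 5 l))) svs)] @ svs)"

text \<open>Compares the offset with a constant: first its low bits with the digits, then all bits
  up to the end of the record with zero.\<close>

primrec chain :: "bool list => fm" where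
 "chain [] = ue (Neg (pv 2)) (Neg (pv 2))"
| "chain (d # ds) = andf (if d then pv 2 else Neg (pv 2)) (Next (chain ds))"

definition "in_f l = bf (%x. x ! 0 & ii (dec (drop 6 x)) = 0 --> ia (dec (drop 6 x)) = (if w ! l then 2 else 1)) (chain (dg l) # svs)"
definition "out_f = bf (%x. iq (dec (drop 6 x)) = start M & (x ! 0 \<or> ii (dec (drop 6 x)) ~= 0 --> ia (dec (drop 6 x)) = 0))
 (conjf (map (%l. Neg (chain (dg l))) [0..<length w]) # svs)"
definition "input_f = bf (%l. l ! 0 & l ! 1 --> l ! 2 & l ! 3) [fst_f, ue ttf (bf (%l. zero_time l) svs), out_f, conjf (map in_f [0..<length w])]"
definition "init_f = andf (bf (init_ok M dec) svs) (andf fst_f (ue (pv 0) (pv 0)))"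
definition "matrix_f = andf init_f (allf (andf (conjf (map incf [0..<b])) (andf step_f (andf cmp_f input_f))))"

end

lemma num_shift: "num f (Suc n) = of_bool (f 0) + 2 * num (%i. f (Suc i)) n"
 by (induction n) (simp_all add: num_Suc)

lemma slices:
 assumes "length a = n" "length c = l"
 shows "(x # a @ c @ d) ! 0 = x" "take n (drop 1 (x # a @ c @ d)) = a" "take l (drop (Suc n) (x # a @ c @ d)) = c"
  "drop (Suc n + l) (x # a @ c @ d) = d"
 using assms by auto

lemma upto_last: "s <= (e::nat) ==> Q e & (ALL x. s <= x & x < e --> Q x) \<longleftrightarrow> (ALL x. s <= x & x < Suc e --> Q x)"
 by (auto simp: less_Suc_eq)

lemma of_bool_eq: "of_bool p + 2 * a = of_bool q + 2 * (c::nat) \<longleftrightarrow> p = q & a = c"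
 by (cases p; cases q; simp; presburger)

section \<open>Semantics of the game formula\<close>

locale game_sem = game_formula M ka dec b w + tm_game M w N t0 "2 ^ b" ka dec
 for M ka dec b w N t0 +
 assumes lw: "length w < 2 ^ b"
begin

context
 fixes A :: "nat \<rightharpoonup> nat trace"
begin

definition "P v z \<longleftrightarrow> (0::nat) : the (A v) z"
definition "adr \<longleftrightarrow> (ALL z. ALL i<b. P (2 ^ Suc i) z = bit (z mod 2 ^ b) i)"
definition "Ls z = map (%p. P (2 * p + 1) z) [0..<K]"
definition "Js z = map (%p. P (2 * p + 1) z) [Suc K..<Suc K + kt]"
definition "mark z \<longleftrightarrow> P (2 * K + 1) z"

lemma sat_props: "sat A z (pv p) = P (2 * p + 1) z" "sat A z (pa i) = P (2 ^ Suc i) z" "sat A z mkf = mark z"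
 "map (sat A z) svs = Ls z" "map (sat A z) chs = Js z" "map (sat A z) (map Next svs) = Ls (Suc z)"
 by (auto simp: pv_def pa_def P_def mkf_def mark_def svs_def chs_def Ls_def Js_def)

lemma len_LJ [simp]: "length (Ls z) = K" "length (Js z) = kt" by (simp_all add: Ls_def Js_def)

lemma Ls_nth: "sat A z (pv 0) = Ls z ! 0" "sat A z (pv 2) = Ls z ! 2" by (simp_all add: sat_props Ls_def del: upt_Suc)

abbreviation "m \<equiv> (2::nat) ^ b"
definition "eor y = y + (m - 1 - y mod m)"

lemma bits_Suc: "i < b ==> bit (Suc z mod m) i = (bit (z mod m) i ~= (ALL j<i. bit (z mod m) j))"
proof -
 assume i: "i < b"
 let ?x = "bit (z mod m)" and ?c = "%i. ALL j<i. bit (z mod m) j"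
 have "num (%i. ?x i ~= ?c i) b + of_bool (?c b) * m = num ?x b + of_bool (?c 0)"
  by (rule ripple_inc) (auto simp: less_Suc_eq)
 then have e: "num (%i. ?x i ~= ?c i) b + of_bool (?c b) * m = z mod m + 1" by (simp add: num_bit)
 have "num (%i. ?x i ~= ?c i) b = (num (%i. ?x i ~= ?c i) b + of_bool (?c b) * m) mod m"
  using num_less[of "%i. ?x i ~= ?c i" b] by simp
 also have "... = Suc z mod m" unfolding e by (simp add: mod_Suc_eq)
 finally show ?thesis using bit_num[OF i, of "%i. ?x i ~= ?c i"] by simp
qed

lemma adr_iff: "adr \<longleftrightarrow> sat A 0 fst_f & (ALL z. ALL i<b. sat A z (incf i))"
proof -
 have inc: "sat A z (incf i) \<longleftrightarrow> P (2 ^ Suc i) (Suc z) = (P (2 ^ Suc i) z ~= (ALL j<i. P (2 ^ Suc j) z))" for z i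
  by (auto simp: incf_def sat_props)
 show ?thesis
 proof
  assume a: adr
  then show "sat A 0 fst_f & (ALL z. ALL i<b. sat A z (incf i))"
   unfolding inc using bits_Suc by (auto simp: adr_def fst_f_def sat_props)
 next
  assume a: "sat A 0 fst_f & (ALL z. ALL i<b. sat A z (incf i))"
  have "ALL i<b. P (2 ^ Suc i) z = bit (z mod 2 ^ b) i" for z
  proof (induction z)
   case 0 then show ?case using a by (simp add: fst_f_def sat_props)
  next
   case (Suc z)
   show ?case
   proof (intro allI impI)
    fix i assume i: "i < b"
    have "P (2 ^ Suc i) (Suc z) = (P (2 ^ Suc i) z ~= (ALL j<i. P (2 ^ Suc j) z))" using a i inc by blast
    also have "... = (bit (z mod m) i ~= (ALL j<i. bit (z mod m) j))" using Suc i by auto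
    finally show "P (2 ^ Suc i) (Suc z) = bit (Suc z mod 2 ^ b) i" using bits_Suc[OF i] by simp
   qed
  qed
  then show adr by (simp add: adr_def)
 qed
qed

lemma mpos: "0 < m" by simp

lemma mod_le: "y mod m <= m - 1" using mod_less_divisor[OF mpos, of y] by linarith

lemma eor: "y <= eor y" "eor y = y div m * m + (m - 1)" "Suc (eor y) mod m = 0" "y <= x ==> x < eor y ==> Suc x mod m ~= 0"
proof -
 show "y <= eor y" by (simp add: eor_def)
 show e: "eor y = y div m * m + (m - 1)" using mod_le[of y] div_mult_mod_eq[of y m] unfolding eor_def by linarith
 have "Suc (eor y) = Suc (y div m) * m" unfolding e using mpos by simp
 then show "Suc (eor y) mod m = 0" by simp
 assume "y <= x" "x < eor y"
 then have "y div m * m <= x" "x < y div m * m + (m - 1)" using e div_mult_mod_eq[of y m] by linarith+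
 then obtain a where a: "x = y div m * m + a" "Suc a < m" using le_Suc_ex by (metis add_less_cancel_left less_diff_conv Suc_eq_plus1)
 then have "Suc x = y div m * m + Suc a" by simp
 then have "Suc x mod m = Suc a" using a(2) by (metis mod_less mod_mult_self3)
 then show "Suc x mod m ~= 0" by simp
qed

context
 assumes ad: adr
begin

lemma sat_lst: "sat A z lst \<longleftrightarrow> Suc z mod m = 0"
proof -
 have "sat A z lst \<longleftrightarrow> (ALL i<b. bit (z mod m) i)" using ad by (auto simp: lst_def sat_props adr_def)
 also have "... \<longleftrightarrow> z mod m = m - 1"
 proof
  assume "ALL i<b. bit (z mod m) i"
  then have "num (bit (z mod m)) b = m - 1" by (intro num_all) auto
  then show "z mod m = m - 1" by (simp add: num_bit)
 next
  assume z: "z mod m = m - 1"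
  have "num (%_. True) b = m - 1" by (simp add: num_all)
  then show "ALL i<b. bit (z mod m) i" unfolding z using bit_num[of _ b "%_. True"] by simp
 qed
 also have "... \<longleftrightarrow> Suc z mod m = 0" using mod_Suc[of z m] mod_le[of z] mpos by (auto split: if_splits)
 finally show ?thesis .
qed

lemma sat_fst: "sat A z fst_f \<longleftrightarrow> z mod m = 0"
proof -
 have "sat A z fst_f \<longleftrightarrow> (ALL i<b. ~ bit (z mod m) i)" using ad by (auto simp: fst_f_def sat_props adr_def)
 also have "... \<longleftrightarrow> z mod m = 0" unfolding num_eq_0[symmetric] num_bit by simp
 finally show ?thesis .
qed

lemma sat_ue: "sat A y (ue ph ps) \<longleftrightarrow> sat A (eor y) ps & (ALL x. y <= x & x < eor y --> sat A x ph)"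
proof
 assume "sat A y (ue ph ps)"
 then obtain j where j: "y <= j" "Suc j mod m = 0" "sat A j ps" "!!x. y <= x ==> x < j ==> sat A x ph & Suc x mod m ~= 0"
  unfolding ue_def by (auto simp: sat_lst sat.simps(5))
 have "j = eor y" using j(1,2,4) eor(1,3,4) by (metis linorder_neqE_nat)
 then show "sat A (eor y) ps & (ALL x. y <= x & x < eor y --> sat A x ph)" using j by blast
next
 assume r: "sat A (eor y) ps & (ALL x. y <= x & x < eor y --> sat A x ph)"
 show "sat A y (ue ph ps)" unfolding ue_def sat.simps(5)
  by (rule exI[of _ "eor y"]) (use r eor in "auto simp: sat_lst")
qed

lemma sat_nmf: "sat A y (nmf ps) \<longleftrightarrow>
 (EX z. eor y < z & z <= eor y + m & mark z & (ALL x. y <= x & x < z --> ~ mark x) & sat A z ps)"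
proof -
 have e2: "eor (Suc (eor y)) = eor y + m"
  using eor(3)[of y] mpos by (simp add: eor_def[of "Suc (eor y)"])
 have "(EX z>=Suc (eor y). (mark z & sat A z ps) & (ALL x. Suc (eor y) <= x & x < z --> ~ mark x & ~ Suc x mod m = 0)) \<longleftrightarrow>
  (EX z. eor y < z & z <= eor y + m & mark z & (ALL x. eor y < x & x < z --> ~ mark x) & sat A z ps)" (is "?a = ?b")
 proof
  assume ?a
  then obtain z where z: "Suc (eor y) <= z" "mark z" "sat A z ps" "!!x. Suc (eor y) <= x ==> x < z ==> ~ mark x & ~ Suc x mod m = 0" by blast
  have "~ eor y + m < z"
  proof
   assume "eor y + m < z"
   then have "~ Suc (eor (Suc (eor y))) mod m = 0" using z(4)[of "eor y + m"] mpos e2 by simp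
   then show False using eor(3)[of "Suc (eor y)"] by blast
  qed
  then show ?b using z by (intro exI[of _ z]) auto
 next
  assume ?b
  then obtain z where z: "eor y < z" "z <= eor y + m" "mark z" "!!x. eor y < x ==> x < z ==> ~ mark x" "sat A z ps" by blast
  have "~ Suc x mod m = 0" if "Suc (eor y) <= x" "x < z" for x using eor(4)[OF that(1)] that(2) z(2) e2 by simp
  then show ?a using z by (intro exI[of _ z]) auto
 qed
 moreover have "sat A y (nmf ps) \<longleftrightarrow> (ALL x. y <= x & x <= eor y --> ~ mark x) &
  (EX z>=Suc (eor y). (mark z & sat A z ps) & (ALL x. Suc (eor y) <= x & x < z --> ~ mark x & ~ Suc x mod m = 0))"
  unfolding nmf_def sat_ue using eor(1)[of y] by (auto simp: sat_props sat_lst le_less sat.simps(5))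
 moreover have "(ALL x. y <= x & x <= eor y --> ~ mark x) &
   (EX z. eor y < z & z <= eor y + m & mark z & (ALL x. eor y < x & x < z --> ~ mark x) & sat A z ps) \<longleftrightarrow>
  (EX z. eor y < z & z <= eor y + m & mark z & (ALL x. y <= x & x < z --> ~ mark x) & sat A z ps)"
 proof -
  have "(ALL x. y <= x & x <= eor y --> ~ mark x) & (ALL x. eor y < x & x < z --> ~ mark x) \<longleftrightarrow> (ALL x. y <= x & x < z --> ~ mark x)"
   if "eor y < z" for z
   using that eor(1)[of y] by (meson le_less_trans less_imp_le_nat not_le order_trans)
  then show ?thesis by blast
 qed
 ultimately show ?thesis by simp
qed

text \<open>The first mark in the next record is unique, so all \<open>nmf\<close> conditions speak
  about one position. Equal addresses in adjacent records mean a distance of exactly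
  \<open>2 ^ b\<close>.\<close>

lemma sat_cmp_f: "sat A y cmp_f \<longleftrightarrow> (mark (y + m) & (ALL x. y <= x & x < y + m --> ~ mark x) --> cmp Ls y)"
proof -
 let ?F = "%z. eor y < z & z <= eor y + m & mark z & (ALL x. y <= x & x < z --> ~ mark x)"
 have un: "z = z'" if "?F z" "?F z'" for z z' using that eor(1)[of y] by (metis linorder_neqE_nat le_less_trans less_imp_le_nat)
 have nm: "sat A y (nmf ps) \<longleftrightarrow> sat A z ps" if "?F z" for z ps unfolding sat_nmf using that un by blast
 have kp: "sat A z (bf (%l. ikp (dec (drop 5 l))) svs) = ikp (iof (Ls z))" for z by (simp only: sat_bf sat_props)
 have c: "sat A y cmp_f \<longleftrightarrow> (sat A y (nmf ttf) & (ALL i<b. sat A y (pa i) = sat A y (nmf (pa i))) -->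
   cmp_ok dec (Ls y) (sat A y (nmf (pv 0))) (sat A y (nmf (pv 2))) (sat A y (nmf (bf (%l. ikp (dec (drop 5 l))) svs))))"
 proof -
  have "map (sat A y) ([f0, f1, f2, f3, f4] @ svs) = [sat A y f0, sat A y f1, sat A y f2, sat A y f3, sat A y f4] @ Ls y" for f0 f1 f2 f3 f4
   by (simp add: sat_props)
  moreover have "(ALL i<b. sat A y (pa i) = sat A y (nmf (pa i))) = sat A y (conjf (map (%i. bf (%l. l ! 0 = l ! 1) [pa i, nmf (pa i)]) [0..<b]))"
   by auto
  ultimately show ?thesis unfolding cmp_f_def sat_bf by (simp add: numeral_eq_Suc del: sat_bf sat_conjf)
 qed
 show ?thesis
 proof (cases "EX z. ?F z")
  case False
  have "eor y < y + m" "y + m <= eor y + m" using eor(1)[of y] mpos by (auto simp: eor_def)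
  then have "~ (mark (y + m) & (ALL x. y <= x & x < y + m --> ~ mark x))" using False by blast
  then show ?thesis unfolding c using False sat_nmf[of y ttf] by blast
 next
  case True
  then obtain z where z: "?F z" by blast
  have a: "(ALL i<b. sat A y (pa i) = sat A z (pa i)) \<longleftrightarrow> z = y + m"
  proof -
   have "(ALL i<b. sat A y (pa i) = sat A z (pa i)) \<longleftrightarrow> (ALL i<b. bit (y mod m) i = bit (z mod m) i)"
    using ad by (simp add: sat_props adr_def)
   also have "... \<longleftrightarrow> y mod m = z mod m"
   proof
    assume "ALL i<b. bit (y mod m) i = bit (z mod m) i"
    then have "num (bit (y mod m)) b = num (bit (z mod m)) b" by (intro num_cong) blast
    then show "y mod m = z mod m" by (simp add: num_bit)
   qed simp
   also have "... \<longleftrightarrow> z = y + m"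
   proof
    assume e: "y mod m = z mod m"
    have "z div m = Suc (y div m)"
    proof -
     obtain q where q: "z = Suc (eor y) + q" "q < m" using z less_iff_Suc_add[of "eor y" z] by auto
     have "z = q + Suc (y div m) * m" unfolding q(1) eor(2) using mpos by simp
     then show ?thesis using q(2) by (metis add.right_neutral add.commute div_less div_mult_self3 less_nat_zero_code mpos)
    qed
    then show "z = y + m" using e div_mult_mod_eq[of z m] div_mult_mod_eq[of y m] by simp
   qed simp
   finally show ?thesis .
  qed
  have e: "(mark (y + m) & (ALL x. y <= x & x < y + m --> ~ mark x)) \<longleftrightarrow> z = y + m"
  proof
   assume h: "mark (y + m) & (ALL x. y <= x & x < y + m --> ~ mark x)"
   have "eor y < y + m" "y + m <= eor y + m" using eor(1)[of y] mpos by (auto simp: eor_def)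
   then show "z = y + m" using h un[OF z, of "y + m"] by blast
  qed (use z in blast)
  show ?thesis unfolding c nm[OF z] a e kp by (auto simp: cmp_def Ls_nth)
 qed
qed

text \<open>Induction peels off the lowest of the bits that remain in the record. The digits must
  end before the record does, so that the final test for zeros still lies inside it.\<close>

lemma sat_chain: "al + length ds < m ==> sat A (r * m + al) (chain ds) \<longleftrightarrow> num (%\<beta>. Ls (r * m + al + \<beta>) ! 2) (m - al) = undig ds"
proof (induction ds arbitrary: al)
 case Nil
 then have a: "al < m" by simp
 have e: "eor (r * m + al) = r * m + (m - 1)" unfolding eor(2) using a by simp
 have "sat A (r * m + al) (chain []) \<longleftrightarrow> (ALL x. r * m + al <= x & x < r * m + m --> ~ Ls x ! 2)"
 proof -
  have "Suc (r * m + (m - 1)) = r * m + m" using mpos by simp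
  then show ?thesis unfolding chain.simps sat_ue e sat.simps(2) Ls_nth
   using upto_last[of "r * m + al" "r * m + (m - 1)" "%x. ~ Ls x ! 2"] a by simp
 qed
 also have "... \<longleftrightarrow> (ALL \<beta><m - al. ~ Ls (r * m + al + \<beta>) ! 2)"
 proof (intro iffI allI impI)
  fix x assume h: "ALL \<beta><m - al. ~ Ls (r * m + al + \<beta>) ! 2" and x: "r * m + al <= x & x < r * m + m"
  have "x - (r * m + al) < m - al" "r * m + al + (x - (r * m + al)) = x" using x by linarith+
  then show "~ Ls x ! 2" using h by metis
 qed simp
 finally show ?case by (simp add: num_eq_0)
next
 case (Cons d ds)
 have s: "m - al = Suc (m - Suc al)" using Cons.prems by simp
 have IH: "sat A (r * m + Suc al) (chain ds) \<longleftrightarrow> num (%\<beta>. Ls (r * m + Suc al + \<beta>) ! 2) (m - Suc al) = undig ds"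
  by (rule Cons.IH) (use Cons.prems in simp)
 have F: "sat A (r * m + al) (chain (d # ds)) \<longleftrightarrow> Ls (r * m + al) ! 2 = d & sat A (r * m + Suc al) (chain ds)"
  by (simp add: Ls_nth)
 then show ?case unfolding s num_shift F IH undig.simps of_bool_eq by simp
qed

lemma sat_input: "sat A z input_f \<longleftrightarrow> (z mod m = 0 & zero_time (Ls (eor z)) -->
 input_ok M w (iof (Ls z)) (num (%al. Ls (z + al) ! 2) m))"
proof -
 let ?d = "num (%al. Ls (z + al) ! 2) m"
 have ch: "sat A z (chain (dg l)) \<longleftrightarrow> ?d = l" if "z mod m = 0" "l < length w" for l
 proof -
  have "sat A (z div m * m + 0) (chain (dg l)) \<longleftrightarrow> num (%\<beta>. Ls (z div m * m + 0 + \<beta>) ! 2) (m - 0) = undig (dg l)"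
   by (rule sat_chain) (use dg[of l] that lw in simp)
  moreover have "z div m * m = z" using that(1) by auto
  ultimately show ?thesis using dg[of l] by simp
 qed
 have z: "sat A z (ue ttf (bf (%l. zero_time l) svs)) = zero_time (Ls (eor z))" unfolding sat_ue sat_bf sat_props by simp
 have i: "sat A z (in_f l) \<longleftrightarrow> (sat A z (chain (dg l)) & ii (iof (Ls z)) = 0 --> ia (iof (Ls z)) = (if w ! l then 2 else 1))" for l
  unfolding in_f_def sat_bf list.map sat_props by (simp add: numeral_eq_Suc)
 have cj: "sat A z (conjf (map f [0..<length w])) \<longleftrightarrow> (ALL l<length w. sat A z (f l))" for f by auto
 have o: "sat A z out_f \<longleftrightarrow> iq (iof (Ls z)) = start M &
   ((ALL l<length w. ~ sat A z (chain (dg l))) \<or> ii (iof (Ls z)) ~= 0 --> ia (iof (Ls z)) = 0)"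
  unfolding out_f_def sat_bf list.map sat_props cj by (simp add: numeral_eq_Suc)
 have "sat A z input_f \<longleftrightarrow> (z mod m = 0 & zero_time (Ls (eor z)) --> sat A z out_f & (ALL l<length w. sat A z (in_f l)))"
  unfolding input_f_def sat_bf list.map sat_fst z cj by (simp add: numeral_eq_Suc)
 also have "... \<longleftrightarrow> (z mod m = 0 & zero_time (Ls (eor z)) --> input_ok M w (iof (Ls z)) ?d)"
 proof (intro imp_cong refl)
  assume "z mod m = 0 & zero_time (Ls (eor z))"
  then have zm: "z mod m = 0" ..
  show "(sat A z out_f & (ALL l<length w. sat A z (in_f l))) = input_ok M w (iof (Ls z)) ?d"
   unfolding o i input_ok_def using ch[OF zm] by (auto split: if_splits)
 qed
 finally show ?thesis .
qed

lemma sat_step: "sat A z step_f \<longleftrightarrow> step_ok M dec (Suc z mod m = 0) (Ls z) (Js z) (Ls (Suc z))"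
proof -
 have "map (sat A z) (lst # svs @ chs @ map Next svs) = (Suc z mod m = 0) # Ls z @ Js z @ Ls (Suc z)"
  by (simp only: list.map map_append sat_lst sat_props)
 then show ?thesis unfolding step_f_def sat_bf by (simp only: slices[OF len_LJ(1)[of z] len_LJ(2)[of z]])
qed

lemma sat_init: "sat A 0 init_f \<longleftrightarrow> init_ok M dec (Ls 0) & sat A 0 fst_f & (ALL z<m. Ls z ! 0)"
proof -
 have "eor 0 = m - 1" by (simp add: eor_def)
 moreover have "Suc (m - 1) = m" using mpos by simp
 ultimately show ?thesis unfolding init_f_def sat_andf sat_bf sat_props(4) sat_ue Ls_nth
  using upto_last[of 0 "m - 1" "%x. Ls x ! 0"] by simp
qed

end

lemma sat_matrix_f:
 "sat A 0 matrix_f \<longleftrightarrow> adr & spec Ls Js & (ALL y. mark (y + m) & (ALL x. y <= x & x < y + m --> ~ mark x) --> cmp Ls y)"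
proof (cases adr)
 case True
 have "(ALL z. sat A z input_f) \<longleftrightarrow> (ALL r. zero_time (Ls (r * m + (m - 1))) --> input_ok M w (iof (Ls (r * m))) (num (%al. Ls (r * m + al) ! 2) m))"
 proof
  assume h: "ALL z. sat A z input_f"
  show "ALL r. zero_time (Ls (r * m + (m - 1))) --> input_ok M w (iof (Ls (r * m))) (num (%al. Ls (r * m + al) ! 2) m)"
  proof
   fix r
   have "eor (r * m) = r * m + (m - 1)" by (simp add: eor(2))
   then show "zero_time (Ls (r * m + (m - 1))) --> input_ok M w (iof (Ls (r * m))) (num (%al. Ls (r * m + al) ! 2) m)"
    using h[rule_format, of "r * m"] unfolding sat_input[OF True] by simp
  qed
 next
  assume h: "ALL r. zero_time (Ls (r * m + (m - 1))) --> input_ok M w (iof (Ls (r * m))) (num (%al. Ls (r * m + al) ! 2) m)"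
  show "ALL z. sat A z input_f" unfolding sat_input[OF True]
  proof (intro allI impI)
   fix z assume z: "z mod m = 0 & zero_time (Ls (eor z))"
   then have "z div m * m = z" by auto
   then show "input_ok M w (iof (Ls z)) (num (%al. Ls (z + al) ! 2) m)"
    using h[rule_format, of "z div m"] z unfolding eor(2) by simp
  qed
 qed
 moreover have "sat A 0 fst_f & (ALL z. ALL i<b. sat A z (incf i))" using True adr_iff by blast
 ultimately show ?thesis using True unfolding matrix_f_def sat_andf sat_allf sat_init[OF True] spec_def sat_conjf
  by (simp add: sat_step[OF True] sat_cmp_f[OF True] all_conj_distrib) blast
next
 case False
 have "sat A 0 matrix_f ==> sat A 0 fst_f & (ALL z. ALL i<b. sat A z (incf i))"
  by (simp add: matrix_f_def init_f_def)
 then show ?thesis using False adr_iff by blast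
qed

end

end

lemma play_at:
 assumes "distinct (univ_vars X @ exist_vars X)"
 shows "j < length (univ_vars X) ==> play_assignment X sg u (univ_vars X ! j) = Some (trace_of (system X) (%i. u i ! j))"
  "l < length (exist_vars X) ==> play_assignment X sg u (exist_vars X ! l) = Some (trace_of (system X) (%i. sg (map u [0..<i]) ! l))"
proof -
 let ?vs = "univ_vars X @ exist_vars X"
 let ?ts = "map (%j. trace_of (system X) (%i. u i ! j)) [0..<length (univ_vars X)] @
      map (%k. trace_of (system X) (%i. sg (map u [0..<i]) ! k)) [0..<length (exist_vars X)]"
 have z: "play_assignment X sg u (?vs ! j) = Some (?ts ! j)" if "j < length ?vs" for j
  unfolding play_assignment_def Let_def by (rule map_of_zip_nth) (use assms that in auto)
 show "j < length (univ_vars X) ==> play_assignment X sg u (univ_vars X ! j) = Some (trace_of (system X) (%i. u i ! j))"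
  using z[of j] by (simp add: nth_append)
 show "l < length (exist_vars X) ==> play_assignment X sg u (exist_vars X ! l) = Some (trace_of (system X) (%i. sg (map u [0..<i]) ! l))"
  using z[of "length (univ_vars X) + l"] by (simp add: nth_append)
qed

section \<open>The instance and its realizability\<close>

context game_formula begin

text \<open>With one input proposition and a single state without outputs a trace is the input
  sequence itself, so each trace variable carries one bit per step. The universal variables are the
  mark and the flags of the environment, the existential ones the letter and the address.\<close>

definition game_inst :: problem_instance where
 "game_inst = \<lparr>in_props = {0}, out_props = {}, system = \<lparr>states = {0}, init = 0, trans = (%_ _. 0), label = (%_. {})\<rparr>,
   univ_vars = map (%p. 2 * p + 1) [K..<Suc K + kt], exist_vars = map (%p. 2 * p + 1) [0..<K] @ map (%i. 2 ^ Suc i) [0..<b],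
   matrix = matrix_f\<rparr>"

abbreviation "vars \<equiv> set (univ_vars game_inst @ exist_vars game_inst)"
definition "fit ph \<longleftrightarrow> set1_qf ph <= {0::nat} & set2_qf ph <= vars"

lemma fit_simps [simp]:
 "fit (Neg ph) \<longleftrightarrow> fit ph" "fit (Or ph ps) \<longleftrightarrow> fit ph & fit ps" "fit (Next ph) \<longleftrightarrow> fit ph" "fit (Until ph ps) \<longleftrightarrow> fit ph & fit ps"
 by (auto simp: fit_def)

lemma fit_pv [simp]: "p < Suc K + kt ==> fit (pv p)" "i < b ==> fit (pa i)"
 by (auto simp: fit_def pv_def pa_def game_inst_def image_iff)

lemma fit_ttf [simp]: "fit ttf" by (simp add: ttf_def)
lemma fit_andf [simp]: "fit (andf ph ps) \<longleftrightarrow> fit ph & fit ps" by (simp add: andf_def)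
lemma fit_conjf [simp]: "fit (conjf phs) \<longleftrightarrow> (ALL ph:set phs. fit ph)" by (induction phs) (auto simp: conjf_def)
lemma fit_bf [simp]: "ALL ph:set phs. fit ph ==> fit (bf R phs)" by (induction phs arbitrary: R) auto

lemma fit_basic [simp]: "ph : set svs ==> fit ph" "ph : set chs ==> fit ph" "fit mkf" "fit lst" "fit fst_f"
 by (auto simp: svs_def chs_def mkf_def lst_def fst_f_def)
lemma fit_ue [simp]: "fit (ue ph ps) \<longleftrightarrow> fit ph & fit ps" by (simp add: ue_def)
lemma fit_nmf [simp]: "fit (nmf ph) \<longleftrightarrow> fit ph" by (simp add: nmf_def)
lemma fit_chain [simp]: "fit (chain ds)" by (induction ds) auto

lemma fit_matrix: "fit matrix_f"
 unfolding matrix_f_def init_f_def incf_def step_f_def cmp_f_def input_f_def out_f_def in_f_def allf_def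
 by (auto intro!: fit_bf)

lemma distinct_vars: "distinct (univ_vars game_inst @ exist_vars game_inst)"
proof -
 have "Suc (2 * p) ~= 2 * 2 ^ i" for i p :: nat by (rule notI, drule arg_cong[where f = even], simp)
 then show ?thesis by (auto simp: game_inst_def distinct_map inj_on_def)
qed

lemma valid_game: "valid_instance game_inst"
 using fit_matrix distinct_vars unfolding valid_instance_def fit_def
 by (auto simp: game_inst_def transition_system_def)

end

context game_sem begin

abbreviation (input) "bset \<equiv> %c. if c then {0::nat} else {}"
abbreviation "Ug \<equiv> tuples (Suc kt) (Pow {0::nat})"
abbreviation "Vg \<equiv> tuples (K + b) (Pow {0::nat})"

lemma game_dims: "length (univ_vars game_inst) = Suc kt" "length (exist_vars game_inst) = K + b" "in_props game_inst = {0}"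
 by (simp_all add: game_inst_def)

lemma play_bits:
 fixes sg :: "nat set list list => nat set list"
 defines "A \<equiv> %u. play_assignment game_inst sg u"
 shows "Ls (A u) z = map (%p. 0 : sg (map u [0..<z]) ! p) [0..<K]"
  "Js (A u) z = map (%j. 0 : u z ! Suc j) [0..<kt]" "mark (A u) z \<longleftrightarrow> 0 : u z ! 0"
  "i < b ==> P (A u) (2 ^ Suc i) z \<longleftrightarrow> 0 : sg (map u [0..<z]) ! (K + i)"
proof -
 have tr: "trace_of (system game_inst) f z = f z" for f z by (simp add: trace_of_def game_inst_def)
 have un: "P (A u) (2 * (K + j) + 1) z \<longleftrightarrow> 0 : u z ! j" if "j < Suc kt" for j
 proof -
  have "univ_vars game_inst ! j = 2 * (K + j) + 1" using that by (simp add: game_inst_def del: upt_Suc)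
  then show ?thesis using play_at(1)[OF distinct_vars, of j sg u] that by (simp add: P_def A_def game_dims tr)
 qed
 have ex: "P (A u) (exist_vars game_inst ! l) z \<longleftrightarrow> 0 : sg (map u [0..<z]) ! l" if "l < K + b" for l
  using play_at(2)[OF distinct_vars, of l sg u] that by (simp add: P_def A_def game_dims tr)
 have e1: "P (A u) (2 * p + 1) z \<longleftrightarrow> 0 : sg (map u [0..<z]) ! p" if "p < K" for p
 proof -
  have "exist_vars game_inst ! p = 2 * p + 1" using that by (simp add: game_inst_def nth_append del: upt_Suc)
  then show ?thesis using ex[of p] that by simp
 qed
 show "Ls (A u) z = map (%p. 0 : sg (map u [0..<z]) ! p) [0..<K]"
  unfolding Ls_def by (rule map_cong[OF refl]) (rule e1, simp)
 show "Js (A u) z = map (%j. 0 : u z ! Suc j) [0..<kt]"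
 proof (rule nth_equalityI)
  fix j assume "j < length (Js (A u) z)"
  then have j: "j < kt" by simp
  then show "Js (A u) z ! j = map (%j. 0 : u z ! Suc j) [0..<kt] ! j"
   using un[of "Suc j"] by (simp add: Js_def del: upt_Suc)
 qed simp
 show "mark (A u) z \<longleftrightarrow> 0 : u z ! 0" using un[of 0] by (simp add: mark_def)
 assume i: "i < b"
 have "exist_vars game_inst ! (K + i) = 2 ^ Suc i" using i by (simp add: game_inst_def nth_append del: upt_Suc)
 then show "P (A u) (2 ^ Suc i) z \<longleftrightarrow> 0 : sg (map u [0..<z]) ! (K + i)" using ex[of "K + i"] i by simp
qed

lemma accept_realizable:
 assumes acc: "st (2 ^ m - 1) = accept M" shows "strategy_realizable game_inst"
proof (rule realizableI[where MS = mems and ?m0.0 = "(0, 0, 0, False)" and up = "%s x. mup s (map (%j. 0 : x ! Suc j) [0..<kt])"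
   and out = "%s. map bset (mlet s @ map (bit (mx s mod m)) [0..<b])"], unfold game_dims)
 show "map bset (mlet s @ map (bit (mx s mod m)) [0..<b]) : Vg" if "s : mems" for s
  using mlet_info(2)[OF that] by (auto simp: tuples_def)
 fix u :: "nat => nat set list" assume "ALL i. u i : Ug"
 let ?up = "%s x. mup s (map (%j. 0 : x ! Suc j) [0..<kt])" and ?out = "%s. map bset (mlet s @ map (bit (mx s mod m)) [0..<b])"
 let ?sg = "%x. ?out (foldl ?up (0, 0, 0, False) x)"
 let ?A = "play_assignment game_inst ?sg u"
 define J where "J z = map (%j. 0 : u z ! Suc j) [0..<kt]" for z
 have lJ: "length (J z) = kt" for z by (simp add: J_def)
 have f: "foldl ?up (0, 0, 0, False) (map u [0..<z]) = mem_at J z" for z by (induction z) (simp_all add: J_def)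
 have S: "mem_at J z : mems" for z by (induction z) (simp_all add: init_mems mup_mems lJ)
 have X: "mx (mem_at J z) = z mod (2 ^ m * m)" for z by (induction z) (simp_all add: mup_def mod_Suc_eq)
 have Xm: "mx (mem_at J z) mod m = z mod m" for z unfolding X by (simp add: mod_mod_cancel)
 have L: "Ls ?A = (%z. mlet (mem_at J z))"
 proof
  fix z
  show "Ls ?A z = mlet (mem_at J z)" unfolding play_bits f
   by (rule nth_equalityI) (use mlet_info(2)[OF S] in "auto simp: nth_append simp del: upt_Suc")
 qed
 have JJ: "Js ?A = J" by (rule ext) (simp add: play_bits J_def)
 have "adr ?A" unfolding adr_def play_bits(4)
 proof (intro allI impI)
  fix z i assume i: "i < b"
  show "P ?A (2 ^ Suc i) z = bit (z mod m) i"
   unfolding play_bits(4)[OF i] f using mlet_info(2)[OF S] i by (simp add: nth_append Xm)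
 qed
 then show "sat ?A 0 (matrix game_inst)"
  using prover_wins[OF lJ acc] sat_matrix_f[of ?A] unfolding L JJ by (simp add: game_inst_def)
next
 fix s and x :: "nat set list" assume "s : mems"
 then show "mup s (map (%j. 0 : x ! Suc j) [0..<kt]) : mems" by (rule mup_mems) simp
qed (rule finite_mems init_mems)+

lemma realizable_accept:
 assumes "strategy_realizable game_inst" shows "st (2 ^ m - 1) = accept M"
proof -
 obtain sg where s: "!!u. (ALL i. u i : Ug) ==> sat (play_assignment game_inst sg u) 0 (matrix game_inst)"
  using assms unfolding strategy_realizable_def game_dims by blast
 define e where "e z v = {} # map bset (challenge z (map (%p. 0 : v ! p) [0..<K]))" for z and v :: "nat set list"
 \<comment> \<open>The play is built by recursion: the flags at \<open>z\<close> refer to the letter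
   printed at \<open>z\<close>, which depends on earlier inputs only. No mark is set in this
   play.\<close>
 define pre where "pre = rec_nat [] (%z xs. xs @ [e z (sg xs)])"
 have pre: "pre 0 = []" "pre (Suc z) = pre z @ [e z (sg (pre z))]" for z by (simp_all add: pre_def)
 define u where "u z = e z (sg (pre z))" for z
 have mu: "map u [0..<z] = pre z" for z by (induction z) (simp_all add: pre u_def)
 have uU: "u z : Ug" for z by (auto simp: u_def e_def tuples_def challenge_def)
 let ?A = "play_assignment game_inst sg u"
 have L: "Ls ?A z = map (%p. 0 : sg (pre z) ! p) [0..<K]" for z unfolding play_bits mu ..
 have nm: "~ mark ?A z" for z unfolding play_bits by (simp add: u_def e_def)
 have J: "Js ?A z = challenge z (Ls ?A z)" for z
  unfolding play_bits(2) L u_def e_def by (rule nth_equalityI) (auto simp: challenge_def)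
 have "sat ?A 0 matrix_f" using s[of u] uU by (simp add: game_inst_def)
 then have sp: "spec (Ls ?A) (Js ?A)" unfolding sat_matrix_f by blast
 have "cmp (Ls ?A) y" for y
 proof -
  \<comment> \<open>The same play with one mark, at \<open>y + m\<close>. The letters up to and
    including that position depend on inputs before the mark, so they are those of the unmarked
    play, to which the enforced comparison transfers.\<close>
  define u' where "u' = u(y + m := {0} # tl (u (y + m)))"
  let ?B = "play_assignment game_inst sg u'"
  have "u' z : Ug" for z using uU[of z] by (auto simp: u'_def tuples_def u_def e_def)
  then have sB: "sat ?B 0 matrix_f" using s[of u'] by (simp add: game_inst_def)
  have "mark ?B z \<longleftrightarrow> z = y + m" for z
   using nm[of z] unfolding play_bits by (auto simp: u'_def)
  then have c: "cmp (Ls ?B) y" using sB unfolding sat_matrix_f by simp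
  have "Ls ?B z = Ls ?A z" if "z <= y + m" for z
  proof -
   have "map u' [0..<z] = map u [0..<z]" using that by (simp add: u'_def)
   then show ?thesis by (simp only: play_bits(1))
  qed
  then show ?thesis using c unfolding cmp_def by simp
 qed
 then show ?thesis by (rule challenger_wins[OF sp _ J])
qed

lemma realizable_iff: "strategy_realizable game_inst \<longleftrightarrow> st (2 ^ m - 1) = accept M"
 using accept_realizable realizable_accept by blast

end

subsection \<open>Writing the instance\<close>

abbreviation "str \<equiv> %ph. tree_word (qf_tree ph)"

definition PF :: "('a::data => fm) => bool" where "PF ph \<longleftrightarrow> PT (%z. str (ph z))"
text \<open>The formulas may vary with the argument, but their number may not. This makes the truth
  tables of \<open>bf\<close> polynomial.\<close>

definition PFL :: "('a::data => fm list) => bool" where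
 "PFL L \<longleftrightarrow> (EX fs. (ALL f:set fs. PF f) & (ALL z. L z = map (%f. f z) fs))"

named_theorems pf

lemma PF_const [pf]: "PF (%z. ph)" unfolding PF_def by (intro pt)
lemma PF_Neg [pf]: "PF ph ==> PF (%z. Neg (ph z))" unfolding PF_def by (simp, intro pt)
lemma PF_Next [pf]: "PF ph ==> PF (%z. Next (ph z))" unfolding PF_def by (simp, intro pt)
lemma PF_Or [pf]: "PF ph ==> PF ps ==> PF (%z. Or (ph z) (ps z))" unfolding PF_def by (simp, intro pt)
lemma PF_Until [pf]: "PF ph ==> PF ps ==> PF (%z. Until (ph z) (ps z))" unfolding PF_def by (simp, intro pt)
lemma PF_andf [pf]: "PF ph ==> PF ps ==> PF (%z. andf (ph z) (ps z))" unfolding andf_def by (intro pf)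
lemma PF_allf [pf]: "PF ph ==> PF (%z. allf (ph z))" unfolding allf_def by (intro pf)

lemma PF_If [pf]: assumes "PT c" "PF ph" "PF ps" shows "PF (%z. if c z then ph z else ps z)"
proof -
 have "PT (%z. if c z then str (ph z) else str (ps z))" using assms unfolding PF_def by (intro pt)
 then show ?thesis unfolding PF_def by (simp only: if_distrib[of str])
qed

lemma PFL_Nil [pf]: "PFL (%z. [])" unfolding PFL_def by (intro exI[of _ "[]"]) simp
lemma PFL_Cons [pf]: assumes "PF f" "PFL L" shows "PFL (%z. f z # L z)"
proof -
 obtain fs where "ALL f:set fs. PF f" "ALL z. L z = map (%f. f z) fs" using assms(2) unfolding PFL_def by blast
 then show ?thesis unfolding PFL_def using assms(1) by (intro exI[of _ "f # fs"]) simp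
qed
lemma PFL_append [pf]: assumes "PFL L" "PFL L'" shows "PFL (%z. L z @ L' z)"
proof -
 obtain fs gs where "ALL f:set fs. PF f" "ALL z. L z = map (%f. f z) fs" "ALL f:set gs. PF f" "ALL z. L' z = map (%f. f z) gs"
  using assms unfolding PFL_def by blast
 then show ?thesis unfolding PFL_def by (intro exI[of _ "fs @ gs"]) auto
qed
lemma PFL_const [pf]: "PFL (%z. xs)"
 unfolding PFL_def by (intro exI[of _ "map (%ph _. ph) xs"]) (auto simp: comp_def PF_const)

lemma PF_bf [pf]: assumes "PFL L" shows "PF (%z. bf R (L z))"
proof -
 obtain fs where fs: "ALL f:set fs. PF f" and L: "!!z. L z = map (%f. f z) fs" using assms unfolding PFL_def by blast
 have "PF (%z. bf R (map (%f. f z) fs))" using fs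
 proof (induction fs arbitrary: R)
  case Nil then show ?case by (simp add: PF_const)
 next
  case (Cons f fs)
  have a: "PF f" and i: "!!R. PF (%z. bf R (map (%f. f z) fs))" using Cons by simp_all
  show ?case unfolding list.map bf.simps by (intro PF_Or PF_andf PF_Neg a i)
 qed
 then show ?thesis by (simp only: L)
qed

lemma digits_power: "digits (2 ^ n) = replicate n False @ [True]"
proof (induction n)
 case (Suc n)
 have "~ 2 * 2 ^ n < (2::nat)" by simp
 then show ?case unfolding power_Suc by (subst digits_cases) (simp add: Suc)
qed (simp add: digits_cases)

lemma PT_leaf [pt]: "PT i ==> PT (%z. tree_word (Leaf (2 ^ Suc (i z))))"
 unfolding tree_word.simps digits_power by (intro pt)

lemma PF_pa [pf]: assumes "PT i" shows "PF (%z. pa (i z))"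
proof -
 have "PT (%z. [True, False] @ tree_word (Leaf 0) @ tree_word (Leaf 0) @ tree_word (Leaf (2 ^ Suc (i z))) @ [False, True])"
  by (intro pt assms)
 then show ?thesis unfolding PF_def pa_def by (simp del: tree_word.simps(1))
qed

definition "and1 = [True, False] @ tree_word (Leaf 1) @ [True, False] @ tree_word (Leaf 2) @ [True, False] @ tree_word (Leaf 1)"
definition "and2 = [False, True, True, False] @ tree_word (Leaf 1)"
definition "and3 = [False, True, False, True, False, True]"

lemma str_andf: "str (andf ph ps) = and1 @ str ph @ and2 @ str ps @ and3"
 by (simp add: andf_def and1_def and2_def and3_def)

lemma concat_replicate_Suc: "concat (replicate n xs) @ xs = xs @ concat (replicate n xs)" by (induction n) auto

text \<open>A nested conjunction is printed as all opening parts, the innermost formula and all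
  closing brackets. This replaces recursion on formulas by concatenation of lists.\<close>

lemma str_conjf: "str (conjf phs) = concat (map (%ph. and1 @ str ph @ and2) phs) @ str ttf @ concat (replicate (length phs) and3)"
proof (induction phs)
 case (Cons ph phs)
 have "conjf (ph # phs) = andf ph (conjf phs)" by (simp add: conjf_def)
 then show ?case by (simp add: str_andf Cons concat_replicate_Suc del: tree_word.simps)
qed (simp add: conjf_def)

lemma PF_conjf [pf]:
 assumes n: "PT n" and f: "PF (%p. ph (fst p) (snd p))" shows "PF (%z. conjf (map (ph z) [0..<n z]))"
proof -
 have "PT (%z. concat (map (%i. and1 @ str (ph z i) @ and2) [0..<n z]) @ str ttf @ concat (replicate (n z) and3))"
  by (intro pt n f[unfolded PF_def])
 then show ?thesis unfolding PF_def str_conjf by (simp add: comp_def)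
qed

definition incb_step :: "bool => bool * bool list => bool * bool list" where
 "incb_step d p = ((d & fst p), (d ~= fst p) # snd p)"

lemma incb_fold: "(let p = fold incb_step ds (c, r) in rev (fst p # snd p)) = rev r @ incb c ds"
 by (induction ds arbitrary: c r) (simp_all add: incb_step_def)

lemma PT_incb: assumes "PT l" shows "PT (%z. incb True (l z))"
proof -
 obtain B where B: "pb B" "!!x. sz (l x) <= B (sz x)" using PT_size[OF assms] by metis
 have f: "PT (%z. fold incb_step (l z) (True, []))"
 proof (rule PT_fold[where s = "%_. incb_step" and B = "%m. Suc (3 + (4 * B m + 1))"])
  show "PT (%z. incb_step (fst (snd z)) (snd (snd z)))" unfolding incb_step_def by (intro pt)
  fix x ys zs assume "l x = ys @ zs"
  then have "length ys <= B (sz x)" using B(2)[of x] length_le_sz[of "l x"] by simp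
  moreover have "length (snd (fold incb_step ys (c, r))) = length ys + length r" for c r
   by (induction ys arbitrary: c r) (simp_all add: incb_step_def)
  ultimately have "length (snd (fold incb_step ys (True, []))) <= B (sz x)" by simp
  then have "sz (snd (fold incb_step ys (True, []))) <= 4 * B (sz x) + 1" using sz_word[of "snd (fold incb_step ys (True, []))"] by linarith
  moreover have "sz (fst (fold incb_step ys (True, []))) <= 3" by (rule sz_bool)
  moreover have "sz p = Suc (sz (fst p) + sz (snd p))" for p :: "bool * bool list" using sz_Pair[of "fst p" "snd p"] by simp
  ultimately show "sz (fold incb_step ys (True, [])) <= Suc (3 + (4 * B (sz x) + 1))" by simp
 qed (intro pt assms pb_intros B)+
 have "PT (%z. rev (fst (fold incb_step (l z) (True, [])) # snd (fold incb_step (l z) (True, []))))" by (intro pt f)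
 then show ?thesis using incb_fold[of _ True "[]"] by (simp add: Let_def)
qed

lemma PT_dg [pt]: assumes "PT n" shows "PT (%z. dg (n z))"
proof -
 obtain B where B: "pb B" "!!x. sz (n x) <= B (sz x)" using PT_size[OF assms] by metis
 have e: "(incb True ^^ j) [] = dg j" for j by (induction j) simp_all
 have "PT (%z. (incb True ^^ n z) [])"
 proof (rule PT_funpow[where B = "%m. 4 * B m + 1"])
  show "PT (%z. incb True (snd z))" by (intro PT_incb pt)
  fix x j assume "j <= n x"
  moreover have "n x <= B (sz x)" using B(2)[of x] by simp
  ultimately show "sz ((incb True ^^ j) []) <= 4 * B (sz x) + 1" unfolding e using sz_word[of "dg j"] dg[of j] by linarith
 qed (intro pt assms pb_intros B)+
 then show ?thesis by (simp only: e)
qed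

lemma PF_lst [pf]: "PT b ==> PF (%z. game_formula.lst (b z))"
 unfolding game_formula.lst_def by (intro pf pt)

lemma PF_ue [pf]: "PT b ==> PF ph ==> PF ps ==> PF (%z. game_formula.ue (b z) (ph z) (ps z))"
 unfolding game_formula.ue_def by (intro pf)

definition "nx1 = [True, False] @ tree_word (Leaf 3)"

lemma str_chain: "str (game_formula.chain b ds) =
 concat (map (%d. and1 @ str (if d then pv 2 else Neg (pv 2)) @ and2 @ nx1) ds) @ str (game_formula.chain b []) @ concat (replicate (length ds) ([False, True] @ and3))"
proof (induction ds)
 case (Cons d ds)
 have n: "str (Next ph) = nx1 @ str ph @ [False, True]" for ph by (simp add: nx1_def)
 show ?case unfolding game_formula.chain.simps(2) str_andf n Cons
  using concat_replicate_Suc[of "length ds" "[False, True] @ and3"] by (simp del: tree_word.simps qf_tree.simps)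
qed simp

lemma PF_chain [pf]: assumes b: "PT b" and d: "PT ds" shows "PF (%z. game_formula.chain (b z) (ds z))"
proof -
 have c: "PT (%z. str (game_formula.chain (b z) []))"
  unfolding game_formula.chain.simps(1) PF_def[symmetric] by (intro pf b)
 have i: "PT (%p :: 'a * bool. str (if snd p then pv 2 else Neg (pv 2)))" unfolding PF_def[symmetric] by (intro pf pt)
 show ?thesis unfolding PF_def by (subst str_chain) (intro pt b d c i)
qed

lemma PF_nmf [pf]: "PT b ==> PF ph ==> PF (%z. game_formula.nmf ka (b z) (ph z))"
 unfolding game_formula.nmf_def by (intro pf)

lemma PF_incf [pf]: "PT i ==> PF (%z. game_formula.incf (i z))"
 unfolding game_formula.incf_def by (intro pf pt)

lemma PF_step_f [pf]: "PT b ==> PF (%z. game_formula.step_f M ka dec (b z))"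
 unfolding game_formula.step_f_def by (intro pf)

lemma PF_cmp_f [pf]: assumes "PT b" shows "PF (%z. game_formula.cmp_f ka dec (b z))"
 unfolding game_formula.cmp_f_def by (intro pf pt assms PT_comp[OF assms])

lemma PF_out_f [pf]: assumes b: "PT b" and w: "PT w" shows "PF (%z. game_formula.out_f M ka dec (b z) (w z))"
 unfolding game_formula.out_f_def by (intro pf pt w PT_comp[OF b])

text \<open>The predicate under \<open>bf\<close> has to be fixed. Splitting on the input bit
  outside of \<open>bf\<close> leaves two fixed predicates.\<close>

lemma PF_in_fs: assumes b: "PT b" and w: "PT w"
 shows "PF (%z. conjf (map (game_formula.in_f ka dec (b z) (w z)) [0..<length (w z)]))"
proof -
 let ?g = "%z l. if nthd False (w z) l
   then bf (%x. x ! 0 & ii (dec (drop 6 x)) = 0 --> ia (dec (drop 6 x)) = 2) (game_formula.chain (b z) (dg l) # game_formula.svs ka)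
   else bf (%x. x ! 0 & ii (dec (drop 6 x)) = 0 --> ia (dec (drop 6 x)) = 1) (game_formula.chain (b z) (dg l) # game_formula.svs ka)"
 have e: "map (game_formula.in_f ka dec (b z) (w z)) [0..<length (w z)] = map (?g z) [0..<length (w z)]" for z
  by (rule map_cong) (auto simp: game_formula.in_f_def nthd_def)
 show ?thesis unfolding e by (intro pf pt w PT_comp[OF b] PT_comp[OF w])
qed

lemma PF_matrix: assumes b: "PT b" and w: "PT w" shows "PF (%z. game_formula.matrix_f M ka dec (b z) (w z))"
 unfolding game_formula.matrix_f_def game_formula.init_f_def game_formula.input_f_def game_formula.fst_f_def
 by (intro pf pt PF_in_fs b w PT_comp[OF b])

lemma PT_encode_game:
 assumes b: "PT b" and w: "PT w" shows "PT (%z. encode (game_formula.game_inst M ka dec (b z) (w z)))"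
proof -
 let ?X = "%z. game_formula.game_inst M ka dec (b z) (w z)"
 let ?c = "[True, False] @ tree_word (set_tree {0}) @ tree_word (set_tree {}) @
   tree_word (system_tree {0} \<lparr>states = {0}, init = 0, trans = (%_ _. 0), label = (%_. {})\<rparr>) @
   tree_word (Node (map Leaf (map (%p. 2 * p + 1) [5 + ka..<Suc (5 + ka) + num_tapes M])))"
 have "encode (?X z) = ?c @ ([True, False] @ (concat (map (%p. tree_word (Leaf (2 * p + 1))) [0..<5 + ka]) @ concat (map (%i. tree_word (Leaf (2 ^ Suc i))) [0..<b z])) @ [False, True]) @
   str (game_formula.matrix_f M ka dec (b z) (w z)) @ [False, True]" for z
  by (simp add: encode_def game_formula.game_inst_def comp_def del: tree_word.simps(1) upt_Suc)
 moreover have "PT (%z. ?c @ ([True, False] @ (concat (map (%p. tree_word (Leaf (2 * p + 1))) [0..<5 + ka]) @ concat (map (%i. tree_word (Leaf (2 ^ Suc i))) [0..<b z])) @ [False, True]) @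
   str (game_formula.matrix_f M ka dec (b z) (w z)) @ [False, True])"
  by (intro PT_append PT_const PT_concat PT_map PT_upt PT_leaf PT_snd PT_id b PF_matrix[unfolded PF_def] w)
 ultimately show ?thesis by simp
qed

subsection \<open>Hardness\<close>

text \<open>The constant \<open>c\<close> absorbs the factor hidden in the asymptotic bound and the
  finitely many short lengths. The \<open>- 1\<close> leaves a factor 2, since a cyclic tape needs
  twice as many cells as the time bound.\<close>

lemma time_bound:
 assumes "(%n. real (t n)) : O(%n. real (2 ^ (2 ^ (n ^ k))))"
 shows "EX c. ALL n. t n < 2 ^ (2 ^ (n ^ k + n + c) - 1)"
proof -
 obtain C where "\<forall>\<^sub>F n in sequentially. norm (real (t n)) <= C * norm (real (2 ^ (2 ^ (n ^ k))))"
  using landau_o.bigE[OF assms] by blast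
 then obtain n0 where n0: "!!n. n0 <= n ==> real (t n) <= C * real (2 ^ (2 ^ (n ^ k)))"
  unfolding eventually_sequentially by auto
 obtain C' :: nat where C': "C <= real C'" using real_arch_simple by blast
 define T where "T = (SUM i<n0. t i)"
 define c where "c = C' + T + 2"
 have "t n < 2 ^ (2 ^ (n ^ k + n + c) - 1)" for n
 proof -
  let ?x = "n ^ k"
  have "c < (2::nat) ^ c" by (rule less_two_power)
  then have "2 ^ ?x * Suc c <= 2 ^ ?x * (2::nat) ^ c" by (intro mult_le_mono2 Suc_leI less_two_power)
  also have "... <= 2 ^ (?x + n + c)" unfolding power_add[symmetric] by (intro power_increasing) auto
  finally have "2 ^ ?x * Suc c <= (2::nat) ^ (?x + n + c)" .
  moreover have "2 ^ ?x + c <= 2 ^ ?x * Suc c" by simp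
  ultimately have g: "2 ^ ?x + c <= (2::nat) ^ (?x + n + c)" by linarith
  show ?thesis
  proof (cases "n0 <= n")
   case True
   have "real (t n) <= real C' * real (2 ^ (2 ^ ?x))"
    using n0[OF True] mult_right_mono[OF C', of "real (2 ^ (2 ^ ?x))"] by linarith
   then have "t n <= C' * 2 ^ (2 ^ ?x)" unfolding of_nat_mult[symmetric] of_nat_le_iff .
   also have "... < 2 ^ C' * 2 ^ (2 ^ ?x)" using less_two_power[of C'] by (intro mult_strict_right_mono) auto
   also have "... = 2 ^ (C' + 2 ^ ?x)" by (simp only: power_add)
   also have "... <= 2 ^ (2 ^ (?x + n + c) - 1)" using g by (intro power_increasing) (auto simp: c_def)
   finally show ?thesis .
  next
   case False
   then have "t n <= T" unfolding T_def by (intro member_le_sum) auto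
   also have "T < 2 ^ T" by (rule less_two_power)
   also have "(2::nat) ^ T <= 2 ^ (2 ^ (?x + n + c) - 1)" using g by (intro power_increasing) (auto simp: c_def)
   finally show ?thesis .
  qed
 qed
 then show ?thesis by blast
qed

lemma strategy_realizability_hard:
 assumes "L : TWO_EXPTIME" shows "poly_time_reducible L strategy_realizability"
proof -
 obtain k M t where M: "turing_machine M" and D: "decides_in_time M L t" and O: "(%n. real (t n)) : O(%n. real (2 ^ (2 ^ (n ^ k))))"
  using assms unfolding TWO_EXPTIME_def DTIME_def by blast
 obtain c where c: "!!n. t n < 2 ^ (2 ^ (n ^ k + n + c) - 1)" using time_bound[OF O] by blast
 have M': "num_tapes M >= 1" "num_syms M >= 3" "start M < num_states M" "accept M ~= reject M"
  using M by (auto simp: turing_machine_def)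
 have "finite (tuples n A)" if "finite A" for n and A :: "nat set"
  using finite_lists_length_eq[OF that, of n] by (simp add: tuples_def conj_commute)
 then have "finite (infos M)" unfolding infos_def by simp
 moreover have "(start M, start M, replicate (num_tapes M) 0, 0, 0, False) : infos M"
  using M' by (auto simp: infos_def tuples_def)
 ultimately obtain ka and dec :: "bool list => info"
  where dec: "!!l. dec l : infos M" "!!io. io : infos M ==> EX l. length l = ka & dec l = io"
  using finite_coding[of "infos M"] by metis
 \<comment> \<open>Large enough for \<open>2 ^ b\<close> to exceed the input length and for
   \<open>2 ^ (2 ^ b - 1)\<close> to exceed the running time.\<close>
 define b where "b w = length w ^ k + length w + Suc c" for w :: "bool list"
 define f where "f w = encode (game_formula.game_inst M ka dec (b w) w)" for w
 have "PT f" unfolding f_def[abs_def] b_def by (intro PT_encode_game pt PT_power)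
 then have p: "poly_time_computable f" by (rule poly_time_PT)
 have "w : L \<longleftrightarrow> f w : strategy_realizability" for w
 proof -
  \<comment> \<open>Half of \<open>2 ^ (2 ^ b)\<close>, so a tape cycle has exactly as many cells as
    a counter of \<open>2 ^ b\<close> bits has values.\<close>
  let ?N = "2 ^ (2 ^ b w - 1) :: nat" and ?t = "t (length w)"
  have run: "fst (run M ?t w) = (if w : L then accept M else reject M)" using D by (simp add: decides_in_time_def)
  have h: "halted M (run M ?t w)" using run by (simp add: halted_def)
  have "(2::nat) ^ (2 ^ (length w ^ k + length w + c) - 1) <= ?N"
   by (intro power_increasing diff_le_mono) (auto simp: b_def)
  then have tN: "?t < ?N" using c[of "length w"] by linarith
  have "length w <= b w" by (simp add: b_def)
  then have lw: "length w < 2 ^ b w" using less_two_power[of "b w"] by linarith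
  have "2 ^ b w - 1 < ?N" by (rule less_two_power)
  then have lN: "length w <= ?N" using lw by linarith
  have N2: "2 * ?N = 2 ^ (2 ^ b w)" by (simp add: power_Suc[symmetric])
  interpret game_sem M ka dec "b w" w ?N ?t
   by unfold_locales (use M h tN lN N2 dec lw in auto)
  have "run M (2 ^ 2 ^ b w - 1) w = run M ?t w" by (rule stable) (use tN N2 in linarith)
  then have "st (2 ^ 2 ^ b w - 1) = accept M \<longleftrightarrow> w : L" using run M'(4) by (simp add: st_def)
  then show ?thesis unfolding f_def encode_in_strategy_realizability[OF valid_game] realizable_iff by simp
 qed
 then show ?thesis using p unfolding poly_time_reducible_def by blast
qed

theorem theorem6:
 shows "two_exptime_complete strategy_realizability"
 unfolding two_exptime_complete_def
 using strategy_realizability_in_TWO_EXPTIME strategy_realizability_hard by blast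

end
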